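(* Let $\mathbb K\in\{\mathbb R,\mathbb C\}$ and let $X$ be a $\mathbb K$-Banach space with $\dim_{\mathbb K}X>1$. Let $GL(X)$ be the Banach Lie group of bounded invertible operators on $X$, acting on $\mathcal I(X)$ by $\mathrm{Ad}(W)(Q):=WQW^{-1}$ and on $\mathscr G(X)$ by $\alpha(W,E):=W(E)$. Let $Q\in\mathcal I(X)$ and $E\in\mathscr G(X)$, and set $$GL(X)^Q:=\{W\in GL(X):WQW^{-1}=Q\},\qquad GL(X)^E:=\{W\in GL(X):W(E)=E\}.$$ Then both $GL(X)^Q$ and $GL(X)^E$ are analytic $\mathbb K$-Banach Lie subgroups of $GL(X)$. The orbits $\mathrm{Ad}(GL(X),Q)=\{WQW^{-1}:W\in GL(X)\}$ and $\alpha(GL(X),E)=\{W(E):W\in GL(X)\}$ are clopen in $\mathcal I(X)$ and $\mathscr G(X)$, respectively. Moreover, the canonical bijections from $GL(X)/GL(X)^Q$ onto $\mathrm{Ad}(GL(X),Q)$ and from $GL(X)/GL(X)^E$ onto $\alpha(GL(X),E)$ are $\mathbb K$-bi-analytic.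
   Context: $\mathcal L(X,Y)$ is the Banach space of bounded $\mathbb K$-linear operators, $\mathcal L(X)=\mathcal L(X,X)$. $\mathscr G(X)$ is the set of all non-zero proper closed complemented subspaces of $X$. For $F\in\mathscr G(X)$, $\mathcal C_F$ is the set of closed complements of $F$ in $X$. For $E\in\mathcal C_F$ the map $q_{E,F}:\mathcal L(E,F)\to\mathcal C_F$, $q_{E,F}(T)=(I+T)(E)$, is a bijection with inverse $p_{E,F}$. $\mathscr G(X)$ carries a Hausdorff metrizable topology in which each $\mathcal C_F$ is open and each $p_{E,F}$ is a homeomorphism, and the charts $(\mathcal C_F,p_{E,F},\mathcal L(E,F))$ form a $\mathbb K$-analytic atlas for $\mathscr G(X)$. $\mathcal I(X)=\{Q\in\mathcal L(X)\setminus\{0,I\}:Q^2=Q\}$, with the norm topology and the $\mathbb K$-analytic Banach submanifold structure induced from $\mathcal L(X)$. $GL(X)$ is an open subset of $\mathcal L(X)$ with the corresponding analytic structure. The actions $\mathrm{Ad}$ and $\alpha$ are $\mathbb K$-analytic. The quotients of $GL(X)$ by the Banach Lie subgroups carry their usual quotient (homogeneous space) analytic manifold structures, and the canonical bijections are those induced by $W\mapsto WQW^{-1}$ and $W\mapsto W(E)$. *)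

theory Defs
  imports
    "HOL-Analysis.Analysis"
    "HOL-Library.Function_Algebras"
    "HOL-Algebra.Group_Action"
    "HOL-Algebra.Left_Coset"
begin

section \<open>Scalars and Banach spaces\<close>

text \<open>A single type class covers the two scalar fields: a type of this class is the real field
  or is \<open>\<real> + \<real> i\<close> with \<open>i * i = - 1\<close> and the usual modulus, and both \<^typ>\<open>real\<close> and
  \<^typ>\<open>complex\<close> are instances.\<close>

class real_or_complex = real_normed_field +
  assumes real_or_complex:
    "(\<forall>z. \<exists>a. z = a *\<^sub>R 1) \<or>
     (\<exists>i. i * i = - 1 \<and> (\<forall>z. \<exists>a b. z = a *\<^sub>R 1 + b *\<^sub>R i) \<and>
          (\<forall>a b. norm (a *\<^sub>R 1 + b *\<^sub>R i) = sqrt (a\<^sup>2 + b\<^sup>2)))"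

instance real :: real_or_complex
  by standard simp

instance complex :: real_or_complex
proof
  have "\<i> * \<i> = - 1 \<and> (\<forall>z. \<exists>a b. z = a *\<^sub>R 1 + b *\<^sub>R \<i>) \<and>
      (\<forall>a b. norm (a *\<^sub>R 1 + b *\<^sub>R \<i>) = sqrt (a\<^sup>2 + b\<^sup>2))"
    by (auto simp: cmod_def complex_eq_iff)
  then show "(\<forall>z::complex. \<exists>a. z = a *\<^sub>R 1) \<or>
     (\<exists>i::complex. i * i = - 1 \<and> (\<forall>z. \<exists>a b. z = a *\<^sub>R 1 + b *\<^sub>R i) \<and>
          (\<forall>a b. norm (a *\<^sub>R 1 + b *\<^sub>R i) = sqrt (a\<^sup>2 + b\<^sup>2)))"
    by blast
qed

text \<open>The Banach space \<open>X\<close> is the whole type \<open>'a\<close>, with the scalar multiplication \<open>smul\<close>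
  extending the real one; for real scalars \<open>smul\<close> is therefore \<^const>\<open>scaleR\<close>.\<close>

locale banach_over = vector_space smul
  for smul :: "'k::real_or_complex \<Rightarrow> 'a::banach \<Rightarrow> 'a" +
  assumes smul_of_real: "smul (of_real r) x = r *\<^sub>R x"
    and norm_smul: "norm (smul c x) = norm c * norm x"

definition dim_greater_one :: "('k::real_or_complex \<Rightarrow> 'a::banach \<Rightarrow> 'a) \<Rightarrow> bool" where
  "dim_greater_one smul \<longleftrightarrow>
     (\<exists>B. \<not> module.dependent smul B \<and> module.span smul B = UNIV \<and> (infinite B \<or> card B > 1))"

text \<open>Model spaces of manifolds depend on terms (for instance on a pair of subspaces of \<open>X\<close>),
  so they are given by a carrier set, a scalar multiplication and a norm; addition is that of the
  ambient type. Restricting the carrier gives subspaces.\<close>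

record ('k, 'v) normed_on =
  vecs :: "'v set"
  vscale :: "'k \<Rightarrow> 'v \<Rightarrow> 'v"
  vnorm :: "'v \<Rightarrow> real"

text \<open>Off the carrier the distance is zero only because \<^locale>\<open>Metric_space\<close> asks for
  nonnegativity and symmetry on the whole type.\<close>

definition vdist :: "('k, 'v::ab_group_add) normed_on \<Rightarrow> 'v \<Rightarrow> 'v \<Rightarrow> real" where
  "vdist V x y = (if x \<in> vecs V \<and> y \<in> vecs V then vnorm V (x - y) else 0)"

definition norm_topology :: "('k, 'v::ab_group_add) normed_on \<Rightarrow> 'v topology" where
  "norm_topology V = Metric_space.mtopology (vecs V) (vdist V)"

definition linear_subset :: "('k, 'v::ab_group_add) normed_on \<Rightarrow> 'v set \<Rightarrow> bool" where
  "linear_subset V S \<longleftrightarrow> S \<subseteq> vecs V \<and> 0 \<in> S \<and>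
     (\<forall>x\<in>S. \<forall>y\<in>S. x + y \<in> S) \<and> (\<forall>c. \<forall>x\<in>S. vscale V c x \<in> S)"

definition banach_on :: "('k::real_or_complex, 'v::ab_group_add) normed_on \<Rightarrow> bool" where
  "banach_on V \<longleftrightarrow>
     linear_subset V (vecs V) \<and>
     (\<forall>c. \<forall>x\<in>vecs V. \<forall>y\<in>vecs V. vscale V c (x + y) = vscale V c x + vscale V c y) \<and>
     (\<forall>c d. \<forall>x\<in>vecs V. vscale V (c + d) x = vscale V c x + vscale V d x) \<and>
     (\<forall>c d. \<forall>x\<in>vecs V. vscale V c (vscale V d x) = vscale V (c * d) x) \<and>
     (\<forall>x\<in>vecs V. vscale V 1 x = x) \<and>
     (\<forall>x\<in>vecs V. vnorm V x \<ge> 0 \<and> (vnorm V x = 0 \<longleftrightarrow> x = 0)) \<and>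
     (\<forall>c. \<forall>x\<in>vecs V. vnorm V (vscale V c x) = norm c * vnorm V x) \<and>
     (\<forall>x\<in>vecs V. \<forall>y\<in>vecs V. vnorm V (x + y) \<le> vnorm V x + vnorm V y) \<and>
     Metric_space.mcomplete (vecs V) (vdist V)"

definition closed_subspace :: "('k, 'v::ab_group_add) normed_on \<Rightarrow> 'v set \<Rightarrow> bool" where
  "closed_subspace V S \<longleftrightarrow> linear_subset V S \<and> closedin (norm_topology V) S"

definition complemented_subspace :: "('k, 'v::ab_group_add) normed_on \<Rightarrow> 'v set \<Rightarrow> bool" where
  "complemented_subspace V S \<longleftrightarrow> closed_subspace V S \<and>
     (\<exists>S'. closed_subspace V S' \<and> S \<inter> S' = {0} \<and> (\<forall>v\<in>vecs V. \<exists>s\<in>S. \<exists>s'\<in>S'. v = s + s'))"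

definition bounded_linear_on ::
  "('k, 'v::ab_group_add) normed_on \<Rightarrow> ('k, 'w::ab_group_add) normed_on \<Rightarrow> ('v \<Rightarrow> 'w) \<Rightarrow> bool" where
  "bounded_linear_on V W T \<longleftrightarrow>
     (\<forall>x\<in>vecs V. T x \<in> vecs W) \<and>
     (\<forall>x\<in>vecs V. \<forall>y\<in>vecs V. T (x + y) = T x + T y) \<and>
     (\<forall>c. \<forall>x\<in>vecs V. T (vscale V c x) = vscale W c (T x)) \<and>
     (\<exists>B. \<forall>x\<in>vecs V. vnorm W (T x) \<le> B * vnorm V x)"

section \<open>Analytic maps between Banach spaces\<close>

text \<open>An \<open>n\<close>-linear map takes a sequence of vectors of which only the first \<open>n\<close> entries matter.\<close>

definition multilinear_on ::
  "('k, 'v::ab_group_add) normed_on \<Rightarrow> ('k, 'w::ab_group_add) normed_on \<Rightarrow> nat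
     \<Rightarrow> ((nat \<Rightarrow> 'v) \<Rightarrow> 'w) \<Rightarrow> bool" where
  "multilinear_on V W n A \<longleftrightarrow>
     (\<forall>x. (\<forall>i<n. x i \<in> vecs V) \<longrightarrow> A x \<in> vecs W) \<and>
     (\<forall>x y. (\<forall>i<n. x i = y i) \<longrightarrow> A x = A y) \<and>
     (\<forall>x. (\<forall>i<n. x i \<in> vecs V) \<longrightarrow>
        (\<forall>i<n. \<forall>u\<in>vecs V. \<forall>v\<in>vecs V. A (x(i := u + v)) = A (x(i := u)) + A (x(i := v))) \<and>
        (\<forall>i<n. \<forall>c. \<forall>u\<in>vecs V. A (x(i := vscale V c u)) = vscale W c (A (x(i := u)))))"

text \<open>Near every point of the open set \<open>U\<close> the map is the sum of a power series
  \<open>f (a + h) = (\<Sum>n. A n (h, \<dots>, h))\<close> with bounded \<open>n\<close>-linear \<open>A n\<close> over the scalar field,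
  converging normally on a ball of radius \<open>r > 0\<close>.\<close>

definition analytic_between ::
  "('k, 'v::ab_group_add) normed_on \<Rightarrow> ('k, 'w::ab_group_add) normed_on \<Rightarrow> 'v set
     \<Rightarrow> ('v \<Rightarrow> 'w) \<Rightarrow> bool" where
  "analytic_between V W U f \<longleftrightarrow>
     openin (norm_topology V) U \<and> f ` U \<subseteq> vecs W \<and>
     (\<forall>a\<in>U. \<exists>A C r. r > 0 \<and>
        (\<forall>n. multilinear_on V W n (A n)) \<and>
        (\<forall>n. C n \<ge> 0 \<and>
           (\<forall>x. (\<forall>i<n. x i \<in> vecs V) \<longrightarrow> vnorm W (A n x) \<le> C n * (\<Prod>i<n. vnorm V (x i)))) \<and>
        summable (\<lambda>n. C n * r ^ n) \<and>
        (\<forall>h\<in>vecs V. vnorm V h < r \<longrightarrow> a + h \<in> U \<and>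
           (\<lambda>N. vnorm W (f (a + h) - (\<Sum>n<N. A n (\<lambda>_. h)))) \<longlonglongrightarrow> 0))"

section \<open>Analytic Banach manifolds\<close>

record ('p, 'k, 'v) chart =
  chart_dom :: "'p set"
  chart_map :: "'p \<Rightarrow> 'v"
  chart_model :: "('k, 'v) normed_on"

record ('p, 'k, 'v) manifold =
  man_top :: "'p topology"
  atlas :: "('p, 'k, 'v) chart set"

abbreviation chart_image :: "('p, 'k, 'v) chart \<Rightarrow> 'v set" where
  "chart_image c \<equiv> chart_map c ` chart_dom c"

abbreviation chart_inv :: "('p, 'k, 'v) chart \<Rightarrow> 'v \<Rightarrow> 'p" where
  "chart_inv c \<equiv> inv_into (chart_dom c) (chart_map c)"

definition is_chart ::
  "'p topology \<Rightarrow> ('p, 'k::real_or_complex, 'v::ab_group_add) chart \<Rightarrow> bool" where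
  "is_chart T c \<longleftrightarrow>
     banach_on (chart_model c) \<and> openin T (chart_dom c) \<and>
     openin (norm_topology (chart_model c)) (chart_image c) \<and>
     homeomorphic_map (subtopology T (chart_dom c))
       (subtopology (norm_topology (chart_model c)) (chart_image c)) (chart_map c)"

definition compatible_charts ::
  "('p, 'k, 'v::ab_group_add) chart \<Rightarrow> ('p, 'k, 'v) chart \<Rightarrow> bool" where
  "compatible_charts c d \<longleftrightarrow>
     analytic_between (chart_model c) (chart_model d)
       (chart_map c ` (chart_dom c \<inter> chart_dom d)) (chart_map d \<circ> chart_inv c) \<and>
     analytic_between (chart_model d) (chart_model c)
       (chart_map d ` (chart_dom c \<inter> chart_dom d)) (chart_map c \<circ> chart_inv d)"

definition analytic_manifold ::
  "('p, 'k::real_or_complex, 'v::ab_group_add) manifold \<Rightarrow> bool" where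
  "analytic_manifold M \<longleftrightarrow>
     Hausdorff_space (man_top M) \<and>
     (\<forall>c\<in>atlas M. is_chart (man_top M) c) \<and>
     \<Union> (chart_dom ` atlas M) = topspace (man_top M) \<and>
     (\<forall>c\<in>atlas M. \<forall>d\<in>atlas M. compatible_charts c d)"

definition maximal_atlas ::
  "('p, 'k::real_or_complex, 'v::ab_group_add) manifold \<Rightarrow> ('p, 'k, 'v) chart set" where
  "maximal_atlas M = {c. is_chart (man_top M) c \<and> (\<forall>d\<in>atlas M. compatible_charts c d)}"

definition analytic_map ::
  "('p, 'k, 'v::ab_group_add) manifold \<Rightarrow> ('q, 'k, 'w::ab_group_add) manifold
     \<Rightarrow> ('p \<Rightarrow> 'q) \<Rightarrow> bool" where
  "analytic_map M N f \<longleftrightarrow>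
     continuous_map (man_top M) (man_top N) f \<and>
     (\<forall>c\<in>atlas M. \<forall>d\<in>atlas N.
        analytic_between (chart_model c) (chart_model d)
          (chart_map c ` {p \<in> chart_dom c. f p \<in> chart_dom d}) (chart_map d \<circ> f \<circ> chart_inv c))"

definition bianalytic ::
  "('p, 'k, 'v::ab_group_add) manifold \<Rightarrow> ('q, 'k, 'w::ab_group_add) manifold
     \<Rightarrow> ('p \<Rightarrow> 'q) \<Rightarrow> bool" where
  "bianalytic M N f \<longleftrightarrow>
     bij_betw f (topspace (man_top M)) (topspace (man_top N)) \<and>
     analytic_map M N f \<and> analytic_map N M (inv_into (topspace (man_top M)) f)"

text \<open>A submersion is locally, in suitable charts, a projection: there \<open>f\<close> is a bounded linear
  map \<open>L\<close> with a bounded linear right inverse \<open>R\<close>, which identifies the model space with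
  \<open>ker L \<times> range L\<close> and \<open>L\<close> with the second projection.\<close>

definition analytic_submersion ::
  "('p, 'k::real_or_complex, 'v::ab_group_add) manifold \<Rightarrow> ('q, 'k, 'w::ab_group_add) manifold
     \<Rightarrow> ('p \<Rightarrow> 'q) \<Rightarrow> bool" where
  "analytic_submersion M N f \<longleftrightarrow>
     analytic_map M N f \<and>
     (\<forall>p\<in>topspace (man_top M). \<exists>c\<in>maximal_atlas M. \<exists>d\<in>maximal_atlas N. \<exists>L R.
        p \<in> chart_dom c \<and> f ` chart_dom c \<subseteq> chart_dom d \<and>
        bounded_linear_on (chart_model c) (chart_model d) L \<and>
        bounded_linear_on (chart_model d) (chart_model c) R \<and>
        (\<forall>w\<in>vecs (chart_model d). L (R w) = w) \<and>
        (\<forall>x\<in>chart_dom c. chart_map d (f x) = L (chart_map c x)))"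

definition space_manifold :: "('k, 'v::ab_group_add) normed_on \<Rightarrow> ('v, 'k, 'v) manifold" where
  "space_manifold V =
     \<lparr>man_top = norm_topology V,
      atlas = {\<lparr>chart_dom = vecs V, chart_map = (\<lambda>x. x), chart_model = V\<rparr>}\<rparr>"

definition open_submanifold :: "('p, 'k, 'v) manifold \<Rightarrow> 'p set \<Rightarrow> ('p, 'k, 'v) manifold" where
  "open_submanifold M U =
     \<lparr>man_top = subtopology (man_top M) U,
      atlas = (\<lambda>c. c\<lparr>chart_dom := chart_dom c \<inter> U\<rparr>) ` atlas M\<rparr>"

text \<open>\<open>(c, V1)\<close> is adapted to \<open>S\<close> if the chart \<open>c\<close> flattens \<open>S\<close> to the closed complemented
  subspace \<open>V1\<close> of its model space. Submanifolds are direct (split), as is needed for homogeneous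
  spaces to be manifolds.\<close>

definition adapted_charts ::
  "('p, 'k::real_or_complex, 'v::ab_group_add) manifold \<Rightarrow> 'p set
     \<Rightarrow> (('p, 'k, 'v) chart \<times> 'v set) set" where
  "adapted_charts M S =
     {(c, V1). c \<in> maximal_atlas M \<and> complemented_subspace (chart_model c) V1 \<and>
        chart_map c ` (chart_dom c \<inter> S) = chart_image c \<inter> V1}"

definition analytic_submanifold ::
  "('p, 'k::real_or_complex, 'v::ab_group_add) manifold \<Rightarrow> 'p set \<Rightarrow> bool" where
  "analytic_submanifold M S \<longleftrightarrow>
     S \<subseteq> topspace (man_top M) \<and> (\<forall>p\<in>S. \<exists>(c, V1)\<in>adapted_charts M S. p \<in> chart_dom c)"

definition induced_manifold ::
  "('p, 'k::real_or_complex, 'v::ab_group_add) manifold \<Rightarrow> 'p set \<Rightarrow> ('p, 'k, 'v) manifold" where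
  "induced_manifold M S =
     \<lparr>man_top = subtopology (man_top M) S,
      atlas = (\<lambda>(c, V1). \<lparr>chart_dom = chart_dom c \<inter> S, chart_map = chart_map c,
                 chart_model = (chart_model c)\<lparr>vecs := V1\<rparr>\<rparr>) ` adapted_charts M S\<rparr>"

text \<open>In the next two definitions \<open>M\<close> is the manifold structure of the ambient group \<open>G\<close>.\<close>

definition banach_lie_subgroup ::
  "('p, 'k::real_or_complex, 'v::ab_group_add) manifold \<Rightarrow> 'p monoid \<Rightarrow> 'p set \<Rightarrow> bool" where
  "banach_lie_subgroup M G H \<longleftrightarrow> subgroup H G \<and> analytic_submanifold M H"

text \<open>\<open>N\<close> is the quotient (homogeneous space) manifold \<open>G / H\<close>: the set of left cosets with the
  quotient topology and an analytic structure making the projection a submersion. These conditions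
  determine the analytic structure.\<close>

definition quotient_manifold ::
  "('p, 'k::real_or_complex, 'v::ab_group_add) manifold \<Rightarrow> 'p monoid \<Rightarrow> 'p set
     \<Rightarrow> ('p set, 'k, 'w::ab_group_add) manifold \<Rightarrow> bool" where
  "quotient_manifold M G H N \<longleftrightarrow>
     analytic_manifold N \<and> topspace (man_top N) = lcosets\<^bsub>G\<^esub> H \<and>
     quotient_map (man_top M) (man_top N) (\<lambda>g. g <#\<^bsub>G\<^esub> H) \<and>
     analytic_submersion M N (\<lambda>g. g <#\<^bsub>G\<^esub> H)"

text \<open>The map on left cosets of the stabilizer of \<open>x\<close> induced by \<open>g \<mapsto> \<phi> g x\<close>, which is
  constant on each of them.\<close>

definition orbit_map :: "('g \<Rightarrow> 'e \<Rightarrow> 'e) \<Rightarrow> 'e \<Rightarrow> 'g set \<Rightarrow> 'e" where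
  "orbit_map \<phi> x C = the_elem ((\<lambda>g. \<phi> g x) ` C)"

section \<open>Operators, idempotents and the Grassmannian\<close>

text \<open>\<open>L(X)\<close>: the operator norm does not depend on the scalar field, so this is a subset of the
  real bounded linear operators with the same norm.\<close>

definition operators :: "('k \<Rightarrow> 'a::banach \<Rightarrow> 'a) \<Rightarrow> ('k, 'a \<Rightarrow>\<^sub>L 'a) normed_on" where
  "operators smul =
     \<lparr>vecs = {T. \<forall>c x. blinfun_apply T (smul c x) = smul c (blinfun_apply T x)},
      vscale = (\<lambda>c T. Blinfun (\<lambda>x. smul c (blinfun_apply T x))),
      vnorm = norm\<rparr>"

text \<open>\<open>L(E, F)\<close> for linear subspaces \<open>E\<close>, \<open>F\<close> of \<open>X\<close>: operators are only given on \<open>E\<close>, hence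
  normalised to be zero off \<open>E\<close>.\<close>

definition operators_between ::
  "('k \<Rightarrow> 'a::banach \<Rightarrow> 'a) \<Rightarrow> 'a set \<Rightarrow> 'a set \<Rightarrow> ('k, 'a \<Rightarrow> 'a) normed_on" where
  "operators_between smul E F =
     \<lparr>vecs = {T. (\<forall>x. x \<notin> E \<longrightarrow> T x = 0) \<and>
        bounded_linear_on \<lparr>vecs = E, vscale = smul, vnorm = norm\<rparr>
                          \<lparr>vecs = F, vscale = smul, vnorm = norm\<rparr> T},
      vscale = (\<lambda>c T x. smul c (T x)),
      vnorm = (\<lambda>T. SUP x\<in>E \<inter> cball 0 1. norm (T x))\<rparr>"

definition operator_monoid :: "('k \<Rightarrow> 'a::banach \<Rightarrow> 'a) \<Rightarrow> ('a \<Rightarrow>\<^sub>L 'a) monoid" where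
  "operator_monoid smul =
     \<lparr>carrier = vecs (operators smul), mult = (o\<^sub>L), one = id_blinfun\<rparr>"

definition GL :: "('k \<Rightarrow> 'a::banach \<Rightarrow> 'a) \<Rightarrow> ('a \<Rightarrow>\<^sub>L 'a) monoid" where
  "GL smul = units_of (operator_monoid smul)"

definition GL_manifold ::
  "('k \<Rightarrow> 'a::banach \<Rightarrow> 'a) \<Rightarrow> ('a \<Rightarrow>\<^sub>L 'a, 'k, 'a \<Rightarrow>\<^sub>L 'a) manifold" where
  "GL_manifold smul = open_submanifold (space_manifold (operators smul)) (carrier (GL smul))"

definition idempotents :: "('k \<Rightarrow> 'a::banach \<Rightarrow> 'a) \<Rightarrow> ('a \<Rightarrow>\<^sub>L 'a) set" where
  "idempotents smul = {Q \<in> vecs (operators smul) - {0, id_blinfun}. Q o\<^sub>L Q = Q}"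

definition idempotent_manifold ::
  "('k::real_or_complex \<Rightarrow> 'a::banach \<Rightarrow> 'a) \<Rightarrow> ('a \<Rightarrow>\<^sub>L 'a, 'k, 'a \<Rightarrow>\<^sub>L 'a) manifold" where
  "idempotent_manifold smul =
     induced_manifold (space_manifold (operators smul)) (idempotents smul)"

definition complements ::
  "('k::real_or_complex \<Rightarrow> 'a::banach \<Rightarrow> 'a) \<Rightarrow> 'a set \<Rightarrow> 'a set set" where
  "complements smul F =
     {E. module.subspace smul E \<and> closed E \<and> E \<inter> F = {0} \<and> (\<forall>x. \<exists>e\<in>E. \<exists>f\<in>F. x = e + f)}"

definition grassmannian :: "('k::real_or_complex \<Rightarrow> 'a::banach \<Rightarrow> 'a) \<Rightarrow> 'a set set" where
  "grassmannian smul =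
     {E. module.subspace smul E \<and> closed E \<and> E \<noteq> {0} \<and> E \<noteq> UNIV \<and> complements smul E \<noteq> {}}"

text \<open>\<open>q_map E T = (I + T)(E)\<close>\<close>

definition q_map :: "'a::banach set \<Rightarrow> ('a \<Rightarrow> 'a) \<Rightarrow> 'a set" where
  "q_map E T = (\<lambda>x. x + T x) ` E"

definition grassmann_chart ::
  "('k::real_or_complex \<Rightarrow> 'a::banach \<Rightarrow> 'a) \<Rightarrow> 'a set \<Rightarrow> 'a set
     \<Rightarrow> ('a set, 'k, 'a \<Rightarrow> 'a) chart" where
  "grassmann_chart smul E F =
     \<lparr>chart_dom = complements smul F,
      chart_map = inv_into (vecs (operators_between smul E F)) (q_map E),
      chart_model = operators_between smul E F\<rparr>"

text \<open>The only topology on the Grassmannian for which every set of complements is open and every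
  \<open>q_map E\<close> is a homeomorphism onto it is the final topology of the maps \<open>q_map E\<close>.\<close>

definition grassmann_topology ::
  "('k::real_or_complex \<Rightarrow> 'a::banach \<Rightarrow> 'a) \<Rightarrow> 'a set topology" where
  "grassmann_topology smul = topology (\<lambda>\<U>. \<U> \<subseteq> grassmannian smul \<and>
     (\<forall>F\<in>grassmannian smul. \<forall>E\<in>complements smul F.
        openin (norm_topology (operators_between smul E F))
          {T \<in> vecs (operators_between smul E F). q_map E T \<in> \<U>}))"

lemma openin_grassmann_topology:
  "openin (grassmann_topology smul) \<U> \<longleftrightarrow> \<U> \<subseteq> grassmannian smul \<and>
     (\<forall>F\<in>grassmannian smul. \<forall>E\<in>complements smul F.
        openin (norm_topology (operators_between smul E F))
          {T \<in> vecs (operators_between smul E F). q_map E T \<in> \<U>})"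
proof -
  have inter: "{T \<in> V. q T \<in> A \<inter> B} = {T \<in> V. q T \<in> A} \<inter> {T \<in> V. q T \<in> B}"
    for V :: "('a \<Rightarrow> 'a) set" and q :: "('a \<Rightarrow> 'a) \<Rightarrow> 'a set" and A B by auto
  have union: "{T \<in> V. q T \<in> \<Union>K} = (\<Union>A\<in>K. {T \<in> V. q T \<in> A})"
    for V :: "('a \<Rightarrow> 'a) set" and q :: "('a \<Rightarrow> 'a) \<Rightarrow> 'a set" and K by auto
  have "istopology (\<lambda>\<U>. \<U> \<subseteq> grassmannian smul \<and>
     (\<forall>F\<in>grassmannian smul. \<forall>E\<in>complements smul F.
        openin (norm_topology (operators_between smul E F))
          {T \<in> vecs (operators_between smul E F). q_map E T \<in> \<U>}))"
    unfolding istopology_def inter union by (auto intro!: openin_Union)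
  then show ?thesis
    by (simp add: grassmann_topology_def topology_inverse')
qed

definition grassmann_manifold ::
  "('k::real_or_complex \<Rightarrow> 'a::banach \<Rightarrow> 'a) \<Rightarrow> ('a set, 'k, 'a \<Rightarrow> 'a) manifold" where
  "grassmann_manifold smul =
     \<lparr>man_top = grassmann_topology smul,
      atlas = {grassmann_chart smul E F | E F. F \<in> grassmannian smul \<and> E \<in> complements smul F}\<rparr>"

definition Ad :: "('k \<Rightarrow> 'a::banach \<Rightarrow> 'a) \<Rightarrow> ('a \<Rightarrow>\<^sub>L 'a) \<Rightarrow> ('a \<Rightarrow>\<^sub>L 'a) \<Rightarrow> ('a \<Rightarrow>\<^sub>L 'a)" where
  "Ad smul W Q = W o\<^sub>L Q o\<^sub>L inv\<^bsub>GL smul\<^esub> W"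

definition \<alpha> :: "('a::banach \<Rightarrow>\<^sub>L 'a) \<Rightarrow> 'a set \<Rightarrow> 'a set" where
  "\<alpha> W E = blinfun_apply W ` E"

end

theory Submission
  imports Defs
begin

text \<open>Left translation reduces everything to a neighbourhood of the identity. For the stabilizer \<open>H\<close>
  of \<open>Q\<close> let \<open>K\<close> be the space of operators that are off-diagonal with respect to \<open>Q\<close>; for the
  stabilizer of \<open>E\<close>, with a projection \<open>P\<close> onto \<open>E\<close>, let \<open>K\<close> be the space of operators
  \<open>(I - P) T P\<close>. Operators close to the identity factor uniquely and analytically as
  \<open>(I + T) B\<close> with \<open>T \<in> K\<close> and \<open>B \<in> H\<close>, so \<open>B + T\<close> is a chart of the group in which \<open>H\<close> is flat and
  \<open>T\<close> is a chart of the quotient. The orbit maps have analytic local sections: an idempotent \<open>X\<close> close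
  to \<open>R\<close> is conjugate to \<open>R\<close> by \<open>X R + (I - X) (I - R)\<close>, and \<open>(I + T)(E)\<close> is the image of \<open>E\<close> under the
  invertible \<open>I + T P\<close>. Hence orbits are open, therefore closed, and the orbit maps are bianalytic.\<close>

section \<open>Normed spaces on a carrier and power series\<close>

text \<open>The carriers are sets inside arbitrary abelian groups and analyticity means a normally
  convergent power series, so the calculus is built by hand. Composition of series, bounded bilinear
  maps and inversion of operators suffice because every chart constructed below has an explicit
  inverse. The spaces K are directions transversal to the stabilizer: two off-diagonal blocks for Q,
  but only one for E, whose stabilizer is block triangular. In infinite dimension an invertible W
  with W(E) inside E may map E onto a proper subspace; hence membership in the stabilizer is
  described in two ways, by an invertible corner (for flatness) and by W together with its inverse
  (for closedness). The quotient structure enters bianalyticity only through the submersion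
  property: local sections of the projection and of the action are compared, so the result covers
  every structure M with that property, and the explicit coset charts serve existence. A closed
  complement must be turned into a bounded projection, which is the open mapping theorem for
  addition.\<close>

locale normed_space_on =
  fixes V :: "('k::real_or_complex, 'v::ab_group_add) normed_on"
  assumes linear_vecs: "linear_subset V (vecs V)"
    and scale_add_right: "\<And>c x y. x \<in> vecs V \<Longrightarrow> y \<in> vecs V \<Longrightarrow>
      vscale V c (x + y) = vscale V c x + vscale V c y"
    and scale_add_left: "\<And>c d x. x \<in> vecs V \<Longrightarrow> vscale V (c + d) x = vscale V c x + vscale V d x"
    and scale_scale: "\<And>c d x. x \<in> vecs V \<Longrightarrow> vscale V c (vscale V d x) = vscale V (c * d) x"
    and scale_one: "\<And>x. x \<in> vecs V \<Longrightarrow> vscale V 1 x = x"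
    and norm_nonneg: "\<And>x. x \<in> vecs V \<Longrightarrow> 0 \<le> vnorm V x"
    and norm_eq_zero: "\<And>x. x \<in> vecs V \<Longrightarrow> vnorm V x = 0 \<longleftrightarrow> x = 0"
    and norm_scale: "\<And>c x. x \<in> vecs V \<Longrightarrow> vnorm V (vscale V c x) = norm c * vnorm V x"
    and norm_triangle: "\<And>x y. x \<in> vecs V \<Longrightarrow> y \<in> vecs V \<Longrightarrow>
      vnorm V (x + y) \<le> vnorm V x + vnorm V y"
begin

lemma zero_mem: "0 \<in> vecs V"
  and add_mem: "x \<in> vecs V \<Longrightarrow> y \<in> vecs V \<Longrightarrow> x + y \<in> vecs V"
  and scale_mem: "x \<in> vecs V \<Longrightarrow> vscale V c x \<in> vecs V"
  using linear_vecs by (auto simp: linear_subset_def)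

lemma scale_zero_left: "x \<in> vecs V \<Longrightarrow> vscale V 0 x = 0"
  using scale_add_left[of x 0 0] by simp

lemma scale_minus_one: "x \<in> vecs V \<Longrightarrow> vscale V (- 1) x = - x"
  using scale_add_left[of x "- 1" 1] scale_one[of x] scale_zero_left[of x]
  by (simp add: eq_neg_iff_add_eq_0)

lemma minus_mem: "x \<in> vecs V \<Longrightarrow> - x \<in> vecs V"
  using scale_mem[of x "- 1"] by (simp add: scale_minus_one)

lemma diff_mem: "x \<in> vecs V \<Longrightarrow> y \<in> vecs V \<Longrightarrow> x - y \<in> vecs V"
  using add_mem[of x "- y"] minus_mem[of y] by simp

lemma scale_zero_right: "vscale V c 0 = 0"
  using scale_add_right[OF zero_mem zero_mem, of c] by simp

lemma sum_mem: "(\<And>i. i \<in> I \<Longrightarrow> x i \<in> vecs V) \<Longrightarrow> (\<Sum>i\<in>I. x i) \<in> vecs V"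
  by (induction I rule: infinite_finite_induct) (auto simp: zero_mem add_mem)

lemma norm_zero: "vnorm V 0 = 0"
  using norm_eq_zero[OF zero_mem] by simp

lemma norm_minus: "x \<in> vecs V \<Longrightarrow> vnorm V (- x) = vnorm V x"
  using norm_scale[of x "- 1"] by (simp add: scale_minus_one)

lemma norm_diff_commute: "x \<in> vecs V \<Longrightarrow> y \<in> vecs V \<Longrightarrow> vnorm V (x - y) = vnorm V (y - x)"
  using norm_minus[OF diff_mem, of x y] by simp

lemma norm_diff_triangle:
  "x \<in> vecs V \<Longrightarrow> y \<in> vecs V \<Longrightarrow> z \<in> vecs V \<Longrightarrow> vnorm V (x - z) \<le> vnorm V (x - y) + vnorm V (y - z)"
  using norm_triangle[OF diff_mem diff_mem, of x y y z] by simp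

lemma norm_diff_le:
  "x \<in> vecs V \<Longrightarrow> y \<in> vecs V \<Longrightarrow> vnorm V (x - y) \<le> vnorm V x + vnorm V y"
  using norm_triangle[OF _ minus_mem, of x y] norm_minus[of y] by simp

lemma norm_sum_le:
  "(\<And>i. i \<in> I \<Longrightarrow> x i \<in> vecs V) \<Longrightarrow> vnorm V (\<Sum>i\<in>I. x i) \<le> (\<Sum>i\<in>I. vnorm V (x i))"
proof (induction I rule: infinite_finite_induct)
  case (insert i I)
  have "vnorm V (x i + sum x I) \<le> vnorm V (x i) + vnorm V (sum x I)"
    using insert by (intro norm_triangle sum_mem) auto
  also have "\<dots> \<le> vnorm V (x i) + (\<Sum>i\<in>I. vnorm V (x i))"
    using insert by auto
  finally show ?case
    using insert by simp
qed (auto simp: norm_zero)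

sublocale Metric_space "vecs V" "vdist V"
proof
  show "0 \<le> vdist V x y" for x y
    by (auto simp: vdist_def norm_nonneg diff_mem)
  show "vdist V x y = vdist V y x" for x y
    by (auto simp: vdist_def norm_diff_commute)
  show "vdist V x y = 0 \<longleftrightarrow> x = y" if "x \<in> vecs V" "y \<in> vecs V" for x y
    using that norm_eq_zero[OF diff_mem, of x y] by (auto simp: vdist_def)
  show "vdist V x z \<le> vdist V x y + vdist V y z"
    if "x \<in> vecs V" "y \<in> vecs V" "z \<in> vecs V" for x y z
    using that norm_diff_triangle[of x y z] by (auto simp: vdist_def)
qed

end

lemma banach_on_iff:
  "banach_on V \<longleftrightarrow> normed_space_on V \<and> Metric_space.mcomplete (vecs V) (vdist V)"
proof
  assume "banach_on V"
  then show "normed_space_on V \<and> Metric_space.mcomplete (vecs V) (vdist V)"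
    unfolding banach_on_def normed_space_on_def by simp
next
  assume "normed_space_on V \<and> Metric_space.mcomplete (vecs V) (vdist V)"
  then show "banach_on V"
    unfolding banach_on_def normed_space_on_def by simp
qed

text \<open>Plays the part of a neighbourhood filter, since the ambient type is only a group.
  Increments range over the carrier, so at a point of the carrier \<open>P\<close> is tested only
  inside it.\<close>

definition near :: "('k, 'v::ab_group_add) normed_on \<Rightarrow> 'v \<Rightarrow> ('v \<Rightarrow> bool) \<Rightarrow> bool" where
  "near V a P \<longleftrightarrow> (\<exists>r>0. \<forall>h\<in>vecs V. vnorm V h < r \<longrightarrow> P (a + h))"

lemma near_conj: "near V a P \<Longrightarrow> near V a Q \<Longrightarrow> near V a (\<lambda>x. P x \<and> Q x)"
  unfolding near_def by (metis min_less_iff_conj)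

lemma near_mono: "near V a P \<Longrightarrow> (\<And>h. h \<in> vecs V \<Longrightarrow> P (a + h) \<Longrightarrow> Q (a + h)) \<Longrightarrow> near V a Q"
  unfolding near_def by metis

lemma (in normed_space_on) near_mono_mem:
  assumes "near V a P" "a \<in> vecs V" "\<And>x. x \<in> vecs V \<Longrightarrow> P x \<Longrightarrow> Q x" shows "near V a Q"
  using near_mono[OF assms(1)] assms(2,3) add_mem by blast

lemma (in normed_space_on) near_imp: "near V a P \<Longrightarrow> P a"
  unfolding near_def using zero_mem norm_zero by fastforce

lemma (in normed_space_on) openin_norm_topology:
  "openin (norm_topology V) U \<longleftrightarrow> U \<subseteq> vecs V \<and> (\<forall>a\<in>U. near V a (\<lambda>x. x \<in> U))"
proof -
  have "mball a r \<subseteq> U \<longleftrightarrow> (\<forall>h\<in>vecs V. vnorm V h < r \<longrightarrow> a + h \<in> U)" if "a \<in> vecs V" for a r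
  proof
    assume *: "mball a r \<subseteq> U"
    have "a + h \<in> mball a r" if "h \<in> vecs V" "vnorm V h < r" for h
      using that \<open>a \<in> vecs V\<close> norm_diff_commute[of a "a + h"] norm_minus[of h]
      by (auto simp: in_mball vdist_def add_mem)
    with * show "\<forall>h\<in>vecs V. vnorm V h < r \<longrightarrow> a + h \<in> U" by blast
  next
    assume *: "\<forall>h\<in>vecs V. vnorm V h < r \<longrightarrow> a + h \<in> U"
    show "mball a r \<subseteq> U"
    proof
      fix x assume "x \<in> mball a r"
      then show "x \<in> U"
        using *[rule_format, of "x - a"] norm_diff_commute[of a x]
        by (auto simp: in_mball vdist_def diff_mem)
    qed
  qed
  then show ?thesis
    unfolding norm_topology_def openin_mtopology near_def by (meson subsetD)
qed

lemma (in normed_space_on) topspace_norm_topology: "topspace (norm_topology V) = vecs V"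
  by (simp add: norm_topology_def)

lemma (in normed_space_on) openin_vecs: "openin (norm_topology V) (vecs V)"
  by (simp add: norm_topology_def)

lemma (in normed_space_on) near_openin: "openin (norm_topology V) U \<Longrightarrow> a \<in> U \<Longrightarrow> near V a (\<lambda>x. x \<in> U)"
  by (simp add: openin_norm_topology)

lemma (in normed_space_on) near_ball: "a \<in> vecs V \<Longrightarrow> 0 < r \<Longrightarrow> near V a (\<lambda>x. x \<in> vecs V \<and> vnorm V (x - a) < r)"
  unfolding near_def by (auto simp: add_mem)

text \<open>\<open>power_series_at V W f a A C r\<close> is the witness condition in \<^const>\<open>analytic_between\<close>, with
  the requirement that the ball lies in the domain replaced by one on the values of \<open>f\<close>.\<close>

definition power_series_at ::
  "('k, 'v::ab_group_add) normed_on \<Rightarrow> ('k, 'w::ab_group_add) normed_on \<Rightarrow> ('v \<Rightarrow> 'w) \<Rightarrow> 'v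
     \<Rightarrow> (nat \<Rightarrow> (nat \<Rightarrow> 'v) \<Rightarrow> 'w) \<Rightarrow> (nat \<Rightarrow> real) \<Rightarrow> real \<Rightarrow> bool" where
  "power_series_at V W f a A C r \<longleftrightarrow> r > 0 \<and>
     (\<forall>n. multilinear_on V W n (A n)) \<and>
     (\<forall>n. C n \<ge> 0 \<and>
        (\<forall>x. (\<forall>i<n. x i \<in> vecs V) \<longrightarrow> vnorm W (A n x) \<le> C n * (\<Prod>i<n. vnorm V (x i)))) \<and>
     summable (\<lambda>n. C n * r ^ n) \<and>
     (\<forall>h\<in>vecs V. vnorm V h < r \<longrightarrow> f (a + h) \<in> vecs W \<and>
        (\<lambda>N. vnorm W (f (a + h) - (\<Sum>n<N. A n (\<lambda>_. h)))) \<longlonglongrightarrow> 0)"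

text \<open>No domain appears: local agreement of maps is expressed by \<open>near\<close>, and
  domains are dealt with once, in \<open>analytic_between_iff\<close>.\<close>

definition analytic_at ::
  "('k, 'v::ab_group_add) normed_on \<Rightarrow> ('k, 'w::ab_group_add) normed_on \<Rightarrow> ('v \<Rightarrow> 'w) \<Rightarrow> 'v \<Rightarrow> bool" where
  "analytic_at V W f a \<longleftrightarrow> a \<in> vecs V \<and> (\<exists>A C r. power_series_at V W f a A C r)"

lemma analytic_atE:
  assumes "analytic_at V W f a"
  obtains A C r where "a \<in> vecs V" "power_series_at V W f a A C r" "0 < r"
proof -
  have *: "a \<in> vecs V" "\<exists>A C r. power_series_at V W f a A C r"
    using assms by (simp_all add: analytic_at_def)
  from *(2) obtain A C r where P: "power_series_at V W f a A C r"
    by (elim exE) (rule that)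
  then have "0 < r" by (simp add: power_series_at_def)
  with * P show ?thesis by (intro that)
qed

lemma power_series_at_shrink:
  assumes "power_series_at V W f a A C r" "0 < s" "s \<le> r"
  shows "power_series_at V W f a A C s"
proof -
  have "summable (\<lambda>n. C n * s ^ n)"
  proof (rule summable_comparison_test[of _ "\<lambda>n. C n * r ^ n"])
    show "\<exists>N. \<forall>n\<ge>N. norm (C n * s ^ n) \<le> C n * r ^ n"
      using assms by (auto simp: power_series_at_def intro!: mult_left_mono power_mono)
  qed (use assms in \<open>simp add: power_series_at_def\<close>)
  then show ?thesis
    using assms unfolding power_series_at_def by (meson order_less_le_trans)
qed

lemma analytic_at_cong:
  assumes "analytic_at V W f a" "near V a (\<lambda>x. f x = g x)"
  shows "analytic_at V W g a"
proof -
  obtain A C r where *: "power_series_at V W f a A C r" and a: "a \<in> vecs V" and "0 < r"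
    using assms(1) by (rule analytic_atE)
  obtain s where s: "s > 0" "\<And>h. h \<in> vecs V \<Longrightarrow> vnorm V h < s \<Longrightarrow> f (a + h) = g (a + h)"
    using assms(2) unfolding near_def by blast
  have "power_series_at V W f a A C (min r s)"
    using power_series_at_shrink[OF *] s(1) \<open>0 < r\<close> by auto
  then have "power_series_at V W g a A C (min r s)"
    using s(2) unfolding power_series_at_def by simp
  with a show ?thesis
    unfolding analytic_at_def by blast
qed

lemma analytic_at_near_mem: "analytic_at V W f a \<Longrightarrow> near V a (\<lambda>x. f x \<in> vecs W)"
  unfolding analytic_at_def power_series_at_def near_def by blast

lemma analytic_at_mem: "analytic_at V W f a \<Longrightarrow> a \<in> vecs V"
  unfolding analytic_at_def by blast

lemma (in normed_space_on) analytic_at_value: "analytic_at V W f a \<Longrightarrow> f a \<in> vecs W"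
  by (rule near_imp[OF analytic_at_near_mem])

text \<open>The radius may be shrunk until its ball lies in the open set, so the condition on the
  domain separates from the condition on the series.\<close>

lemma (in normed_space_on) analytic_between_iff:
  "analytic_between V W U f \<longleftrightarrow> openin (norm_topology V) U \<and> (\<forall>a\<in>U. analytic_at V W f a)"
proof
  assume L: "analytic_between V W U f"
  have "analytic_at V W f a" if "a \<in> U" for a
  proof -
    have a: "a \<in> vecs V" and img: "f ` U \<subseteq> vecs W"
      using L that unfolding analytic_between_def openin_norm_topology by auto
    have "\<exists>A C r. r > 0 \<and>
        (\<forall>n. multilinear_on V W n (A n)) \<and>
        (\<forall>n. C n \<ge> 0 \<and>
           (\<forall>x. (\<forall>i<n. x i \<in> vecs V) \<longrightarrow> vnorm W (A n x) \<le> C n * (\<Prod>i<n. vnorm V (x i)))) \<and>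
        summable (\<lambda>n. C n * r ^ n) \<and>
        (\<forall>h\<in>vecs V. vnorm V h < r \<longrightarrow> a + h \<in> U \<and>
           (\<lambda>N. vnorm W (f (a + h) - (\<Sum>n<N. A n (\<lambda>_. h)))) \<longlonglongrightarrow> 0)"
      using L \<open>a \<in> U\<close> unfolding analytic_between_def by (elim conjE) (erule (1) bspec)
    then obtain A C r where "r > 0 \<and>
        (\<forall>n. multilinear_on V W n (A n)) \<and>
        (\<forall>n. C n \<ge> 0 \<and>
           (\<forall>x. (\<forall>i<n. x i \<in> vecs V) \<longrightarrow> vnorm W (A n x) \<le> C n * (\<Prod>i<n. vnorm V (x i)))) \<and>
        summable (\<lambda>n. C n * r ^ n) \<and>
        (\<forall>h\<in>vecs V. vnorm V h < r \<longrightarrow> a + h \<in> U \<and>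
           (\<lambda>N. vnorm W (f (a + h) - (\<Sum>n<N. A n (\<lambda>_. h)))) \<longlonglongrightarrow> 0)"
      by (elim exE) (rule that)
    then have "power_series_at V W f a A C r"
      using img unfolding power_series_at_def by blast
    with a show ?thesis unfolding analytic_at_def by blast
  qed
  moreover have "openin (norm_topology V) U"
    using L by (simp only: analytic_between_def)
  ultimately show "openin (norm_topology V) U \<and> (\<forall>a\<in>U. analytic_at V W f a)"
    by simp
next
  assume R: "openin (norm_topology V) U \<and> (\<forall>a\<in>U. analytic_at V W f a)"
  have series: "\<exists>A C r. r > 0 \<and>
        (\<forall>n. multilinear_on V W n (A n)) \<and>
        (\<forall>n. C n \<ge> 0 \<and>
           (\<forall>x. (\<forall>i<n. x i \<in> vecs V) \<longrightarrow> vnorm W (A n x) \<le> C n * (\<Prod>i<n. vnorm V (x i)))) \<and>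
        summable (\<lambda>n. C n * r ^ n) \<and>
        (\<forall>h\<in>vecs V. vnorm V h < r \<longrightarrow> a + h \<in> U \<and>
           (\<lambda>N. vnorm W (f (a + h) - (\<Sum>n<N. A n (\<lambda>_. h)))) \<longlonglongrightarrow> 0)" if "a \<in> U" for a
  proof -
    have "analytic_at V W f a" using R that by simp
    then obtain A C r where *: "power_series_at V W f a A C r" and "0 < r"
      by (rule analytic_atE)
    have "near V a (\<lambda>x. x \<in> U)" using near_openin[of U a] R that by simp
    then obtain s where s: "s > 0" "\<And>h. h \<in> vecs V \<Longrightarrow> vnorm V h < s \<Longrightarrow> a + h \<in> U"
      unfolding near_def by blast
    have "power_series_at V W f a A C (min r s)"
      using power_series_at_shrink[OF *] s(1) \<open>0 < r\<close> by auto
    then show ?thesis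
      using s(2) unfolding power_series_at_def
      by (intro exI[of _ A] exI[of _ C] exI[of _ "min r s"]) simp
  qed
  have "f ` U \<subseteq> vecs W"
    using R analytic_at_value by blast
  with R show "analytic_between V W U f"
    unfolding analytic_between_def by (intro conjI ballI) (erule conjunct1, assumption, rule series)
qed

section \<open>Multilinear maps and first estimates for power series\<close>

lemma multilinear_onD:
  assumes "multilinear_on V W n A"
  shows "\<And>x. (\<And>i. i < n \<Longrightarrow> x i \<in> vecs V) \<Longrightarrow> A x \<in> vecs W"
    and "\<And>x y. (\<And>i. i < n \<Longrightarrow> x i = y i) \<Longrightarrow> A x = A y"
    and "\<And>x i u v. (\<And>i. i < n \<Longrightarrow> x i \<in> vecs V) \<Longrightarrow> i < n \<Longrightarrow> u \<in> vecs V \<Longrightarrow> v \<in> vecs V \<Longrightarrow>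
        A (x(i := u + v)) = A (x(i := u)) + A (x(i := v))"
    and "\<And>x i c u. (\<And>i. i < n \<Longrightarrow> x i \<in> vecs V) \<Longrightarrow> i < n \<Longrightarrow> u \<in> vecs V \<Longrightarrow>
        A (x(i := vscale V c u)) = vscale W c (A (x(i := u)))"
  using assms unfolding multilinear_on_def by blast+

lemma multilinear_onI:
  assumes "\<And>x. (\<And>i. i < n \<Longrightarrow> x i \<in> vecs V) \<Longrightarrow> A x \<in> vecs W"
    and "\<And>x y. (\<And>i. i < n \<Longrightarrow> x i = y i) \<Longrightarrow> A x = A y"
    and "\<And>x i u v. (\<And>i. i < n \<Longrightarrow> x i \<in> vecs V) \<Longrightarrow> i < n \<Longrightarrow> u \<in> vecs V \<Longrightarrow> v \<in> vecs V \<Longrightarrow>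
        A (x(i := u + v)) = A (x(i := u)) + A (x(i := v))"
    and "\<And>x i c u. (\<And>i. i < n \<Longrightarrow> x i \<in> vecs V) \<Longrightarrow> i < n \<Longrightarrow> u \<in> vecs V \<Longrightarrow>
        A (x(i := vscale V c u)) = vscale W c (A (x(i := u)))"
  shows "multilinear_on V W n A"
  using assms unfolding multilinear_on_def by blast

text \<open>For exponents at least 1 the factor \<open>(t / r) ^ n\<close> is at most
  \<open>t / r\<close>. Without its constant term the majorant is therefore linearly small in
  \<open>t\<close>; this gives continuity and, later, the radius of a composed series.\<close>

lemma majorant_tail_le:
  fixes C :: "nat \<Rightarrow> real"
  assumes C: "\<And>n. C n \<ge> 0" and su: "summable (\<lambda>n. C n * r ^ n)" and t: "0 \<le> t" "t \<le> r" "0 < r"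
  shows "(\<Sum>n=1..<N. C n * t ^ n) \<le> (\<Sum>n. C n * r ^ n) * (t / r)"
proof -
  have "C n * t ^ n \<le> (C n * r ^ n) * (t / r)" if n: "n \<in> {1..<N}" for n
  proof -
    have "C n * t ^ n = (C n * r ^ n) * (t / r) ^ n"
      using t by (simp add: power_divide)
    also have "(t / r) ^ n \<le> t / r"
      using power_decreasing[of 1 n "t / r"] n t by simp
    finally show ?thesis
      using C[of n] t by (simp add: mult_left_mono)
  qed
  then have "(\<Sum>n=1..<N. C n * t ^ n) \<le> (\<Sum>n=1..<N. (C n * r ^ n) * (t / r))"
    by (rule sum_mono)
  also have "\<dots> = (\<Sum>n=1..<N. C n * r ^ n) * (t / r)"
    by (rule sum_distrib_right[symmetric])
  also have "\<dots> \<le> (\<Sum>n. C n * r ^ n) * (t / r)"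
    using t C by (intro mult_right_mono sum_le_suminf su) auto
  finally show ?thesis .
qed

locale normed_space_pair = V: normed_space_on V + W: normed_space_on W
  for V :: "('k::real_or_complex, 'v::ab_group_add) normed_on"
  and W :: "('k, 'w::ab_group_add) normed_on"
begin

lemma multilinear_zero:
  assumes "multilinear_on V W n A" "i < n" "x i = 0" "\<And>i. i < n \<Longrightarrow> x i \<in> vecs V"
  shows "A x = 0"
  using multilinear_onD(3)[OF assms(1), of x i 0 0] assms by (simp add: fun_upd_idem V.zero_mem)

lemma multilinear_diff:
  assumes "multilinear_on V W n A" "i < n" "u \<in> vecs V" "v \<in> vecs V" "\<And>i. i < n \<Longrightarrow> x i \<in> vecs V"
  shows "A (x(i := u - v)) = A (x(i := u)) - A (x(i := v))"
  using multilinear_onD(3)[OF assms(1), of x i "u - v" v] assms by (simp add: V.diff_mem)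

text \<open>At \<open>h = 0\<close> all terms of positive degree vanish, so the constant term is
  \<open>f a\<close>; its argument \<open>x\<close> is arbitrary because a 0-linear map ignores it.
  Both bounds are the linear decay of the majorant, once for the increment of \<open>f\<close> and
  once for its truncations.\<close>

lemma power_series_at_lipschitz:
  assumes P: "power_series_at V W f a A C r" and h: "h \<in> vecs V" "vnorm V h < r"
  shows "f (a + h) \<in> vecs W" "f a = A 0 x" 
    "vnorm W (f (a + h) - f a) \<le> (\<Sum>n. C n * r ^ n) * (vnorm V h / r)"
    "vnorm W (\<Sum>n=1..<N. A n (\<lambda>_. h)) \<le> (\<Sum>n. C n * r ^ n) * (vnorm V h / r)"
    "(\<lambda>N. vnorm W (f (a + h) - f a - (\<Sum>n=1..<N. A n (\<lambda>_. h)))) \<longlonglongrightarrow> 0"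
proof -
  note P' = P[unfolded power_series_at_def]
  have r: "r > 0" and ml: "\<And>n. multilinear_on V W n (A n)" and C: "\<And>n. C n \<ge> 0"
    and su: "summable (\<lambda>n. C n * r ^ n)"
    and bd: "\<And>n x. (\<And>i. i < n \<Longrightarrow> x i \<in> vecs V) \<Longrightarrow> vnorm W (A n x) \<le> C n * (\<Prod>i<n. vnorm V (x i))"
    and mem: "\<And>h. h \<in> vecs V \<Longrightarrow> vnorm V h < r \<Longrightarrow> f (a + h) \<in> vecs W"
    and lim: "\<And>h. h \<in> vecs V \<Longrightarrow> vnorm V h < r \<Longrightarrow>
      (\<lambda>N. vnorm W (f (a + h) - (\<Sum>n<N. A n (\<lambda>_. h)))) \<longlonglongrightarrow> 0"
    using P' by auto
  show fm: "f (a + h) \<in> vecs W" using mem h by blast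
  have Am: "A n (\<lambda>_. h) \<in> vecs W" if "h \<in> vecs V" for n h
    by (rule multilinear_onD(1)[OF ml]) (rule that)
  have A0: "A 0 y = A 0 x" for y
    by (rule multilinear_onD(2)[OF ml[of 0]]) simp
  have split: "(\<Sum>n<Suc N. A n (\<lambda>_. h)) = A 0 x + (\<Sum>n=1..<Suc N. A n (\<lambda>_. h))" for N h
    using A0[of "\<lambda>_. h"] by (simp add: lessThan_atLeast0 sum.atLeast_Suc_lessThan)
  show fa: "f a = A 0 x"
  proof -
    have "(\<lambda>N. vnorm W (f a - (\<Sum>n<Suc N. A n (\<lambda>_. 0)))) \<longlonglongrightarrow> 0"
      using lim[OF V.zero_mem] r by (simp add: V.norm_zero del: sum.lessThan_Suc) (rule LIMSEQ_Suc)
    moreover have "(\<Sum>n=1..<Suc N. A n (\<lambda>_. 0)) = 0" for N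
      by (rule sum.neutral) (auto intro!: multilinear_zero[OF ml, of 0] V.zero_mem)
    ultimately have "vnorm W (f a - A 0 x) = 0"
      by (simp add: split LIMSEQ_const_iff del: sum.lessThan_Suc)
    moreover have "f a \<in> vecs W" using mem[OF V.zero_mem] r by (simp add: V.norm_zero)
    moreover have "A 0 x \<in> vecs W" using A0[of "\<lambda>_. 0"] Am[OF V.zero_mem, of 0] by simp
    ultimately show ?thesis
      using W.norm_eq_zero[OF W.diff_mem] by auto
  qed
  have fam: "f a \<in> vecs W" using mem[OF V.zero_mem] r by (simp add: V.norm_zero)
  show lim1: "(\<lambda>N. vnorm W (f (a + h) - f a - (\<Sum>n=1..<N. A n (\<lambda>_. h)))) \<longlonglongrightarrow> 0"
    using LIMSEQ_Suc[OF lim[OF h]] unfolding split fa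
    by (intro LIMSEQ_imp_Suc[of "\<lambda>N. vnorm W (f (a + h) - A 0 x - (\<Sum>n=1..<N. A n (\<lambda>_. h)))"])
      (simp add: algebra_simps del: sum.lessThan_Suc sum.op_ivl_Suc)
  show part: "vnorm W (\<Sum>n=1..<N. A n (\<lambda>_. h)) \<le> (\<Sum>n. C n * r ^ n) * (vnorm V h / r)" for N
  proof -
    have "vnorm W (\<Sum>n=1..<N. A n (\<lambda>_. h)) \<le> (\<Sum>n=1..<N. vnorm W (A n (\<lambda>_. h)))"
      by (rule W.norm_sum_le) (use Am h in auto)
    also have "\<dots> \<le> (\<Sum>n=1..<N. C n * vnorm V h ^ n)"
      using bd[of _ "\<lambda>_. h"] h by (intro sum_mono) simp
    also have "\<dots> \<le> (\<Sum>n. C n * r ^ n) * (vnorm V h / r)"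
      using h r V.norm_nonneg by (intro majorant_tail_le C su) auto
    finally show ?thesis .
  qed
  \<comment> \<open>The increment is a partial sum plus a remainder that tends to 0; letting
    \<open>N\<close> grow leaves the bound for partial sums.\<close>
  have "vnorm W (f (a + h) - f a) \<le> (\<Sum>n. C n * r ^ n) * (vnorm V h / r)
     + vnorm W (f (a + h) - f a - (\<Sum>n=1..<N. A n (\<lambda>_. h)))" for N
  proof -
    have "vnorm W (f (a + h) - f a) \<le> vnorm W (f (a + h) - f a - (\<Sum>n=1..<N. A n (\<lambda>_. h)))
       + vnorm W (\<Sum>n=1..<N. A n (\<lambda>_. h))"
      using W.norm_triangle[OF W.diff_mem[OF W.diff_mem[OF fm fam] W.sum_mem] W.sum_mem,
        of "{1..<N}" "\<lambda>n. A n (\<lambda>_. h)" "{1..<N}" "\<lambda>n. A n (\<lambda>_. h)"] Am h by simp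
    with part[of N] show ?thesis by linarith
  qed
  then have "vnorm W (f (a + h) - f a) \<le> (\<Sum>n. C n * r ^ n) * (vnorm V h / r) + 0"
    by (intro LIMSEQ_le_const[OF tendsto_add[OF tendsto_const lim1]] exI allI impI)
  then show "vnorm W (f (a + h) - f a) \<le> (\<Sum>n. C n * r ^ n) * (vnorm V h / r)"
    by simp
qed

lemma analytic_at_near_ball:
  assumes "analytic_at V W f a" "e > 0"
  shows "near V a (\<lambda>x. f x \<in> vecs W \<and> vnorm W (f x - f a) < e)"
proof -
  obtain A C r where P: "power_series_at V W f a A C r" and r: "0 < r"
    using assms(1) by (rule analytic_atE)
  define S where "S = (\<Sum>n. C n * r ^ n)"
  have S: "S \<ge> 0"
    unfolding S_def using P by (intro suminf_nonneg) (auto simp: power_series_at_def)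
  \<comment> \<open>\<open>S + 1\<close> instead of \<open>S\<close> because the sum of the majorant
    may be 0.\<close>
  have "vnorm W (f (a + h) - f a) < e" if "h \<in> vecs V" "vnorm V h < r" "vnorm V h < e * r / (S + 1)" for h
  proof -
    have "vnorm W (f (a + h) - f a) \<le> S * (vnorm V h / r)"
      using power_series_at_lipschitz(3)[OF P that(1,2)] by (simp add: S_def)
    also have "\<dots> \<le> (S + 1) * (vnorm V h / r)"
      using r V.norm_nonneg[OF that(1)] by (intro mult_right_mono) auto
    also have "\<dots> < e"
      using that(3) r S by (simp add: field_simps)
    finally show ?thesis .
  qed
  then show ?thesis
    unfolding near_def using r S assms(2) power_series_at_lipschitz(1)[OF P]
    by (intro exI[of _ "min r (e * r / (S + 1))"]) (auto simp: field_simps)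
qed

lemma near_compose:
  assumes "analytic_at V W f a" "near W (f a) P"
  shows "near V a (\<lambda>x. P (f x))"
proof -
  obtain e where e: "e > 0" "\<And>k. k \<in> vecs W \<Longrightarrow> vnorm W k < e \<Longrightarrow> P (f a + k)"
    using assms(2) unfolding near_def by blast
  have "f a \<in> vecs W" by (rule V.analytic_at_value[OF assms(1)])
  then show ?thesis
    using e(2)[of "f x - f a" for x] W.diff_mem
    by (intro near_mono[OF analytic_at_near_ball[OF assms(1) e(1)]]) force
qed

lemma analytic_at_bounded_linear:
  assumes "bounded_linear_on V W L" "a \<in> vecs V"
  shows "analytic_at V W L a"
proof -
  obtain B where B: "\<And>x. x \<in> vecs V \<Longrightarrow> vnorm W (L x) \<le> B * vnorm V x"
    using assms(1) unfolding bounded_linear_on_def by blast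
  have L: "\<And>x. x \<in> vecs V \<Longrightarrow> L x \<in> vecs W"
    "\<And>x y. x \<in> vecs V \<Longrightarrow> y \<in> vecs V \<Longrightarrow> L (x + y) = L x + L y"
    "\<And>c x. x \<in> vecs V \<Longrightarrow> L (vscale V c x) = vscale W c (L x)"
    using assms(1) unfolding bounded_linear_on_def by auto
  define A where "A = (\<lambda>(n::nat) (x::nat \<Rightarrow> 'v). if n = 0 then L a else if n = 1 then L (x 0) else 0)"
  \<comment> \<open>\<open>B\<close> can be negative if \<open>V\<close> contains only 0, hence the
    absolute value.\<close>
  define C where "C = (\<lambda>n::nat. if n = 0 then vnorm W (L a) else if n = 1 then \<bar>B\<bar> else 0)"
  have "power_series_at V W L a A C 1"
    unfolding power_series_at_def
  proof (intro conjI allI ballI impI)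
    show "multilinear_on V W n (A n)" for n
      by (rule multilinear_onI)
        (auto simp: A_def L W.zero_mem W.scale_zero_right assms(2))
    show "C n \<ge> 0" for n by (auto simp: C_def W.norm_nonneg L assms(2))
    show "vnorm W (A n x) \<le> C n * (\<Prod>i<n. vnorm V (x i))" if "\<forall>i<n. x i \<in> vecs V" for n x
    proof -
      have "vnorm W (L (x 0)) \<le> \<bar>B\<bar> * vnorm V (x 0)" if "n = 1"
        using B[of "x 0"] V.norm_nonneg[of "x 0"] \<open>\<forall>i<n. x i \<in> vecs V\<close> that
        by (smt (verit, best) mult_right_mono less_one)
      then show ?thesis by (auto simp: A_def C_def W.norm_zero)
    qed
    show "summable (\<lambda>n. C n * 1 ^ n)"
      by (rule summable_finite[of "{0,1}"]) (auto simp: C_def)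
    fix h assume h: "h \<in> vecs V"
    then show "L (a + h) \<in> vecs W" using assms(2) L V.add_mem by blast
    have "vnorm W (L (a + h) - (\<Sum>n<N. A n (\<lambda>_. h))) = 0" if "N \<ge> 2" for N
    proof -
      have "(\<Sum>n<N. A n (\<lambda>_. h)) = (\<Sum>n\<in>{0,1}. A n (\<lambda>_. h))"
        using that by (intro sum.mono_neutral_right) (auto simp: A_def)
      then show ?thesis by (simp add: A_def L assms(2) h W.norm_zero)
    qed
    then show "(\<lambda>N. vnorm W (L (a + h) - (\<Sum>n<N. A n (\<lambda>_. h)))) \<longlonglongrightarrow> 0"
      by (intro tendsto_eventually eventually_sequentiallyI)
  qed simp
  with assms(2) show ?thesis unfolding analytic_at_def by blast
qed

lemma analytic_at_const:
  assumes "c \<in> vecs W" "a \<in> vecs V"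
  shows "analytic_at V W (\<lambda>_. c) a"
proof -
  define A where "A = (\<lambda>(n::nat) (x::nat \<Rightarrow> 'v). if n = 0 then c else 0)"
  define C where "C = (\<lambda>n::nat. if n = 0 then vnorm W c else 0)"
  have "power_series_at V W (\<lambda>_. c) a A C 1"
    unfolding power_series_at_def
  proof (intro conjI allI ballI impI)
    show "multilinear_on V W n (A n)" for n
      by (rule multilinear_onI) (auto simp: A_def W.zero_mem assms(1) W.scale_zero_right)
    show "C n \<ge> 0" for n by (auto simp: C_def W.norm_nonneg assms)
    show "vnorm W (A n x) \<le> C n * (\<Prod>i<n. vnorm V (x i))" for n x
      by (auto simp: A_def C_def W.norm_zero)
    show "summable (\<lambda>n. C n * 1 ^ n)"
      by (rule summable_finite[of "{0}"]) (auto simp: C_def)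
    fix h :: 'v
    have "vnorm W (c - (\<Sum>n<N. A n (\<lambda>_. h))) = 0" if "N \<ge> 1" for N
      using that by (simp add: A_def W.norm_zero sum.delta)
    then show "(\<lambda>N. vnorm W (c - (\<Sum>n<N. A n (\<lambda>_. h)))) \<longlonglongrightarrow> 0"
      by (intro tendsto_eventually eventually_sequentiallyI)
  qed (use assms in auto)
  with assms(2) show ?thesis unfolding analytic_at_def by blast
qed

lemma analytic_between_continuous:
  assumes "analytic_between V W U f"
  shows "continuous_map (subtopology (norm_topology V) U) (norm_topology W) f"
proof -
  have U: "openin (norm_topology V) U" and f: "\<And>a. a \<in> U \<Longrightarrow> analytic_at V W f a"
    using assms V.analytic_between_iff by auto
  have "openin (norm_topology V) {x \<in> U. f x \<in> O'}" if O': "openin (norm_topology W) O'" for O'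
    unfolding V.openin_norm_topology
  proof (intro conjI ballI)
    show "{x \<in> U. f x \<in> O'} \<subseteq> vecs V" using U V.openin_norm_topology by auto
    fix a assume a: "a \<in> {x \<in> U. f x \<in> O'}"
    have "near V a (\<lambda>x. x \<in> U \<and> f x \<in> O')"
      using a U O' by (intro near_conj near_compose[OF f] V.near_openin W.near_openin) auto
    then show "near V a (\<lambda>x. x \<in> {x \<in> U. f x \<in> O'})" by simp
  qed
  moreover have "{x \<in> vecs V. x \<in> U \<and> f x \<in> O'} = {x \<in> U. f x \<in> O'}" for O'
    using U V.openin_norm_topology by auto
  ultimately show ?thesis
    using V.analytic_at_value[OF f] U
    by (auto simp: continuous_map V.topspace_norm_topology W.topspace_norm_topology
        openin_open_subtopology)
qed

end

section \<open>Composition of analytic maps\<close>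

lemma multilinear_on_sum:
  assumes "normed_space_on W" "\<And>p. p \<in> P \<Longrightarrow> multilinear_on V W n (A p)"
  shows "multilinear_on V W n (\<lambda>x. \<Sum>p\<in>P. A p x)"
proof -
  interpret W: normed_space_on W by fact
  note A = multilinear_onD[OF assms(2)]
  have scale: "vscale W c (\<Sum>p\<in>P'. y p) = (\<Sum>p\<in>P'. vscale W c (y p))"
    if "\<And>p. p \<in> P' \<Longrightarrow> y p \<in> vecs W" for c P' and y :: "_ \<Rightarrow> _"
    using that by (induction P' rule: infinite_finite_induct)
      (simp_all add: W.scale_zero_right W.scale_add_right W.sum_mem)
  show ?thesis
  proof (rule multilinear_onI)
    show "(\<Sum>p\<in>P. A p x) \<in> vecs W" if "\<And>i. i < n \<Longrightarrow> x i \<in> vecs V" for x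
      by (rule W.sum_mem) (rule A(1), assumption, rule that)
    show "(\<Sum>p\<in>P. A p x) = (\<Sum>p\<in>P. A p y)" if "\<And>i. i < n \<Longrightarrow> x i = y i" for x y
      by (rule sum.cong[OF refl]) (rule A(2), assumption, rule that)
    show "(\<Sum>p\<in>P. A p (x(i := u + v))) = (\<Sum>p\<in>P. A p (x(i := u))) + (\<Sum>p\<in>P. A p (x(i := v)))"
      if "\<And>i. i < n \<Longrightarrow> x i \<in> vecs V" "i < n" "u \<in> vecs V" "v \<in> vecs V" for x i u v
      unfolding sum.distrib[symmetric]
      by (rule sum.cong[OF refl]) (rule A(3), assumption, rule that(1), assumption, rule that, rule that, rule that)
    show "(\<Sum>p\<in>P. A p (x(i := vscale V c u))) = vscale W c (\<Sum>p\<in>P. A p (x(i := u)))"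
      if "\<And>i. i < n \<Longrightarrow> x i \<in> vecs V" "i < n" "u \<in> vecs V" for x i c u
    proof -
      have "A p (x(i := u)) \<in> vecs W" if "p \<in> P" for p
        using \<open>p \<in> P\<close> by (rule A(1)) (use \<open>u \<in> vecs V\<close> \<open>\<And>i. i < n \<Longrightarrow> x i \<in> vecs V\<close> in auto)
      then have "vscale W c (\<Sum>p\<in>P. A p (x(i := u))) = (\<Sum>p\<in>P. vscale W c (A p (x(i := u))))"
        by (rule scale)
      also have "\<dots> = (\<Sum>p\<in>P. A p (x(i := vscale V c u)))"
        by (rule sum.cong[OF refl], rule A(4)[symmetric], assumption, rule that(1), assumption, rule that, rule that)
      finally show ?thesis by simp
    qed
  qed
qed

lemma (in normed_space_pair) multilinear_sum_slot:
  assumes ml: "multilinear_on V W n A" and k: "k < n"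
    and x: "\<And>i. i < n \<Longrightarrow> x i \<in> vecs V" and v: "\<And>j. j \<in> J \<Longrightarrow> v j \<in> vecs V"
  shows "A (x(k := \<Sum>j\<in>J. v j)) = (\<Sum>j\<in>J. A (x(k := v j)))"
  using v
proof (induction J rule: infinite_finite_induct)
  case (insert j J)
  then show ?case
    using multilinear_onD(3)[OF ml, of x k "v j" "sum v J"] x k by (simp add: V.sum_mem fun_upd_def)
qed (use multilinear_zero[OF ml k, of "x(k := 0)"] x in \<open>auto simp: V.zero_mem\<close>)

text \<open>Induction on the number \<open>k\<close> of slots that hold the sum. The other slots
  hold a free family \<open>w\<close>, into which the last slot is moved before the induction
  hypothesis is applied.\<close>

lemma (in normed_space_pair) multilinear_sum_expand:
  assumes ml: "multilinear_on V W n A" and J: "finite J" and v: "\<And>j. j \<in> J \<Longrightarrow> v j \<in> vecs V"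
  shows "A (\<lambda>i. \<Sum>j\<in>J. v j) = (\<Sum>l \<in> PiE {..<n} (\<lambda>_. J). A (\<lambda>i. v (l i)))"
proof -
  have *: "A (\<lambda>i. if i < k then sum v J else w i)
      = (\<Sum>l \<in> PiE {..<k} (\<lambda>_. J). A (\<lambda>i. if i < k then v (l i) else w i))"
    if "k \<le> n" "\<And>i. w i \<in> vecs V" for k w
    using that
  proof (induction k arbitrary: w)
    case (Suc k)
    let ?x = "\<lambda>l i. if i < k then v (l i) else w i"
    have lv: "v (l i) \<in> vecs V" if "l \<in> PiE {..<k} (\<lambda>_. J)" "i < k" for l i
      using that v by (auto simp: PiE_iff)
    have eq: "(\<lambda>i. if i < Suc k then sum v J else w i) = (\<lambda>i. if i < k then sum v J else (w(k := sum v J)) i)"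
      by auto
    have upd: "A ((?x l)(k := v j)) = A (\<lambda>i. if i < Suc k then v ((l(k := j)) i) else w i)" for l j
      by (rule arg_cong[of _ _ A], rule ext) simp
    have "A (\<lambda>i. if i < Suc k then sum v J else w i)
      = (\<Sum>l \<in> PiE {..<k} (\<lambda>_. J). A (\<lambda>i. if i < k then v (l i) else (w(k := sum v J)) i))"
      unfolding eq using Suc.prems v by (intro Suc.IH) (auto simp: V.sum_mem)
    also have "\<dots> = (\<Sum>l \<in> PiE {..<k} (\<lambda>_. J). A ((?x l)(k := sum v J)))"
      by (rule sum.cong[OF refl], rule arg_cong[of _ _ A], rule ext) simp
    also have "\<dots> = (\<Sum>l \<in> PiE {..<k} (\<lambda>_. J). \<Sum>j\<in>J. A ((?x l)(k := v j)))"
      using Suc.prems v lv by (intro sum.cong[OF refl] multilinear_sum_slot[OF ml]) auto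
    also have "\<dots> = (\<Sum>j\<in>J. \<Sum>l \<in> PiE {..<k} (\<lambda>_. J). A ((?x l)(k := v j)))"
      by (rule sum.swap)
    also have "\<dots> = (\<Sum>(j, l) \<in> J \<times> PiE {..<k} (\<lambda>_. J). A ((?x l)(k := v j)))"
      by (rule sum.cartesian_product)
    also have "\<dots> = (\<Sum>(j, l) \<in> J \<times> PiE {..<k} (\<lambda>_. J). A (\<lambda>i. if i < Suc k then v ((l(k := j)) i) else w i))"
      by (simp only: upd)
    also have "\<dots> = (\<Sum>l \<in> (\<lambda>(j, l). l(k := j)) ` (J \<times> PiE {..<k} (\<lambda>_. J)). A (\<lambda>i. if i < Suc k then v (l i) else w i))"
      using inj_combinator[of k "{..<k}" "\<lambda>_. J"]
      by (subst sum.reindex) (simp_all add: case_prod_unfold)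
    also have "(\<lambda>(j, l). l(k := j)) ` (J \<times> PiE {..<k} (\<lambda>_. J)) = PiE {..<Suc k} (\<lambda>_. J)"
      by (simp add: lessThan_Suc PiE_insert_eq)
    finally show ?case .
  qed simp
  have "A (\<lambda>i. \<Sum>j\<in>J. v j) = A (\<lambda>i. if i < n then sum v J else 0)"
    by (rule multilinear_onD(2)[OF ml]) simp
  also have "\<dots> = (\<Sum>l \<in> PiE {..<n} (\<lambda>_. J). A (\<lambda>i. if i < n then v (l i) else 0))"
    by (rule *) (simp_all add: V.zero_mem)
  also have "\<dots> = (\<Sum>l \<in> PiE {..<n} (\<lambda>_. J). A (\<lambda>i. v (l i)))"
    by (intro sum.cong[OF refl] multilinear_onD(2)[OF ml]) simp
  finally show ?thesis .
qed

text \<open>The arguments \<open>u\<close> are exchanged for \<open>v\<close> one slot at a time.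
  Each of the \<open>n\<close> exchanges changes one slot by \<open>u - v\<close> while the others
  stay bounded by \<open>q\<close>.\<close>

lemma (in normed_space_pair) multilinear_diagonal_lipschitz:
  assumes ml: "multilinear_on V W n A"
    and bd: "\<And>x. (\<And>i. i < n \<Longrightarrow> x i \<in> vecs V) \<Longrightarrow> vnorm W (A x) \<le> D * (\<Prod>i<n. vnorm V (x i))"
    and D: "D \<ge> 0" and u: "u \<in> vecs V" "vnorm V u \<le> q" and v: "v \<in> vecs V" "vnorm V v \<le> q"
  shows "vnorm W (A (\<lambda>_. u) - A (\<lambda>_. v)) \<le> D * (real n * q ^ (n - 1)) * vnorm V (u - v)"
proof -
  let ?w = "\<lambda>k i. if i < k then v else u"
  have wm: "?w k i \<in> vecs V" for k i using u v by auto
  have Aw: "A (?w k) \<in> vecs W" for k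
    by (rule multilinear_onD(1)[OF ml]) (rule wm)
  have "vnorm W (A (\<lambda>_. u) - A (?w k)) \<le> D * (real k * q ^ (n - 1)) * vnorm V (u - v)" if "k \<le> n" for k
    using that
  proof (induction k)
    case 0
    then show ?case by (simp add: W.norm_zero)
  next
    case (Suc k)
    have "?w (Suc k) = (?w k)(k := v)" "?w k = (?w k)(k := u)" by auto
    then have eq: "A (?w k) - A (?w (Suc k)) = A ((?w k)(k := u - v))"
      using multilinear_diff[OF ml, of k u v "?w k"] Suc.prems u v by auto
    have "vnorm W (A ((?w k)(k := u - v))) \<le> D * (\<Prod>i<n. vnorm V (((?w k)(k := u - v)) i))"
      using u v by (intro bd) (auto simp: V.diff_mem)
    also have "(\<Prod>i<n. vnorm V (((?w k)(k := u - v)) i))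
        = vnorm V (u - v) * (\<Prod>i\<in>{..<n} - {k}. vnorm V (((?w k)(k := u - v)) i))"
      using Suc.prems by (subst prod.remove[of _ k]) auto
    also have "(\<Prod>i\<in>{..<n} - {k}. vnorm V (((?w k)(k := u - v)) i)) \<le> (\<Prod>i\<in>{..<n} - {k}. q)"
      using u v by (intro prod_mono) (auto simp: V.norm_nonneg)
    also have "(\<Prod>i\<in>{..<n} - {k}. q) = q ^ (n - 1)"
      using Suc.prems by simp
    finally have step: "vnorm W (A (?w k) - A (?w (Suc k))) \<le> D * (vnorm V (u - v) * q ^ (n - 1))"
      unfolding eq using D V.norm_nonneg[OF V.diff_mem[OF u(1) v(1)]]
      by (simp add: mult_left_mono fun_upd_def)
    have "A (\<lambda>_. u) \<in> vecs W" using Aw[of 0] by simp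
    then have "vnorm W (A (\<lambda>_. u) - A (?w (Suc k)))
      \<le> vnorm W (A (\<lambda>_. u) - A (?w k)) + vnorm W (A (?w k) - A (?w (Suc k)))"
      using Aw by (intro W.norm_diff_triangle)
    also have "\<dots> \<le> D * (real (Suc k) * q ^ (n - 1)) * vnorm V (u - v)"
      using Suc step by (simp add: algebra_simps)
    finally show ?case .
  qed
  from this[of n] have "vnorm W (A (\<lambda>_. u) - A (?w n)) \<le> D * (real n * q ^ (n - 1)) * vnorm V (u - v)"
    by simp
  also have "A (?w n) = A (\<lambda>_. v)"
    by (rule multilinear_onD(2)[OF ml]) simp
  finally show ?thesis .
qed

text \<open>A term of the composed series inserts \<open>A (l 0)\<close>, \<open>A (l 1)\<close>,
  ... into \<open>B m\<close> and reads its arguments from one sequence, cut into consecutive blocks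
  of lengths \<open>l 0\<close>, \<open>l 1\<close>, ...; this is the index where block
  \<open>k\<close> begins.\<close>

definition block_start :: "(nat \<Rightarrow> nat) \<Rightarrow> nat \<Rightarrow> nat" where
  "block_start l k = (\<Sum>i<k. l i)"

lemma block_start_Suc: "block_start l (Suc k) = block_start l k + l k"
  by (simp add: block_start_def)

lemma block_start_mono: "k \<le> m \<Longrightarrow> block_start l k \<le> block_start l m"
  unfolding block_start_def by (rule sum_mono2) auto

lemma block_exists:
  "i < block_start l m \<Longrightarrow> \<exists>k<m. block_start l k \<le> i \<and> i < block_start l (Suc k)"
proof (induction m)
  case (Suc m)
  then show ?case
    by (cases "i < block_start l m") (auto simp: less_Suc_eq)
qed (simp add: block_start_def)

lemma prod_blocks:
  "(\<Prod>k<m. \<Prod>j<l k. f (block_start l k + j)) = (\<Prod>i<block_start l m. f i)"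
proof (induction m)
  case (Suc m)
  have "(\<Prod>i<a + b. f i) = (\<Prod>i<a. f i) * (\<Prod>j<b. f (a + j))" for a b
    by (induction b) (auto simp: mult.assoc)
  with Suc show ?case by (simp add: block_start_Suc)
qed (simp add: block_start_def)

definition compose_term ::
  "(nat \<Rightarrow> (nat \<Rightarrow> 'v) \<Rightarrow> 'w) \<Rightarrow> (nat \<Rightarrow> (nat \<Rightarrow> 'w) \<Rightarrow> 'z) \<Rightarrow> nat \<times> (nat \<Rightarrow> nat) \<Rightarrow> (nat \<Rightarrow> 'v) \<Rightarrow> 'z" where
  "compose_term A B = (\<lambda>(m, l) x. B m (\<lambda>k. A (l k) (\<lambda>j. x (block_start l k + j))))"

text \<open>Ordered decompositions of \<open>n\<close> into parts. The parts are positive because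
  the constant term of the inner series is the expansion point of the outer one; this makes each
  degree a finite sum.\<close>

definition compositions :: "nat \<Rightarrow> (nat \<times> (nat \<Rightarrow> nat)) set" where
  "compositions n = {(m, l). m \<le> n \<and> l \<in> PiE {..<m} (\<lambda>_. {1..n}) \<and> block_start l m = n}"

text \<open>The indices that arise when the truncated inner series is inserted into the truncated
  outer series and everything is multiplied out.\<close>

definition composition_box :: "nat \<Rightarrow> (nat \<times> (nat \<Rightarrow> nat)) set" where
  "composition_box N = Sigma {..<N} (\<lambda>m. PiE {..<m} (\<lambda>_. {1..<N}))"

lemma finite_composition_box: "finite (composition_box N)"
  unfolding composition_box_def by (intro finite_SigmaI finite_PiE) auto

text \<open>Positive parts force both their number and each single part to be at most the total, so
  every composition of \<open>n < N\<close> already fits into the box.\<close>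

lemma composition_box_level:
  assumes "n < N"
  shows "{p \<in> composition_box N. (case p of (m, l) \<Rightarrow> block_start l m) = n} = compositions n"
proof -
  have bounds: "m \<le> block_start l m" "\<And>i. i < m \<Longrightarrow> l i \<le> block_start l m"
    if "\<And>i. i < m \<Longrightarrow> 1 \<le> l i" for m l
  proof -
    have "(\<Sum>i<m. 1) \<le> block_start l m"
      unfolding block_start_def using that by (intro sum_mono) auto
    then show "m \<le> block_start l m" by simp
    show "l i \<le> block_start l m" if "i < m" for i
      unfolding block_start_def using that by (intro member_le_sum) auto
  qed
  have "(m, l) \<in> composition_box N \<and> block_start l m = n \<longleftrightarrow> (m, l) \<in> compositions n" for m l
  proof
    assume L: "(m, l) \<in> composition_box N \<and> block_start l m = n"
    then have l: "\<And>i. i < m \<Longrightarrow> 1 \<le> l i" "l \<in> extensional {..<m}"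
      by (simp_all add: composition_box_def PiE_iff)
    with bounds[of m l] L show "(m, l) \<in> compositions n"
      by (simp add: compositions_def PiE_iff)
  next
    assume "(m, l) \<in> compositions n"
    with \<open>n < N\<close> show "(m, l) \<in> composition_box N \<and> block_start l m = n"
      by (auto simp: compositions_def composition_box_def PiE_iff intro: le_less_trans)
  qed
  then show ?thesis by auto
qed

text \<open>Fewer than \<open>N\<close> parts, each below \<open>N\<close>, have total at most
  \<open>N * N\<close>; the added 1 makes the bound strict. Together with the previous lemma the box
  lies between the compositions of numbers below \<open>N\<close> and those of numbers below
  \<open>N * N + 1\<close>.\<close>

lemma composition_box_weight_less:
  assumes "(m, l) \<in> composition_box N"
  shows "block_start l m < N * N + 1" "(m, l) \<in> composition_box (N * N + 1)"
proof -
  have m: "m < N" and l: "l \<in> PiE {..<m} (\<lambda>_. {1..<N})"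
    using assms by (auto simp: composition_box_def)
  have "block_start l m \<le> (\<Sum>i<m. N)"
    unfolding block_start_def using l by (intro sum_mono) (force simp: PiE_iff)
  also have "\<dots> \<le> N * N" using m by simp
  finally show "block_start l m < N * N + 1" by simp
  have "N \<le> N * N + 1"
    by (cases N) auto
  then show "(m, l) \<in> composition_box (N * N + 1)"
    using m l by (force simp: composition_box_def PiE_iff)
qed

locale normed_space_triple = normed_space_pair V W + Z: normed_space_on Z
  for V :: "('k::real_or_complex, 'v::ab_group_add) normed_on"
  and W :: "('k, 'w::ab_group_add) normed_on"
  and Z :: "('k, 'z::ab_group_add) normed_on"
begin

sublocale WZ: normed_space_pair W Z ..
sublocale VZ: normed_space_pair V Z ..

text \<open>An index \<open>i\<close> lies in exactly one block \<open>k\<close>, so changing the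
  argument there changes a single slot of \<open>B m\<close>. Linearity in \<open>i\<close> is
  linearity of \<open>A (l k)\<close> in the position inside the block, followed by linearity of
  \<open>B m\<close> in slot \<open>k\<close>.\<close>

lemma multilinear_compose_term:
  assumes mlA: "\<And>n. multilinear_on V W n (A n)" and mlB: "multilinear_on W Z m (B m)"
  shows "multilinear_on V Z (block_start l m) (compose_term A B (m, l))"
proof -
  let ?b = "block_start l"
  have le: "?b k + j < ?b m" if "k < m" "j < l k" for k j
    using block_start_mono[of "Suc k" m l] that by (simp add: block_start_Suc)
  have memY: "A (l k) (\<lambda>j. x (?b k + j)) \<in> vecs W" if "k < m" "\<And>i. i < ?b m \<Longrightarrow> x i \<in> vecs V" for k x
    by (rule multilinear_onD(1)[OF mlA]) (use le that in auto)
  have key: "\<exists>k<m. \<exists>i0<l k. (\<forall>u. compose_term A B (m, l) (x(i := u)) =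
      B m ((\<lambda>k. A (l k) (\<lambda>j. x (?b k + j)))(k := A (l k) ((\<lambda>j. x (?b k + j))(i0 := u)))))"
    if i: "i < ?b m" for x :: "nat \<Rightarrow> 'v" and i
  proof -
    obtain k where k: "k < m" "?b k \<le> i" "i < ?b (Suc k)"
      using block_exists[OF i] by blast
    have "compose_term A B (m, l) (x(i := u)) =
      B m ((\<lambda>k. A (l k) (\<lambda>j. x (?b k + j)))(k := A (l k) ((\<lambda>j. x (?b k + j))(i - ?b k := u))))" for u
      unfolding compose_term_def prod.case
    proof (rule multilinear_onD(2)[OF mlB])
      fix k' assume "k' < m"
      show "A (l k') (\<lambda>j. (x(i := u)) (?b k' + j)) =
        ((\<lambda>k. A (l k) (\<lambda>j. x (?b k + j)))(k := A (l k) ((\<lambda>j. x (?b k + j))(i - ?b k := u)))) k'"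
      proof (cases "k' = k")
        case True
        have "(\<lambda>j. (x(i := u)) (?b k + j)) = (\<lambda>j. x (?b k + j))(i - ?b k := u)"
          by (rule ext) (use k in auto)
        with True show ?thesis by simp
      next
        case False
        have "A (l k') (\<lambda>j. (x(i := u)) (?b k' + j)) = A (l k') (\<lambda>j. x (?b k' + j))"
        proof (rule multilinear_onD(2)[OF mlA])
          fix j assume j: "j < l k'"
          have "?b k' + j \<noteq> i"
            using False k j block_start_mono[of "Suc k'" k l] block_start_mono[of "Suc k" k' l]
            by (cases "k' < k") (auto simp: block_start_Suc)
          then show "(x(i := u)) (?b k' + j) = x (?b k' + j)" by simp
        qed
        with False show ?thesis by simp
      qed
    qed
    moreover have "i - ?b k < l k" using k by (simp add: block_start_Suc)
    ultimately show ?thesis using k(1) by blast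
  qed
  show ?thesis
  proof (rule multilinear_onI)
    show "compose_term A B (m, l) x \<in> vecs Z" if "\<And>i. i < ?b m \<Longrightarrow> x i \<in> vecs V" for x
      unfolding compose_term_def prod.case
      by (rule multilinear_onD(1)[OF mlB]) (rule memY, assumption, rule that)
    show "compose_term A B (m, l) x = compose_term A B (m, l) y"
      if "\<And>i. i < ?b m \<Longrightarrow> x i = y i" for x y
      unfolding compose_term_def prod.case
      by (rule multilinear_onD(2)[OF mlB], rule multilinear_onD(2)[OF mlA], rule that, rule le)
    fix x :: "nat \<Rightarrow> 'v" and i
    assume x: "\<And>i. i < ?b m \<Longrightarrow> x i \<in> vecs V" and i: "i < ?b m"
    define Y where "Y = (\<lambda>k. A (l k) (\<lambda>j. x (?b k + j)))"
    define X where "X = (\<lambda>k j. x (?b k + j))"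
    obtain k i0 where k: "k < m" and i0: "i0 < l k"
      and eq: "\<And>u. compose_term A B (m, l) (x(i := u)) = B m (Y(k := A (l k) ((X k)(i0 := u))))"
      using key[OF i, of x] unfolding X_def Y_def by blast
    have Y: "Y k \<in> vecs W" if "k < m" for k
      unfolding Y_def by (rule memY[OF that x])
    have X: "X k j \<in> vecs V" if "j < l k" for j
      unfolding X_def by (rule x, rule le[OF k that])
    have AX: "A (l k) ((X k)(i0 := u)) \<in> vecs W" if "u \<in> vecs V" for u
      by (rule multilinear_onD(1)[OF mlA]) (use X that in auto)
    show "compose_term A B (m, l) (x(i := u + v))
      = compose_term A B (m, l) (x(i := u)) + compose_term A B (m, l) (x(i := v))"
      if "u \<in> vecs V" "v \<in> vecs V" for u v
    proof -
      have "A (l k) ((X k)(i0 := u + v)) = A (l k) ((X k)(i0 := u)) + A (l k) ((X k)(i0 := v))"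
        by (rule multilinear_onD(3)[OF mlA]) (use X i0 that in auto)
      then show ?thesis
        using multilinear_onD(3)[OF mlB Y k AX[OF that(1)] AX[OF that(2)]] by (simp only: eq)
    qed
    show "compose_term A B (m, l) (x(i := vscale V c u)) = vscale Z c (compose_term A B (m, l) (x(i := u)))"
      if "u \<in> vecs V" for c u
    proof -
      have "A (l k) ((X k)(i0 := vscale V c u)) = vscale W c (A (l k) ((X k)(i0 := u)))"
        by (rule multilinear_onD(4)[OF mlA]) (use X i0 that in auto)
      then show ?thesis
        using multilinear_onD(4)[OF mlB Y k AX[OF that]] by (simp only: eq)
    qed
  qed
qed

lemma compose_term_bound:
  assumes mlA: "\<And>n. multilinear_on V W n (A n)"
    and bdA: "\<And>n x. (\<And>i. i < n \<Longrightarrow> x i \<in> vecs V) \<Longrightarrow> vnorm W (A n x) \<le> C n * (\<Prod>i<n. vnorm V (x i))"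
    and bdB: "\<And>m x. (\<And>i. i < m \<Longrightarrow> x i \<in> vecs W) \<Longrightarrow> vnorm Z (B m x) \<le> D m * (\<Prod>i<m. vnorm W (x i))"
    and D: "\<And>m. D m \<ge> 0"
    and x: "\<And>i. i < block_start l m \<Longrightarrow> x i \<in> vecs V"
  shows "vnorm Z (compose_term A B (m, l) x)
    \<le> (D m * (\<Prod>k<m. C (l k))) * (\<Prod>i<block_start l m. vnorm V (x i))"
proof -
  let ?b = "block_start l"
  have le: "?b k + j < ?b m" if "k < m" "j < l k" for k j
    using block_start_mono[of "Suc k" m l] that by (simp add: block_start_Suc)
  have xb: "x (?b k + j) \<in> vecs V" if "k < m" "j < l k" for k j
    using le[OF that] x by auto
  have Am: "A (l k) (\<lambda>j. x (?b k + j)) \<in> vecs W" if "k < m" for k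
    by (rule multilinear_onD(1)[OF mlA]) (rule xb[OF that])
  have "vnorm Z (compose_term A B (m, l) x) \<le> D m * (\<Prod>k<m. vnorm W (A (l k) (\<lambda>j. x (?b k + j))))"
    unfolding compose_term_def prod.case by (rule bdB) (rule Am)
  also have "(\<Prod>k<m. vnorm W (A (l k) (\<lambda>j. x (?b k + j))))
      \<le> (\<Prod>k<m. C (l k) * (\<Prod>j<l k. vnorm V (x (?b k + j))))"
    using xb Am by (intro prod_mono conjI bdA W.norm_nonneg) auto
  also have "\<dots> = (\<Prod>k<m. C (l k)) * (\<Prod>i<?b m. vnorm V (x i))"
    by (simp add: prod.distrib prod_blocks[of "\<lambda>i. vnorm V (x i)"])
  finally show ?thesis
    using D[of m] by (simp add: mult_left_mono mult.assoc)
qed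

end

text \<open>The difference \<open>s ^ m - q ^ m\<close> is \<open>s - q\<close> times a sum of
  \<open>m\<close> terms, each at least \<open>q ^ (m - 1)\<close>. This bounds the Lipschitz
  constant of the m-th outer term on the ball of radius \<open>q\<close> by a multiple of its
  majorant at \<open>s\<close>.\<close>

lemma real_power_derivative_le:
  fixes q s :: real
  assumes "0 \<le> q" "q < s"
  shows "real m * q ^ (m - 1) * (s - q) \<le> s ^ m"
proof -
  have "real m * q ^ (m - 1) * (s - q) \<le> s ^ m - q ^ m"
  proof (induction m)
    case (Suc m)
    have "real (Suc m) * q ^ (Suc m - 1) * (s - q) = q * (real m * q ^ (m - 1) * (s - q)) + q ^ m * (s - q)"
      by (cases m) (auto simp: algebra_simps)
    also have "\<dots> \<le> q * (s ^ m - q ^ m) + q ^ m * (s - q)"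
      using Suc assms by (intro add_right_mono mult_left_mono) auto
    also have "\<dots> = s ^ Suc m - q ^ Suc m - (s - q) * (s ^ m - q ^ m)"
      by (simp add: algebra_simps)
    also have "\<dots> \<le> s ^ Suc m - q ^ Suc m"
      using assms power_mono[of q s m] by simp
    finally show ?case .
  qed simp
  also have "\<dots> \<le> s ^ m" using assms by simp
  finally show ?thesis .
qed

context normed_space_triple
begin

text \<open>Regrouping \<open>\<Sum>m. B m (u, \<dots>, u)\<close> with \<open>u = (\<Sum>n\<ge>1. A n (h, \<dots>, h))\<close> by total degree: the partial
  sums over the boxes \<open>m, n < N\<close> and over the compositions of numbers below \<open>N\<close> are cofinal, so they
  have the same limit.\<close>

theorem analytic_at_compose:
  assumes f: "analytic_at V W f a" and g: "analytic_at W Z g (f a)"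
  shows "analytic_at V Z (\<lambda>x. g (f x)) a"
proof -
  obtain A C r where a: "a \<in> vecs V" and P: "power_series_at V W f a A C r" and r: "0 < r"
    using f by (rule analytic_atE)
  obtain B D s where b: "f a \<in> vecs W" and Q: "power_series_at W Z g (f a) B D s" and s: "0 < s"
    using g by (rule analytic_atE)
  have mlA: "\<And>n. multilinear_on V W n (A n)" and C: "\<And>n. C n \<ge> 0"
    and suC: "summable (\<lambda>n. C n * r ^ n)"
    and bdA: "\<And>n x. (\<And>i. i < n \<Longrightarrow> x i \<in> vecs V) \<Longrightarrow> vnorm W (A n x) \<le> C n * (\<Prod>i<n. vnorm V (x i))"
    using P by (simp_all add: power_series_at_def)
  have mlB: "\<And>n. multilinear_on W Z n (B n)" and D: "\<And>n. D n \<ge> 0"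
    and suD: "summable (\<lambda>n. D n * s ^ n)"
    and bdB: "\<And>n x. (\<And>i. i < n \<Longrightarrow> x i \<in> vecs W) \<Longrightarrow> vnorm Z (B n x) \<le> D n * (\<Prod>i<n. vnorm W (x i))"
    and memg: "\<And>k. k \<in> vecs W \<Longrightarrow> vnorm W k < s \<Longrightarrow> g (f a + k) \<in> vecs Z"
    and limg: "\<And>k. k \<in> vecs W \<Longrightarrow> vnorm W k < s \<Longrightarrow>
      (\<lambda>N. vnorm Z (g (f a + k) - (\<Sum>n<N. B n (\<lambda>_. k)))) \<longlonglongrightarrow> 0"
    using Q by (simp_all add: power_series_at_def)
  define S where "S = (\<Sum>n. C n * r ^ n)"
  have S: "S \<ge> 0"
    unfolding S_def using suC C r by (intro suminf_nonneg) auto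
  \<comment> \<open>\<open>q\<close> bounds the increment of \<open>f\<close> on the ball of radius
    \<open>\<rho>\<close>. The choice of \<open>\<rho>\<close> gives
    \<open>q \<le> S * (s / (2 * (S + 1))) < s\<close>, so increments stay strictly inside the ball
    where the series of \<open>g\<close> converges.\<close>
  define \<rho> where "\<rho> = min r (r * s / (2 * (S + 1)))"
  define q where "q = S * (\<rho> / r)"
  have \<rho>: "0 < \<rho>" "\<rho> \<le> r"
    using r s S by (auto simp: \<rho>_def)
  have q0: "0 \<le> q" using S \<rho> r by (simp add: q_def)
  have "\<rho> / r \<le> (r * s / (2 * (S + 1))) / r"
    unfolding \<rho>_def using r by (intro divide_right_mono) auto
  then have "q \<le> S * (s / (2 * (S + 1)))"
    unfolding q_def using S r by (intro mult_left_mono) auto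
  also have "\<dots> < s"
  proof -
    have "S * s < s * (2 * (S + 1))"
      using S s by (simp add: algebra_simps add_nonneg_pos)
    then show ?thesis using S by (simp add: pos_divide_less_eq)
  qed
  finally have qs: "q < s" .
  have tail: "(\<Sum>n=1..<N. C n * \<rho> ^ n) \<le> q" for N
    unfolding q_def S_def using \<rho> r by (intro majorant_tail_le C suC) auto
  define deg where "deg = (\<lambda>(m::nat, l). block_start l m)"
  define T where "T = (\<lambda>(m, l). D m * (\<Prod>k<m. C (l k) * \<rho> ^ l k))"
  define E where "E n x = (\<Sum>p\<in>compositions n. compose_term A B p x)" for n x
  define e where "e n = (\<Sum>(m, l)\<in>compositions n. D m * (\<Prod>k<m. C (l k)))" for n
  have T: "T p \<ge> 0" for p
    using \<rho> C D by (auto simp: T_def intro!: mult_nonneg_nonneg prod_nonneg split: prod.split)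
  have T_eq: "T (m, l) = (D m * (\<Prod>k<m. C (l k))) * \<rho> ^ block_start l m" for m l
    by (simp add: T_def block_start_def prod.distrib power_sum)
  have fin: "finite (compositions n)" for n
    using finite_composition_box[of "Suc n"] by (subst composition_box_level[symmetric, of n "Suc n"]) auto
  have level: "{p \<in> composition_box N. deg p = n} = compositions n" if "n < N" for n N
    using composition_box_level[OF that] by (simp add: deg_def)
  have e_eq: "e n * \<rho> ^ n = (\<Sum>p\<in>compositions n. T p)" for n
    unfolding e_def sum_distrib_right
  proof (rule sum.cong[OF refl])
    fix p assume "p \<in> compositions n"
    then obtain m l where "p = (m, l)" "block_start l m = n"
      by (cases p) (simp add: compositions_def)
    then show "(case p of (m, l) \<Rightarrow> D m * (\<Prod>k<m. C (l k))) * \<rho> ^ n = T p"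
      by (simp add: T_eq)
  qed
  have group: "(\<Sum>n<N. \<Sum>p\<in>compositions n. G p) = (\<Sum>p\<in>{p \<in> composition_box N. deg p < N}. G p)"
    for N and G :: "nat \<times> (nat \<Rightarrow> nat) \<Rightarrow> 'b::comm_monoid_add"
  proof -
    have "(\<Sum>n<N. \<Sum>p\<in>compositions n. G p)
        = (\<Sum>n<N. \<Sum>p\<in>{p \<in> {p \<in> composition_box N. deg p < N}. deg p = n}. G p)"
    proof (rule sum.cong[OF refl])
      fix n assume "n \<in> {..<N}"
      then have "{p \<in> {p \<in> composition_box N. deg p < N}. deg p = n} = compositions n"
        using level[of n N] by auto
      then show "(\<Sum>p\<in>compositions n. G p) = (\<Sum>p\<in>{p \<in> {p \<in> composition_box N. deg p < N}. deg p = n}. G p)"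
        by simp
    qed
    also have "\<dots> = (\<Sum>p\<in>{p \<in> composition_box N. deg p < N}. G p)"
      by (rule sum.group) (use finite_composition_box in auto)
    finally show ?thesis .
  qed
  \<comment> \<open>By distributivity the majorants over a box add up to the truncated outer
    majorant evaluated at the truncated inner one; this is what boxes are made for.\<close>
  have box_T: "(\<Sum>p\<in>composition_box N. T p) = (\<Sum>m<N. D m * (\<Sum>n=1..<N. C n * \<rho> ^ n) ^ m)" for N
  proof -
    have "(\<Sum>p\<in>composition_box N. T p)
        = (\<Sum>m<N. \<Sum>l\<in>PiE {..<m} (\<lambda>_. {1..<N}). D m * (\<Prod>k<m. C (l k) * \<rho> ^ l k))"
      unfolding composition_box_def T_def by (subst sum.Sigma) (auto intro!: finite_PiE)
    also have "\<dots> = (\<Sum>m<N. D m * (\<Prod>k<m. \<Sum>n=1..<N. C n * \<rho> ^ n))"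
      by (subst prod_sum_PiE) (auto simp: sum_distrib_left)
    finally show ?thesis by simp
  qed
  have box_le: "(\<Sum>p\<in>composition_box N. T p) \<le> (\<Sum>m. D m * s ^ m)" for N
  proof -
    have "(\<Sum>n=1..<N. C n * \<rho> ^ n) \<le> s"
      using tail[of N] qs by linarith
    then have "(\<Sum>p\<in>composition_box N. T p) \<le> (\<Sum>m<N. D m * s ^ m)"
      unfolding box_T using C \<rho> D by (intro sum_mono mult_left_mono power_mono sum_nonneg) auto
    also have "\<dots> \<le> (\<Sum>m. D m * s ^ m)"
      using D s by (intro sum_le_suminf suD) auto
    finally show ?thesis .
  qed
  have part_le: "(\<Sum>n<N. e n * \<rho> ^ n) \<le> (\<Sum>p\<in>composition_box N. T p)" for N
    unfolding e_eq group using T finite_composition_box by (intro sum_mono2) auto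
  have box_le_part: "(\<Sum>p\<in>composition_box N. T p) \<le> (\<Sum>n<N * N + 1. e n * \<rho> ^ n)" for N
    unfolding e_eq group using T finite_composition_box composition_box_weight_less
    by (intro sum_mono2) (auto simp: deg_def)
  have e0: "0 \<le> e n" for n
    unfolding e_def using C D by (auto intro!: sum_nonneg mult_nonneg_nonneg prod_nonneg)
  have sue: "summable (\<lambda>n. e n * \<rho> ^ n)"
  proof (rule summableI_nonneg_bounded)
    show "(\<Sum>n<N. e n * \<rho> ^ n) \<le> (\<Sum>m. D m * s ^ m)" for N
      using part_le[of N] box_le[of N] by linarith
  qed (use e0 \<rho> in auto)
  have "(\<lambda>N. \<Sum>n<N. e n * \<rho> ^ n) \<longlonglongrightarrow> (\<Sum>n. e n * \<rho> ^ n)"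
    by (rule summable_LIMSEQ[OF sue])
  moreover have "(\<lambda>N. \<Sum>n<N * N + 1. e n * \<rho> ^ n) \<longlonglongrightarrow> (\<Sum>n. e n * \<rho> ^ n)"
  proof -
    have "filterlim (\<lambda>N::nat. N * N + 1) at_top at_top"
    proof (rule filterlim_at_top_mono[OF filterlim_ident], rule always_eventually, rule allI)
      show "N \<le> N * N + 1" for N :: nat by (cases N) auto
    qed
    from filterlim_compose[OF summable_LIMSEQ[OF sue] this] show ?thesis .
  qed
  \<comment> \<open>The box sum of the majorants is squeezed between these two partial sums of one
    convergent series, so what lies between them is negligible.\<close>
  ultimately have gap: "(\<lambda>N. (\<Sum>n<N * N + 1. e n * \<rho> ^ n) - (\<Sum>n<N. e n * \<rho> ^ n)) \<longlonglongrightarrow> 0"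
    using tendsto_diff by fastforce
  have "power_series_at V Z (\<lambda>x. g (f x)) a E e \<rho>"
    unfolding power_series_at_def
  proof (intro conjI allI ballI impI)
    have mlt: "multilinear_on V Z n (compose_term A B p)" if "p \<in> compositions n" for n p
      using multilinear_compose_term[where A = A and B = B and m = "fst p" and l = "snd p", OF mlA mlB] that
      by (cases p) (simp add: compositions_def)
    show "multilinear_on V Z n (E n)" for n
      unfolding E_def by (rule multilinear_on_sum[OF Z.normed_space_on_axioms mlt])
    show "vnorm Z (E n x) \<le> e n * (\<Prod>i<n. vnorm V (x i))" if x: "\<forall>i<n. x i \<in> vecs V" for n x
    proof -
      have "vnorm Z (E n x) \<le> (\<Sum>p\<in>compositions n. vnorm Z (compose_term A B p x))"
        unfolding E_def using x by (intro Z.norm_sum_le multilinear_onD(1)[OF mlt]) auto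
      also have "\<dots> \<le> (\<Sum>(m, l)\<in>compositions n. (D m * (\<Prod>k<m. C (l k))) * (\<Prod>i<n. vnorm V (x i)))"
      proof (rule sum_mono, clarify)
        fix m l assume ml: "(m, l) \<in> compositions n"
        then have n: "block_start l m = n" by (simp add: compositions_def)
        show "vnorm Z (compose_term A B (m, l) x) \<le> (D m * (\<Prod>k<m. C (l k))) * (\<Prod>i<n. vnorm V (x i))"
          using compose_term_bound[where l = l and m = m and x = x, OF mlA bdA bdB D] x unfolding n by auto
      qed
      finally show ?thesis
        unfolding e_def by (simp add: sum_distrib_right case_prod_unfold)
    qed
    fix h assume h: "h \<in> vecs V" "vnorm V h < \<rho>"
    then have hr: "vnorm V h < r" using \<rho> by linarith
    define u where "u = f (a + h) - f a"
    define uN where "uN N = (\<Sum>n=1..<N. A n (\<lambda>_. h))" for N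
    note lip = power_series_at_lipschitz[OF P h(1) hr]
    have scale_q: "S * (vnorm V h / r) \<le> q"
      unfolding q_def using h S r by (intro mult_left_mono divide_right_mono) auto
    have u: "u \<in> vecs W" "vnorm W u \<le> q"
      using lip(1) lip(3) b scale_q by (auto simp: u_def W.diff_mem S_def)
    have Am: "A n (\<lambda>_. h) \<in> vecs W" for n
      by (rule multilinear_onD(1)[OF mlA]) (rule h)
    have uN: "uN N \<in> vecs W" "vnorm W (uN N) \<le> q" for N
      using lip(4)[of N] scale_q Am unfolding uN_def by (auto simp: S_def intro!: W.sum_mem)
    have gu: "g (f (a + h)) = g (f a + u)" by (simp add: u_def)
    show mem: "g (f (a + h)) \<in> vecs Z"
      unfolding gu using u qs by (intro memg) auto
    have Bm: "B m (\<lambda>_. v) \<in> vecs Z" if "v \<in> vecs W" for m v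
      by (rule multilinear_onD(1)[OF mlB]) (rule that)
    have tm: "compose_term A B (m, l) (\<lambda>_. h) \<in> vecs Z" for m l
      by (rule multilinear_onD(1)[OF multilinear_compose_term[OF mlA mlB]]) (rule h)
    have Em: "E n (\<lambda>_. h) \<in> vecs Z" for n
      unfolding E_def by (rule Z.sum_mem) (use tm in auto)
    \<comment> \<open>A Lipschitz constant for all partial sums of the series of \<open>g\<close> at
      once, on increments of norm at most \<open>q\<close>.\<close>
    define K where "K = (\<Sum>m. D m * s ^ m) / (s - q)"
    have diff_le: "vnorm Z ((\<Sum>m<N. B m (\<lambda>_. u)) - (\<Sum>m<N. B m (\<lambda>_. uN N))) \<le> K * vnorm W (u - uN N)" for N
    proof -
      have "vnorm Z ((\<Sum>m<N. B m (\<lambda>_. u)) - (\<Sum>m<N. B m (\<lambda>_. uN N)))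
          \<le> (\<Sum>m<N. vnorm Z (B m (\<lambda>_. u) - B m (\<lambda>_. uN N)))"
        unfolding sum_subtractf[symmetric] using u uN by (intro Z.norm_sum_le Z.diff_mem Bm) auto
      also have "\<dots> \<le> (\<Sum>m<N. (D m * s ^ m) / (s - q) * vnorm W (u - uN N))"
      proof (rule sum_mono)
        fix m
        have "vnorm Z (B m (\<lambda>_. u) - B m (\<lambda>_. uN N)) \<le> D m * (real m * q ^ (m - 1)) * vnorm W (u - uN N)"
          by (rule WZ.multilinear_diagonal_lipschitz[OF mlB bdB D u uN])
        also have "\<dots> \<le> D m * (s ^ m / (s - q)) * vnorm W (u - uN N)"
          using real_power_derivative_le[OF q0 qs, of m] qs D W.norm_nonneg[OF W.diff_mem[OF u(1) uN(1)]]
          by (intro mult_right_mono mult_left_mono) (auto simp: field_simps)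
        finally show "vnorm Z (B m (\<lambda>_. u) - B m (\<lambda>_. uN N)) \<le> (D m * s ^ m) / (s - q) * vnorm W (u - uN N)"
          by simp
      qed
      also have "\<dots> = (\<Sum>m<N. D m * s ^ m) * (1 / (s - q) * vnorm W (u - uN N))"
        unfolding sum_distrib_right by (rule sum.cong[OF refl]) simp
      also have "\<dots> \<le> (\<Sum>m. D m * s ^ m) * (1 / (s - q) * vnorm W (u - uN N))"
        using D s qs W.norm_nonneg[OF W.diff_mem[OF u(1) uN(1)]]
        by (intro mult_right_mono sum_le_suminf suD) auto
      finally show ?thesis by (simp add: K_def)
    qed
    have expand: "(\<Sum>m<N. B m (\<lambda>_. uN N)) = (\<Sum>p\<in>composition_box N. compose_term A B p (\<lambda>_. h))" for N
    proof -
      have "B m (\<lambda>_. uN N) = (\<Sum>l\<in>PiE {..<m} (\<lambda>_. {1..<N}). compose_term A B (m, l) (\<lambda>_. h))" for m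
        unfolding uN_def compose_term_def prod.case
        by (rule WZ.multilinear_sum_expand[OF mlB]) (use Am in auto)
      then show ?thesis
        unfolding composition_box_def by (simp add: sum.Sigma finite_PiE)
    qed
    \<comment> \<open>The difference consists of the box terms of degree at least \<open>N\<close>.
      Their majorants add up to the box sum minus the partial sum, which is at most the gap.\<close>
    have regroup: "vnorm Z ((\<Sum>m<N. B m (\<lambda>_. uN N)) - (\<Sum>n<N. E n (\<lambda>_. h)))
        \<le> (\<Sum>n<N * N + 1. e n * \<rho> ^ n) - (\<Sum>n<N. e n * \<rho> ^ n)" for N
    proof -
      let ?L = "{p \<in> composition_box N. deg p < N}"
      have "(\<Sum>n<N. E n (\<lambda>_. h)) = (\<Sum>p\<in>?L. compose_term A B p (\<lambda>_. h))"
        unfolding E_def by (rule group)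
      then have "(\<Sum>m<N. B m (\<lambda>_. uN N)) - (\<Sum>n<N. E n (\<lambda>_. h))
          = (\<Sum>p\<in>composition_box N - ?L. compose_term A B p (\<lambda>_. h))"
        unfolding expand using finite_composition_box[of N]
        by (subst sum_diff) auto
      then have "vnorm Z ((\<Sum>m<N. B m (\<lambda>_. uN N)) - (\<Sum>n<N. E n (\<lambda>_. h)))
          \<le> (\<Sum>p\<in>composition_box N - ?L. vnorm Z (compose_term A B p (\<lambda>_. h)))"
        using tm by (auto intro!: Z.norm_sum_le)
      also have "\<dots> \<le> (\<Sum>p\<in>composition_box N - ?L. T p)"
      proof (rule sum_mono)
        fix p :: "nat \<times> (nat \<Rightarrow> nat)"
        obtain m l where p: "p = (m, l)" by fastforce
        have "vnorm Z (compose_term A B (m, l) (\<lambda>_. h))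
            \<le> (D m * (\<Prod>k<m. C (l k))) * (\<Prod>i<block_start l m. vnorm V h)"
          using compose_term_bound[where l = l and m = m and x = "\<lambda>_. h", OF mlA bdA bdB D] h by auto
        also have "\<dots> \<le> (D m * (\<Prod>k<m. C (l k))) * \<rho> ^ block_start l m"
          using h C D V.norm_nonneg by (auto intro!: mult_left_mono power_mono prod_nonneg mult_nonneg_nonneg)
        finally show "vnorm Z (compose_term A B p (\<lambda>_. h)) \<le> T p"
          by (simp add: p T_eq)
      qed
      also have "\<dots> = (\<Sum>p\<in>composition_box N. T p) - (\<Sum>n<N. e n * \<rho> ^ n)"
        unfolding e_eq group using finite_composition_box[of N] by (subst sum_diff) auto
      also have "\<dots> \<le> (\<Sum>n<N * N + 1. e n * \<rho> ^ n) - (\<Sum>n<N. e n * \<rho> ^ n)"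
        using box_le_part[of N] by simp
      finally show ?thesis .
    qed
    \<comment> \<open>Three errors: cutting the outer series at the exact increment
      \<open>u\<close>, replacing \<open>u\<close> by the cut inner series, and regrouping by
      degree.\<close>
    have bound: "vnorm Z (g (f (a + h)) - (\<Sum>n<N. E n (\<lambda>_. h))) \<le>
        vnorm Z (g (f a + u) - (\<Sum>m<N. B m (\<lambda>_. u))) + K * vnorm W (u - uN N)
        + ((\<Sum>n<N * N + 1. e n * \<rho> ^ n) - (\<Sum>n<N. e n * \<rho> ^ n))" for N
    proof -
      have m1: "(\<Sum>m<N. B m (\<lambda>_. u)) \<in> vecs Z" and m2: "(\<Sum>m<N. B m (\<lambda>_. uN N)) \<in> vecs Z"
        and m3: "(\<Sum>n<N. E n (\<lambda>_. h)) \<in> vecs Z"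
        using u uN Bm Em by (auto intro!: Z.sum_mem)
      show ?thesis
        using Z.norm_diff_triangle[OF mem m1 m3] Z.norm_diff_triangle[OF m1 m2 m3] diff_le[of N] regroup[of N]
        unfolding gu by linarith
    qed
    show "(\<lambda>N. vnorm Z (g (f (a + h)) - (\<Sum>n<N. E n (\<lambda>_. h)))) \<longlonglongrightarrow> 0"
    proof (rule tendsto_sandwich[OF always_eventually always_eventually tendsto_const])
      show "\<forall>N. 0 \<le> vnorm Z (g (f (a + h)) - (\<Sum>n<N. E n (\<lambda>_. h)))"
        using mem Em by (auto intro!: Z.norm_nonneg Z.diff_mem Z.sum_mem)
      show "\<forall>N. vnorm Z (g (f (a + h)) - (\<Sum>n<N. E n (\<lambda>_. h))) \<le>
        vnorm Z (g (f a + u) - (\<Sum>m<N. B m (\<lambda>_. u))) + K * vnorm W (u - uN N)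
        + ((\<Sum>n<N * N + 1. e n * \<rho> ^ n) - (\<Sum>n<N. e n * \<rho> ^ n))"
        using bound by blast
      have "(\<lambda>N. vnorm Z (g (f a + u) - (\<Sum>m<N. B m (\<lambda>_. u)))) \<longlonglongrightarrow> 0"
        using u qs by (intro limg) auto
      moreover have "(\<lambda>N. K * vnorm W (u - uN N)) \<longlonglongrightarrow> K * 0"
        using lip(5) unfolding u_def uN_def by (intro tendsto_mult tendsto_const)
      ultimately show "(\<lambda>N. vnorm Z (g (f a + u) - (\<Sum>m<N. B m (\<lambda>_. u))) + K * vnorm W (u - uN N)
        + ((\<Sum>n<N * N + 1. e n * \<rho> ^ n) - (\<Sum>n<N. e n * \<rho> ^ n))) \<longlonglongrightarrow> 0"
        using tendsto_add[OF tendsto_add gap] by fastforce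
    qed
  qed (use \<rho> e0 sue in auto)
  with a show ?thesis
    unfolding analytic_at_def by blast
qed

end

section \<open>Products and bilinear maps\<close>

definition prod_normed ::
  "('k, 'v) normed_on \<Rightarrow> ('k, 'w) normed_on \<Rightarrow> ('k, 'v \<times> 'w) normed_on" where
  "prod_normed V W = \<lparr>vecs = vecs V \<times> vecs W, vscale = (\<lambda>c (x, y). (vscale V c x, vscale W c y)),
     vnorm = (\<lambda>(x, y). vnorm V x + vnorm W y)\<rparr>"

lemma prod_normed_simps [simp]:
  "vecs (prod_normed V W) = vecs V \<times> vecs W"
  "vscale (prod_normed V W) c p = (vscale V c (fst p), vscale W c (snd p))"
  "vnorm (prod_normed V W) p = vnorm V (fst p) + vnorm W (snd p)"
  by (simp_all add: prod_normed_def case_prod_unfold)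

context normed_space_pair
begin

lemma normed_space_prod: "normed_space_on (prod_normed V W)"
proof
  show "linear_subset (prod_normed V W) (vecs (prod_normed V W))"
    by (auto simp: linear_subset_def zero_prod_def V.zero_mem W.zero_mem V.add_mem W.add_mem
        V.scale_mem W.scale_mem)
  show "(vnorm (prod_normed V W) p = 0) = (p = 0)" if "p \<in> vecs (prod_normed V W)" for p
    using that V.norm_nonneg[of "fst p"] W.norm_nonneg[of "snd p"]
    by (auto simp: prod_eq_iff add_nonneg_eq_0_iff V.norm_eq_zero W.norm_eq_zero)
  show "vnorm (prod_normed V W) (p + q) \<le> vnorm (prod_normed V W) p + vnorm (prod_normed V W) q"
    if "p \<in> vecs (prod_normed V W)" "q \<in> vecs (prod_normed V W)" for p q
    using that V.norm_triangle[of "fst p" "fst q"] W.norm_triangle[of "snd p" "snd q"] by auto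
qed (auto simp: V.scale_add_right W.scale_add_right V.scale_add_left W.scale_add_left
    V.scale_scale W.scale_scale V.scale_one W.scale_one V.norm_nonneg W.norm_nonneg
    V.norm_scale W.norm_scale algebra_simps)

end

lemma analytic_at_Pair:
  assumes ns: "normed_space_on U" "normed_space_on V" "normed_space_on W"
    and f: "analytic_at U V f a" and g: "analytic_at U W g a"
  shows "analytic_at U (prod_normed V W) (\<lambda>x. (f x, g x)) a"
proof -
  interpret U: normed_space_on U by fact
  interpret V: normed_space_on V by fact
  interpret W: normed_space_on W by fact
  obtain A C r where a: "a \<in> vecs U" and P: "power_series_at U V f a A C r" and r: "0 < r"
    using f by (rule analytic_atE)
  obtain B D s where Q: "power_series_at U W g a B D s" and s: "0 < s"
    using g by (rule analytic_atE)
  let ?t = "min r s"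
  have P': "power_series_at U V f a A C ?t" and Q': "power_series_at U W g a B D ?t"
    using power_series_at_shrink[OF P, of ?t] power_series_at_shrink[OF Q, of ?t] r s by auto
  note P' = P'[unfolded power_series_at_def] and Q' = Q'[unfolded power_series_at_def]
  have ml: "multilinear_on U V n (A n)" "multilinear_on U W n (B n)" for n
    using P' Q' by simp_all
  have "power_series_at U (prod_normed V W) (\<lambda>x. (f x, g x)) a (\<lambda>n x. (A n x, B n x)) (\<lambda>n. C n + D n) ?t"
    unfolding power_series_at_def
  proof (intro conjI allI ballI impI)
    show "multilinear_on U (prod_normed V W) n (\<lambda>x. (A n x, B n x))" for n
      using ml[of n] unfolding multilinear_on_def by simp
    show "vnorm (prod_normed V W) (A n x, B n x) \<le> (C n + D n) * (\<Prod>i<n. vnorm U (x i))"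
      if "\<forall>i<n. x i \<in> vecs U" for n x
      using P' Q' that by (simp add: distrib_right add_mono)
    show "summable (\<lambda>n. (C n + D n) * ?t ^ n)"
      using summable_add[of "\<lambda>n. C n * ?t ^ n" "\<lambda>n. D n * ?t ^ n"] P' Q' by (simp add: distrib_right)
    fix h assume h: "h \<in> vecs U" "vnorm U h < ?t"
    show "(f (a + h), g (a + h)) \<in> vecs (prod_normed V W)"
      using P' Q' h by simp
    have "(\<lambda>N. vnorm V (f (a + h) - (\<Sum>n<N. A n (\<lambda>_. h))) + vnorm W (g (a + h) - (\<Sum>n<N. B n (\<lambda>_. h)))) \<longlonglongrightarrow> 0 + 0"
      using P' Q' h by (intro tendsto_add) simp_all
    then show "(\<lambda>N. vnorm (prod_normed V W) ((f (a + h), g (a + h)) - (\<Sum>n<N. (A n (\<lambda>_. h), B n (\<lambda>_. h))))) \<longlonglongrightarrow> 0"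
      by (simp add: fst_sum snd_sum)
  qed (use P' Q' in auto)
  with a show ?thesis unfolding analytic_at_def by blast
qed

definition bilinear_on ::
  "('k, 'v::ab_group_add) normed_on \<Rightarrow> ('k, 'w::ab_group_add) normed_on \<Rightarrow>
    ('k, 'z::ab_group_add) normed_on \<Rightarrow> ('v \<Rightarrow> 'w \<Rightarrow> 'z) \<Rightarrow> bool" where
  "bilinear_on V W Z b \<longleftrightarrow>
     (\<forall>y\<in>vecs W. (\<forall>x\<in>vecs V. b x y \<in> vecs Z) \<and>
        (\<forall>x\<in>vecs V. \<forall>x'\<in>vecs V. b (x + x') y = b x y + b x' y) \<and>
        (\<forall>x\<in>vecs V. \<forall>c. b (vscale V c x) y = vscale Z c (b x y))) \<and>
     (\<forall>x\<in>vecs V. (\<forall>y\<in>vecs W. \<forall>y'\<in>vecs W. b x (y + y') = b x y + b x y') \<and>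
        (\<forall>y\<in>vecs W. \<forall>c. b x (vscale W c y) = vscale Z c (b x y))) \<and>
     (\<exists>K\<ge>0. \<forall>x\<in>vecs V. \<forall>y\<in>vecs W. vnorm Z (b x y) \<le> K * vnorm V x * vnorm W y)"

text \<open>Expanding \<open>b (x0 + h) (y0 + k)\<close> gives a constant, the linear part
  \<open>b x0 k + b h y0\<close> and the quadratic part \<open>b h k\<close>. The last becomes a
  2-linear map on pairs by reading the first component of slot 0 and the second component of slot
  1.\<close>

lemma (in normed_space_triple) analytic_at_bilinear_fun:
  assumes b: "bilinear_on V W Z b" and p: "p \<in> vecs V \<times> vecs W"
  shows "analytic_at (prod_normed V W) Z (\<lambda>(x, y). b x y) p"
proof -
  interpret VW: normed_space_on "prod_normed V W" by (rule normed_space_prod)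
  obtain x0 y0 where p_eq: "p = (x0, y0)" and x0: "x0 \<in> vecs V" and y0: "y0 \<in> vecs W"
    using p by auto
  have mem: "b x y \<in> vecs Z" if "x \<in> vecs V" "y \<in> vecs W" for x y
    using b that by (simp add: bilinear_on_def)
  have add1: "b (x + x') y = b x y + b x' y" if "x \<in> vecs V" "x' \<in> vecs V" "y \<in> vecs W" for x x' y
    using b that by (simp add: bilinear_on_def)
  have add2: "b x (y + y') = b x y + b x y'" if "x \<in> vecs V" "y \<in> vecs W" "y' \<in> vecs W" for x y y'
    using b that by (simp add: bilinear_on_def)
  have sc1: "b (vscale V c x) y = vscale Z c (b x y)" if "x \<in> vecs V" "y \<in> vecs W" for c x y
    using b that by (simp add: bilinear_on_def)
  have sc2: "b x (vscale W c y) = vscale Z c (b x y)" if "x \<in> vecs V" "y \<in> vecs W" for c x y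
    using b that by (simp add: bilinear_on_def)
  obtain K where K: "K \<ge> 0" "\<And>x y. x \<in> vecs V \<Longrightarrow> y \<in> vecs W \<Longrightarrow> vnorm Z (b x y) \<le> K * vnorm V x * vnorm W y"
    using b unfolding bilinear_on_def by auto
  define A where "A = (\<lambda>(n::nat) (x::nat \<Rightarrow> 'v \<times> 'w).
    if n = 0 then b x0 y0 else if n = 1 then b x0 (snd (x 0)) + b (fst (x 0)) y0
    else if n = 2 then b (fst (x 0)) (snd (x 1)) else 0)"
  define C where "C = (\<lambda>n::nat. if n = 0 then vnorm Z (b x0 y0)
    else if n = 1 then K * (vnorm V x0 + vnorm W y0) else if n = 2 then K else 0)"
  have "power_series_at (prod_normed V W) Z (\<lambda>(x, y). b x y) p A C 1"
    unfolding power_series_at_def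
  proof (intro conjI allI ballI impI)
    have n3: "n = 0 \<or> n = 1 \<or> n = 2 \<or> n > 2" for n :: nat by linarith
    show "multilinear_on (prod_normed V W) Z n (A n)" for n
    proof (rule multilinear_onI)
      show "A n x \<in> vecs Z" if "\<And>i. i < n \<Longrightarrow> x i \<in> vecs (prod_normed V W)" for x
        using that[of 0] that[of 1] n3[of n] by (auto simp: A_def mem x0 y0 Z.zero_mem Z.add_mem)
      show "A n x = A n y" if "\<And>i. i < n \<Longrightarrow> x i = y i" for x y
        using that[of 0] that[of 1] n3[of n] by (auto simp: A_def)
      show "A n (x(i := u + v)) = A n (x(i := u)) + A n (x(i := v))"
        if "\<And>i. i < n \<Longrightarrow> x i \<in> vecs (prod_normed V W)" "i < n"
          "u \<in> vecs (prod_normed V W)" "v \<in> vecs (prod_normed V W)" for x i u v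
        using that(1)[of 0] that(1)[of 1] that(2-4) n3[of n]
        by (auto simp: A_def add1 add2 x0 y0 mem_Times_iff less_2_cases_iff)
      show "A n (x(i := vscale (prod_normed V W) c u)) = vscale Z c (A n (x(i := u)))"
        if "\<And>i. i < n \<Longrightarrow> x i \<in> vecs (prod_normed V W)" "i < n" "u \<in> vecs (prod_normed V W)" for x i c u
        using that(1)[of 0] that(1)[of 1] that(2-3) n3[of n]
        by (auto simp: A_def sc1 sc2 mem x0 y0 Z.scale_add_right Z.scale_zero_right mem_Times_iff less_2_cases_iff)
    qed
    show "C n \<ge> 0" for n
      using K(1) x0 y0 by (auto simp: C_def mem V.norm_nonneg W.norm_nonneg Z.norm_nonneg)
    show "vnorm Z (A n x) \<le> C n * (\<Prod>i<n. vnorm (prod_normed V W) (x i))"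
      if x: "\<forall>i<n. x i \<in> vecs (prod_normed V W)" for n x
    proof -
      consider "n = 0" | "n = 1" | "n = 2" | "n > 2" using n3[of n] by blast
      then show ?thesis
      proof cases
        case 1 then show ?thesis by (simp add: A_def C_def)
      next
        case 2
        obtain h k where hk: "x 0 = (h, k)" "h \<in> vecs V" "k \<in> vecs W" using x 2 by auto
        have "vnorm Z (b x0 k + b h y0) \<le> vnorm Z (b x0 k) + vnorm Z (b h y0)"
          using hk x0 y0 by (intro Z.norm_triangle mem)
        also have "\<dots> \<le> K * vnorm V x0 * vnorm W k + K * vnorm V h * vnorm W y0"
          using hk x0 y0 by (intro add_mono K(2))
        also have "\<dots> \<le> K * (vnorm V x0 + vnorm W y0) * (vnorm V h + vnorm W k)"
          using hk x0 y0 K(1) by (simp add: algebra_simps V.norm_nonneg W.norm_nonneg)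
        finally show ?thesis using 2 hk by (simp add: A_def C_def)
      next
        case 3
        obtain h k h' k' where hk: "x 0 = (h, k)" "x 1 = (h', k')"
          by (cases "x 0", cases "x 1") blast
        with x[rule_format, of 0] x[rule_format, of 1] 3
        have hk': "h \<in> vecs V" "k \<in> vecs W" "h' \<in> vecs V" "k' \<in> vecs W"
          by simp_all
        have "vnorm Z (b h k') \<le> K * vnorm V h * vnorm W k'"
          using hk' by (intro K(2))
        also have "\<dots> \<le> K * ((vnorm V h + vnorm W k) * (vnorm V h' + vnorm W k'))"
          using hk' K(1) by (simp add: algebra_simps V.norm_nonneg W.norm_nonneg)
        finally show ?thesis
          using 3 hk by (simp add: A_def C_def numeral_2_eq_2)
      next
        case 4 then show ?thesis by (simp add: A_def C_def Z.norm_zero)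
      qed
    qed
    show "summable (\<lambda>n. C n * 1 ^ n)"
      by (rule summable_finite[of "{0,1,2}"]) (auto simp: C_def)
    fix h assume h: "h \<in> vecs (prod_normed V W)"
    then show "(\<lambda>(x, y). b x y) (p + h) \<in> vecs Z"
      using x0 y0 by (auto simp: p_eq intro!: mem V.add_mem W.add_mem)
    have "(\<Sum>n<N. A n (\<lambda>_. h)) = (\<lambda>(x, y). b x y) (p + h)" if "N \<ge> 3" for N
    proof -
      have "(\<Sum>n<N. A n (\<lambda>_. h)) = (\<Sum>n\<in>{0,1,2}. A n (\<lambda>_. h))"
        using that by (intro sum.mono_neutral_right) (auto simp: A_def)
      also have "\<dots> = (\<lambda>(x, y). b x y) (p + h)"
        using h x0 y0 by (auto simp: A_def p_eq add1 add2 V.add_mem W.add_mem)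
      finally show ?thesis .
    qed
    then have "vnorm Z ((\<lambda>(x, y). b x y) (p + h) - (\<Sum>n<N. A n (\<lambda>_. h))) = 0" if "N \<ge> 3" for N
      using that by (simp add: Z.norm_zero)
    then show "(\<lambda>N. vnorm Z ((\<lambda>(x, y). b x y) (p + h) - (\<Sum>n<N. A n (\<lambda>_. h)))) \<longlonglongrightarrow> 0"
      by (intro tendsto_eventually eventually_sequentiallyI)
  qed simp
  with p show ?thesis unfolding analytic_at_def by auto
qed

lemma analytic_at_comp:
  assumes "normed_space_on V" "normed_space_on W" "normed_space_on Z"
    and "analytic_at V W f a" "analytic_at W Z g (f a)"
  shows "analytic_at V Z (\<lambda>x. g (f x)) a"
proof -
  interpret normed_space_triple V W Z
    using assms by (simp add: normed_space_triple_def normed_space_pair_def)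
  show ?thesis using assms by (intro analytic_at_compose)
qed

lemma analytic_at_bilinear:
  assumes ns: "normed_space_on U" "normed_space_on V" "normed_space_on W" "normed_space_on Z"
    and b: "bilinear_on V W Z b" and f: "analytic_at U V f a" and g: "analytic_at U W g a"
  shows "analytic_at U Z (\<lambda>x. b (f x) (g x)) a"
proof -
  interpret U: normed_space_on U by fact
  interpret normed_space_triple V W Z
    using ns by (simp add: normed_space_triple_def normed_space_pair_def)
  have "(f a, g a) \<in> vecs V \<times> vecs W"
    using U.analytic_at_value[OF f] U.analytic_at_value[OF g] by simp
  from analytic_at_comp[OF ns(1) normed_space_prod ns(4) analytic_at_Pair[OF ns(1-3) f g]
      analytic_at_bilinear_fun[OF b this]]
  show ?thesis by simp
qed

section \<open>Projections along closed complements\<close>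

context normed_space_on
begin

lemma mcomplete_iff:
  "mcomplete \<longleftrightarrow> (\<forall>\<sigma>. (\<forall>n. \<sigma> n \<in> vecs V) \<and>
      (\<forall>e>0. \<exists>N. \<forall>n\<ge>N. \<forall>m\<ge>N. vnorm V (\<sigma> n - \<sigma> m) < e) \<longrightarrow>
      (\<exists>x\<in>vecs V. (\<lambda>n. vnorm V (\<sigma> n - x)) \<longlonglongrightarrow> 0))"
proof -
  have cauchy: "MCauchy \<sigma> \<longleftrightarrow> (\<forall>n. \<sigma> n \<in> vecs V) \<and>
      (\<forall>e>0. \<exists>N. \<forall>n\<ge>N. \<forall>m\<ge>N. vnorm V (\<sigma> n - \<sigma> m) < e)" for \<sigma>
    unfolding MCauchy_def by (auto simp: vdist_def image_subset_iff)
  have "limitin mtopology \<sigma> x sequentially \<longleftrightarrow> x \<in> vecs V \<and> (\<lambda>n. vnorm V (\<sigma> n - x)) \<longlonglongrightarrow> 0"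
    if "\<forall>n. \<sigma> n \<in> vecs V" for \<sigma> x
    using that unfolding limitin_metric_dist_null by (auto simp: vdist_def)
  then have limit: "(\<exists>x. limitin mtopology \<sigma> x sequentially) \<longleftrightarrow>
      (\<exists>x\<in>vecs V. (\<lambda>n. vnorm V (\<sigma> n - x)) \<longlonglongrightarrow> 0)"
    if "\<forall>n. \<sigma> n \<in> vecs V" for \<sigma>
    using that by auto
  show ?thesis
    unfolding mcomplete_def cauchy using limit by (auto 0 3)
qed

lemma mcompleteD:
  assumes "mcomplete" "\<And>n. \<sigma> n \<in> vecs V"
    and "\<And>e. e > 0 \<Longrightarrow> \<exists>N. \<forall>n\<ge>N. \<forall>m\<ge>N. vnorm V (\<sigma> n - \<sigma> m) < e"
  obtains x where "x \<in> vecs V" "(\<lambda>n. vnorm V (\<sigma> n - x)) \<longlonglongrightarrow> 0"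
proof -
  have "\<exists>x\<in>vecs V. (\<lambda>n. vnorm V (\<sigma> n - x)) \<longlonglongrightarrow> 0"
    using assms(1)[unfolded mcomplete_iff, THEN spec, of \<sigma>] assms(2,3) by simp
  then show ?thesis using that by blast
qed

lemma closedin_limit:
  assumes "closedin (norm_topology V) S" "\<And>n. \<sigma> n \<in> S" "x \<in> vecs V"
    and "(\<lambda>n. vnorm V (\<sigma> n - x)) \<longlonglongrightarrow> 0"
  shows "x \<in> S"
proof (rule limitin_closedin[of "norm_topology V" \<sigma> x sequentially S])
  have "S \<subseteq> vecs V"
    using closedin_subset[OF assms(1)] by (simp add: topspace_norm_topology)
  then have "\<And>n. \<sigma> n \<in> vecs V" using assms(2) by blast
  then show "limitin (norm_topology V) \<sigma> x sequentially"
    using assms(3,4) by (simp add: norm_topology_def limitin_metric_dist_null vdist_def)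
qed (use assms in auto)

lemma geometric_sum_converges:
  assumes "mcomplete" and a: "\<And>i. a i \<in> vecs V" "\<And>i. vnorm V (a i) \<le> M / 2 ^ i"
  obtains x where "x \<in> vecs V" "(\<lambda>N. vnorm V ((\<Sum>i<N. a i) - x)) \<longlonglongrightarrow> 0" "vnorm V x \<le> 2 * M"
proof -
  have M: "M \<ge> 0" using a(2)[of 0] norm_nonneg[OF a(1), of 0] by simp
  let ?s = "\<lambda>N. \<Sum>i<N. a i"
  have sm: "?s N \<in> vecs V" for N by (rule sum_mem) (rule a)
  \<comment> \<open>The bound is the geometric tail from \<open>m\<close> on minus the tail from
    \<open>n\<close> on, so that each further term is absorbed exactly.\<close>
  have step: "vnorm V (?s n - ?s m) \<le> 2 * M / 2 ^ m - 2 * M / 2 ^ n" if "m \<le> n" for m n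
    using that
  proof (induction n rule: dec_induct)
    case (step n)
    have "vnorm V (?s (Suc n) - ?s m) \<le> vnorm V (?s n - ?s m) + vnorm V (a n)"
      using norm_triangle[OF diff_mem[OF sm sm] a(1), of n m n] by (simp add: algebra_simps)
    also have "\<dots> \<le> (2 * M / 2 ^ m - 2 * M / 2 ^ n) + M / 2 ^ n"
      using step.IH a(2)[of n] by linarith
    also have "\<dots> = 2 * M / 2 ^ m - 2 * M / 2 ^ Suc n"
      by (simp add: field_simps)
    finally show ?case .
  qed (simp add: norm_zero)
  have step': "vnorm V (?s n - ?s m) \<le> 2 * M / 2 ^ N" if "N \<le> n" "N \<le> m" for n m N
  proof -
    have le: "vnorm V (?s n - ?s m) \<le> 2 * M / 2 ^ N" if "N \<le> m" "m \<le> n" for n m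
    proof -
      have "0 \<le> 2 * M / 2 ^ n" using M by simp
      moreover have "2 * M / 2 ^ m \<le> 2 * M / 2 ^ N"
        using M that by (intro divide_left_mono power_increasing) auto
      ultimately show ?thesis using step[OF that(2)] by linarith
    qed
    show ?thesis
      using le[of m n] le[of n m] that norm_diff_commute[OF sm sm, of n m] by (cases "m \<le> n") auto
  qed
  have lim0: "(\<lambda>N. 2 * M / 2 ^ N) \<longlonglongrightarrow> 0"
    using tendsto_mult[OF tendsto_const LIMSEQ_power_zero[of "1/2::real"], of "2 * M"]
    by (simp add: power_divide)
  have cauchy: "\<exists>N. \<forall>n\<ge>N. \<forall>m\<ge>N. vnorm V (?s n - ?s m) < e" if "e > 0" for e
  proof -
    obtain N where "2 * M / 2 ^ N < e"
      using order_tendstoD(2)[OF lim0 \<open>e > 0\<close>] eventually_happens' sequentially_bot by blast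
    then show ?thesis
      by (intro exI[of _ N]) (meson step' le_less_trans)
  qed
  then obtain x where x: "x \<in> vecs V" and lim: "(\<lambda>N. vnorm V (?s N - x)) \<longlonglongrightarrow> 0"
    using mcompleteD[OF \<open>mcomplete\<close> sm cauchy] by blast
  have "vnorm V x \<le> 2 * M + vnorm V (?s N - x)" for N
  proof -
    have "vnorm V (?s N) \<le> 2 * M"
      using step[of 0 N] M by (simp add: order_trans[of _ "2 * M - 2 * M / 2 ^ N"])
    moreover have "vnorm V x \<le> vnorm V (?s N) + vnorm V (?s N - x)"
      using norm_diff_triangle[OF x sm zero_mem, of N] norm_diff_commute[OF x sm, of N] by simp
    ultimately show ?thesis by linarith
  qed
  then have "vnorm V x \<le> 2 * M + 0"
    by (intro LIMSEQ_le_const[OF tendsto_add[OF tendsto_const lim]] exI allI impI)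
  then show ?thesis using that[OF x lim] by simp
qed

end

section \<open>Subspaces and the open mapping argument\<close>

lemma subspace_normed_space:
  assumes "normed_space_on V" "linear_subset V S"
  shows "normed_space_on (V\<lparr>vecs := S\<rparr>)"
proof -
  interpret V: normed_space_on V by fact
  have sub: "\<And>x. x \<in> S \<Longrightarrow> x \<in> vecs V" using assms(2) by (auto simp: linear_subset_def)
  show ?thesis
  proof
    show "linear_subset (V\<lparr>vecs := S\<rparr>) (vecs (V\<lparr>vecs := S\<rparr>))"
      using assms(2) by (auto simp: linear_subset_def)
  qed (auto dest!: sub simp: V.scale_add_right V.scale_add_left V.scale_scale V.scale_one
      V.norm_nonneg V.norm_eq_zero V.norm_scale V.norm_triangle)
qed

lemma subspace_banach:
  assumes "banach_on V" "closed_subspace V S"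
  shows "banach_on (V\<lparr>vecs := S\<rparr>)"
proof -
  have lin: "linear_subset V S" and cl: "closedin (norm_topology V) S"
    using assms(2) by (simp_all add: closed_subspace_def)
  interpret V: normed_space_on V using assms(1) by (simp add: banach_on_iff)
  interpret S: normed_space_on "V\<lparr>vecs := S\<rparr>" by (rule subspace_normed_space[OF V.normed_space_on_axioms lin])
  have sub: "S \<subseteq> vecs V" using lin by (simp add: linear_subset_def)
  have "S.mcomplete"
    unfolding S.mcomplete_iff
  proof (intro allI impI, elim conjE)
    fix \<sigma> :: "nat \<Rightarrow> 'b" assume \<sigma>: "\<forall>n. \<sigma> n \<in> vecs (V\<lparr>vecs := S\<rparr>)"
      and C: "\<forall>e>0. \<exists>N. \<forall>n\<ge>N. \<forall>m\<ge>N. vnorm (V\<lparr>vecs := S\<rparr>) (\<sigma> n - \<sigma> m) < e"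
    have "V.mcomplete" using assms(1) by (simp add: banach_on_iff)
    moreover have "\<And>n. \<sigma> n \<in> vecs V" using \<sigma> sub by auto
    moreover have "\<And>e. e > 0 \<Longrightarrow> \<exists>N. \<forall>n\<ge>N. \<forall>m\<ge>N. vnorm V (\<sigma> n - \<sigma> m) < e" using C by simp
    ultimately obtain x where "x \<in> vecs V" "(\<lambda>n. vnorm V (\<sigma> n - x)) \<longlonglongrightarrow> 0"
      by (rule V.mcompleteD)
    with V.closedin_limit[OF cl] \<sigma>
    show "\<exists>x\<in>vecs (V\<lparr>vecs := S\<rparr>). (\<lambda>n. vnorm (V\<lparr>vecs := S\<rparr>) (\<sigma> n - x)) \<longlonglongrightarrow> 0"
      by auto
  qed
  then show ?thesis
    using S.normed_space_on_axioms by (simp add: banach_on_iff)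
qed

lemma (in normed_space_on) linear_subset_diff:
  assumes "linear_subset V S" "x \<in> S" "y \<in> S" shows "x - y \<in> S"
proof -
  interpret S: normed_space_on "V\<lparr>vecs := S\<rparr>"
    by (rule subspace_normed_space[OF normed_space_on_axioms assms(1)])
  show ?thesis using S.diff_mem assms by simp
qed

lemma (in normed_space_on) linear_subset_sum:
  assumes "linear_subset V S" "\<And>i. i \<in> I \<Longrightarrow> x i \<in> S" shows "sum x I \<in> S"
proof -
  interpret S: normed_space_on "V\<lparr>vecs := S\<rparr>"
    by (rule subspace_normed_space[OF normed_space_on_axioms assms(1)])
  show ?thesis using S.sum_mem[of I x] assms by simp
qed

text \<open>The open mapping theorem for the addition map \<open>S \<times> S' \<rightarrow> V\<close>.\<close>

lemma complement_summand_bound: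
  fixes V :: "('k::real_or_complex, 'v::ab_group_add) normed_on"
  assumes V: "banach_on V" and S: "closed_subspace V S" and S': "closed_subspace V S'"
    and int: "S \<inter> S' = {0}" and dec: "\<And>v. v \<in> vecs V \<Longrightarrow> \<exists>s\<in>S. \<exists>s'\<in>S'. v = s + s'"
  obtains K where "\<And>s s'. s \<in> S \<Longrightarrow> s' \<in> S' \<Longrightarrow> vnorm V s \<le> K * vnorm V (s + s')"
proof -
  interpret V: normed_space_on V using V by (simp add: banach_on_iff)
  have comp: "V.mcomplete" using V by (simp add: banach_on_iff)
  have lin: "linear_subset V S" "linear_subset V S'"
    and cl: "closedin (norm_topology V) S" "closedin (norm_topology V) S'"
    using S S' by (simp_all add: closed_subspace_def)
  have sub: "\<And>x. x \<in> S \<Longrightarrow> x \<in> vecs V" "\<And>x. x \<in> S' \<Longrightarrow> x \<in> vecs V"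
    using lin by (auto simp: linear_subset_def)
  \<comment> \<open>Images of balls under addition. They exhaust the space, so by the Baire theorem
    the closure of one of them has an interior point \<open>x0\<close>.\<close>
  define B where "B = (\<lambda>n::nat. {s + s' | s s'. s \<in> S \<and> s' \<in> S' \<and> vnorm V s \<le> n \<and> vnorm V s' \<le> n})"
  define T where "T = (\<lambda>n. norm_topology V closure_of B n)"
  have BV: "B n \<subseteq> vecs V" for n
    using sub V.add_mem by (auto simp: B_def)
  have "vecs V \<subseteq> \<Union> (range T)"
  proof
    fix v assume "v \<in> vecs V"
    then obtain s s' where s: "s \<in> S" "s' \<in> S'" "v = s + s'" using dec by blast
    obtain n :: nat where "vnorm V s + vnorm V s' \<le> n" using real_arch_simple by blast
    then have "vnorm V s \<le> n" "vnorm V s' \<le> n"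
      using V.norm_nonneg[OF sub(1)[OF s(1)]] V.norm_nonneg[OF sub(2)[OF s(2)]] by linarith+
    then have "v \<in> B n" using s unfolding B_def by blast
    then show "v \<in> \<Union> (range T)"
      using closure_of_subset[of "B n" "norm_topology V"] BV
      by (auto simp: T_def V.topspace_norm_topology)
  qed
  then have "\<Union> (range T) = topspace (norm_topology V)"
    using closure_of_subset_topspace[of "norm_topology V"]
    by (auto simp: T_def V.topspace_norm_topology)
  then have ne: "norm_topology V interior_of \<Union> (range T) \<noteq> {}"
    using V.zero_mem by (auto simp: V.topspace_norm_topology interior_of_openin[OF V.openin_vecs])
  have "\<exists>n. norm_topology V interior_of T n \<noteq> {}"
  proof (rule ccontr)
    assume "\<not> ?thesis"
    then have "V.mtopology interior_of \<Union> (range T) = {}"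
      by (intro V.metric_Baire_category_alt comp) (auto simp: T_def norm_topology_def)
    with ne show False by (simp add: norm_topology_def)
  qed
  then obtain n x0 where x0: "x0 \<in> norm_topology V interior_of T n" by blast
  then have x0V: "x0 \<in> vecs V"
    using interior_of_subset_topspace[of "norm_topology V"] by (auto simp: V.topspace_norm_topology)
  have "near V x0 (\<lambda>x. x \<in> norm_topology V interior_of T n)"
    using x0 by (intro V.near_openin openin_interior_of)
  then obtain r where r: "r > 0" "\<And>h. h \<in> vecs V \<Longrightarrow> vnorm V h < r \<Longrightarrow> x0 + h \<in> T n"
    unfolding near_def using interior_of_subset[of "norm_topology V" "T n"] by blast
  have T_approx: "\<exists>s\<in>S. \<exists>s'\<in>S'. vnorm V s \<le> n \<and> vnorm V s' \<le> n \<and> vnorm V (x - (s + s')) < e"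
    if "x \<in> T n" "e > 0" for x e
  proof -
    obtain y where "y \<in> B n" "y \<in> V.mball x e"
      using \<open>x \<in> T n\<close> \<open>e > 0\<close> unfolding T_def norm_topology_def V.metric_closure_of by blast
    moreover obtain s s' where "y = s + s'" "s \<in> S" "s' \<in> S'" "vnorm V s \<le> n" "vnorm V s' \<le> n"
      using \<open>y \<in> B n\<close> unfolding B_def by blast
    ultimately show ?thesis
      by (intro bexI[of _ s] bexI[of _ s']) (auto simp: V.in_mball vdist_def)
  qed
  \<comment> \<open>Approximations of \<open>x0 + y\<close> and of \<open>x0\<close> are subtracted,
    which moves the ball from \<open>x0\<close> to 0 and doubles both the bound \<open>n\<close> and
    the error.\<close>
  have small: "\<exists>s\<in>S. \<exists>s'\<in>S'. vnorm V s \<le> 2 * n \<and> vnorm V s' \<le> 2 * n \<and> vnorm V (y - (s + s')) < e"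
    if y: "y \<in> vecs V" "vnorm V y < r" and "e > 0" for y e
  proof -
    have e2: "e / 2 > 0" using \<open>e > 0\<close> by simp
    obtain s s' where s: "s \<in> S" "s' \<in> S'" "vnorm V s \<le> n" "vnorm V s' \<le> n" "vnorm V (x0 + y - (s + s')) < e / 2"
      using T_approx[OF r(2)[OF y] e2] by blast
    have "x0 \<in> T n" using r(2)[OF V.zero_mem] r(1) by (simp add: V.norm_zero)
    then obtain t t' where t: "t \<in> S" "t' \<in> S'" "vnorm V t \<le> n" "vnorm V t' \<le> n" "vnorm V (x0 - (t + t')) < e / 2"
      using T_approx[OF _ e2] by blast
    note mem = sub(1)[OF s(1)] sub(2)[OF s(2)] sub(1)[OF t(1)] sub(2)[OF t(2)]
    have "vnorm V ((x0 + y - (s + s')) - (x0 - (t + t'))) < e"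
      using V.norm_diff_le[of "x0 + y - (s + s')" "x0 - (t + t')"] s(5) t(5) mem x0V y(1)
      by (simp add: V.diff_mem V.add_mem)
    moreover have "(x0 + y - (s + s')) - (x0 - (t + t')) = y - ((s - t) + (s' - t'))"
      by (simp add: algebra_simps)
    moreover have "vnorm V (s - t) \<le> 2 * n" "vnorm V (s' - t') \<le> 2 * n"
      using V.norm_diff_le[OF mem(1,3)] V.norm_diff_le[OF mem(2,4)] s t by linarith+
    moreover have "s - t \<in> S" "s' - t' \<in> S'"
      using s t lin V.linear_subset_diff by blast+
    ultimately show ?thesis by metis
  qed
  \<comment> \<open>A vector is rescaled by \<open>c = r / (2 * vnorm V y)\<close> to norm
    \<open>r / 2\<close>; undoing this turns the bound \<open>2 * n\<close> into
    \<open>4 * n / r\<close> times the norm of \<open>y\<close>.\<close>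
  define K where "K = 4 * n / r"
  have K: "K \<ge> 0" using r by (simp add: K_def)
  have approx: "\<exists>s\<in>S. \<exists>s'\<in>S'. vnorm V s \<le> K * vnorm V y \<and> vnorm V s' \<le> K * vnorm V y \<and>
      vnorm V (y - (s + s')) < e" if y: "y \<in> vecs V" and e: "e > 0" for y e
  proof (cases "y = 0")
    case True
    then show ?thesis
      using lin e by (intro bexI[of _ 0]) (auto simp: V.norm_zero linear_subset_def)
  next
    case False
    define c where "c = r / (2 * vnorm V y)"
    have ny: "vnorm V y > 0" using V.norm_nonneg[OF y] V.norm_eq_zero[OF y] False by linarith
    have c: "c > 0" using r ny by (simp add: c_def)
    have nc: "norm (of_real c :: 'k) = c" "norm (of_real (1 / c) :: 'k) = 1 / c"
      unfolding norm_of_real using c by auto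
    have inv: "vscale V (of_real (1 / c)) (vscale V (of_real c) y) = y"
      using c y by (simp only: V.scale_scale of_real_mult[symmetric]) (simp add: V.scale_one)
    have "vnorm V (vscale V (of_real c) y) < r"
      unfolding V.norm_scale[OF y] nc using r ny by (simp add: c_def)
    then obtain s s' where s: "s \<in> S" "s' \<in> S'" "vnorm V s \<le> 2 * n" "vnorm V s' \<le> 2 * n"
      "vnorm V (vscale V (of_real c) y - (s + s')) < c * e"
      using small[OF V.scale_mem[OF y], of "of_real c" "c * e"] c e by auto
    let ?s = "vscale V (of_real (1 / c)) s" and ?s' = "vscale V (of_real (1 / c)) s'"
    note mem = sub(1)[OF s(1)] sub(2)[OF s(2)]
    have bound: "(1 / c) * (2 * n) = K * vnorm V y"
      using r ny by (simp add: c_def K_def field_simps)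
    have "vnorm V ?s \<le> (1 / c) * (2 * n)" "vnorm V ?s' \<le> (1 / c) * (2 * n)"
      using s mem c unfolding V.norm_scale[OF mem(1)] V.norm_scale[OF mem(2)] nc
      by (auto intro: divide_right_mono)
    moreover have "vnorm V (y - (?s + ?s')) < e"
    proof -
      have neg: "vscale V a (- x) = - vscale V a x" if "x \<in> vecs V" for a x
        using V.scale_add_right[OF that V.minus_mem[OF that], of a] V.scale_zero_right[of a]
        by (simp add: eq_neg_iff_add_eq_0 add.commute)
      have "y - (?s + ?s') = vscale V (of_real (1 / c)) (vscale V (of_real c) y - (s + s'))"
        using V.scale_add_right[of "vscale V (of_real c) y" "- (s + s')" "of_real (1 / c)"] mem y
        unfolding inv by (simp add: V.scale_mem V.add_mem V.minus_mem V.scale_add_right neg del: minus_add_distrib)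
      also have "vnorm V \<dots> = (1 / c) * vnorm V (vscale V (of_real c) y - (s + s'))"
        using mem y by (simp only: nc V.norm_scale V.diff_mem V.add_mem V.scale_mem)
      also have "\<dots> < (1 / c) * (c * e)"
        using s(5) c by (intro mult_strict_left_mono) auto
      finally show ?thesis using c by simp
    qed
    moreover have "?s \<in> S" "?s' \<in> S'"
      using s lin by (auto simp: linear_subset_def)
    ultimately show ?thesis unfolding bound by blast
  qed
  define good where "good = (\<lambda>y e (p, p'). p \<in> S \<and> p' \<in> S' \<and> vnorm V p \<le> K * vnorm V y \<and>
      vnorm V p' \<le> K * vnorm V y \<and> vnorm V (y - (p + p')) < e)"
  \<comment> \<open>Chosen as a function because the corrections below are built by recursion on the
    remaining error.\<close>
  define pick where "pick = (\<lambda>y e. SOME p. good y e p)"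
  have pick: "good y e (pick y e)" if "y \<in> vecs V" "e > 0" for y e
    unfolding pick_def using approx[OF that] by (intro someI_ex[of "good y e"]) (auto simp: good_def)
  \<comment> \<open>Approximate decompositions are improved to an exact one by decomposing the error
    again and again. With tolerances that halve, the corrections in \<open>S\<close> and in
    \<open>S'\<close> form geometric series; their sums stay in the closed subspaces and decompose
    \<open>y\<close>, and the trivial intersection identifies them with \<open>s\<close> and
    \<open>s'\<close>. The factor 2 is the geometric sum.\<close>
  have main: "vnorm V s \<le> (2 * K) * vnorm V (s + s')" if s: "s \<in> S" "s' \<in> S'" for s s'
  proof (cases "s + s' = 0")
    case True
    then have "s = - s'" by (simp add: eq_neg_iff_add_eq_0)
    then have "s \<in> S'"
      using V.linear_subset_diff[OF lin(2), of 0 s'] s lin(2) by (simp add: linear_subset_def)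
    then have "s = 0" using int s by blast
    then show ?thesis using True by (simp add: V.norm_zero)
  next
    case False
    define y where "y = s + s'"
    have y: "y \<in> vecs V" using s sub V.add_mem by (simp add: y_def)
    have ny: "vnorm V y > 0" using V.norm_nonneg[OF y] V.norm_eq_zero[OF y] False by (simp add: y_def)
    define E where "E = (\<lambda>i::nat. vnorm V y / 2 ^ Suc i)"
    define Y where "Y = rec_nat y (\<lambda>i z. z - (fst (pick z (E i)) + snd (pick z (E i))))"
    have Y0: "Y 0 = y" and YS: "Y (Suc i) = Y i - (fst (pick (Y i) (E i)) + snd (pick (Y i) (E i)))" for i
      by (simp_all add: Y_def)
    have E: "E i > 0" for i using ny by (simp add: E_def)
    have YV: "Y i \<in> vecs V" for i
    proof (induction i)
      case (Suc i)
      with pick[OF Suc E[of i]] show ?case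
        using sub by (auto simp: YS good_def case_prod_unfold intro!: V.diff_mem V.add_mem)
    qed (simp add: Y0 y)
    define a where "a i = fst (pick (Y i) (E i))" for i
    define a' where "a' i = snd (pick (Y i) (E i))" for i
    have good: "a i \<in> S" "a' i \<in> S'" "vnorm V (a i) \<le> K * vnorm V (Y i)"
      "vnorm V (a' i) \<le> K * vnorm V (Y i)" "vnorm V (Y (Suc i)) < E i" for i
      using pick[OF YV E, of i i] by (simp_all add: good_def a_def a'_def YS case_prod_unfold)
    have Yb: "vnorm V (Y i) \<le> vnorm V y / 2 ^ i" for i
      using good(5)[of "i - 1"] by (cases i) (auto simp: Y0 E_def)
    have ab: "vnorm V (a i) \<le> (K * vnorm V y) / 2 ^ i" "vnorm V (a' i) \<le> (K * vnorm V y) / 2 ^ i" for i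
      using good(3,4)[of i] mult_left_mono[OF Yb[of i] K] by auto
    obtain x where x: "x \<in> vecs V" "(\<lambda>N. vnorm V ((\<Sum>i<N. a i) - x)) \<longlonglongrightarrow> 0" "vnorm V x \<le> 2 * (K * vnorm V y)"
      by (rule V.geometric_sum_converges[OF comp sub(1)[OF good(1)] ab(1)])
    obtain x' where x': "x' \<in> vecs V" "(\<lambda>N. vnorm V ((\<Sum>i<N. a' i) - x')) \<longlonglongrightarrow> 0"
      by (rule V.geometric_sum_converges[OF comp sub(2)[OF good(2)] ab(2)])
    have xS: "x \<in> S"
      by (rule V.closedin_limit[OF cl(1) _ x(1,2)]) (intro V.linear_subset_sum[OF lin(1)] good)
    have xS': "x' \<in> S'"
      by (rule V.closedin_limit[OF cl(2) _ x'(1,2)]) (intro V.linear_subset_sum[OF lin(2)] good)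
    have am: "(\<Sum>i<N. a i) \<in> vecs V" "(\<Sum>i<N. a' i) \<in> vecs V" for N
      using sub(1)[OF good(1)] sub(2)[OF good(2)] by (auto intro: V.sum_mem)
    have tel: "Y N = y - ((\<Sum>i<N. a i) + (\<Sum>i<N. a' i))" for N
      by (induction N) (simp_all add: Y0 YS a_def a'_def algebra_simps)
    have "vnorm V (y - (x + x')) \<le> vnorm V y / 2 ^ N + vnorm V ((\<Sum>i<N. a i) - x) + vnorm V ((\<Sum>i<N. a' i) - x')" for N
    proof -
      have "y - (x + x') = Y N + (((\<Sum>i<N. a i) - x) + ((\<Sum>i<N. a' i) - x'))"
        by (simp add: tel algebra_simps)
      also have "vnorm V \<dots> \<le> vnorm V (Y N) + vnorm V (((\<Sum>i<N. a i) - x) + ((\<Sum>i<N. a' i) - x'))"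
        using YV am x(1) x'(1) by (intro V.norm_triangle V.add_mem V.diff_mem)
      also have "vnorm V (((\<Sum>i<N. a i) - x) + ((\<Sum>i<N. a' i) - x')) \<le>
        vnorm V ((\<Sum>i<N. a i) - x) + vnorm V ((\<Sum>i<N. a' i) - x')"
        using am x(1) x'(1) by (intro V.norm_triangle V.diff_mem)
      finally show ?thesis using Yb[of N] by linarith
    qed
    moreover have lim: "(\<lambda>N. vnorm V y / 2 ^ N + vnorm V ((\<Sum>i<N. a i) - x) + vnorm V ((\<Sum>i<N. a' i) - x')) \<longlonglongrightarrow> 0 + 0 + 0"
      using tendsto_mult[OF tendsto_const LIMSEQ_power_zero[of "1/2::real"], of "vnorm V y"]
      by (intro tendsto_add x x') (simp add: power_divide)
    ultimately have "vnorm V (y - (x + x')) \<le> 0 + 0 + 0"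
      by (intro LIMSEQ_le_const[OF lim] exI allI impI)
    then have "y = x + x'"
      using V.norm_nonneg[OF V.diff_mem[OF y V.add_mem[OF x(1) x'(1)]]]
        V.norm_eq_zero[OF V.diff_mem[OF y V.add_mem[OF x(1) x'(1)]]] by simp
    then have "s - x = x' - s'" by (simp add: y_def algebra_simps)
    with V.linear_subset_diff[OF lin(1) s(1) xS] V.linear_subset_diff[OF lin(2) xS' s(2)]
    have "s - x \<in> S \<inter> S'" by simp
    then have "s = x" unfolding int by simp
    then show ?thesis using x(3) by (simp add: y_def)
  qed
  then show ?thesis by (rule that)
qed

text \<open>Uniqueness of the decomposition makes the component in \<open>S\<close> a linear
  function of the vector; its boundedness is the preceding estimate.\<close>

lemma projection_along:
  fixes V :: "('k::real_or_complex, 'v::ab_group_add) normed_on"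
  assumes V: "banach_on V" and S: "closed_subspace V S" and S': "closed_subspace V S'"
    and int: "S \<inter> S' = {0}" and dec: "\<And>v. v \<in> vecs V \<Longrightarrow> \<exists>s\<in>S. \<exists>s'\<in>S'. v = s + s'"
  obtains p where "bounded_linear_on V (V\<lparr>vecs := S\<rparr>) p" "\<And>s s'. s \<in> S \<Longrightarrow> s' \<in> S' \<Longrightarrow> p (s + s') = s"
proof -
  interpret V: normed_space_on V using V by (simp add: banach_on_iff)
  obtain K where K: "\<And>s s'. s \<in> S \<Longrightarrow> s' \<in> S' \<Longrightarrow> vnorm V s \<le> K * vnorm V (s + s')"
    using complement_summand_bound[OF V S S' int dec] by blast
  have lin: "linear_subset V S" "linear_subset V S'"
    using S S' by (simp_all add: closed_subspace_def)
  have sub: "\<And>x. x \<in> S \<Longrightarrow> x \<in> vecs V" "\<And>x. x \<in> S' \<Longrightarrow> x \<in> vecs V"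
    using lin by (auto simp: linear_subset_def)
  define p where "p v = (THE s. s \<in> S \<and> v - s \<in> S')" for v
  have p: "p (s + s') = s" if s: "s \<in> S" "s' \<in> S'" for s s'
    unfolding p_def
  proof (rule the_equality)
    fix t assume t: "t \<in> S \<and> s + s' - t \<in> S'"
    then have "(s + s' - t) - s' \<in> S'" by (intro V.linear_subset_diff[OF lin(2) _ s(2)]) simp
    then have "s - t \<in> S'" by (simp add: algebra_simps)
    moreover have "s - t \<in> S" using V.linear_subset_diff[OF lin(1) s(1)] t by simp
    ultimately have "s - t \<in> S \<inter> S'" by simp
    then show "t = s" unfolding int by simp
  qed (use s in auto)
  have "bounded_linear_on V (V\<lparr>vecs := S\<rparr>) p"
    unfolding bounded_linear_on_def
  proof (intro conjI exI ballI allI)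
    fix x assume "x \<in> vecs V"
    then obtain s s' where s: "s \<in> S" "s' \<in> S'" "x = s + s'" using dec by blast
    show "p x \<in> vecs (V\<lparr>vecs := S\<rparr>)" using s p by simp
    show "vnorm (V\<lparr>vecs := S\<rparr>) (p x) \<le> K * vnorm V x" using s p K by simp
    show "p (vscale V c x) = vscale (V\<lparr>vecs := S\<rparr>) c (p x)" for c
    proof -
      have "vscale V c x = vscale V c s + vscale V c s'"
        using s sub V.scale_add_right by simp
      moreover have "vscale V c s \<in> S" "vscale V c s' \<in> S'"
        using s lin by (auto simp: linear_subset_def)
      ultimately show ?thesis using s p by simp
    qed
    fix y assume "y \<in> vecs V"
    then obtain t t' where t: "t \<in> S" "t' \<in> S'" "y = t + t'" using dec by blast
    have "x + y = (s + t) + (s' + t')" using s t by (simp add: algebra_simps)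
    moreover have "s + t \<in> S" "s' + t' \<in> S'"
      using s t lin by (auto simp: linear_subset_def)
    ultimately have "p (x + y) = s + t" using p by simp
    then show "p (x + y) = p x + p y" using s t p by simp
  qed
  with p show ?thesis using that by blast
qed

section \<open>The group of invertible operators\<close>

lemma analytic_at_linear_comp:
  assumes "normed_space_on U" "normed_space_on V" "normed_space_on W"
    and "analytic_at U V f a" "bounded_linear_on V W L"
  shows "analytic_at U W (\<lambda>x. L (f x)) a"
proof -
  interpret U: normed_space_on U by fact
  interpret normed_space_pair V W using assms by (simp add: normed_space_pair_def)
  show ?thesis
    using assms U.analytic_at_value[OF assms(4)]
    by (intro analytic_at_comp[OF assms(1-4)] analytic_at_bounded_linear)
qed

lemma analytic_at_add:
  assumes U: "normed_space_on U" and V: "normed_space_on V"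
    and f: "analytic_at U V f a" and g: "analytic_at U V g a"
  shows "analytic_at U V (\<lambda>x. f x + g x) a"
proof -
  interpret V: normed_space_on V by fact
  interpret VV: normed_space_pair V V by (simp add: normed_space_pair_def V)
  have "bounded_linear_on (prod_normed V V) V (\<lambda>p. fst p + snd p)"
    unfolding bounded_linear_on_def
  proof (intro conjI ballI allI exI)
    show "vnorm V (fst p + snd p) \<le> 1 * vnorm (prod_normed V V) p" if "p \<in> vecs (prod_normed V V)" for p
      using V.norm_triangle[of "fst p" "snd p"] that by auto
  qed (auto simp: V.add_mem V.scale_add_right)
  from analytic_at_linear_comp[OF U VV.normed_space_prod V analytic_at_Pair[OF U V V f g] this]
  show ?thesis by simp
qed

lemma analytic_at_diff:
  assumes U: "normed_space_on U" and V: "normed_space_on V"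
    and f: "analytic_at U V f a" and g: "analytic_at U V g a"
  shows "analytic_at U V (\<lambda>x. f x - g x) a"
proof -
  interpret V: normed_space_on V by fact
  have "bounded_linear_on V V uminus"
    unfolding bounded_linear_on_def
  proof (intro conjI ballI allI exI)
    show "- vscale V c x = vscale V c (- x)" if "x \<in> vecs V" for c x
      using V.scale_add_right[OF that V.minus_mem[OF that], of c] V.scale_zero_right[of c]
      by (simp add: neg_eq_iff_add_eq_0)
    show "vnorm V (- x) \<le> 1 * vnorm V x" if "x \<in> vecs V" for x
      using V.norm_minus[OF that] by simp
  qed (simp_all add: V.minus_mem)
  from analytic_at_add[OF U V f analytic_at_linear_comp[OF U V V g this]] show ?thesis by simp
qed

lemma (in normed_space_on) analytic_at_ident: "a \<in> vecs V \<Longrightarrow> analytic_at V V (\<lambda>x. x) a"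
proof -
  assume a: "a \<in> vecs V"
  interpret VV: normed_space_pair V V by unfold_locales
  have "bounded_linear_on V V (\<lambda>x. x)"
    unfolding bounded_linear_on_def by (auto intro: exI[of _ 1])
  then show "analytic_at V V (\<lambda>x. x) a"
    using a by (rule VV.analytic_at_bounded_linear)
qed

lemma blinfun_compose_assoc: "(R o\<^sub>L S) o\<^sub>L T = R o\<^sub>L (S o\<^sub>L T)"
  by (rule blinfun_eqI) simp

lemma blinfun_compose_id [simp]: "id_blinfun o\<^sub>L T = T" "T o\<^sub>L id_blinfun = T"
  by (rule blinfun_eqI, simp)+

section \<open>The algebra of operators and its group of units\<close>

context banach_over
begin

lemma bounded_linear_smul: "bounded_linear (smul c)"
proof (rule bounded_linear_intro)
  show "smul c (r *\<^sub>R x) = r *\<^sub>R smul c x" for r x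
    unfolding smul_of_real[symmetric] by (rule scale_left_commute)
  show "norm (smul c x) \<le> norm x * norm c" for x
    by (simp add: norm_smul)
qed (rule scale_right_distrib)

abbreviation Op where "Op \<equiv> operators smul"

abbreviation G where "G \<equiv> carrier (GL smul)"

abbreviation ginv where "ginv W \<equiv> inv\<^bsub>GL smul\<^esub> W"

lemma mem_Op: "T \<in> vecs Op \<longleftrightarrow> (\<forall>c x. blinfun_apply T (smul c x) = smul c (blinfun_apply T x))"
  by (simp add: operators_def)

lemma vnorm_Op [simp]: "vnorm Op = norm"
  by (simp add: operators_def)

lemma vscale_Op_apply: "blinfun_apply (vscale Op c T) x = smul c (blinfun_apply T x)"
  unfolding operators_def
  using bounded_linear_compose[OF bounded_linear_smul blinfun.bounded_linear_right, of c T]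
  by (simp add: bounded_linear_Blinfun_apply)

text \<open>The lower bound is the upper one for the scalar \<open>1 / c\<close>.\<close>

lemma norm_vscale_Op: "norm (vscale Op c T) = norm c * norm T"
proof -
  have le: "norm (vscale Op c T) \<le> norm c * norm T" for c T
    by (rule norm_blinfun_bound)
      (simp_all add: vscale_Op_apply norm_smul mult.assoc mult_left_mono norm_blinfun)
  show ?thesis
  proof (cases "c = 0")
    case False
    have "vscale Op (1 / c) (vscale Op c T) = T"
      using False by (intro blinfun_eqI) (simp add: vscale_Op_apply)
    then have "norm T \<le> norm (1 / c) * norm (vscale Op c T)"
      using le[of "1 / c" "vscale Op c T"] by simp
    also have "\<dots> = norm (vscale Op c T) / norm c"
      by (simp add: norm_divide)
    finally have "norm c * norm T \<le> norm (vscale Op c T)"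
      using False by (simp add: field_simps)
    with le[of c T] show ?thesis by linarith
  qed (use le[of 0 T] in simp)
qed

lemma normed_space_Op: "normed_space_on Op"
proof
  show "linear_subset Op (vecs Op)"
    unfolding linear_subset_def
    by (auto simp: mem_Op blinfun.bilinear_simps scale_right_distrib vscale_Op_apply mult.commute)
qed (auto intro!: blinfun_eqI simp: vscale_Op_apply norm_vscale_Op blinfun.bilinear_simps
    scale_right_distrib scale_left_distrib norm_triangle_ineq)

sublocale Op: normed_space_on Op by (rule normed_space_Op)

text \<open>A pointwise limit of operators that commute with scalars commutes with them too, so the
  carrier is closed in the complete space of real operators.\<close>

lemma banach_Op: "banach_on Op"
proof -
  have "Op.mcomplete"
    unfolding Op.mcomplete_iff
  proof (intro allI impI, elim conjE)
    fix \<sigma> :: "nat \<Rightarrow> 'a \<Rightarrow>\<^sub>L 'a"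
    assume \<sigma>: "\<forall>n. \<sigma> n \<in> vecs Op"
      and "\<forall>e>0. \<exists>N. \<forall>n\<ge>N. \<forall>m\<ge>N. vnorm Op (\<sigma> n - \<sigma> m) < e"
    then have "Cauchy \<sigma>"
      unfolding Cauchy_def dist_norm by simp
    then obtain T where T: "\<sigma> \<longlonglongrightarrow> T" using Cauchy_convergent convergent_def by blast
    have app: "(\<lambda>n. blinfun_apply (\<sigma> n) x) \<longlonglongrightarrow> blinfun_apply T x" for x
      by (intro tendsto_intros T)
    have "blinfun_apply T (smul c x) = smul c (blinfun_apply T x)" for c x
    proof (rule LIMSEQ_unique[OF app])
      have "(\<lambda>n. smul c (blinfun_apply (\<sigma> n) x)) \<longlonglongrightarrow> smul c (blinfun_apply T x)"
        by (rule bounded_linear.tendsto[OF bounded_linear_smul app])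
      then show "(\<lambda>n. blinfun_apply (\<sigma> n) (smul c x)) \<longlonglongrightarrow> smul c (blinfun_apply T x)"
        using \<sigma> by (simp add: mem_Op)
    qed
    then have "T \<in> vecs Op" by (simp add: mem_Op)
    moreover have "(\<lambda>n. vnorm Op (\<sigma> n - T)) \<longlonglongrightarrow> 0"
      by (simp add: tendsto_norm_zero[OF LIM_zero[OF T]])
    ultimately show "\<exists>T\<in>vecs Op. (\<lambda>n. vnorm Op (\<sigma> n - T)) \<longlonglongrightarrow> 0" by blast
  qed
  then show ?thesis using normed_space_Op by (simp add: banach_on_iff)
qed

lemma compose_mem_Op: "S \<in> vecs Op \<Longrightarrow> T \<in> vecs Op \<Longrightarrow> S o\<^sub>L T \<in> vecs Op"
  by (simp add: mem_Op)

lemma id_mem_Op: "id_blinfun \<in> vecs Op"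
  by (simp add: mem_Op)

lemma bilinear_compose: "bilinear_on Op Op Op (o\<^sub>L)"
  unfolding bilinear_on_def
proof (intro conjI ballI allI)
  show "\<exists>K\<ge>0. \<forall>S\<in>vecs Op. \<forall>T\<in>vecs Op. vnorm Op (S o\<^sub>L T) \<le> K * vnorm Op S * vnorm Op T"
    using norm_blinfun_compose by (intro exI[of _ 1]) auto
qed (auto simp: compose_mem_Op mem_Op vscale_Op_apply blinfun.bilinear_simps intro!: blinfun_eqI)

lemma monoid_operators: "monoid (operator_monoid smul)"
  by unfold_locales
    (auto simp: operator_monoid_def compose_mem_Op id_mem_Op blinfun_compose_assoc intro!: blinfun_eqI)

lemma group_GL: "group (GL smul)"
  unfolding GL_def by (rule monoid.units_group[OF monoid_operators])

sublocale GL: group "GL smul" by (rule group_GL)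

lemma mult_GL [simp]: "mult (GL smul) = (o\<^sub>L)" and one_GL [simp]: "one (GL smul) = id_blinfun"
  by (simp_all add: GL_def units_of_mult units_of_one operator_monoid_def)

lemma carrier_GL: "W \<in> G \<longleftrightarrow> W \<in> vecs Op \<and> (\<exists>V\<in>vecs Op. V o\<^sub>L W = id_blinfun \<and> W o\<^sub>L V = id_blinfun)"
  by (simp add: GL_def units_of_carrier Units_def operator_monoid_def)

lemma GL_mem_Op: "W \<in> G \<Longrightarrow> W \<in> vecs Op"
  by (simp add: carrier_GL)

text \<open>\<open>V\<close> is a priori only real linear; its linearity over the scalar field is
  inherited from \<open>W\<close>.\<close>

lemma GL_I:
  assumes W: "W \<in> vecs Op" and V: "V o\<^sub>L W = id_blinfun" "W o\<^sub>L V = id_blinfun"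
  shows "W \<in> G" "ginv W = V"
proof -
  have VW: "blinfun_apply V (blinfun_apply W x) = x" "blinfun_apply W (blinfun_apply V x) = x" for x
    using V[THEN arg_cong, of "\<lambda>T. blinfun_apply T x"] by simp_all
  have "blinfun_apply V (smul c x) = smul c (blinfun_apply V x)" for c x
  proof -
    have "blinfun_apply V (smul c x) = blinfun_apply V (blinfun_apply W (smul c (blinfun_apply V x)))"
      using W by (simp add: mem_Op VW)
    then show ?thesis by (simp add: VW)
  qed
  then have "V \<in> vecs Op" by (simp add: mem_Op)
  then show "W \<in> G" "ginv W = V"
    using W V GL.inv_equality[of V W] by (auto simp: carrier_GL)
qed

lemma ginv_apply:
  assumes "W \<in> G"
  shows "blinfun_apply (ginv W) (blinfun_apply W x) = x" "blinfun_apply W (blinfun_apply (ginv W) x) = x"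
  using GL.l_inv[OF assms, THEN arg_cong, of "\<lambda>T. blinfun_apply T x"]
    GL.r_inv[OF assms, THEN arg_cong, of "\<lambda>T. blinfun_apply T x"] by simp_all

lemma compose_GL: "W \<in> G \<Longrightarrow> W' \<in> G \<Longrightarrow> W o\<^sub>L W' \<in> G"
  using GL.m_closed[of W W'] by simp

lemma id_GL: "id_blinfun \<in> G"
  using GL.one_closed by simp

lemma ginv_compose: "W \<in> G \<Longrightarrow> W' \<in> G \<Longrightarrow> ginv (W o\<^sub>L W') = ginv W' o\<^sub>L ginv W"
  using GL.inv_mult_group[of W W'] by simp

lemma ginv_GL: "W \<in> G \<Longrightarrow> ginv W \<in> G"
  by (rule GL.inv_closed)

text \<open>Neumann series: \<open>pw n\<close> is the n-th power of \<open>- h\<close>. Since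
  \<open>h\<close> commutes with these powers, the sum is a two-sided inverse.\<close>

lemma id_plus_GL:
  assumes h: "h \<in> vecs Op" "norm h < 1"
  shows "id_blinfun + h \<in> G"
proof -
  define pw where "pw = rec_nat id_blinfun (\<lambda>_ T. - (h o\<^sub>L T))"
  have pw: "pw 0 = id_blinfun" "pw (Suc n) = - (h o\<^sub>L pw n)" for n by (simp_all add: pw_def)
  have comm: "h o\<^sub>L pw n = pw n o\<^sub>L h" for n
  proof (induction n)
    case (Suc n)
    have "h o\<^sub>L pw (Suc n) = - (h o\<^sub>L (h o\<^sub>L pw n))"
      by (rule blinfun_eqI) (simp add: pw blinfun.bilinear_simps)
    also have "\<dots> = - ((h o\<^sub>L pw n) o\<^sub>L h)"
      by (metis Suc blinfun_compose_assoc)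
    also have "\<dots> = pw (Suc n) o\<^sub>L h"
      by (rule blinfun_eqI) (simp add: pw blinfun.bilinear_simps)
    finally show ?case .
  qed (auto simp: pw intro: blinfun_eqI)
  have bound: "norm (pw n) \<le> norm h ^ n" for n
  proof (induction n)
    case (Suc n)
    have "norm (h o\<^sub>L pw n) \<le> norm h * norm (pw n)" by (rule norm_blinfun_compose)
    also have "\<dots> \<le> norm h * norm h ^ n" by (rule mult_left_mono[OF Suc]) simp
    finally show ?case by (simp add: pw)
  qed (simp add: pw norm_blinfun_id_le)
  have su: "summable pw"
    by (rule summable_comparison_test[of _ "\<lambda>n. norm h ^ n"]) (use h bound in auto)
  define S where "S = suminf pw"
  have tail: "suminf pw = id_blinfun + (\<Sum>n. pw (Suc n))"
    using suminf_split_head[OF su] by (simp add: pw)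
  have "(\<Sum>n. pw (Suc n)) = (\<Sum>n. - (h o\<^sub>L pw n))" by (simp add: pw)
  also have "\<dots> = - (h o\<^sub>L S)"
    unfolding S_def using su
    by (simp add: suminf_minus bounded_linear.suminf[OF bounded_bilinear.bounded_linear_right[OF bounded_bilinear_blinfun_compose]]
        bounded_linear.summable[OF bounded_bilinear.bounded_linear_right[OF bounded_bilinear_blinfun_compose]])
  finally have S1: "S = id_blinfun - (h o\<^sub>L S)" unfolding S_def tail[symmetric] using tail by (simp add: S_def)
  have "h o\<^sub>L S = (\<Sum>n. h o\<^sub>L pw n)"
    unfolding S_def by (rule bounded_linear.suminf[OF bounded_bilinear.bounded_linear_right[OF bounded_bilinear_blinfun_compose] su])
  also have "\<dots> = (\<Sum>n. pw n o\<^sub>L h)" by (simp add: comm)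
  also have "\<dots> = S o\<^sub>L h"
    unfolding S_def by (rule bounded_linear.suminf[OF bounded_bilinear.bounded_linear_left[OF bounded_bilinear_blinfun_compose] su, symmetric])
  finally have S2: "h o\<^sub>L S = S o\<^sub>L h" .
  have "(id_blinfun + h) o\<^sub>L S = S + (h o\<^sub>L S)"
    by (rule blinfun_eqI) (simp add: blinfun.bilinear_simps)
  also have "\<dots> = id_blinfun" by (subst S1) simp
  finally have r: "(id_blinfun + h) o\<^sub>L S = id_blinfun" .
  have "S o\<^sub>L (id_blinfun + h) = S + (S o\<^sub>L h)"
    by (rule blinfun_eqI) (simp add: blinfun.bilinear_simps)
  also have "\<dots> = id_blinfun" unfolding S2[symmetric] by (subst S1) simp
  finally show ?thesis
    using r h(1) by (intro GL_I(1)[of _ S]) (auto intro: Op.add_mem id_mem_Op)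
qed

text \<open>\<open>W + h\<close> is \<open>W\<close> composed with
  \<open>id_blinfun + (ginv W o\<^sub>L h)\<close>, to which the Neumann series applies for small
  \<open>h\<close>.\<close>

lemma near_GL:
  assumes W: "W \<in> G" shows "near Op W (\<lambda>x. x \<in> G)"
  unfolding near_def
proof (intro exI[of _ "1 / (norm (ginv W) + 1)"] conjI ballI impI)
  show "0 < 1 / (norm (ginv W) + 1)" by (simp add: add_nonneg_pos)
  fix h assume h: "h \<in> vecs Op" "vnorm Op h < 1 / (norm (ginv W) + 1)"
  have "norm (ginv W o\<^sub>L h) \<le> norm (ginv W) * norm h" by (rule norm_blinfun_compose)
  also have "\<dots> \<le> (norm (ginv W) + 1) * norm h" by (rule mult_right_mono) simp_all
  also have "\<dots> < 1"
    using h(2) pos_less_divide_eq[of "norm (ginv W) + 1" "norm h" 1] by (simp add: add_nonneg_pos mult.commute)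
  finally have "id_blinfun + (ginv W o\<^sub>L h) \<in> G"
    by (intro id_plus_GL compose_mem_Op[OF GL_mem_Op[OF ginv_GL[OF W]] h(1)])
  with W have "W o\<^sub>L (id_blinfun + (ginv W o\<^sub>L h)) \<in> G" by (rule compose_GL)
  moreover have "W o\<^sub>L (id_blinfun + (ginv W o\<^sub>L h)) = W + h"
    using W by (intro blinfun_eqI) (simp add: blinfun.bilinear_simps ginv_apply)
  ultimately show "W + h \<in> G" by simp
qed

lemma openin_GL: "openin (norm_topology Op) G"
  unfolding Op.openin_norm_topology using near_GL GL_mem_Op by blast

text \<open>The expansion is the Neumann series around \<open>W\<close>, made multilinear: up to the
  sign \<open>(-1)^n\<close>, \<open>A n x\<close> is the product
  \<open>V (x 0) V (x 1) V ... (x (n - 1)) V\<close>.\<close>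

lemma analytic_at_ginv:
  assumes W: "W \<in> G" shows "analytic_at Op Op (\<lambda>x. ginv x) W"
proof -
  define V where "V = ginv W"
  have VG: "V \<in> G" using W by (simp add: V_def)
  have V: "V \<in> vecs Op" using VG by (rule GL_mem_Op)
  obtain r where r: "r > 0" and rG: "\<And>h. h \<in> vecs Op \<Longrightarrow> vnorm Op h < r \<Longrightarrow> W + h \<in> G"
    using near_GL[OF W] unfolding near_def by blast
  define A where "A = rec_nat (\<lambda>_::nat \<Rightarrow> 'a \<Rightarrow>\<^sub>L 'a. V) (\<lambda>n f x. - (f x o\<^sub>L x n o\<^sub>L V))"
  have A: "A 0 x = V" "A (Suc n) x = - (A n x o\<^sub>L x n o\<^sub>L V)" for n x by (simp_all add: A_def)
  \<comment> \<open>Keeps the ratio \<open>norm V * s\<close> of the geometric majorant at most 1/2;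
    the added 1 in the denominator covers \<open>norm V = 0\<close>.\<close>
  define s where "s = min r (1 / (2 * (norm V + 1)))"
  have s: "s > 0" "s \<le> r" using r by (auto simp: s_def add_nonneg_pos)
  have "norm V * s \<le> (norm V + 1) * (1 / (2 * (norm V + 1)))"
    by (intro mult_mono) (auto simp: s_def min.coboundedI2 r less_imp_le)
  also have "\<dots> = 1 / 2"
  proof -
    have *: "a * (1 / (2 * a)) = 1 / 2" if "0 < a" for a :: real using that by simp
    show ?thesis by (rule *) (simp add: add_nonneg_pos)
  qed
  finally have Vs: "norm V * s \<le> 1 / 2" .
  have bound: "norm (A n x) \<le> (norm V ^ Suc n) * (\<Prod>i<n. norm (x i))" for n x
  proof (induction n)
    case (Suc n)
    have "norm (A (Suc n) x) \<le> norm (A n x) * norm (x n) * norm V"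
      using order_trans[OF norm_blinfun_compose mult_right_mono[OF norm_blinfun_compose norm_ge_zero]]
      by (simp add: A)
    also have "\<dots> \<le> (norm V ^ Suc n * (\<Prod>i<n. norm (x i))) * norm (x n) * norm V"
      using Suc by (intro mult_right_mono) auto
    finally show ?case by (simp add: mult_ac)
  qed (simp add: A)
  have mem: "A n x \<in> vecs Op" if "\<And>i. i < n \<Longrightarrow> x i \<in> vecs Op" for n x
    using that by (induction n) (simp_all add: A V Op.minus_mem compose_mem_Op)
  have cong: "A n x = A n y" if "\<And>i. i < n \<Longrightarrow> x i = y i" for n x y
    using that by (induction n) (simp_all add: A)
  have ml: "multilinear_on Op Op n (A n)" for n
  proof (rule multilinear_onI[OF mem cong])
    show "A n (x(i := u + v)) = A n (x(i := u)) + A n (x(i := v))"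
      if "\<And>i. i < n \<Longrightarrow> x i \<in> vecs Op" "i < n" "u \<in> vecs Op" "v \<in> vecs Op" for x i u v
      using that(2)
    proof (induction n)
      case (Suc n)
      show ?case
      proof (cases "i = n")
        case True
        have "A n (x(i := w)) = A n x" for w by (rule cong) (use True in auto)
        then show ?thesis
          using True by (intro blinfun_eqI) (simp add: A blinfun.bilinear_simps fun_upd_def)
      next
        case False
        then have "A n (x(i := u + v)) = A n (x(i := u)) + A n (x(i := v))"
          by (intro Suc.IH) (use Suc.prems False in simp)
        then show ?thesis
          using False by (intro blinfun_eqI) (simp add: A blinfun.bilinear_simps fun_upd_def)
      qed
    qed simp
    show "A n (x(i := vscale Op c u)) = vscale Op c (A n (x(i := u)))"
      if "\<And>i. i < n \<Longrightarrow> x i \<in> vecs Op" "i < n" "u \<in> vecs Op" for x i c u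
      using that(1,2)
    proof (induction n)
      case (Suc n)
      have An: "A n x \<in> vecs Op" using Suc.prems by (intro mem) simp
      have neg: "smul c (- z) = - smul c z" for z by (rule scale_minus_right)
      show ?case
      proof (cases "i = n")
        case True
        have "A n (x(i := w)) = A n x" for w by (rule cong) (use True in auto)
        then show ?thesis
          using True An by (intro blinfun_eqI) (simp add: A blinfun.bilinear_simps vscale_Op_apply mem_Op neg fun_upd_def)
      next
        case False
        then have "A n (x(i := vscale Op c u)) = vscale Op c (A n (x(i := u)))"
          by (intro Suc.IH) (use Suc.prems False in simp_all)
        then show ?thesis
          using False by (intro blinfun_eqI) (simp add: A blinfun.bilinear_simps vscale_Op_apply neg fun_upd_def)
      qed
    qed simp
  qed
  have "power_series_at Op Op (\<lambda>x. ginv x) W A (\<lambda>n. norm V ^ Suc n) s"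
    unfolding power_series_at_def
  proof (intro conjI allI ballI impI ml s)
    show "vnorm Op (A n x) \<le> norm V ^ Suc n * (\<Prod>i<n. vnorm Op (x i))" for n x
      using bound by simp
    have "summable (\<lambda>n. norm V * (norm V * s) ^ n)"
      using Vs s by (intro summable_mult summable_geometric) auto
    then show "summable (\<lambda>n. norm V ^ Suc n * s ^ n)"
      by (simp add: power_mult_distrib mult_ac)
    fix h assume h: "h \<in> vecs Op" "vnorm Op h < s"
    have Wh: "W + h \<in> G" using h s by (intro rG) auto
    then show "ginv (W + h) \<in> vecs Op" by (intro GL_mem_Op ginv_GL)
    \<comment> \<open>Telescoping: \<open>A (Suc N)\<close> ends with \<open>V\<close>, which
      cancels against \<open>W\<close>, so after multiplication by \<open>W + h\<close> consecutive
      terms annihilate each other and one remainder is left.\<close>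
    have part: "(\<Sum>n<N. A n (\<lambda>_. h)) o\<^sub>L (W + h) = id_blinfun - (A N (\<lambda>_. h) o\<^sub>L W)" for N
    proof (induction N)
      case 0
      show ?case using W by (intro blinfun_eqI) (simp add: A V_def ginv_apply blinfun.bilinear_simps)
    next
      case (Suc N)
      have "(\<Sum>n<Suc N. A n (\<lambda>_. h)) o\<^sub>L (W + h)
          = ((\<Sum>n<N. A n (\<lambda>_. h)) o\<^sub>L (W + h)) + (A N (\<lambda>_. h) o\<^sub>L (W + h))"
        by (rule blinfun_eqI) (simp add: blinfun.bilinear_simps)
      also have "\<dots> = id_blinfun - (A (Suc N) (\<lambda>_. h) o\<^sub>L W)"
        unfolding Suc using W
        by (intro blinfun_eqI) (simp add: A V_def ginv_apply blinfun.bilinear_simps)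
      finally show ?case .
    qed
    have diff: "ginv (W + h) - (\<Sum>n<N. A n (\<lambda>_. h)) = A N (\<lambda>_. h) o\<^sub>L W o\<^sub>L ginv (W + h)" for N
    proof (rule blinfun_eqI)
      fix x
      have "blinfun_apply ((\<Sum>n<N. A n (\<lambda>_. h)) o\<^sub>L (W + h)) (blinfun_apply (ginv (W + h)) x)
          = blinfun_apply (\<Sum>n<N. A n (\<lambda>_. h)) x"
        using ginv_apply(2)[OF Wh] by simp
      then show "blinfun_apply (ginv (W + h) - (\<Sum>n<N. A n (\<lambda>_. h))) x
          = blinfun_apply (A N (\<lambda>_. h) o\<^sub>L W o\<^sub>L ginv (W + h)) x"
        unfolding part by (simp add: blinfun.bilinear_simps algebra_simps)
    qed
    have le: "norm (ginv (W + h) - (\<Sum>n<N. A n (\<lambda>_. h))) \<le> norm V * (norm V * s) ^ N * (norm W * norm (ginv (W + h)))" for N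
    proof -
      have "norm (A N (\<lambda>_. h)) \<le> norm V ^ Suc N * norm h ^ N"
        using bound[of N "\<lambda>_. h"] by simp
      also have "\<dots> \<le> norm V ^ Suc N * s ^ N"
        using h by (intro mult_left_mono power_mono) auto
      finally have "norm (A N (\<lambda>_. h)) \<le> norm V * (norm V * s) ^ N" by (simp add: power_mult_distrib mult_ac)
      then have "norm (A N (\<lambda>_. h)) * norm W * norm (ginv (W + h))
          \<le> norm V * (norm V * s) ^ N * norm W * norm (ginv (W + h))"
        by (intro mult_right_mono) simp_all
      moreover have "norm (A N (\<lambda>_. h) o\<^sub>L W o\<^sub>L ginv (W + h)) \<le> norm (A N (\<lambda>_. h)) * norm W * norm (ginv (W + h))"
        by (rule order_trans[OF norm_blinfun_compose mult_right_mono[OF norm_blinfun_compose norm_ge_zero]])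
      ultimately show ?thesis
        unfolding diff by (simp only: mult.assoc)
    qed
    have lim: "(\<lambda>N. norm V * (norm V * s) ^ N * (norm W * norm (ginv (W + h)))) \<longlonglongrightarrow>
        norm V * 0 * (norm W * norm (ginv (W + h)))"
      using Vs s by (intro tendsto_mult tendsto_const LIMSEQ_power_zero) simp
    have "(\<lambda>N. norm (ginv (W + h) - (\<Sum>n<N. A n (\<lambda>_. h)))) \<longlonglongrightarrow> 0"
    proof (rule tendsto_sandwich[OF always_eventually always_eventually tendsto_const])
      show "\<forall>N. 0 \<le> norm (ginv (W + h) - (\<Sum>n<N. A n (\<lambda>_. h)))" by simp
      show "\<forall>N. norm (ginv (W + h) - (\<Sum>n<N. A n (\<lambda>_. h)))
          \<le> norm V * (norm V * s) ^ N * (norm W * norm (ginv (W + h)))"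
        using le by blast
      show "(\<lambda>N. norm V * (norm V * s) ^ N * (norm W * norm (ginv (W + h)))) \<longlonglongrightarrow> 0"
        using lim by simp
    qed
    then show "(\<lambda>N. vnorm Op (ginv (W + h) - (\<Sum>n<N. A n (\<lambda>_. h)))) \<longlonglongrightarrow> 0" by simp
  qed simp_all
  then show ?thesis
    unfolding analytic_at_def using GL_mem_Op[OF W] by blast
qed

lemma analytic_at_GL_inv:
  assumes "normed_space_on V" "analytic_at V Op f a" "f a \<in> G"
  shows "analytic_at V Op (\<lambda>x. ginv (f x)) a"
  by (rule analytic_at_comp[OF assms(1) normed_space_Op normed_space_Op assms(2) analytic_at_ginv[OF assms(3)]])

lemma analytic_at_o:
  assumes "normed_space_on V" "analytic_at V Op f a" "analytic_at V Op g a"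
  shows "analytic_at V Op (\<lambda>x. f x o\<^sub>L g x) a"
  by (rule analytic_at_bilinear[OF assms(1) normed_space_Op normed_space_Op normed_space_Op bilinear_compose assms(2,3)])

lemma analytic_at_Op_const:
  assumes "normed_space_on V" "T \<in> vecs Op" "a \<in> vecs V"
  shows "analytic_at V Op (\<lambda>_. T) a"
proof -
  interpret normed_space_pair V Op using assms(1) normed_space_Op by (simp add: normed_space_pair_def)
  show ?thesis using assms by (intro analytic_at_const)
qed

lemmas analytic_Op_intros = analytic_at_GL_inv analytic_at_o analytic_at_Op_const
  analytic_at_add analytic_at_diff Op.analytic_at_ident

end

section \<open>Homogeneous spaces of subgroups with an analytic splitting\<close>

lemma near_comp:
  assumes "normed_space_on V" "normed_space_on W" "analytic_at V W f a" "near W (f a) P"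
  shows "near V a (\<lambda>x. P (f x))"
proof -
  interpret normed_space_pair V W using assms by (simp add: normed_space_pair_def)
  show ?thesis using assms(3,4) by (rule near_compose)
qed

lemma near_nonzero:
  assumes "normed_space_on V" "normed_space_on W" "analytic_at V W f a" "f a \<noteq> 0"
  shows "near V a (\<lambda>x. f x \<noteq> 0)"
proof -
  interpret normed_space_pair V W using assms by (simp add: normed_space_pair_def)
  have fa: "f a \<in> vecs W" by (rule V.analytic_at_value[OF assms(3)])
  then have "vnorm W (f a) > 0"
    using W.norm_nonneg[OF fa] W.norm_eq_zero[OF fa] assms(4) by linarith
  from analytic_at_near_ball[OF assms(3) this]
  show ?thesis
  proof (rule near_mono)
    fix h assume "f (a + h) \<in> vecs W \<and> vnorm W (f (a + h) - f a) < vnorm W (f a)"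
    then show "f (a + h) \<noteq> 0" using W.norm_minus[OF fa] by auto
  qed
qed

context normed_space_on
begin

lemma openinI: "U \<subseteq> vecs V \<Longrightarrow> (\<And>a. a \<in> U \<Longrightarrow> near V a (\<lambda>x. x \<in> U)) \<Longrightarrow> openin (norm_topology V) U"
  unfolding openin_norm_topology by blast

lemma near_mem: "a \<in> vecs V \<Longrightarrow> near V a (\<lambda>x. x \<in> vecs V)"
  by (rule near_openin[OF openin_vecs])

lemma closedin_zero_set:
  assumes W: "normed_space_on W" and f: "\<And>a. a \<in> vecs V \<Longrightarrow> analytic_at V W f a"
  shows "closedin (norm_topology V) {x \<in> vecs V. f x = 0}"
proof -
  have "openin (norm_topology V) (vecs V - {x \<in> vecs V. f x = 0})"
  proof (rule openinI)
    fix a assume a: "a \<in> vecs V - {x \<in> vecs V. f x = 0}"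
    then have "near V a (\<lambda>x. x \<in> vecs V \<and> f x \<noteq> 0)"
      by (intro near_conj near_mem near_nonzero[OF normed_space_on_axioms W f]) auto
    then show "near V a (\<lambda>x. x \<in> vecs V - {x \<in> vecs V. f x = 0})"
      by (rule near_mono) auto
  qed auto
  then show ?thesis by (auto simp: closedin_def topspace_norm_topology)
qed

lemma analytic_betweenI:
  assumes "openin (norm_topology V) U" "\<And>a. a \<in> U \<Longrightarrow> analytic_at V W g a" "\<And>x. x \<in> U \<Longrightarrow> f x = g x"
  shows "analytic_between V W U f"
  unfolding analytic_between_iff
proof (intro conjI ballI assms(1))
  fix a assume a: "a \<in> U"
  have "near V a (\<lambda>x. g x = f x)"
    by (rule near_mono[OF near_openin[OF assms(1) a]]) (simp add: assms(3))
  with assms(2)[OF a] show "analytic_at V W f a" by (rule analytic_at_cong)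
qed

end

lemma analytic_at_inclusion:
  assumes "normed_space_on V" "linear_subset V S" "a \<in> S"
  shows "analytic_at (V\<lparr>vecs := S\<rparr>) V (\<lambda>x. x) a"
proof -
  interpret S: normed_space_on "V\<lparr>vecs := S\<rparr>" using assms by (intro subspace_normed_space)
  interpret normed_space_pair "V\<lparr>vecs := S\<rparr>" V
    using assms S.normed_space_on_axioms by (simp add: normed_space_pair_def)
  have "bounded_linear_on (V\<lparr>vecs := S\<rparr>) V (\<lambda>x. x)"
    unfolding bounded_linear_on_def using assms(2) by (auto simp: linear_subset_def intro: exI[of _ 1])
  then show ?thesis using assms by (intro analytic_at_bounded_linear) auto
qed

lemma inv_into_ident: "x \<in> A \<Longrightarrow> inv_into A (\<lambda>x. x) x = x"
  using inv_into_f_f[of "\<lambda>x. x" A x] by simp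

lemma atlas_subset_maximal: "analytic_manifold M \<Longrightarrow> c \<in> atlas M \<Longrightarrow> c \<in> maximal_atlas M"
  by (auto simp: analytic_manifold_def maximal_atlas_def)

text \<open>With an explicit inverse \<open>\<xi>\<close> the homeomorphism reduces to two
  continuity statements, and \<open>inv_into\<close>, which occurs in the definition of
  compatibility, receives a formula.\<close>

lemma is_chartI:
  assumes V: "banach_on V" and D: "openin T D" and I: "openin (norm_topology V) I"
    and \<psi>: "\<And>x. x \<in> D \<Longrightarrow> \<psi> x \<in> I \<and> \<xi> (\<psi> x) = x" and \<xi>: "\<And>y. y \<in> I \<Longrightarrow> \<xi> y \<in> D \<and> \<psi> (\<xi> y) = y"
    and c\<psi>: "continuous_map (subtopology T D) (norm_topology V) \<psi>"
    and c\<xi>: "continuous_map (subtopology (norm_topology V) I) T \<xi>"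
  shows "is_chart T \<lparr>chart_dom = D, chart_map = \<psi>, chart_model = V\<rparr>"
    and "\<psi> ` D = I" and "\<And>y. y \<in> I \<Longrightarrow> inv_into D \<psi> y = \<xi> y"
proof -
  show img: "\<psi> ` D = I"
    using \<psi> \<xi> by (auto simp: image_iff) metis
  have inj: "inj_on \<psi> D" using \<psi> by (metis inj_onI)
  show "inv_into D \<psi> y = \<xi> y" if "y \<in> I" for y
    using \<xi>[OF that] inv_into_f_f[OF inj, of "\<xi> y"] by simp
  interpret V: normed_space_on V using V by (simp add: banach_on_iff)
  have sub: "D \<subseteq> topspace T" "I \<subseteq> vecs V"
    using openin_subset[OF D] openin_subset[OF I] by (auto simp: V.topspace_norm_topology)
  have "homeomorphic_maps (subtopology T D) (subtopology (norm_topology V) I) \<psi> \<xi>"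
    unfolding homeomorphic_maps_def
  proof (intro conjI ballI)
    show "continuous_map (subtopology T D) (subtopology (norm_topology V) I) \<psi>"
      using c\<psi> \<psi> by (auto simp: continuous_map_in_subtopology)
    show "continuous_map (subtopology (norm_topology V) I) (subtopology T D) \<xi>"
      using c\<xi> \<xi> by (auto simp: continuous_map_in_subtopology)
  qed (use \<psi> \<xi> in auto)
  then have "homeomorphic_map (subtopology T D) (subtopology (norm_topology V) I) \<psi>"
    by (rule homeomorphic_maps_imp_map)
  then show "is_chart T \<lparr>chart_dom = D, chart_map = \<psi>, chart_model = V\<rparr>"
    unfolding is_chart_def by (simp add: V D I img)
qed

section \<open>The manifold GL(X)\<close>

context banach_over
begin

abbreviation GM where "GM \<equiv> GL_manifold smul"

lemma man_top_GM: "man_top GM = subtopology (norm_topology Op) G"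
  by (simp add: GL_manifold_def open_submanifold_def space_manifold_def)

lemma openin_GM: "openin (man_top GM) U \<longleftrightarrow> U \<subseteq> G \<and> openin (norm_topology Op) U"
  unfolding man_top_GM by (auto simp: openin_open_subtopology[OF openin_GL])

lemma topspace_GM: "topspace (man_top GM) = G"
  unfolding man_top_GM using GL_mem_Op by (auto simp: Op.topspace_norm_topology)

lemma atlas_GM: "atlas GM = {\<lparr>chart_dom = G, chart_map = (\<lambda>x. x), chart_model = Op\<rparr>}"
  using GL_mem_Op by (auto simp: GL_manifold_def open_submanifold_def space_manifold_def Int_absorb1 subset_iff)

text \<open>The atlas of the group consists of the identity chart alone, so compatibility amounts to
  analyticity of the map and of its inverse.\<close>

lemma GL_chartI:
  assumes D: "openin (norm_topology Op) D" "D \<subseteq> G" and I: "openin (norm_topology Op) I"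
    and \<psi>: "\<And>x. x \<in> D \<Longrightarrow> \<psi> x \<in> I \<and> \<xi> (\<psi> x) = x" and \<xi>: "\<And>y. y \<in> I \<Longrightarrow> \<xi> y \<in> D \<and> \<psi> (\<xi> y) = y"
    and a\<psi>: "\<And>x. x \<in> D \<Longrightarrow> analytic_at Op Op \<psi> x" and a\<xi>: "\<And>y. y \<in> I \<Longrightarrow> analytic_at Op Op \<xi> y"
  shows "\<lparr>chart_dom = D, chart_map = \<psi>, chart_model = Op\<rparr> \<in> maximal_atlas GM"
proof -
  interpret P: normed_space_pair Op Op by unfold_locales
  have DG: "D \<inter> G = D" "G \<inter> D = D" using D(2) by auto
  have ab\<psi>: "analytic_between Op Op D \<psi>" and ab\<xi>: "analytic_between Op Op I \<xi>"
    using D I a\<psi> a\<xi> by (auto simp: Op.analytic_between_iff)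
  have c1: "continuous_map (subtopology (man_top GM) D) (norm_topology Op) \<psi>"
    using P.analytic_between_continuous[OF ab\<psi>] by (simp add: man_top_GM subtopology_subtopology DG)
  have "\<xi> ` I \<subseteq> G" using \<xi> D(2) by auto
  then have c2: "continuous_map (subtopology (norm_topology Op) I) (man_top GM) \<xi>"
    using P.analytic_between_continuous[OF ab\<xi>] openin_subset[OF I]
    by (auto simp: man_top_GM continuous_map_in_subtopology)
  have Dt: "openin (man_top GM) D" using D by (simp add: openin_GM)
  note ch = is_chartI[OF banach_Op Dt I \<psi> \<xi> c1 c2]
  have "\<psi> ` (D \<inter> G) = I" using ch(2) DG by simp
  then have "analytic_between Op Op (\<psi> ` (D \<inter> G)) ((\<lambda>x. x) \<circ> inv_into D \<psi>)"
    using I a\<xi> ch(3) by (intro Op.analytic_betweenI) auto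
  moreover have "analytic_between Op Op ((\<lambda>x. x) ` (D \<inter> G)) (\<psi> \<circ> inv_into G (\<lambda>x. x))"
    unfolding DG image_ident using D a\<psi> by (intro Op.analytic_betweenI) (auto simp: inv_into_ident subset_iff)
  ultimately show ?thesis
    using ch(1) unfolding maximal_atlas_def atlas_GM compatible_charts_def by simp
qed

end

text \<open>Common frame for both stabilizers. \<open>k\<close> is a linear projection whose kernel
  contains \<open>H\<close>, and \<open>e\<close> is a diagonal part, which may be affine. If
  \<open>e U\<close> is invertible, then \<open>T = k U o\<^sub>L ginv (e U)\<close> and
  \<open>B = ginv (id_blinfun + T) o\<^sub>L U\<close> split \<open>U\<close> as
  \<open>(id_blinfun + T) o\<^sub>L B\<close>; \<open>unfactor\<close> recovers \<open>T\<close>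
  from such a product and makes the splitting unique. \<open>H_iff\<close> shows \<open>H\<close> as
  an open part of the kernel of \<open>k\<close>, \<open>H_closed\<close> as a closed set in the
  group.\<close>

locale split_subgroup = banach_over smul
  for smul :: "'k::real_or_complex \<Rightarrow> 'a::banach \<Rightarrow> 'a" +
  fixes k e :: "('a \<Rightarrow>\<^sub>L 'a) \<Rightarrow> ('a \<Rightarrow>\<^sub>L 'a)" and H :: "('a \<Rightarrow>\<^sub>L 'a) set"
  assumes k: "bounded_linear_on Op Op k" and kk: "T \<in> vecs Op \<Longrightarrow> k (k T) = k T"
    and e: "W \<in> vecs Op \<Longrightarrow> analytic_at Op Op e W"
    and H: "subgroup H (GL smul)"
    and H_iff: "W \<in> G \<Longrightarrow> W \<in> H \<longleftrightarrow> k W = 0 \<and> e W \<in> G"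
    and H_closed: "W \<in> G \<Longrightarrow> W \<in> H \<longleftrightarrow> k W = 0 \<and> k (ginv W) = 0"
    and factor: "U \<in> G \<Longrightarrow> e U \<in> G \<Longrightarrow> k (k U o\<^sub>L ginv (e U)) = k U o\<^sub>L ginv (e U) \<and>
      id_blinfun + (k U o\<^sub>L ginv (e U)) \<in> G \<and> ginv (id_blinfun + (k U o\<^sub>L ginv (e U))) o\<^sub>L U \<in> H"
    and unfactor: "T \<in> vecs Op \<Longrightarrow> k T = T \<Longrightarrow> id_blinfun + T \<in> G \<Longrightarrow> B \<in> H \<Longrightarrow>
      e ((id_blinfun + T) o\<^sub>L B) \<in> G \<and>
      k ((id_blinfun + T) o\<^sub>L B) o\<^sub>L ginv (e ((id_blinfun + T) o\<^sub>L B)) = T"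
begin

definition \<tau> where "\<tau> U = k U o\<^sub>L ginv (e U)"

definition \<Omega> where "\<Omega> = {U \<in> G. e U \<in> G}"

abbreviation K where "K \<equiv> {T \<in> vecs Op. k T = T}"

abbreviation S where "S \<equiv> {T \<in> vecs Op. k T = 0}"

abbreviation KN where "KN \<equiv> Op\<lparr>vecs := K\<rparr>"

abbreviation proj where "proj g \<equiv> g <#\<^bsub>GL smul\<^esub> H"

lemma k_mem: "T \<in> vecs Op \<Longrightarrow> k T \<in> vecs Op"
  and k_add: "T \<in> vecs Op \<Longrightarrow> T' \<in> vecs Op \<Longrightarrow> k (T + T') = k T + k T'"
  and k_scale: "T \<in> vecs Op \<Longrightarrow> k (vscale Op c T) = vscale Op c (k T)"
  using k by (auto simp: bounded_linear_on_def)

lemma k_zero: "k 0 = 0"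
  using k_add[OF Op.zero_mem Op.zero_mem] by simp

lemma k_diff: "T \<in> vecs Op \<Longrightarrow> T' \<in> vecs Op \<Longrightarrow> k (T - T') = k T - k T'"
  using k_add[of "T - T'" T'] by (simp add: Op.diff_mem)

lemma HG: "h \<in> H \<Longrightarrow> h \<in> G"
  by (rule subgroup.mem_carrier[OF H])

lemma id_H: "id_blinfun \<in> H"
  using subgroup.one_closed[OF H] by simp

lemma H_compose: "h \<in> H \<Longrightarrow> h' \<in> H \<Longrightarrow> h o\<^sub>L h' \<in> H"
  using subgroup.m_closed[OF H] by simp

lemma analytic_k: "T \<in> vecs Op \<Longrightarrow> analytic_at Op Op k T"
proof -
  interpret P: normed_space_pair Op Op by unfold_locales
  show "T \<in> vecs Op \<Longrightarrow> analytic_at Op Op k T" by (rule P.analytic_at_bounded_linear[OF k])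
qed

lemma closed_subspaces: "closed_subspace Op S" "closed_subspace Op K"
proof -
  have "linear_subset Op S" "linear_subset Op K"
    by (auto simp: linear_subset_def k_zero Op.zero_mem k_add k_scale Op.add_mem Op.scale_mem Op.scale_zero_right)
  moreover have "closedin (norm_topology Op) S"
    by (rule Op.closedin_zero_set[OF normed_space_Op analytic_k])
  moreover have "closedin (norm_topology Op) {T \<in> vecs Op. k T - T = 0}"
    by (rule Op.closedin_zero_set[OF normed_space_Op])
      (intro analytic_at_diff normed_space_Op analytic_k Op.analytic_at_ident)
  ultimately show "closed_subspace Op S" "closed_subspace Op K"
    by (simp_all add: closed_subspace_def)
qed

lemma banach_KN: "banach_on KN"
  by (rule subspace_banach[OF banach_Op closed_subspaces(2)])

lemma normed_KN: "normed_space_on KN"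
  using banach_KN by (simp add: banach_on_iff)

sublocale KN: normed_space_on KN by (rule normed_KN)

lemma complemented_S: "complemented_subspace Op S"
  unfolding complemented_subspace_def
proof (intro conjI exI[of _ K] ballI closed_subspaces)
  show "S \<inter> K = {0}" by (auto simp: k_zero Op.zero_mem)
  fix T assume T: "T \<in> vecs Op"
  show "\<exists>s\<in>S. \<exists>t\<in>K. T = s + t"
    using T by (intro bexI[of _ "T - k T"] bexI[of _ "k T"]) (auto simp: k_diff kk k_mem Op.diff_mem)
qed

lemma near_\<Omega>: "U \<in> \<Omega> \<Longrightarrow> near Op U (\<lambda>x. x \<in> \<Omega>)"
  unfolding \<Omega>_def mem_Collect_eq
  by (intro near_conj near_GL near_comp[OF normed_space_Op normed_space_Op e] GL_mem_Op) auto

lemma openin_\<Omega>: "openin (norm_topology Op) \<Omega>"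
  by (rule Op.openinI[OF _ near_\<Omega>]) (auto simp: \<Omega>_def GL_mem_Op)

lemma \<Omega>_G: "U \<in> \<Omega> \<Longrightarrow> U \<in> G"
  by (simp add: \<Omega>_def)

lemma \<Omega>_factor:
  assumes "U \<in> \<Omega>"
  shows "\<tau> U \<in> K" "id_blinfun + \<tau> U \<in> G" "ginv (id_blinfun + \<tau> U) o\<^sub>L U \<in> H"
proof -
  have U: "U \<in> G" "e U \<in> G" using assms by (simp_all add: \<Omega>_def)
  then have "\<tau> U \<in> vecs Op"
    unfolding \<tau>_def by (intro compose_mem_Op k_mem GL_mem_Op[OF ginv_GL] GL_mem_Op[OF U(1)])
  with factor[OF U] show "\<tau> U \<in> K" "id_blinfun + \<tau> U \<in> G" "ginv (id_blinfun + \<tau> U) o\<^sub>L U \<in> H"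
    by (simp_all add: \<tau>_def)
qed

lemma \<Omega>_unfactor:
  assumes "T \<in> K" "id_blinfun + T \<in> G" "B \<in> H"
  shows "(id_blinfun + T) o\<^sub>L B \<in> \<Omega>" "\<tau> ((id_blinfun + T) o\<^sub>L B) = T"
  using unfactor[of T B] assms by (auto simp: \<Omega>_def \<tau>_def intro: compose_GL HG)

text \<open>Right multiplication by \<open>h\<close> changes only the factor in \<open>H\<close> and
  leaves the factor \<open>id_blinfun + \<tau> U\<close> alone; uniqueness of the splitting does the
  rest.\<close>

lemma \<Omega>_compose_H:
  assumes "U \<in> \<Omega>" "h \<in> H"
  shows "U o\<^sub>L h \<in> \<Omega>" "\<tau> (U o\<^sub>L h) = \<tau> U"
proof -
  note f = \<Omega>_factor[OF assms(1)]
  have "U o\<^sub>L h = (id_blinfun + \<tau> U) o\<^sub>L ((ginv (id_blinfun + \<tau> U) o\<^sub>L U) o\<^sub>L h)"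
    using f(2) by (intro blinfun_eqI) (simp add: ginv_apply)
  then show "U o\<^sub>L h \<in> \<Omega>" "\<tau> (U o\<^sub>L h) = \<tau> U"
    using \<Omega>_unfactor[OF f(1,2) H_compose[OF f(3) assms(2)]] by simp_all
qed

lemma id_\<Omega>: "id_blinfun \<in> \<Omega>"
  using \<Omega>_unfactor(1)[of 0 id_blinfun] by (simp add: k_zero Op.zero_mem id_GL id_H)

lemma analytic_\<tau>: "U \<in> \<Omega> \<Longrightarrow> analytic_at Op Op \<tau> U"
  unfolding \<tau>_def \<Omega>_def
  by (intro analytic_Op_intros analytic_k e normed_space_Op) (auto intro: GL_mem_Op)

text \<open>\<open>k\<close> is a bounded linear retraction of the operators onto \<open>K\<close>.
  Composing with it changes the target of the map but not its values.\<close>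

lemma analytic_to_KN:
  assumes "normed_space_on V" "analytic_at V Op f a" "near V a (\<lambda>x. f x \<in> K)"
  shows "analytic_at V KN f a"
proof -
  have "bounded_linear_on Op KN k"
    using k unfolding bounded_linear_on_def by (auto simp: kk)
  from analytic_at_linear_comp[OF assms(1) normed_space_Op normed_KN assms(2) this]
  show ?thesis
    by (rule analytic_at_cong) (rule near_mono[OF assms(3)], simp)
qed

lemma analytic_of_KN: "T \<in> K \<Longrightarrow> analytic_at KN Op (\<lambda>x. x) T"
  using closed_subspaces(2) by (intro analytic_at_inclusion normed_space_Op) (auto simp: closed_subspace_def)

text \<open>The identity chart restricted to \<open>\<Omega>\<close> is already adapted:
  \<open>H\<close> lies in \<open>\<Omega>\<close>, and inside \<open>\<Omega>\<close> it is cut out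
  by the linear equation \<open>k W = 0\<close>.\<close>

lemma lie_subgroup: "banach_lie_subgroup GM (GL smul) H"
  unfolding banach_lie_subgroup_def analytic_submanifold_def
proof (intro conjI H ballI)
  show "H \<subseteq> topspace (man_top GM)" using HG by (auto simp: topspace_GM)
  fix p assume p: "p \<in> H"
  have chart: "\<lparr>chart_dom = \<Omega>, chart_map = (\<lambda>x. x), chart_model = Op\<rparr> \<in> maximal_atlas GM"
    by (rule GL_chartI[where \<xi> = "\<lambda>x. x", OF openin_\<Omega> _ openin_\<Omega>])
      (auto simp: \<Omega>_G intro!: Op.analytic_at_ident GL_mem_Op)
  have H\<Omega>: "h \<in> H \<Longrightarrow> h \<in> \<Omega>" for h
    using \<Omega>_compose_H(1)[OF id_\<Omega>, of h] by simp
  have "\<Omega> \<inter> H = \<Omega> \<inter> S"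
    using H_iff by (auto simp: \<Omega>_def GL_mem_Op)
  then have "(\<lparr>chart_dom = \<Omega>, chart_map = (\<lambda>x. x), chart_model = Op\<rparr>, S) \<in> adapted_charts GM H"
    unfolding adapted_charts_def using chart complemented_S by simp
  then show "\<exists>(c, V1)\<in>adapted_charts GM H. p \<in> chart_dom c"
    using H\<Omega>[OF p] by (intro bexI) auto
qed

lemma mem_proj: "g' \<in> proj g \<longleftrightarrow> (\<exists>h\<in>H. g' = g o\<^sub>L h)"
  by (auto simp: l_coset_def)

lemma proj_eq_iff:
  assumes "g \<in> G" "g' \<in> G"
  shows "proj g = proj g' \<longleftrightarrow> ginv g o\<^sub>L g' \<in> H"
proof
  assume eq: "proj g = proj g'"
  have "g' \<in> proj g" unfolding eq mem_proj by (rule bexI[OF _ id_H]) simp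
  then obtain h where "h \<in> H" "g' = g o\<^sub>L h" unfolding mem_proj by blast
  moreover have "ginv g o\<^sub>L (g o\<^sub>L h) = h"
    using assms(1) by (intro blinfun_eqI) (simp add: ginv_apply)
  ultimately show "ginv g o\<^sub>L g' \<in> H" by simp
next
  assume "ginv g o\<^sub>L g' \<in> H"
  moreover have "g' = g o\<^sub>L (ginv g o\<^sub>L g')"
    using assms(1) by (intro blinfun_eqI) (simp add: ginv_apply)
  ultimately have "g' \<in> proj g" unfolding mem_proj by blast
  then show "proj g = proj g'" by (rule GL.l_repr_independence[OF _ assms(1) H])
qed

lemma proj_compose: "g \<in> G \<Longrightarrow> h \<in> H \<Longrightarrow> proj (g o\<^sub>L h) = proj g"
  using GL.l_repr_independence[of "g o\<^sub>L h" g H] H by (auto simp: mem_proj)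

lemma lcosets_eq: "lcosets\<^bsub>GL smul\<^esub> H = proj ` G"
  by (auto simp: LCOSETS_def)

section \<open>The quotient topology\<close>

definition quotient_top where
  "quotient_top = topology (\<lambda>\<U>. \<U> \<subseteq> proj ` G \<and> openin (norm_topology Op) {g \<in> G. proj g \<in> \<U>})"

lemma openin_quotient_top:
  "openin quotient_top \<U> \<longleftrightarrow> \<U> \<subseteq> proj ` G \<and> openin (norm_topology Op) {g \<in> G. proj g \<in> \<U>}"
proof -
  have inter: "{g \<in> G. proj g \<in> A \<inter> B} = {g \<in> G. proj g \<in> A} \<inter> {g \<in> G. proj g \<in> B}" for A B by auto
  have union: "{g \<in> G. proj g \<in> \<Union>\<K>} = (\<Union>A\<in>\<K>. {g \<in> G. proj g \<in> A})" for \<K> by auto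
  have "istopology (\<lambda>\<U>. \<U> \<subseteq> proj ` G \<and> openin (norm_topology Op) {g \<in> G. proj g \<in> \<U>})"
    unfolding istopology_def inter union by (auto intro!: openin_Union)
  then show ?thesis by (simp add: quotient_top_def topology_inverse')
qed

lemma topspace_quotient_top: "topspace quotient_top = proj ` G"
proof -
  have "{g \<in> G. proj g \<in> proj ` G} = G" by auto
  then have "openin quotient_top (proj ` G)" by (simp add: openin_quotient_top openin_GL)
  then show ?thesis
    using openin_subset openin_quotient_top[of "topspace quotient_top"] by fastforce
qed

lemma quotient_map_proj: "quotient_map (man_top GM) quotient_top proj"
  unfolding quotient_map_def topspace_GM topspace_quotient_top
  by (auto simp: openin_GM openin_quotient_top)

text \<open>A point \<open>g\<close> over the image is carried into \<open>D\<close> by right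
  translation with some \<open>h\<close> in \<open>H\<close>. Translation is analytic, so points
  near \<open>g\<close> are carried into \<open>D\<close> as well.\<close>

lemma openin_proj_image:
  assumes "openin (norm_topology Op) D" "D \<subseteq> G"
  shows "openin quotient_top (proj ` D)"
  unfolding openin_quotient_top
proof (intro conjI Op.openinI)
  fix g assume "g \<in> {g \<in> G. proj g \<in> proj ` D}"
  then obtain d where g: "g \<in> G" and d: "d \<in> D" "proj g = proj d" by auto
  define h where "h = ginv g o\<^sub>L d"
  have h: "h \<in> H" using d g assms(2) proj_eq_iff[of g d] by (auto simp: h_def)
  have gh: "g o\<^sub>L h = d" unfolding h_def using g by (intro blinfun_eqI) (simp add: ginv_apply)
  have hO: "h \<in> vecs Op" and gO: "g \<in> vecs Op" using GL_mem_Op HG[OF h] g by auto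
  have an: "analytic_at Op Op (\<lambda>x. x o\<^sub>L h) g"
    by (intro analytic_Op_intros normed_space_Op hO gO)
  have "near Op (g o\<^sub>L h) (\<lambda>x. x \<in> D)"
    unfolding gh by (rule Op.near_openin[OF assms(1) d(1)])
  from near_comp[OF normed_space_Op normed_space_Op an this]
  have "near Op g (\<lambda>x. x \<in> G \<and> x o\<^sub>L h \<in> D)"
    using near_GL[OF g] near_conj by blast
  then show "near Op g (\<lambda>x. x \<in> {g \<in> G. proj g \<in> proj ` D})"
  proof (rule near_mono)
    fix y assume "g + y \<in> G \<and> (g + y) o\<^sub>L h \<in> D"
    then show "g + y \<in> {g \<in> G. proj g \<in> proj ` D}"
      using proj_compose[of "g + y" h] h by auto
  qed
qed (use assms(2) GL_mem_Op in auto)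

text \<open>By \<open>H_closed\<close> one of the two analytic expressions \<open>k u\<close> and
  \<open>k (ginv u)\<close> is nonzero, and this persists nearby.\<close>

lemma near_not_H:
  assumes u: "u \<in> G" "u \<notin> H" shows "near Op u (\<lambda>x. x \<notin> H)"
proof -
  consider "k u \<noteq> 0" | "k (ginv u) \<noteq> 0" using H_closed[OF u(1)] u(2) by blast
  then have "near Op u (\<lambda>x. k x \<noteq> 0 \<or> k (ginv x) \<noteq> 0)"
  proof cases
    case 1
    show ?thesis
      by (rule near_mono[OF near_nonzero[OF normed_space_Op normed_space_Op analytic_k[OF GL_mem_Op[OF u(1)]] 1]]) simp
  next
    case 2
    have "analytic_at Op Op (\<lambda>x. k (ginv x)) u"
      using u(1) by (intro analytic_at_linear_comp[OF normed_space_Op normed_space_Op normed_space_Op _ k] analytic_at_ginv)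
    from near_nonzero[OF normed_space_Op normed_space_Op this 2] show ?thesis
      by (rule near_mono) simp
  qed
  then have "near Op u (\<lambda>x. x \<in> G \<and> (k x \<noteq> 0 \<or> k (ginv x) \<noteq> 0))"
    using near_GL[OF u(1)] near_conj by blast
  then show ?thesis by (rule near_mono) (use H_closed in auto)
qed

text \<open>Two cosets differ when \<open>ginv g1 o\<^sub>L g2\<close> avoids the closed set
  \<open>H\<close>. By continuity in the pair this holds for all representatives in small balls, so
  the open images of these balls are disjoint.\<close>

lemma Hausdorff_quotient_top: "Hausdorff_space quotient_top"
  unfolding Hausdorff_space_def topspace_quotient_top
proof (intro allI impI, elim conjE)
  fix C1 C2 assume "C1 \<in> proj ` G" "C2 \<in> proj ` G" and ne: "C1 \<noteq> C2"
  then obtain g1 g2 where g: "g1 \<in> G" "g2 \<in> G" and C: "C1 = proj g1" "C2 = proj g2" by auto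
  interpret PP: normed_space_pair Op Op by unfold_locales
  let ?P = "prod_normed Op Op"
  have nP: "normed_space_on ?P" by (rule PP.normed_space_prod)
  interpret P: normed_space_on ?P by (rule nP)
  have mem: "(g1, g2) \<in> vecs ?P" using g GL_mem_Op by simp
  have lin: "bounded_linear_on ?P Op fst" "bounded_linear_on ?P Op snd"
    unfolding bounded_linear_on_def by (auto intro!: exI[of _ 1])
  have an: "analytic_at ?P Op fst (g1, g2)" "analytic_at ?P Op snd (g1, g2)"
    using analytic_at_linear_comp[OF nP nP normed_space_Op P.analytic_at_ident[OF mem]] lin by auto
  have "analytic_at ?P Op (\<lambda>p. ginv (fst p) o\<^sub>L snd p) (g1, g2)"
    using g by (intro analytic_Op_intros nP an) simp
  moreover have "near Op (ginv g1 o\<^sub>L g2) (\<lambda>x. x \<notin> H)"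
    using g ne proj_eq_iff[OF g] by (intro near_not_H compose_GL ginv_GL) (auto simp: C)
  ultimately have "near ?P (g1, g2) (\<lambda>p. ginv (fst p) o\<^sub>L snd p \<notin> H)"
    by (intro near_comp[OF nP normed_space_Op, of "\<lambda>p. ginv (fst p) o\<^sub>L snd p" "(g1, g2)" "\<lambda>x. x \<notin> H"]) simp_all
  then obtain r where r: "r > 0" "\<And>y. y \<in> vecs ?P \<Longrightarrow> vnorm ?P y < r \<Longrightarrow>
      ginv (fst ((g1, g2) + y)) o\<^sub>L snd ((g1, g2) + y) \<notin> H"
    unfolding near_def by blast
  \<comment> \<open>Half the radius for each component because the norm of a pair is the sum of the
    norms.\<close>
  define B where "B = (\<lambda>g. {x \<in> G. norm (x - g) < r / 2})"
  have openB: "openin (norm_topology Op) (B g)" if "g \<in> G" for g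
  proof (rule Op.openinI)
    show "B g \<subseteq> vecs Op" by (auto simp: B_def GL_mem_Op)
    fix a assume a: "a \<in> B g"
    then have aG: "a \<in> G" and an: "norm (a - g) < r / 2" by (auto simp: B_def)
    have "near Op a (\<lambda>x. x \<in> vecs Op \<and> vnorm Op (x - a) < r / 2 - norm (a - g))"
      using aG an by (intro Op.near_ball GL_mem_Op) auto
    then have "near Op a (\<lambda>x. x \<in> G \<and> x \<in> vecs Op \<and> vnorm Op (x - a) < r / 2 - norm (a - g))"
      using near_GL[OF aG] near_conj by blast
    then show "near Op a (\<lambda>x. x \<in> B g)"
    proof (rule near_mono)
      fix y assume "a + y \<in> G \<and> a + y \<in> vecs Op \<and> vnorm Op (a + y - a) < r / 2 - norm (a - g)"
      then show "a + y \<in> B g"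
        using norm_triangle_ineq[of y "a - g"] by (simp add: B_def algebra_simps)
    qed
  qed
  have disj: "disjnt (proj ` B g1) (proj ` B g2)"
  proof (rule ccontr)
    assume "\<not> ?thesis"
    then obtain x1 x2 where x: "x1 \<in> B g1" "x2 \<in> B g2" "proj x1 = proj x2"
      by (auto simp: disjnt_def)
    then have xG: "x1 \<in> G" "x2 \<in> G" by (auto simp: B_def)
    have "ginv (fst ((g1, g2) + (x1 - g1, x2 - g2))) o\<^sub>L snd ((g1, g2) + (x1 - g1, x2 - g2)) \<notin> H"
      using x(1,2) xG g by (intro r(2)) (auto simp: B_def GL_mem_Op Op.diff_mem)
    then show False using proj_eq_iff[OF xG] x(3) by simp
  qed
  have "g1 \<in> B g1" "g2 \<in> B g2" using g r(1) by (auto simp: B_def)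
  moreover have "openin quotient_top (proj ` B g1)" "openin quotient_top (proj ` B g2)"
    using openB g by (auto intro!: openin_proj_image) (auto simp: B_def)
  ultimately show "\<exists>U V. openin quotient_top U \<and> openin quotient_top V \<and> C1 \<in> U \<and> C2 \<in> V \<and> disjnt U V"
    using disj unfolding C by blast
qed

section \<open>Charts of the quotient\<close>

definition dom_at where "dom_at W = {g \<in> G. ginv W o\<^sub>L g \<in> \<Omega>}"

text \<open>Any representative gives the same value, since \<open>\<tau>\<close> is unchanged by
  right multiplication with \<open>H\<close>; this is \<open>coord_proj\<close>.\<close>

definition coord where "coord W C = \<tau> (ginv W o\<^sub>L (SOME g. g \<in> C))"

definition coset_chart where
  "coset_chart W = \<lparr>chart_dom = proj ` dom_at W, chart_map = coord W, chart_model = KN\<rparr>"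

abbreviation I where "I \<equiv> {T \<in> K. id_blinfun + T \<in> G}"

lemma dom_at_compose_H:
  assumes "W \<in> G" "g \<in> dom_at W" "h \<in> H"
  shows "g o\<^sub>L h \<in> dom_at W" "\<tau> (ginv W o\<^sub>L (g o\<^sub>L h)) = \<tau> (ginv W o\<^sub>L g)"
  using assms \<Omega>_compose_H[of "ginv W o\<^sub>L g" h] by (auto simp: dom_at_def blinfun_compose_assoc compose_GL HG)

lemma coord_proj:
  assumes "W \<in> G" "g \<in> dom_at W" shows "coord W (proj g) = \<tau> (ginv W o\<^sub>L g)"
proof -
  have "\<exists>g'. g' \<in> proj g" unfolding mem_proj using id_H by blast
  then have "(SOME g'. g' \<in> proj g) \<in> proj g" by (rule someI_ex)
  then obtain h where h: "h \<in> H" "(SOME g'. g' \<in> proj g) = g o\<^sub>L h" unfolding mem_proj by blast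
  then show ?thesis unfolding coord_def using dom_at_compose_H(2)[OF assms h(1)] by simp
qed

text \<open>Stability of \<open>\<Omega>\<close> under right multiplication by \<open>H\<close>
  makes the domain a union of cosets.\<close>

lemma proj_dom_at:
  assumes "W \<in> G" "g \<in> G" shows "proj g \<in> proj ` dom_at W \<longleftrightarrow> g \<in> dom_at W"
proof
  assume "proj g \<in> proj ` dom_at W"
  then obtain d where d: "d \<in> dom_at W" "proj d = proj g" by auto
  then have dG: "d \<in> G" by (simp add: dom_at_def)
  have "ginv d o\<^sub>L g \<in> H" using proj_eq_iff[OF dG assms(2)] d by simp
  moreover have "d o\<^sub>L (ginv d o\<^sub>L g) = g" using dG by (intro blinfun_eqI) (simp add: ginv_apply)
  ultimately show "g \<in> dom_at W" using dom_at_compose_H(1)[OF assms(1) d(1)] by metis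
qed auto

lemma near_dom_at:
  assumes "W \<in> G" "g \<in> dom_at W" shows "near Op g (\<lambda>x. x \<in> dom_at W)"
proof -
  have g: "g \<in> G" "ginv W o\<^sub>L g \<in> \<Omega>" using assms by (auto simp: dom_at_def)
  have "near Op g (\<lambda>x. ginv W o\<^sub>L x \<in> \<Omega>)"
    using g assms(1)
    by (intro near_comp[OF normed_space_Op normed_space_Op, of "\<lambda>x. ginv W o\<^sub>L x" g "\<lambda>x. x \<in> \<Omega>"]
        near_\<Omega> analytic_Op_intros normed_space_Op GL_mem_Op ginv_GL)
  then show ?thesis unfolding dom_at_def mem_Collect_eq using near_GL[OF g(1)] near_conj by blast
qed

lemma openin_dom_at: "W \<in> G \<Longrightarrow> openin (norm_topology Op) (dom_at W)"
  by (rule Op.openinI[OF _ near_dom_at]) (auto simp: dom_at_def GL_mem_Op)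

lemma dom_at_G: "dom_at W \<subseteq> G"
  by (auto simp: dom_at_def)

lemma analytic_coord:
  assumes "W \<in> G" "g \<in> dom_at W"
  shows "analytic_at Op KN (\<lambda>g. \<tau> (ginv W o\<^sub>L g)) g"
proof (rule analytic_to_KN[OF normed_space_Op])
  have g: "g \<in> G" "ginv W o\<^sub>L g \<in> \<Omega>" using assms by (auto simp: dom_at_def)
  show "analytic_at Op Op (\<lambda>g. \<tau> (ginv W o\<^sub>L g)) g"
    using g assms(1)
    by (intro analytic_at_comp[OF normed_space_Op normed_space_Op normed_space_Op _ analytic_\<tau>]
        analytic_Op_intros normed_space_Op GL_mem_Op ginv_GL)
  show "near Op g (\<lambda>x. \<tau> (ginv W o\<^sub>L x) \<in> K)"
    by (rule near_mono[OF near_dom_at[OF assms]]) (use \<Omega>_factor(1) in \<open>simp add: dom_at_def\<close>)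
qed

lemma analytic_id_plus:
  assumes "T \<in> K" "W \<in> vecs Op" shows "analytic_at KN Op (\<lambda>T. W o\<^sub>L (id_blinfun + T)) T"
  using assms by (intro analytic_Op_intros normed_KN normed_space_Op analytic_of_KN id_mem_Op) simp_all

lemma openin_I: "openin (norm_topology KN) I"
proof (rule KN.openinI)
  fix T assume T: "T \<in> I"
  have "near KN T (\<lambda>T. id_blinfun o\<^sub>L (id_blinfun + T) \<in> G)"
    using T by (intro near_comp[OF normed_KN normed_space_Op analytic_id_plus] near_GL id_mem_Op)
      (auto simp: blinfun_compose_assoc)
  then have "near KN T (\<lambda>T. T \<in> vecs KN \<and> id_blinfun + T \<in> G)"
    using T by (intro near_conj KN.near_mem) simp_all
  then show "near KN T (\<lambda>T. T \<in> I)" by (rule near_mono) auto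
qed auto

lemma coset_param:
  assumes "W \<in> G" "T \<in> I"
  shows "W o\<^sub>L (id_blinfun + T) \<in> dom_at W" "\<tau> (ginv W o\<^sub>L (W o\<^sub>L (id_blinfun + T))) = T"
proof -
  have "ginv W o\<^sub>L (W o\<^sub>L (id_blinfun + T)) = (id_blinfun + T) o\<^sub>L id_blinfun"
    using assms(1) by (intro blinfun_eqI) (simp add: ginv_apply)
  with \<Omega>_unfactor[of T id_blinfun] assms
  show "W o\<^sub>L (id_blinfun + T) \<in> dom_at W" "\<tau> (ginv W o\<^sub>L (W o\<^sub>L (id_blinfun + T))) = T"
    by (auto simp: dom_at_def id_H compose_GL)
qed

lemma coset_unparam:
  assumes "W \<in> G" "g \<in> dom_at W"
  shows "\<tau> (ginv W o\<^sub>L g) \<in> I" "proj (W o\<^sub>L (id_blinfun + \<tau> (ginv W o\<^sub>L g))) = proj g"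
proof -
  have g: "g \<in> G" "ginv W o\<^sub>L g \<in> \<Omega>" using assms by (auto simp: dom_at_def)
  note f = \<Omega>_factor[OF g(2)]
  show "\<tau> (ginv W o\<^sub>L g) \<in> I" using f by simp
  let ?P = "id_blinfun + \<tau> (ginv W o\<^sub>L g)"
  have "g = (W o\<^sub>L ?P) o\<^sub>L (ginv ?P o\<^sub>L (ginv W o\<^sub>L g))"
    using f(2) assms(1) by (intro blinfun_eqI) (simp add: ginv_apply)
  then show "proj (W o\<^sub>L ?P) = proj g"
    using proj_compose[OF compose_GL[OF assms(1) f(2)] f(3)] by simp
qed

lemma coset_chart_is_chart:
  assumes W: "W \<in> G"
  shows "is_chart quotient_top (coset_chart W)"
    and "coord W ` (proj ` dom_at W) = I"
    and "\<And>T. T \<in> I \<Longrightarrow> inv_into (proj ` dom_at W) (coord W) T = proj (W o\<^sub>L (id_blinfun + T))"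
proof -
  have D: "openin quotient_top (proj ` dom_at W)"
    by (rule openin_proj_image[OF openin_dom_at[OF W] dom_at_G])
  have \<psi>: "coord W C \<in> I \<and> proj (W o\<^sub>L (id_blinfun + coord W C)) = C" if "C \<in> proj ` dom_at W" for C
  proof -
    obtain g where g: "g \<in> dom_at W" "C = proj g" using \<open>C \<in> proj ` dom_at W\<close> by (elim imageE)
    show ?thesis unfolding g(2) coord_proj[OF W g(1)] using coset_unparam[OF W g(1)] by (intro conjI)
  qed
  have \<xi>: "proj (W o\<^sub>L (id_blinfun + T)) \<in> proj ` dom_at W \<and> coord W (proj (W o\<^sub>L (id_blinfun + T))) = T"
    if "T \<in> I" for T
    using imageI[OF coset_param(1)[OF W that], of proj] coset_param(2)[OF W that]
      coord_proj[OF W coset_param(1)[OF W that]] by simp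
  \<comment> \<open>Openness in the quotient is tested after pulling back to the group, where the
    coordinate is the analytic map sending \<open>g\<close> to
    \<open>\<tau> (ginv W o\<^sub>L g)\<close>.\<close>
  have c\<psi>: "continuous_map (subtopology quotient_top (proj ` dom_at W)) (norm_topology KN) (coord W)"
    unfolding continuous_map
  proof (intro conjI allI impI)
    show "coord W ` topspace (subtopology quotient_top (proj ` dom_at W)) \<subseteq> topspace (norm_topology KN)"
      using \<psi> by (auto simp: KN.topspace_norm_topology)
    fix O' assume O': "openin (norm_topology KN) O'"
    let ?R = "{C \<in> proj ` dom_at W. coord W C \<in> O'}"
    have "openin quotient_top ?R"
      unfolding openin_quotient_top
    proof (intro conjI Op.openinI)
      show "?R \<subseteq> proj ` G" using dom_at_G by auto
      show "{g \<in> G. proj g \<in> ?R} \<subseteq> vecs Op" using GL_mem_Op by auto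
      fix g assume g: "g \<in> {g \<in> G. proj g \<in> ?R}"
      then have gd: "g \<in> dom_at W" using proj_dom_at[OF W] by auto
      then have "\<tau> (ginv W o\<^sub>L g) \<in> O'" using g coord_proj[OF W gd] by auto
      then have "near Op g (\<lambda>x. x \<in> dom_at W \<and> \<tau> (ginv W o\<^sub>L x) \<in> O')"
        by (intro near_conj near_dom_at[OF W gd] near_comp[OF normed_space_Op normed_KN analytic_coord[OF W gd]]
            KN.near_openin[OF O'])
      then show "near Op g (\<lambda>x. x \<in> {g \<in> G. proj g \<in> ?R})"
        by (rule near_mono) (use dom_at_G coord_proj[OF W] in auto)
    qed
    moreover have "{C \<in> topspace (subtopology quotient_top (proj ` dom_at W)). coord W C \<in> O'} = ?R"
      using dom_at_G by (auto simp: topspace_quotient_top)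
    ultimately show "openin (subtopology quotient_top (proj ` dom_at W))
        {C \<in> topspace (subtopology quotient_top (proj ` dom_at W)). coord W C \<in> O'}"
      by (auto simp: openin_open_subtopology[OF D])
  qed
  have c\<xi>: "continuous_map (subtopology (norm_topology KN) I) quotient_top (\<lambda>T. proj (W o\<^sub>L (id_blinfun + T)))"
    unfolding continuous_map
  proof (intro conjI allI impI)
    show "(\<lambda>T. proj (W o\<^sub>L (id_blinfun + T))) ` topspace (subtopology (norm_topology KN) I) \<subseteq> topspace quotient_top"
      using W compose_GL by (auto simp: topspace_quotient_top KN.topspace_norm_topology)
    fix \<U> assume \<U>: "openin quotient_top \<U>"
    have op: "openin (norm_topology KN) {T \<in> I. proj (W o\<^sub>L (id_blinfun + T)) \<in> \<U>}"
    proof (rule KN.openinI)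
      fix T assume T: "T \<in> {T \<in> I. proj (W o\<^sub>L (id_blinfun + T)) \<in> \<U>}"
      then have TI: "T \<in> I" and TK: "T \<in> K" by auto
      have "openin (norm_topology Op) {g \<in> G. proj g \<in> \<U>}"
        using \<U> by (simp add: openin_quotient_top)
      then have "near KN T (\<lambda>T. W o\<^sub>L (id_blinfun + T) \<in> {g \<in> G. proj g \<in> \<U>})"
        using T W by (intro near_comp[OF normed_KN normed_space_Op analytic_id_plus[OF TK GL_mem_Op[OF W]]]
            Op.near_openin) (auto intro: compose_GL)
      then have "near KN T (\<lambda>T. T \<in> I \<and> W o\<^sub>L (id_blinfun + T) \<in> {g \<in> G. proj g \<in> \<U>})"
        using KN.near_openin[OF openin_I TI] near_conj by blast
      then show "near KN T (\<lambda>T. T \<in> {T \<in> I. proj (W o\<^sub>L (id_blinfun + T)) \<in> \<U>})"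
        by (rule near_mono) simp
    qed auto
    have eq: "{T \<in> topspace (subtopology (norm_topology KN) I). proj (W o\<^sub>L (id_blinfun + T)) \<in> \<U>}
        = {T \<in> I. proj (W o\<^sub>L (id_blinfun + T)) \<in> \<U>}"
      by (auto simp: KN.topspace_norm_topology)
    show "openin (subtopology (norm_topology KN) I)
        {T \<in> topspace (subtopology (norm_topology KN) I). proj (W o\<^sub>L (id_blinfun + T)) \<in> \<U>}"
      unfolding eq openin_open_subtopology[OF openin_I] using op by (intro conjI) auto
  qed
  note ch = is_chartI[OF banach_KN D openin_I \<psi> \<xi> c\<psi> c\<xi>]
  show "is_chart quotient_top (coset_chart W)" unfolding coset_chart_def by (rule ch(1))
  show "coord W ` (proj ` dom_at W) = I" by (rule ch(2))
  show "\<And>T. T \<in> I \<Longrightarrow> inv_into (proj ` dom_at W) (coord W) T = proj (W o\<^sub>L (id_blinfun + T))" by (rule ch(3))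
qed

definition quotient_mfd where
  "quotient_mfd = \<lparr>man_top = quotient_top, atlas = coset_chart ` G\<rparr>"

text \<open>The transition map sends \<open>T\<close> to
  \<open>\<tau> (ginv W' o\<^sub>L (W o\<^sub>L (id_blinfun + T)))\<close>: an affine map into the
  group followed by an analytic coordinate.\<close>

lemma compatible_coset_charts:
  assumes W: "W \<in> G" and W': "W' \<in> G"
  shows "analytic_between KN KN (coord W ` (proj ` dom_at W \<inter> proj ` dom_at W'))
    (coord W' \<circ> inv_into (proj ` dom_at W) (coord W))"
proof -
  note WO = GL_mem_Op[OF W]
  let ?U = "{T \<in> I. W o\<^sub>L (id_blinfun + T) \<in> dom_at W'}"
  have img: "coord W ` (proj ` dom_at W \<inter> proj ` dom_at W') = ?U"
  proof (intro equalityI subsetI)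
    fix T assume "T \<in> coord W ` (proj ` dom_at W \<inter> proj ` dom_at W')"
    then obtain C where C: "C \<in> proj ` dom_at W" "C \<in> proj ` dom_at W'" "T = coord W C" by blast
    then obtain g where g: "g \<in> dom_at W" "C = proj g" by (elim imageE)
    have T: "T = \<tau> (ginv W o\<^sub>L g)" using C(3) coord_proj[OF W g(1)] g(2) by simp
    have TI: "T \<in> I" and p: "proj (W o\<^sub>L (id_blinfun + T)) = C"
      using coset_unparam[OF W g(1)] unfolding T g(2) by simp_all
    have gG: "W o\<^sub>L (id_blinfun + T) \<in> G" using TI W by (intro compose_GL) simp_all
    have "proj (W o\<^sub>L (id_blinfun + T)) \<in> proj ` dom_at W'" using C(2) by (simp only: p)
    then have "W o\<^sub>L (id_blinfun + T) \<in> dom_at W'" by (simp only: proj_dom_at[OF W' gG])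
    with TI show "T \<in> ?U" by simp
  next
    fix T assume "T \<in> ?U"
    then have TI: "T \<in> I" and d: "W o\<^sub>L (id_blinfun + T) \<in> dom_at W'" by auto
    have "coord W (proj (W o\<^sub>L (id_blinfun + T))) = T"
      using coord_proj[OF W coset_param(1)[OF W TI]] coset_param(2)[OF W TI] by simp
    then show "T \<in> coord W ` (proj ` dom_at W \<inter> proj ` dom_at W')"
      using imageI[OF coset_param(1)[OF W TI], of proj] imageI[OF d, of proj] by (metis IntI imageI)
  qed
  show ?thesis
    unfolding img
  proof (rule KN.analytic_betweenI)
    show "openin (norm_topology KN) ?U"
    proof (rule KN.openinI)
      fix T assume T: "T \<in> ?U"
      then have TI: "T \<in> I" and TK: "T \<in> K" and d: "W o\<^sub>L (id_blinfun + T) \<in> dom_at W'" by auto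
      have "near KN T (\<lambda>T. T \<in> I \<and> W o\<^sub>L (id_blinfun + T) \<in> dom_at W')"
        by (intro near_conj KN.near_openin[OF openin_I TI]
            near_comp[OF normed_KN normed_space_Op analytic_id_plus[OF TK WO] near_dom_at[OF W' d]])
      then show "near KN T (\<lambda>T. T \<in> ?U)" by (rule near_mono) simp
    qed auto
    show "analytic_at KN KN (\<lambda>T. \<tau> (ginv W' o\<^sub>L (W o\<^sub>L (id_blinfun + T)))) T" if "T \<in> ?U" for T
    proof -
      have TK: "T \<in> K" and d: "W o\<^sub>L (id_blinfun + T) \<in> dom_at W'" using that by auto
      show ?thesis
        by (rule analytic_at_comp[OF normed_KN normed_space_Op normed_KN
              analytic_id_plus[OF TK WO] analytic_coord[OF W' d]])
    qed
    fix T assume "T \<in> ?U"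
    then have TI: "T \<in> I" and d: "W o\<^sub>L (id_blinfun + T) \<in> dom_at W'" by auto
    show "(coord W' \<circ> inv_into (proj ` dom_at W) (coord W)) T = \<tau> (ginv W' o\<^sub>L (W o\<^sub>L (id_blinfun + T)))"
      using coset_chart_is_chart(3)[OF W TI] coord_proj[OF W' d] by simp
  qed
qed

lemma self_dom_at: "W \<in> G \<Longrightarrow> W \<in> dom_at W"
  using id_\<Omega> GL.l_inv[of W] by (simp add: dom_at_def)

lemma analytic_manifold_quotient_mfd: "analytic_manifold quotient_mfd"
  unfolding analytic_manifold_def
proof (intro conjI ballI)
  show "Hausdorff_space (man_top quotient_mfd)"
    using Hausdorff_quotient_top by (simp add: quotient_mfd_def)
  show "is_chart (man_top quotient_mfd) c" if "c \<in> atlas quotient_mfd" for c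
    using that coset_chart_is_chart(1) by (auto simp: quotient_mfd_def)
  show "\<Union> (chart_dom ` atlas quotient_mfd) = topspace (man_top quotient_mfd)"
    using self_dom_at dom_at_G by (force simp: quotient_mfd_def topspace_quotient_top coset_chart_def)
  fix c d assume "c \<in> atlas quotient_mfd" "d \<in> atlas quotient_mfd"
  then obtain W W' where W: "W \<in> G" "W' \<in> G" and cd: "c = coset_chart W" "d = coset_chart W'"
    by (auto simp: quotient_mfd_def)
  show "compatible_charts c d"
    using compatible_coset_charts[OF W] compatible_coset_charts[OF W(2,1)]
    unfolding compatible_charts_def cd coset_chart_def by (simp add: Int_commute)
qed

lemma analytic_map_proj: "analytic_map GM quotient_mfd proj"
  unfolding analytic_map_def
proof (intro conjI ballI)
  show "continuous_map (man_top GM) (man_top quotient_mfd) proj"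
    using quotient_imp_continuous_map[OF quotient_map_proj] by (simp add: quotient_mfd_def)
  fix c d assume c: "c \<in> atlas GM" and "d \<in> atlas quotient_mfd"
  then obtain W where W: "W \<in> G" and d: "d = coset_chart W" by (auto simp: quotient_mfd_def)
  have eq: "{p \<in> G. proj p \<in> proj ` dom_at W} = dom_at W"
    using proj_dom_at[OF W] dom_at_G by auto
  have "analytic_between Op KN (dom_at W) (coord W \<circ> proj \<circ> inv_into G (\<lambda>x. x))"
  proof (rule Op.analytic_betweenI[OF openin_dom_at[OF W] analytic_coord[OF W]])
    fix g assume g: "g \<in> dom_at W"
    then have "inv_into G (\<lambda>x. x) g = g" using dom_at_G by (intro inv_into_ident) blast
    then show "(coord W \<circ> proj \<circ> inv_into G (\<lambda>x. x)) g = \<tau> (ginv W o\<^sub>L g)"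
      using coord_proj[OF W g] by simp
  qed
  then show "analytic_between (chart_model c) (chart_model d)
      (chart_map c ` {p \<in> chart_dom c. proj p \<in> chart_dom d}) (chart_map d \<circ> proj \<circ> inv_into (chart_dom c) (chart_map c))"
    using c unfolding atlas_GM d coset_chart_def by (simp add: eq)
qed

text \<open>For a sum \<open>X = B + T\<close> with \<open>B\<close> in \<open>H\<close> and
  \<open>T\<close> in \<open>K\<close> the parts are \<open>T = k X\<close> and
  \<open>B = X - k X\<close>. The conditions say that \<open>id_blinfun + T\<close> is invertible
  and that \<open>B\<close> lies in \<open>\<Omega>\<close>, hence in \<open>H\<close> because
  \<open>k B = 0\<close>.\<close>

definition product_image where
  "product_image = {X \<in> vecs Op. id_blinfun + k X \<in> G \<and> X - k X \<in> \<Omega>}"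

text \<open>The chart \<open>W (I + T) B \<mapsto> B + T\<close> of \<open>GL(X)\<close>, in which the projection becomes \<open>k\<close>.\<close>

definition product_chart where
  "product_chart W = \<lparr>chart_dom = dom_at W,
     chart_map = (\<lambda>g. (ginv (id_blinfun + \<tau> (ginv W o\<^sub>L g)) o\<^sub>L (ginv W o\<^sub>L g)) + \<tau> (ginv W o\<^sub>L g)),
     chart_model = Op\<rparr>"

lemma H_\<Omega>: "h \<in> H \<longleftrightarrow> h \<in> \<Omega> \<and> k h = 0"
  using H_iff[of h] HG by (auto simp: \<Omega>_def)

text \<open>\<open>k\<close> vanishes on \<open>H\<close> and is the identity on \<open>K\<close>,
  so both factors can be read off from the sum \<open>B + T\<close>, and the inverse is the product
  \<open>W (I + k X) (X - k X)\<close>.\<close>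

lemma product_chart_maximal:
  assumes W: "W \<in> G" shows "product_chart W \<in> maximal_atlas GM"
  unfolding product_chart_def
proof (rule GL_chartI[where I = product_image and
      \<xi> = "\<lambda>X. (W o\<^sub>L (id_blinfun + k X)) o\<^sub>L (X - k X)", OF openin_dom_at[OF W] dom_at_G])
  show "openin (norm_topology Op) product_image"
  proof (rule Op.openinI)
    fix X assume X: "X \<in> product_image"
    then have XO: "X \<in> vecs Op" by (simp add: product_image_def)
    have "near Op X (\<lambda>X. X \<in> vecs Op \<and> id_blinfun + k X \<in> G \<and> X - k X \<in> \<Omega>)"
    proof (intro near_conj Op.near_mem XO)
      show "near Op X (\<lambda>X. id_blinfun + k X \<in> G)"
        using X by (intro near_comp[OF normed_space_Op normed_space_Op, of "\<lambda>X. id_blinfun + k X" X "\<lambda>x. x \<in> G"]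
          near_GL analytic_Op_intros analytic_k normed_space_Op id_mem_Op XO) (simp add: product_image_def)
      show "near Op X (\<lambda>X. X - k X \<in> \<Omega>)"
        using X by (intro near_comp[OF normed_space_Op normed_space_Op, of "\<lambda>X. X - k X" X "\<lambda>x. x \<in> \<Omega>"]
          near_\<Omega> analytic_Op_intros analytic_k normed_space_Op XO) (simp add: product_image_def)
    qed
    then show "near Op X (\<lambda>x. x \<in> product_image)" by (simp add: product_image_def)
  qed (auto simp: product_image_def)
next
  fix g assume g: "g \<in> dom_at W"
  define U where "U = ginv W o\<^sub>L g"
  have gG: "g \<in> G" and U: "U \<in> \<Omega>" using g by (auto simp: dom_at_def U_def)
  define B where "B = ginv (id_blinfun + \<tau> U) o\<^sub>L U"
  note f = \<Omega>_factor[OF U]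
  have B: "B \<in> \<Omega>" "k B = 0" using f(3) H_\<Omega>[of B] by (auto simp: B_def)
  have BO: "B \<in> vecs Op" by (rule GL_mem_Op[OF \<Omega>_G[OF B(1)]])
  have kX: "k (B + \<tau> U) = \<tau> U" using f(1) BO B(2) by (simp add: k_add)
  have "(W o\<^sub>L (id_blinfun + \<tau> U)) o\<^sub>L B = g"
    unfolding B_def U_def using f(2) W by (intro blinfun_eqI) (simp add: ginv_apply U_def)
  moreover have "B + \<tau> U \<in> product_image"
    using f BO B kX by (simp add: product_image_def Op.add_mem)
  ultimately show "(ginv (id_blinfun + \<tau> (ginv W o\<^sub>L g)) o\<^sub>L (ginv W o\<^sub>L g)) + \<tau> (ginv W o\<^sub>L g) \<in> product_image \<and>
      (W o\<^sub>L (id_blinfun + k ((ginv (id_blinfun + \<tau> (ginv W o\<^sub>L g)) o\<^sub>L (ginv W o\<^sub>L g)) + \<tau> (ginv W o\<^sub>L g)))) o\<^sub>L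
      ((ginv (id_blinfun + \<tau> (ginv W o\<^sub>L g)) o\<^sub>L (ginv W o\<^sub>L g)) + \<tau> (ginv W o\<^sub>L g)
        - k ((ginv (id_blinfun + \<tau> (ginv W o\<^sub>L g)) o\<^sub>L (ginv W o\<^sub>L g)) + \<tau> (ginv W o\<^sub>L g))) = g"
    unfolding U_def[symmetric] B_def[symmetric] kX by simp
  have a0: "analytic_at Op Op (\<lambda>g. ginv W o\<^sub>L g) g"
    using W gG by (intro analytic_Op_intros normed_space_Op GL_mem_Op ginv_GL)
  have at: "analytic_at Op Op (\<lambda>g. \<tau> (ginv W o\<^sub>L g)) g"
    using U by (intro analytic_at_comp[OF normed_space_Op normed_space_Op normed_space_Op a0 analytic_\<tau>]) (simp add: U_def)
  show "analytic_at Op Op (\<lambda>g. (ginv (id_blinfun + \<tau> (ginv W o\<^sub>L g)) o\<^sub>L (ginv W o\<^sub>L g)) + \<tau> (ginv W o\<^sub>L g)) g"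
    using f(2) GL_mem_Op[OF gG] unfolding U_def
    by (intro analytic_at_add analytic_at_o analytic_at_GL_inv analytic_at_Op_const normed_space_Op a0 at id_mem_Op)
next
  fix X assume X: "X \<in> product_image"
  then have XO: "X \<in> vecs Op" and XG: "id_blinfun + k X \<in> G" and X\<Omega>: "X - k X \<in> \<Omega>"
    by (simp_all add: product_image_def)
  have kXK: "k X \<in> K" using XO by (simp add: k_mem kk)
  have XH: "X - k X \<in> H"
    unfolding H_\<Omega> using X\<Omega> XO by (simp add: k_diff kk k_mem)
  let ?g = "(W o\<^sub>L (id_blinfun + k X)) o\<^sub>L (X - k X)"
  have eq: "ginv W o\<^sub>L ?g = (id_blinfun + k X) o\<^sub>L (X - k X)"
    using W by (intro blinfun_eqI) (simp add: ginv_apply)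
  note u = \<Omega>_unfactor[OF kXK XG XH]
  have "?g \<in> dom_at W"
    unfolding dom_at_def mem_Collect_eq eq
    using u(1) W XG HG[OF XH] by (intro conjI compose_GL)
  moreover have "ginv (id_blinfun + k X) o\<^sub>L ((id_blinfun + k X) o\<^sub>L (X - k X)) = X - k X"
    by (rule blinfun_eqI) (simp add: ginv_apply(1)[OF XG] del: blinfun.add_left blinfun.diff_left)
  ultimately show "?g \<in> dom_at W \<and> (ginv (id_blinfun + \<tau> (ginv W o\<^sub>L ?g)) o\<^sub>L (ginv W o\<^sub>L ?g)) + \<tau> (ginv W o\<^sub>L ?g) = X"
    unfolding eq u(2) by simp
  show "analytic_at Op Op (\<lambda>X. (W o\<^sub>L (id_blinfun + k X)) o\<^sub>L (X - k X)) X"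
    using GL_mem_Op[OF W] XO by (intro analytic_Op_intros analytic_k normed_space_Op id_mem_Op)
qed

text \<open>In the product chart of the group and the coset chart of the quotient the projection is
  the linear map \<open>k\<close>, with the inclusion of \<open>K\<close> as right inverse.\<close>

lemma quotient_manifold_quotient_mfd: "quotient_manifold GM (GL smul) H quotient_mfd"
  unfolding quotient_manifold_def analytic_submersion_def
proof (intro conjI ballI analytic_manifold_quotient_mfd analytic_map_proj)
  show "topspace (man_top quotient_mfd) = lcosets\<^bsub>GL smul\<^esub> H"
    by (simp add: quotient_mfd_def topspace_quotient_top lcosets_eq)
  show "quotient_map (man_top GM) (man_top quotient_mfd) proj"
    using quotient_map_proj by (simp add: quotient_mfd_def)
  fix W assume "W \<in> topspace (man_top GM)"
  then have W: "W \<in> G" by (simp add: topspace_GM)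
  have R: "bounded_linear_on KN Op (\<lambda>T. T)"
    unfolding bounded_linear_on_def by (auto intro: exI[of _ 1])
  have L: "bounded_linear_on Op KN k"
    using k unfolding bounded_linear_on_def by (auto simp: kk)
  have d: "coset_chart W \<in> maximal_atlas quotient_mfd"
    using W by (intro atlas_subset_maximal analytic_manifold_quotient_mfd) (simp add: quotient_mfd_def)
  have param: "coord W (proj g) = k ((ginv (id_blinfun + \<tau> (ginv W o\<^sub>L g)) o\<^sub>L (ginv W o\<^sub>L g)) + \<tau> (ginv W o\<^sub>L g))"
    if g: "g \<in> dom_at W" for g
  proof -
    have U: "ginv W o\<^sub>L g \<in> \<Omega>" using g by (simp add: dom_at_def)
    note f = \<Omega>_factor[OF U]
    then show ?thesis
      using H_\<Omega> GL_mem_Op[OF HG[OF f(3)]] by (simp add: coord_proj[OF W g] k_add)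
  qed
  show "\<exists>c\<in>maximal_atlas GM. \<exists>d\<in>maximal_atlas quotient_mfd. \<exists>L R. W \<in> chart_dom c \<and> proj ` chart_dom c \<subseteq> chart_dom d \<and>
        bounded_linear_on (chart_model c) (chart_model d) L \<and>
        bounded_linear_on (chart_model d) (chart_model c) R \<and>
        (\<forall>w\<in>vecs (chart_model d). L (R w) = w) \<and>
        (\<forall>x\<in>chart_dom c. chart_map d (proj x) = L (chart_map c x))"
    using R L self_dom_at[OF W] param
    by (intro bexI[OF _ product_chart_maximal[OF W]] bexI[OF _ d] exI[of _ k] exI[of _ "\<lambda>T. T"])
      (simp add: product_chart_def coset_chart_def)
qed

end

section \<open>Bianalytic orbit maps\<close>

lemma analytic_at_constant:
  assumes "normed_space_on V" "normed_space_on W" "c \<in> vecs W" "a \<in> vecs V"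
  shows "analytic_at V W (\<lambda>_. c) a"
proof -
  interpret normed_space_pair V W using assms by (simp add: normed_space_pair_def)
  show ?thesis using assms(3,4) by (rule analytic_at_const)
qed

lemma is_chartD:
  assumes "is_chart T c"
  shows "normed_space_on (chart_model c)" "openin T (chart_dom c)" "inj_on (chart_map c) (chart_dom c)"
    "chart_image c \<subseteq> vecs (chart_model c)" "openin (norm_topology (chart_model c)) (chart_image c)"
    "\<And>U. openin T U \<Longrightarrow> U \<subseteq> chart_dom c \<Longrightarrow> openin (norm_topology (chart_model c)) (chart_map c ` U)"
proof -
  show V: "normed_space_on (chart_model c)" and D: "openin T (chart_dom c)"
    and I: "openin (norm_topology (chart_model c)) (chart_image c)"
    using assms by (simp_all add: is_chart_def banach_on_iff)
  interpret V: normed_space_on "chart_model c" by (rule V)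
  have h: "homeomorphic_map (subtopology T (chart_dom c))
      (subtopology (norm_topology (chart_model c)) (chart_image c)) (chart_map c)"
    using assms by (simp add: is_chart_def)
  have tD: "topspace (subtopology T (chart_dom c)) = chart_dom c"
    using openin_subset[OF D] by auto
  show "inj_on (chart_map c) (chart_dom c)"
    using homeomorphic_imp_injective_map[OF h] by (simp only: tD)
  show "chart_image c \<subseteq> vecs (chart_model c)"
    using openin_subset[OF I] by (simp add: V.topspace_norm_topology)
  fix U assume U: "openin T U" "U \<subseteq> chart_dom c"
  then have "openin (subtopology T (chart_dom c)) U"
    by (simp add: openin_open_subtopology[OF D])
  then have "openin (subtopology (norm_topology (chart_model c)) (chart_image c)) (chart_map c ` U)"
    using homeomorphic_map_openness[OF h, of U] U openin_subset[OF U(1)] by simp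
  then show "openin (norm_topology (chart_model c)) (chart_map c ` U)"
    by (simp add: openin_open_subtopology[OF I])
qed

context banach_over
begin

text \<open>In submersion charts the projection is linear with a right inverse, which gives local analytic
  sections of it. The orbit map is the action after such a section, and its inverse is the projection
  after a local section of the action.\<close>

theorem homogeneous_bianalytic:
  fixes N :: "('p, 'k, 'w::ab_group_add) manifold" and M :: "(('a \<Rightarrow>\<^sub>L 'a) set, 'k, 'v::ab_group_add) manifold"
  assumes M: "quotient_manifold GM (GL smul) H M"
    and \<phi>_eq: "\<And>g g'. g \<in> G \<Longrightarrow> g' \<in> G \<Longrightarrow> \<phi> g = \<phi> g' \<longleftrightarrow> g <#\<^bsub>GL smul\<^esub> H = g' <#\<^bsub>GL smul\<^esub> H"
    and f: "\<And>g. g \<in> G \<Longrightarrow> f (g <#\<^bsub>GL smul\<^esub> H) = \<phi> g"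
    and top: "topspace (man_top N) = \<phi> ` G"
    and cont: "continuous_map (man_top GM) (man_top N) \<phi>"
    and open_map: "\<And>U. openin (man_top GM) U \<Longrightarrow> openin (man_top N) (\<phi> ` U)"
    and model: "\<And>d. d \<in> atlas N \<Longrightarrow> normed_space_on (chart_model d)"
    and inj: "\<And>d. d \<in> atlas N \<Longrightarrow> inj_on (chart_map d) (chart_dom d)"
    and dom: "\<And>d. d \<in> atlas N \<Longrightarrow> openin (man_top N) (chart_dom d)"
    and an: "\<And>g d. g \<in> G \<Longrightarrow> d \<in> atlas N \<Longrightarrow> \<phi> g \<in> chart_dom d \<Longrightarrow>
      analytic_at Op (chart_model d) (\<lambda>g. chart_map d (\<phi> g)) g"
    and sec: "\<And>g d. g \<in> G \<Longrightarrow> d \<in> atlas N \<Longrightarrow> \<phi> g \<in> chart_dom d \<Longrightarrow>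
      \<exists>\<sigma>. analytic_at (chart_model d) Op \<sigma> (chart_map d (\<phi> g)) \<and> \<sigma> (chart_map d (\<phi> g)) = g \<and>
        near (chart_model d) (chart_map d (\<phi> g))
          (\<lambda>x. \<sigma> x \<in> G \<and> \<phi> (\<sigma> x) \<in> chart_dom d \<and> chart_map d (\<phi> (\<sigma> x)) = x)"
  shows "bianalytic M N f"
proof -
  define \<pi> where "\<pi> = (\<lambda>g. g <#\<^bsub>GL smul\<^esub> H)"
  have Mm: "analytic_manifold M" and qm: "quotient_map (man_top GM) (man_top M) \<pi>"
    and am: "analytic_map GM M \<pi>"
    and subm: "\<And>p. p \<in> G \<Longrightarrow> \<exists>c\<in>maximal_atlas GM. \<exists>d\<in>maximal_atlas M. \<exists>L R.
        p \<in> chart_dom c \<and> \<pi> ` chart_dom c \<subseteq> chart_dom d \<and>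
        bounded_linear_on (chart_model c) (chart_model d) L \<and>
        bounded_linear_on (chart_model d) (chart_model c) R \<and>
        (\<forall>w\<in>vecs (chart_model d). L (R w) = w) \<and>
        (\<forall>x\<in>chart_dom c. chart_map d (\<pi> x) = L (chart_map c x))"
    using M unfolding quotient_manifold_def analytic_submersion_def \<pi>_def topspace_GM by simp_all
  have topM: "topspace (man_top M) = \<pi> ` G"
    using qm unfolding quotient_map_def topspace_GM by simp
  have f\<pi>: "f (\<pi> g) = \<phi> g" if "g \<in> G" for g using f[OF that] by (simp add: \<pi>_def)
  have \<phi>\<pi>: "\<phi> g = \<phi> g' \<longleftrightarrow> \<pi> g = \<pi> g'" if "g \<in> G" "g' \<in> G" for g g'
    using \<phi>_eq[OF that] by (simp add: \<pi>_def)
  have injf: "inj_on f (\<pi> ` G)" using f\<pi> \<phi>\<pi> by (auto simp: inj_on_def)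
  have bij: "bij_betw f (topspace (man_top M)) (topspace (man_top N))"
    unfolding bij_betw_def topM top using injf f\<pi> by (auto simp: image_image)
  define fi where "fi = inv_into (topspace (man_top M)) f"
  have fi: "fi (\<phi> g) = \<pi> g" if "g \<in> G" for g
    unfolding fi_def topM using inv_into_f_f[OF injf, of "\<pi> g"] f\<pi>[OF that] that by simp
  have chartM: "is_chart (man_top M) c" if "c \<in> atlas M" for c
    using Mm that by (simp add: analytic_manifold_def)
  have contf: "continuous_map (man_top M) (man_top N) f"
  proof (rule continuous_compose_quotient_map[OF qm])
    show "continuous_map (man_top GM) (man_top N) (f \<circ> \<pi>)"
      by (rule continuous_map_eq[OF cont]) (simp add: topspace_GM f\<pi>)
  qed
  have \<pi>_open: "openin (norm_topology Op) {g \<in> G. \<pi> g \<in> U}" if "openin (man_top M) U" for U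
    using openin_continuous_map_preimage[OF quotient_imp_continuous_map[OF qm] that]
    by (simp add: topspace_GM openin_GM)
  have map: "analytic_map M N f"
    unfolding analytic_map_def
  proof (intro conjI ballI contf)
    fix c d assume c: "c \<in> atlas M" and d: "d \<in> atlas N"
    note cD = is_chartD[OF chartM[OF c]]
    interpret Vc: normed_space_on "chart_model c" by (rule cD)
    define P where "P = {p \<in> chart_dom c. f p \<in> chart_dom d}"
    have "P = {p \<in> topspace (man_top M). f p \<in> chart_dom d} \<inter> chart_dom c"
      using openin_subset[OF cD(2)] by (auto simp: P_def)
    then have "openin (man_top M) P"
      using openin_continuous_map_preimage[OF contf dom[OF d]] cD(2) by (simp add: openin_Int)
    then have openP: "openin (norm_topology (chart_model c)) (chart_map c ` P)"
      by (rule cD(6)) (auto simp: P_def)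
    have "analytic_at (chart_model c) (chart_model d) (chart_map d \<circ> f \<circ> chart_inv c) x0"
      if x0: "x0 \<in> chart_map c ` P" for x0
    proof -
      obtain p0 where p0: "p0 \<in> P" "x0 = chart_map c p0" using x0 by (elim imageE)
      then have p0c: "p0 \<in> chart_dom c" and p0d: "f p0 \<in> chart_dom d" by (simp_all add: P_def)
      obtain g0 where g0: "g0 \<in> G" "p0 = \<pi> g0"
        using openin_subset[OF cD(2)] p0c topM by blast
      obtain c' d' L R where c': "c' \<in> maximal_atlas GM" and d': "d' \<in> maximal_atlas M"
        and g0c': "g0 \<in> chart_dom c'" and \<pi>c': "\<pi> ` chart_dom c' \<subseteq> chart_dom d'"
        and L: "bounded_linear_on (chart_model c') (chart_model d') L"
        and R: "bounded_linear_on (chart_model d') (chart_model c') R"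
        and LR: "\<forall>w\<in>vecs (chart_model d'). L (R w) = w"
        and L\<pi>: "\<forall>x\<in>chart_dom c'. chart_map d' (\<pi> x) = L (chart_map c' x)"
        using subm[OF g0(1)] by blast
      have chc': "is_chart (man_top GM) c'" and chd': "is_chart (man_top M) d'"
        using c' d' by (simp_all add: maximal_atlas_def)
      note c'D = is_chartD[OF chc'] and d'D = is_chartD[OF chd']
      interpret Vc': normed_space_on "chart_model c'" by (rule c'D)
      interpret Vd': normed_space_on "chart_model d'" by (rule d'D)
      have c'G: "chart_dom c' \<subseteq> G" using openin_subset[OF c'D(2)] by (simp add: topspace_GM)
      have "analytic_between (chart_model c') Op (chart_map c' ` (chart_dom c' \<inter> G)) ((\<lambda>x. x) \<circ> chart_inv c')"
        using c' by (simp add: maximal_atlas_def atlas_GM compatible_charts_def)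
      then have an_inv: "analytic_at (chart_model c') Op ((\<lambda>x. x) \<circ> chart_inv c') (chart_map c' g0)"
        using g0(1) g0c' by (auto simp: Vc'.analytic_between_iff)
      let ?B = "chart_map c ` (chart_dom d' \<inter> chart_dom c)"
      have ab: "analytic_between (chart_model c) (chart_model d') ?B (chart_map d' \<circ> chart_inv c)"
        using d' c by (simp add: maximal_atlas_def compatible_charts_def)
      have p0d': "p0 \<in> chart_dom d'" using \<pi>c' g0c' g0(2) by blast
      have x0B: "x0 \<in> ?B" using p0(2) p0c p0d' by blast
      define z where "z = chart_map d' \<circ> chart_inv c"
      have anz: "analytic_at (chart_model c) (chart_model d') z x0"
        using ab x0B unfolding Vc.analytic_between_iff z_def by blast
      have zx0: "z x0 = chart_map d' p0"
        unfolding z_def p0(2) by (simp add: inv_into_f_f[OF cD(3) p0c])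
      define w0 where "w0 = chart_map d' p0"
      have w0: "w0 \<in> vecs (chart_model d')" unfolding w0_def using d'D(4) p0d' by blast
      have v0: "chart_map c' g0 \<in> vecs (chart_model c')" using c'D(4) g0c' by blast
      define X where "X = (\<lambda>x. chart_map c' g0 + R (z x - w0))"
      \<comment> \<open>\<open>X\<close> starts at the coordinates of \<open>g0\<close> and lifts
        the displacement of the quotient coordinates by the right inverse \<open>R\<close>; carried
        back to the group it becomes the local section \<open>s\<close> of the projection.\<close>
      have anX: "analytic_at (chart_model c) (chart_model c') X x0"
        unfolding X_def using analytic_at_mem[OF anz]
        by (intro analytic_at_add analytic_at_linear_comp[OF _ _ _ _ R] analytic_at_diff analytic_at_constant
            anz w0 v0 cD(1) c'D(1) d'D(1))
      have R0: "R 0 = 0"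
        using R Vd'.zero_mem unfolding bounded_linear_on_def by (metis add_cancel_right_right)
      have Xx0: "X x0 = chart_map c' g0" by (simp add: X_def zx0 w0_def R0)
      define s where "s = (\<lambda>x. chart_inv c' (X x))"
      have ans: "analytic_at (chart_model c) Op s x0"
        using analytic_at_comp[OF cD(1) c'D(1) normed_space_Op anX, of "(\<lambda>x. x) \<circ> chart_inv c'"] an_inv
        by (simp add: Xx0 s_def o_def)
      have sx0: "s x0 = g0" unfolding s_def Xx0 by (rule inv_into_f_f[OF c'D(3) g0c'])
      have n1: "near (chart_model c) x0 (\<lambda>x. x \<in> ?B)"
        using ab x0B by (intro Vc.near_openin) (simp_all add: Vc.analytic_between_iff)
      have n2: "near (chart_model c) x0 (\<lambda>x. X x \<in> chart_image c')"
        using g0c' by (intro near_comp[OF cD(1) c'D(1) anX] Vc'.near_openin c'D(5)) (simp add: Xx0)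
      \<comment> \<open>\<open>L\<close> sends \<open>X x\<close> to \<open>w0 + (z x - w0)\<close>,
        so \<open>s x\<close> projects to the point with coordinates \<open>x\<close>, and there
        \<open>f\<close> is given by \<open>\<phi> (s x)\<close>.\<close>
      have key: "f (chart_inv c x) = \<phi> (s x)" if x: "x \<in> ?B" "X x \<in> chart_image c'" for x
      proof -
        obtain y where y: "y \<in> chart_dom d'" "y \<in> chart_dom c" "x = chart_map c y" using x(1) by blast
        have invx: "chart_inv c x = y" unfolding y(3) by (rule inv_into_f_f[OF cD(3) y(2)])
        have zy: "z x = chart_map d' y" by (simp add: z_def invx)
        have zm: "z x \<in> vecs (chart_model d')" unfolding zy using d'D(4) y(1) by blast
        have sx: "s x \<in> chart_dom c'" "chart_map c' (s x) = X x"
          unfolding s_def using x(2) by (rule inv_into_into, rule f_inv_into_f)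
        have dm: "z x - w0 \<in> vecs (chart_model d')" using zm w0 by (rule Vd'.diff_mem)
        have Rm: "R (z x - w0) \<in> vecs (chart_model c')"
          using R dm by (simp add: bounded_linear_on_def)
        have "chart_map d' (\<pi> (s x)) = L (X x)" using L\<pi> sx by simp
        also have "\<dots> = L (chart_map c' g0) + L (R (z x - w0))"
          unfolding X_def using L v0 Rm by (simp add: bounded_linear_on_def)
        also have "L (chart_map c' g0) = w0" using L\<pi> g0c' g0(2) by (simp add: w0_def)
        also have "w0 + L (R (z x - w0)) = chart_map d' y" using LR dm by (simp add: zy)
        finally have "\<pi> (s x) = y"
          using inj_onD[OF d'D(3), of "\<pi> (s x)" y] \<pi>c' sx(1) y(1) by blast
        then show ?thesis using f\<pi>[of "s x"] sx(1) c'G invx by auto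
      qed
      have "\<phi> (s x0) \<in> chart_dom d" using p0d f\<pi>[OF g0(1)] g0(2) sx0 by simp
      then have "analytic_at (chart_model c) (chart_model d) (\<lambda>x. chart_map d (\<phi> (s x))) x0"
        using g0(1) d by (intro analytic_at_comp[OF cD(1) normed_space_Op model[OF d] ans]) (simp add: sx0 an)
      moreover have "near (chart_model c) x0 (\<lambda>x. chart_map d (\<phi> (s x)) = (chart_map d \<circ> f \<circ> chart_inv c) x)"
        by (rule near_mono[OF near_conj[OF n1 n2]]) (simp add: key)
      ultimately show ?thesis by (rule analytic_at_cong)
    qed
    then show "analytic_between (chart_model c) (chart_model d)
        (chart_map c ` {p \<in> chart_dom c. f p \<in> chart_dom d}) (chart_map d \<circ> f \<circ> chart_inv c)"
      using openP unfolding Vc.analytic_between_iff P_def by simp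
  qed
  have inv: "analytic_map N M fi"
    unfolding analytic_map_def
  proof (intro conjI ballI)
    show "continuous_map (man_top N) (man_top M) fi"
      unfolding continuous_map
    proof (intro conjI allI impI)
      show "fi ` topspace (man_top N) \<subseteq> topspace (man_top M)"
        unfolding top topM using fi by auto
      fix U assume U: "openin (man_top M) U"
      \<comment> \<open>Preimages under the inverse are images under \<open>\<phi>\<close> of open
        sets of the group, so openness of \<open>\<phi>\<close> is continuity of the
        inverse.\<close>
      have "{y \<in> topspace (man_top N). fi y \<in> U} = \<phi> ` {g \<in> G. \<pi> g \<in> U}"
        unfolding top using fi by auto
      then show "openin (man_top N) {y \<in> topspace (man_top N). fi y \<in> U}"
        using open_map[of "{g \<in> G. \<pi> g \<in> U}"] \<pi>_open[OF U] by (simp add: openin_GM)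
    qed
    fix d c assume d: "d \<in> atlas N" and c: "c \<in> atlas M"
    note cD = is_chartD[OF chartM[OF c]]
    interpret Vd: normed_space_on "chart_model d" by (rule model[OF d])
    interpret Vc: normed_space_on "chart_model c" by (rule cD)
    let ?U = "chart_map d ` {y \<in> chart_dom d. fi y \<in> chart_dom c}"
    have c\<pi>: "analytic_at Op (chart_model c) (\<lambda>g. chart_map c (\<pi> g)) g" if g: "g \<in> G" "\<pi> g \<in> chart_dom c" for g
    proof -
      have "analytic_between Op (chart_model c) ((\<lambda>x. x) ` {p \<in> G. \<pi> p \<in> chart_dom c})
          (chart_map c \<circ> \<pi> \<circ> inv_into G (\<lambda>x. x))"
        using am c by (simp add: analytic_map_def atlas_GM)
      then have "analytic_at Op (chart_model c) (chart_map c \<circ> \<pi> \<circ> inv_into G (\<lambda>x. x)) g"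
        using g by (auto simp: Op.analytic_between_iff)
      moreover have "near Op g (\<lambda>x. (chart_map c \<circ> \<pi> \<circ> inv_into G (\<lambda>x. x)) x = chart_map c (\<pi> x))"
        by (rule near_mono[OF near_GL[OF g(1)]]) (simp add: inv_into_ident)
      ultimately show ?thesis by (rule analytic_at_cong)
    qed
    \<comment> \<open>The local section \<open>\<sigma>\<close> of the action yields both claims:
      every point near \<open>x0\<close> is the coordinate of \<open>\<phi> (\<sigma> x)\<close>, so
      \<open>?U\<close> is open, and the inverse of the orbit map is there the projection after
      \<open>\<sigma>\<close>.\<close>
    have loc: "near (chart_model d) x0 (\<lambda>x. x \<in> ?U) \<and>
        analytic_at (chart_model d) (chart_model c) (chart_map c \<circ> fi \<circ> chart_inv d) x0" if x0: "x0 \<in> ?U" for x0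
    proof -
      obtain y0 where y0: "y0 \<in> chart_dom d" "fi y0 \<in> chart_dom c" "x0 = chart_map d y0"
        using x0 by blast
      obtain g0 where g0: "g0 \<in> G" "y0 = \<phi> g0"
        using openin_subset[OF dom[OF d]] y0(1) top by blast
      obtain \<sigma> where \<sigma>: "analytic_at (chart_model d) Op \<sigma> x0" "\<sigma> x0 = g0"
        "near (chart_model d) x0 (\<lambda>x. \<sigma> x \<in> G \<and> \<phi> (\<sigma> x) \<in> chart_dom d \<and> chart_map d (\<phi> (\<sigma> x)) = x)"
        using sec[OF g0(1) d] y0 g0(2) by blast
      have \<pi>g0: "\<pi> g0 \<in> chart_dom c" using y0(2) g0 fi by simp
      have "near (chart_model d) x0 (\<lambda>x. \<sigma> x \<in> {g \<in> G. \<pi> g \<in> chart_dom c})"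
        using \<pi>g0 g0(1) \<pi>_open[OF cD(2)]
        by (intro near_comp[OF model[OF d] normed_space_Op \<sigma>(1)] Op.near_openin) (simp_all add: \<sigma>(2))
      note n = near_conj[OF \<sigma>(3) this]
      have inv_d: "chart_inv d x = \<phi> (\<sigma> x)" if "\<phi> (\<sigma> x) \<in> chart_dom d" "chart_map d (\<phi> (\<sigma> x)) = x" for x
        using inv_into_f_f[OF inj[OF d] that(1)] that(2) by simp
      have "analytic_at (chart_model d) (chart_model c) (\<lambda>x. chart_map c (\<pi> (\<sigma> x))) x0"
        using g0(1) \<pi>g0 by (intro analytic_at_comp[OF model[OF d] normed_space_Op cD(1) \<sigma>(1)]) (simp add: \<sigma>(2) c\<pi>)
      moreover have "near (chart_model d) x0 (\<lambda>x. chart_map c (\<pi> (\<sigma> x)) = (chart_map c \<circ> fi \<circ> chart_inv d) x)"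
        by (rule near_mono[OF n]) (simp add: inv_d fi)
      ultimately have "analytic_at (chart_model d) (chart_model c) (chart_map c \<circ> fi \<circ> chart_inv d) x0"
        by (rule analytic_at_cong)
      moreover have "near (chart_model d) x0 (\<lambda>x. x \<in> ?U)"
      proof (rule near_mono[OF n])
        fix h let ?x = "x0 + h"
        assume *: "(\<sigma> ?x \<in> G \<and> \<phi> (\<sigma> ?x) \<in> chart_dom d \<and> chart_map d (\<phi> (\<sigma> ?x)) = ?x) \<and>
          \<sigma> ?x \<in> {g \<in> G. \<pi> g \<in> chart_dom c}"
        then have "\<phi> (\<sigma> ?x) \<in> {y \<in> chart_dom d. fi y \<in> chart_dom c}" by (simp add: fi)
        from imageI[OF this, of "chart_map d"] * show "?x \<in> ?U" by simp
      qed
      ultimately show ?thesis by simp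
    qed
    then have "?U \<subseteq> vecs (chart_model d)" using analytic_at_mem by blast
    then show "analytic_between (chart_model d) (chart_model c) ?U (chart_map c \<circ> fi \<circ> chart_inv d)"
      unfolding Vd.analytic_between_iff using loc by (intro conjI Vd.openinI) blast+
  qed
  show ?thesis
    unfolding bianalytic_def using bij map inv by (simp add: fi_def)
qed

end

section \<open>Idempotents\<close>

lemma bounded_linear_on_add:
  assumes V: "normed_space_on V" and W: "normed_space_on W"
    and f: "bounded_linear_on V W f" and g: "bounded_linear_on V W g"
  shows "bounded_linear_on V W (\<lambda>x. f x + g x)"
proof -
  interpret V: normed_space_on V by fact
  interpret W: normed_space_on W by fact
  obtain B where B: "\<And>x. x \<in> vecs V \<Longrightarrow> vnorm W (f x) \<le> B * vnorm V x"
    using f unfolding bounded_linear_on_def by blast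
  obtain C where C: "\<And>x. x \<in> vecs V \<Longrightarrow> vnorm W (g x) \<le> C * vnorm V x"
    using g unfolding bounded_linear_on_def by blast
  have fm: "f x \<in> vecs W" and gm: "g x \<in> vecs W" if "x \<in> vecs V" for x
    using f g that by (simp_all add: bounded_linear_on_def)
  show ?thesis
    unfolding bounded_linear_on_def
  proof (intro conjI ballI allI exI)
    fix x assume x: "x \<in> vecs V"
    show "f x + g x \<in> vecs W" using x by (intro W.add_mem fm gm)
    show "f (x + y) + g (x + y) = f x + g x + (f y + g y)" if "y \<in> vecs V" for y
      using f g x that by (simp add: bounded_linear_on_def)
    show "f (vscale V c x) + g (vscale V c x) = vscale W c (f x + g x)" for c
      using f g x fm gm by (simp add: bounded_linear_on_def W.scale_add_right)
    show "vnorm W (f x + g x) \<le> (B + C) * vnorm V x"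
      using W.norm_triangle[OF fm[OF x] gm[OF x]] B[OF x] C[OF x] by (simp add: distrib_right)
  qed
qed

context banach_over
begin

lemma bounded_linear_sandwich:
  assumes "A \<in> vecs Op" "B \<in> vecs Op"
  shows "bounded_linear_on Op Op (\<lambda>W. A o\<^sub>L W o\<^sub>L B)"
  unfolding bounded_linear_on_def
proof (intro conjI ballI allI exI)
  fix W assume W: "W \<in> vecs Op"
  show "A o\<^sub>L W o\<^sub>L B \<in> vecs Op" using assms W by (intro compose_mem_Op)
  show "A o\<^sub>L (W + W') o\<^sub>L B = (A o\<^sub>L W o\<^sub>L B) + (A o\<^sub>L W' o\<^sub>L B)" for W'
    by (rule blinfun_eqI) (simp add: blinfun.bilinear_simps)
  show "A o\<^sub>L vscale Op c W o\<^sub>L B = vscale Op c (A o\<^sub>L W o\<^sub>L B)" for c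
    using assms(1) by (intro blinfun_eqI) (simp add: vscale_Op_apply mem_Op)
  have "norm (A o\<^sub>L W o\<^sub>L B) \<le> norm A * norm W * norm B"
    by (rule order_trans[OF norm_blinfun_compose mult_right_mono[OF norm_blinfun_compose norm_ge_zero]])
  then show "vnorm Op (A o\<^sub>L W o\<^sub>L B) \<le> (norm A * norm B) * vnorm Op W"
    by (simp add: mult_ac)
qed

lemma ginv_commute:
  assumes V: "V \<in> G" and c: "V o\<^sub>L P = P o\<^sub>L V"
  shows "ginv V o\<^sub>L P = P o\<^sub>L ginv V"
proof (rule blinfun_eqI)
  fix x
  have "blinfun_apply V (blinfun_apply P y) = blinfun_apply P (blinfun_apply V y)" for y
    using c[THEN arg_cong, of "\<lambda>T. blinfun_apply T y"] by simp
  from this[of "blinfun_apply (ginv V) x"]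
  have "blinfun_apply (ginv V) (blinfun_apply V (blinfun_apply P (blinfun_apply (ginv V) x)))
      = blinfun_apply (ginv V) (blinfun_apply P x)"
    by (simp add: ginv_apply(2)[OF V])
  then show "blinfun_apply (ginv V o\<^sub>L P) x = blinfun_apply (P o\<^sub>L ginv V) x"
    by (simp add: ginv_apply(1)[OF V])
qed

section \<open>Stabilizers, cosets and conjugation\<close>

lemma subgroup_stabilizer:
  assumes "\<And>g h. g \<in> G \<Longrightarrow> h \<in> G \<Longrightarrow> \<phi> (g o\<^sub>L h) x = \<phi> g (\<phi> h x)" "\<phi> id_blinfun x = x"
  shows "subgroup (stabilizer (GL smul) \<phi> x) (GL smul)"
proof
  show "inv\<^bsub>GL smul\<^esub> g \<in> stabilizer (GL smul) \<phi> x" if "g \<in> stabilizer (GL smul) \<phi> x" for g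
  proof -
    have g: "g \<in> G" "\<phi> g x = x" using that by (simp_all add: stabilizer_def)
    have "\<phi> (ginv g) x = \<phi> (ginv g) (\<phi> g x)" by (simp add: g)
    also have "\<dots> = \<phi> (ginv g o\<^sub>L g) x" using g by (intro assms(1)[symmetric] ginv_GL)
    also have "\<dots> = x" using GL.l_inv[OF g(1)] assms(2) by simp
    finally show ?thesis using g by (simp add: stabilizer_def)
  qed
qed (auto simp: stabilizer_def assms id_GL compose_GL)

lemma action_eq_iff:
  assumes act: "\<And>g h. g \<in> G \<Longrightarrow> h \<in> G \<Longrightarrow> \<phi> (g o\<^sub>L h) x = \<phi> g (\<phi> h x)" "\<phi> id_blinfun x = x"
    and inj: "\<And>g y z. g \<in> G \<Longrightarrow> \<phi> g y = \<phi> g z \<Longrightarrow> y = z" and g: "g \<in> G" "g' \<in> G"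
  shows "\<phi> g x = \<phi> g' x \<longleftrightarrow> ginv g o\<^sub>L g' \<in> stabilizer (GL smul) \<phi> x"
proof -
  let ?h = "ginv g o\<^sub>L g'"
  have h: "?h \<in> G" using g by (intro compose_GL ginv_GL)
  have "g' = g o\<^sub>L ?h" using g by (intro blinfun_eqI) (simp add: ginv_apply)
  then have "\<phi> g' x = \<phi> g (\<phi> ?h x)" using act(1)[OF g(1) h] by simp
  then show ?thesis using inj[OF g(1), of x "\<phi> ?h x"] h by (auto simp: stabilizer_def)
qed

lemma orbit_map_coset:
  assumes act: "\<And>g h. g \<in> G \<Longrightarrow> h \<in> G \<Longrightarrow> \<phi> (g o\<^sub>L h) x = \<phi> g (\<phi> h x)" "\<phi> id_blinfun x = x" and g: "g \<in> G"
  shows "orbit_map \<phi> x (g <#\<^bsub>GL smul\<^esub> stabilizer (GL smul) \<phi> x) = \<phi> g x"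
proof -
  have "(\<lambda>g. \<phi> g x) ` (g <#\<^bsub>GL smul\<^esub> stabilizer (GL smul) \<phi> x) = {\<phi> g x}"
  proof (intro equalityI subsetI)
    fix y assume "y \<in> (\<lambda>g. \<phi> g x) ` (g <#\<^bsub>GL smul\<^esub> stabilizer (GL smul) \<phi> x)"
    then obtain h where "h \<in> G" "\<phi> h x = x" "y = \<phi> (g o\<^sub>L h) x"
      by (auto simp: l_coset_def stabilizer_def)
    then show "y \<in> {\<phi> g x}" using act(1)[OF g] by simp
  next
    fix y assume "y \<in> {\<phi> g x}"
    moreover have "g o\<^sub>L id_blinfun \<in> g <#\<^bsub>GL smul\<^esub> stabilizer (GL smul) \<phi> x"
      unfolding l_coset_def using act(2) id_GL by (auto simp: stabilizer_def)
    ultimately show "y \<in> (\<lambda>g. \<phi> g x) ` (g <#\<^bsub>GL smul\<^esub> stabilizer (GL smul) \<phi> x)" by auto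
  qed
  then show ?thesis by (simp add: orbit_map_def)
qed

lemma Ad_apply: "blinfun_apply (Ad smul W Q) x = blinfun_apply W (blinfun_apply Q (blinfun_apply (ginv W) x))"
  by (simp add: Ad_def)

lemma Ad_compose: "g \<in> G \<Longrightarrow> h \<in> G \<Longrightarrow> Ad smul (g o\<^sub>L h) Q = Ad smul g (Ad smul h Q)"
  by (rule blinfun_eqI) (simp add: Ad_apply ginv_compose)

lemma Ad_id: "Ad smul id_blinfun Q = Q"
  using GL.inv_one by (intro blinfun_eqI) (simp add: Ad_apply)

lemma Ad_inj: "g \<in> G \<Longrightarrow> Ad smul g Q = Ad smul g R \<Longrightarrow> Q = R"
  using Ad_compose[of "ginv g" g] GL.l_inv[of g] by (metis Ad_id ginv_GL mult_GL one_GL)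

lemma Ad_eq_iff: "g \<in> G \<Longrightarrow> Ad smul g Q = R \<longleftrightarrow> g o\<^sub>L Q = R o\<^sub>L g"
proof
  assume g: "g \<in> G"
  { assume "Ad smul g Q = R"
    then have "R o\<^sub>L g = Ad smul g Q o\<^sub>L g" by simp
    also have "\<dots> = g o\<^sub>L Q" using g by (intro blinfun_eqI) (simp add: Ad_apply ginv_apply)
    finally show "g o\<^sub>L Q = R o\<^sub>L g" by simp }
  assume c: "g o\<^sub>L Q = R o\<^sub>L g"
  have "Ad smul g Q = (g o\<^sub>L Q) o\<^sub>L ginv g" by (simp add: Ad_def)
  also have "\<dots> = R" unfolding c using g by (intro blinfun_eqI) (simp add: ginv_apply)
  finally show "Ad smul g Q = R" .
qed

lemma Ad_idempotents:
  assumes "g \<in> G" "Q \<in> idempotents smul" shows "Ad smul g Q \<in> idempotents smul"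
proof -
  have Q: "Q \<in> vecs Op" "Q o\<^sub>L Q = Q" "Q \<noteq> 0" "Q \<noteq> id_blinfun" using assms by (auto simp: idempotents_def)
  have QQ: "blinfun_apply Q (blinfun_apply Q x) = blinfun_apply Q x" for x
    using Q(2)[THEN arg_cong, of "\<lambda>T. blinfun_apply T x"] by simp
  have "Ad smul g Q \<in> vecs Op"
    unfolding Ad_def using GL_mem_Op[OF assms(1)] GL_mem_Op[OF ginv_GL[OF assms(1)]] Q(1) by (intro compose_mem_Op)
  moreover have "Ad smul g Q o\<^sub>L Ad smul g Q = Ad smul g Q"
    using assms(1) by (intro blinfun_eqI) (simp add: Ad_apply ginv_apply QQ)
  moreover have "Ad smul g 0 = 0" by (rule blinfun_eqI) (simp add: Ad_apply)
  moreover have "Ad smul g id_blinfun = id_blinfun"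
    using assms(1) by (intro blinfun_eqI) (simp add: Ad_apply ginv_apply)
  ultimately show ?thesis
    using Q(3,4) Ad_inj[OF assms(1), of Q 0] Ad_inj[OF assms(1), of Q id_blinfun]
    by (auto simp: idempotents_def)
qed

end

section \<open>The stabilizer of an idempotent\<close>

locale idempotent_in = banach_over smul
  for smul :: "'k::real_or_complex \<Rightarrow> 'a::banach \<Rightarrow> 'a" +
  fixes Q :: "'a \<Rightarrow>\<^sub>L 'a"
  assumes Q: "Q \<in> idempotents smul"
begin

lemma QO: "Q \<in> vecs Op" and Q_idem: "Q o\<^sub>L Q = Q"
  using Q by (auto simp: idempotents_def)

lemma QQ [simp]: "blinfun_apply Q (blinfun_apply Q x) = blinfun_apply Q x"
  using Q_idem[THEN arg_cong, of "\<lambda>T. blinfun_apply T x"] by simp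

definition off where "off W = (Q o\<^sub>L W o\<^sub>L (id_blinfun - Q)) + ((id_blinfun - Q) o\<^sub>L W o\<^sub>L Q)"

definition diag where "diag W = (Q o\<^sub>L W o\<^sub>L Q) + ((id_blinfun - Q) o\<^sub>L W o\<^sub>L (id_blinfun - Q))"

abbreviation St where "St \<equiv> stabilizer (GL smul) (Ad smul) Q"

lemma cQO: "id_blinfun - Q \<in> vecs Op"
  by (intro Op.diff_mem id_mem_Op QO)

lemma linear_off: "bounded_linear_on Op Op off"
  unfolding off_def by (intro bounded_linear_on_add normed_space_Op bounded_linear_sandwich QO cQO)

lemma linear_diag: "bounded_linear_on Op Op diag"
  unfolding diag_def by (intro bounded_linear_on_add normed_space_Op bounded_linear_sandwich QO cQO)

lemma off_apply: "blinfun_apply (off W) x = blinfun_apply Q (blinfun_apply W x) + blinfun_apply W (blinfun_apply Q x)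
    - 2 *\<^sub>R blinfun_apply Q (blinfun_apply W (blinfun_apply Q x))"
  by (simp add: off_def blinfun.bilinear_simps scaleR_2)

lemma diag_apply: "blinfun_apply (diag W) x = blinfun_apply W x - blinfun_apply (off W) x"
  by (simp add: diag_def off_def blinfun.bilinear_simps)

lemma off_zero_iff: "off W = 0 \<longleftrightarrow> W o\<^sub>L Q = Q o\<^sub>L W"
proof
  assume "off W = 0"
  then have z: "blinfun_apply (off W) x = 0" for x by simp
  have "blinfun_apply W (blinfun_apply Q x) = blinfun_apply Q (blinfun_apply W x)" for x
  proof -
    \<comment> \<open>Composition with \<open>Q\<close> singles out one of the two off-diagonal
      blocks; what is left of \<open>off W\<close> is the other one.\<close>
    have "blinfun_apply Q (blinfun_apply (off W) x) = 0" using z by (simp add: blinfun.bilinear_simps)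
    then have 1: "blinfun_apply Q (blinfun_apply W x) = blinfun_apply Q (blinfun_apply W (blinfun_apply Q x))"
      by (simp add: off_apply blinfun.bilinear_simps scaleR_2)
    then show ?thesis using z[of x] by (simp add: off_apply scaleR_2)
  qed
  then show "W o\<^sub>L Q = Q o\<^sub>L W" by (intro blinfun_eqI) simp
next
  assume "W o\<^sub>L Q = Q o\<^sub>L W"
  then have "blinfun_apply W (blinfun_apply Q x) = blinfun_apply Q (blinfun_apply W x)" for x
    by (drule_tac arg_cong[of _ _ "\<lambda>T. blinfun_apply T x"]) simp
  then show "off W = 0" by (intro blinfun_eqI) (simp add: off_apply scaleR_2)
qed

lemma off_off: "off (off W) = off W"
  by (rule blinfun_eqI) (simp add: off_apply blinfun.bilinear_simps scaleR_2)

lemma commute_apply: "Z o\<^sub>L Q = Q o\<^sub>L Z \<Longrightarrow> blinfun_apply Z (blinfun_apply Q x) = blinfun_apply Q (blinfun_apply Z x)"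
  by (drule arg_cong[of _ _ "\<lambda>T. blinfun_apply T x"]) simp

text \<open>An operator that commutes with \<open>Q\<close> passes through the projections on the
  right, so \<open>off\<close> and \<open>diag\<close> respect right multiplication by the
  stabilizer.\<close>

lemma off_compose: "Z o\<^sub>L Q = Q o\<^sub>L Z \<Longrightarrow> off (X o\<^sub>L Z) = off X o\<^sub>L Z"
  by (rule blinfun_eqI) (simp add: off_apply commute_apply)

lemma diag_compose: "Z o\<^sub>L Q = Q o\<^sub>L Z \<Longrightarrow> diag (X o\<^sub>L Z) = diag X o\<^sub>L Z"
  by (rule blinfun_eqI) (simp add: diag_apply off_compose)

lemma diag_commute: "diag W o\<^sub>L Q = Q o\<^sub>L diag W"
  by (rule blinfun_eqI) (simp add: diag_def blinfun.bilinear_simps)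

lemma St_iff: "W \<in> St \<longleftrightarrow> W \<in> G \<and> off W = 0"
  by (auto simp: stabilizer_def Ad_eq_iff off_zero_iff)

lemma diag_of_off_zero: "off W = 0 \<Longrightarrow> diag W = W"
  by (rule blinfun_eqI) (simp add: diag_apply)

lemma off_plus_diag: "off W + diag W = W"
  by (rule blinfun_eqI) (simp add: diag_apply blinfun.bilinear_simps)

text \<open>From \<open>U = off U + diag U\<close>, pulling the diagonal part out on the right gives
  \<open>id_blinfun + (off U o\<^sub>L ginv (diag U))\<close>; the factor in the stabilizer is
  \<open>diag U\<close> itself.\<close>

sublocale Q: split_subgroup smul off diag St
proof (rule split_subgroup.intro[OF banach_over_axioms], rule split_subgroup_axioms.intro)
  show "subgroup St (GL smul)"
    by (rule subgroup_stabilizer) (simp_all add: Ad_compose Ad_id)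
  show "analytic_at Op Op diag W" if "W \<in> vecs Op" for W
  proof -
    interpret P: normed_space_pair Op Op by unfold_locales
    show ?thesis by (rule P.analytic_at_bounded_linear[OF linear_diag that])
  qed
  show "W \<in> St \<longleftrightarrow> off W = 0 \<and> diag W \<in> G" if "W \<in> G" for W
    using that diag_of_off_zero[of W] by (auto simp: St_iff)
  show "W \<in> St \<longleftrightarrow> off W = 0 \<and> off (ginv W) = 0" if "W \<in> G" for W
    using ginv_commute[OF that, of Q] by (auto simp: St_iff that off_zero_iff)
  fix U assume U: "U \<in> G" "diag U \<in> G"
  have c: "ginv (diag U) o\<^sub>L Q = Q o\<^sub>L ginv (diag U)" by (rule ginv_commute[OF U(2) diag_commute])
  have eq: "id_blinfun + (off U o\<^sub>L ginv (diag U)) = U o\<^sub>L ginv (diag U)"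
  proof -
    have "U o\<^sub>L ginv (diag U) = (off U + diag U) o\<^sub>L ginv (diag U)" by (simp add: off_plus_diag)
    also have "\<dots> = id_blinfun + (off U o\<^sub>L ginv (diag U))"
      using U(2) by (intro blinfun_eqI) (simp add: blinfun.add_left ginv_apply)
    finally show ?thesis by simp
  qed
  have g: "U o\<^sub>L ginv (diag U) \<in> G" using U by (intro compose_GL ginv_GL)
  have "ginv (U o\<^sub>L ginv (diag U)) o\<^sub>L U = diag U"
    using U GL.inv_inv[OF U(2)] by (intro blinfun_eqI) (simp add: ginv_compose[OF U(1) ginv_GL[OF U(2)]] ginv_apply)
  then show "off (off U o\<^sub>L ginv (diag U)) = off U o\<^sub>L ginv (diag U) \<and>
      id_blinfun + (off U o\<^sub>L ginv (diag U)) \<in> G \<and>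
      ginv (id_blinfun + (off U o\<^sub>L ginv (diag U))) o\<^sub>L U \<in> St"
    using g U(2) diag_commute[of U] unfolding eq by (simp add: off_compose[OF c] off_off St_iff off_zero_iff)
next
  fix T B assume T: "T \<in> vecs Op" "off T = T" "id_blinfun + T \<in> G" and B: "B \<in> St"
  have BG: "B \<in> G" and c: "B o\<^sub>L Q = Q o\<^sub>L B" using B by (simp_all add: St_iff off_zero_iff)
  have offT: "off (id_blinfun + T) = T"
    using T(2)[THEN arg_cong, of "\<lambda>T. blinfun_apply T x" for x]
    by (intro blinfun_eqI) (simp add: off_apply blinfun.bilinear_simps scaleR_2)
  have diagT: "diag (id_blinfun + T) = id_blinfun"
    by (rule blinfun_eqI) (simp add: diag_apply offT blinfun.bilinear_simps)
  show "diag ((id_blinfun + T) o\<^sub>L B) \<in> G \<and> off ((id_blinfun + T) o\<^sub>L B) o\<^sub>L ginv (diag ((id_blinfun + T) o\<^sub>L B)) = T"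
    unfolding off_compose[OF c] diag_compose[OF c] offT diagT
    using BG by (simp add: blinfun_compose_assoc) (rule blinfun_eqI, simp add: ginv_apply)
qed (use linear_off off_off in auto)

end

text \<open>Serves adapted charts: on the submanifold a chart takes values in the subspace, and
  composition with the projection makes it analytic as a map into that subspace.\<close>

lemma complemented_projection:
  assumes "banach_on V" "complemented_subspace V S"
  shows "\<exists>p. bounded_linear_on V (V\<lparr>vecs := S\<rparr>) p \<and> (\<forall>s\<in>S. p s = s)"
proof -
  have S: "closed_subspace V S"
    and ex: "\<exists>S'. closed_subspace V S' \<and> S \<inter> S' = {0} \<and> (\<forall>v\<in>vecs V. \<exists>s\<in>S. \<exists>s'\<in>S'. v = s + s')"
    using assms(2) by (simp_all only: complemented_subspace_def)
  from ex obtain S' where S': "closed_subspace V S'" and int: "S \<inter> S' = {0}"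
    and dec: "\<forall>v\<in>vecs V. \<exists>s\<in>S. \<exists>s'\<in>S'. v = s + s'"
    by (elim exE conjE) (rule that)
  have "0 \<in> S'" using int by blast
  show ?thesis
  proof (rule projection_along[OF assms(1) S S' int bspec[OF dec]])
    fix p assume p: "bounded_linear_on V (V\<lparr>vecs := S\<rparr>) p" "\<And>s s'. s \<in> S \<Longrightarrow> s' \<in> S' \<Longrightarrow> p (s + s') = s"
    have "\<forall>s\<in>S. p s = s" using p(2)[OF _ \<open>0 \<in> S'\<close>] by simp
    with p(1) show ?thesis by blast
  qed
qed

section \<open>Conjugation of nearby idempotents and openness of orbits\<close>

context banach_over
begin

definition intertwiner where
  "intertwiner R X = (X o\<^sub>L R) + ((id_blinfun - X) o\<^sub>L (id_blinfun - R))"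

lemma idem_apply: "R o\<^sub>L R = R \<Longrightarrow> blinfun_apply R (blinfun_apply R x) = blinfun_apply R x"
  by (drule arg_cong[of _ _ "\<lambda>T. blinfun_apply T x"]) simp

lemma intertwiner_self: "R o\<^sub>L R = R \<Longrightarrow> intertwiner R R = id_blinfun"
  by (rule blinfun_eqI) (simp add: intertwiner_def blinfun.bilinear_simps idem_apply)

text \<open>By idempotence, the intertwiner followed on the left by \<open>X\<close> and the
  intertwiner applied after \<open>R\<close> both equal \<open>X o\<^sub>L R\<close>.\<close>

lemma Ad_intertwiner:
  assumes "intertwiner R X \<in> G" "R o\<^sub>L R = R" "X o\<^sub>L X = X"
  shows "Ad smul (intertwiner R X) R = X"
  unfolding Ad_eq_iff[OF assms(1)]
  by (rule blinfun_eqI)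
    (simp add: intertwiner_def blinfun.bilinear_simps idem_apply[OF assms(2)] idem_apply[OF assms(3)])

lemma analytic_intertwiner:
  assumes "R \<in> vecs Op" "normed_space_on V" "analytic_at V Op f a"
  shows "analytic_at V Op (\<lambda>x. intertwiner R (f x)) a"
  unfolding intertwiner_def
  using analytic_at_mem[OF assms(3)]
  by (intro analytic_at_add analytic_at_o analytic_at_diff analytic_at_Op_const normed_space_Op assms
      Op.diff_mem id_mem_Op)

lemma man_top_idempotent: "man_top (idempotent_manifold smul) = subtopology (norm_topology Op) (idempotents smul)"
  by (simp add: idempotent_manifold_def induced_manifold_def space_manifold_def)

lemma idempotents_Op: "R \<in> idempotents smul \<Longrightarrow> R \<in> vecs Op" "R \<in> idempotents smul \<Longrightarrow> R o\<^sub>L R = R"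
  by (simp_all add: idempotents_def)

lemma topspace_idempotent: "topspace (man_top (idempotent_manifold smul)) = idempotents smul"
  unfolding man_top_idempotent using idempotents_Op(1) by (auto simp: Op.topspace_norm_topology)

text \<open>The image is cut out of the idempotents by an open set \<open>U\<close> of operators:
  \<open>X\<close> belongs to \<open>U\<close> if for some \<open>g\<close> in \<open>D\<close> the
  operator that would carry \<open>Ad smul g R\<close> to \<open>X\<close> is invertible and,
  multiplied by \<open>g\<close>, stays in \<open>D\<close>. For \<open>X = Ad smul g R\<close> that
  operator is the identity.\<close>

lemma openin_Ad_image:
  assumes R: "R \<in> idempotents smul" and D: "openin (norm_topology Op) D" "D \<subseteq> G"
  shows "openin (man_top (idempotent_manifold smul)) ((\<lambda>g. Ad smul g R) ` D)"
proof -
  define U where "U = {X \<in> vecs Op. \<exists>g\<in>D. intertwiner (Ad smul g R) X \<in> G \<and> intertwiner (Ad smul g R) X o\<^sub>L g \<in> D}"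
  have Ag: "Ad smul g R \<in> idempotents smul" if "g \<in> D" for g
    using that D(2) R by (intro Ad_idempotents) auto
  have "openin (norm_topology Op) U"
  proof (rule Op.openinI)
    fix X assume "X \<in> U"
    then obtain g where X: "X \<in> vecs Op" and g: "g \<in> D" "intertwiner (Ad smul g R) X \<in> G"
      "intertwiner (Ad smul g R) X o\<^sub>L g \<in> D" by (auto simp: U_def)
    have gO: "g \<in> vecs Op" using g(1) D(2) GL_mem_Op by blast
    have an: "analytic_at Op Op (\<lambda>X. intertwiner (Ad smul g R) X) X"
      by (intro analytic_intertwiner idempotents_Op(1)[OF Ag[OF g(1)]] normed_space_Op Op.analytic_at_ident X)
    have an2: "analytic_at Op Op (\<lambda>X. intertwiner (Ad smul g R) X o\<^sub>L g) X"
      by (intro analytic_at_o normed_space_Op an analytic_at_Op_const gO X)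
    have "near Op X (\<lambda>X. X \<in> vecs Op \<and> intertwiner (Ad smul g R) X \<in> G \<and> intertwiner (Ad smul g R) X o\<^sub>L g \<in> D)"
      by (intro near_conj Op.near_mem X near_comp[OF normed_space_Op normed_space_Op an near_GL[OF g(2)]]
          near_comp[OF normed_space_Op normed_space_Op an2 Op.near_openin[OF D(1) g(3)]])
    then show "near Op X (\<lambda>x. x \<in> U)"
      by (rule near_mono) (use g(1) in \<open>auto simp: U_def\<close>)
  qed (auto simp: U_def)
  moreover have "(\<lambda>g. Ad smul g R) ` D = U \<inter> idempotents smul"
  proof (intro equalityI subsetI)
    fix X assume "X \<in> (\<lambda>g. Ad smul g R) ` D"
    then obtain g where g: "g \<in> D" "X = Ad smul g R" by auto
    have "X \<in> idempotents smul" using Ag[OF g(1)] g(2) by simp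
    moreover have "intertwiner (Ad smul g R) X = id_blinfun"
      using intertwiner_self[OF idempotents_Op(2)[OF Ag[OF g(1)]]] g(2) by simp
    ultimately show "X \<in> U \<inter> idempotents smul"
      using g(1) idempotents_Op(1)[of X] id_GL by (auto simp: U_def intro!: bexI[of _ g])
  next
    fix X assume "X \<in> U \<inter> idempotents smul"
    then obtain g where X: "X \<in> idempotents smul" and g: "g \<in> D" "intertwiner (Ad smul g R) X \<in> G"
      "intertwiner (Ad smul g R) X o\<^sub>L g \<in> D" by (auto simp: U_def)
    have eq: "Ad smul (intertwiner (Ad smul g R) X o\<^sub>L g) R = X"
      using Ad_intertwiner[OF g(2) idempotents_Op(2)[OF Ag[OF g(1)]] idempotents_Op(2)[OF X]] g D(2)
      by (subst Ad_compose) auto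
    show "X \<in> (\<lambda>g. Ad smul g R) ` D"
      by (rule image_eqI[where f = "\<lambda>g. Ad smul g R", OF eq[symmetric] g(3)])
  qed
  ultimately show ?thesis
    unfolding man_top_idempotent openin_subtopology by blast
qed

lemma orbit_eq_image: "orbit (GL smul) \<phi> x = (\<lambda>g. \<phi> g x) ` G"
  by (auto simp: orbit_def)

text \<open>The complement of an orbit is a union of orbits.\<close>

lemma closedin_orbit:
  assumes top: "topspace T = Y" and open_orbit: "\<And>y. y \<in> Y \<Longrightarrow> openin T (orbit (GL smul) \<phi> y)"
    and mem: "\<And>g y. g \<in> G \<Longrightarrow> y \<in> Y \<Longrightarrow> \<phi> g y \<in> Y"
    and act: "\<And>g h y. g \<in> G \<Longrightarrow> h \<in> G \<Longrightarrow> \<phi> (g o\<^sub>L h) y = \<phi> g (\<phi> h y)" "\<And>y. \<phi> id_blinfun y = y"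
    and x: "x \<in> Y"
  shows "closedin T (orbit (GL smul) \<phi> x)"
proof -
  let ?O = "orbit (GL smul) \<phi>"
  have self: "y \<in> ?O y" for y using act(2)[of y] id_GL by (auto simp: orbit_eq_image intro!: image_eqI[of _ _ id_blinfun])
  have "y \<in> ?O x" if yz: "z \<in> ?O y" "z \<in> ?O x" for y z
  proof -
    obtain g h where g: "g \<in> G" "z = \<phi> g y" and h: "h \<in> G" "z = \<phi> h x"
      using yz by (auto simp: orbit_eq_image)
    have "y = \<phi> (ginv g o\<^sub>L g) y" using GL.l_inv[OF g(1)] act(2) by simp
    also have "\<dots> = \<phi> (ginv g) (\<phi> h x)" using act(1)[OF ginv_GL[OF g(1)] g(1)] g h by simp
    also have "\<dots> = \<phi> (ginv g o\<^sub>L h) x" using act(1)[OF ginv_GL[OF g(1)] h(1)] by simp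
    finally show ?thesis
      unfolding orbit_eq_image using compose_GL[OF ginv_GL[OF g(1)] h(1)] by blast
  qed
  moreover have sub: "?O y \<subseteq> Y" if "y \<in> Y" for y using mem that by (auto simp: orbit_eq_image)
  ultimately have "Y - ?O x = (\<Union>y\<in>Y - ?O x. ?O y)"
    using self by blast
  moreover have "openin T (\<Union>y\<in>Y - ?O x. ?O y)"
    using open_orbit by (intro openin_Union) auto
  ultimately show ?thesis
    unfolding closedin_def top using sub[OF x] by simp
qed

lemma openin_orbit_idempotent:
  assumes "R \<in> idempotents smul"
  shows "openin (man_top (idempotent_manifold smul)) (orbit (GL smul) (Ad smul) R)"
  unfolding orbit_eq_image by (rule openin_Ad_image[OF assms openin_GL order_refl])

lemma closedin_orbit_idempotent:
  assumes "R \<in> idempotents smul"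
  shows "closedin (man_top (idempotent_manifold smul)) (orbit (GL smul) (Ad smul) R)"
  by (rule closedin_orbit[OF topspace_idempotent openin_orbit_idempotent])
    (use assms in \<open>simp_all add: Ad_idempotents Ad_compose Ad_id\<close>)

text \<open>An adapted chart is compatible with the identity chart of L(X); this makes it and its
  inverse analytic in the plain sense.\<close>

lemma atlas_idempotentE:
  assumes "d \<in> atlas (open_submanifold (idempotent_manifold smul) U)"
  obtains c V1 where
    "d = \<lparr>chart_dom = chart_dom c \<inter> idempotents smul \<inter> U, chart_map = chart_map c,
      chart_model = (chart_model c)\<lparr>vecs := V1\<rparr>\<rparr>"
    "is_chart (norm_topology Op) c"
    "analytic_between (chart_model c) Op (chart_image c) (chart_inv c)"
    "analytic_between Op (chart_model c) (chart_dom c) (chart_map c)"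
    "complemented_subspace (chart_model c) V1"
    "chart_map c ` (chart_dom c \<inter> idempotents smul) = chart_image c \<inter> V1"
proof -
  obtain c V1 where cV: "(c, V1) \<in> adapted_charts (space_manifold Op) (idempotents smul)"
    and d: "d = \<lparr>chart_dom = chart_dom c \<inter> idempotents smul \<inter> U, chart_map = chart_map c,
      chart_model = (chart_model c)\<lparr>vecs := V1\<rparr>\<rparr>"
    using assms by (auto simp: open_submanifold_def idempotent_manifold_def induced_manifold_def)
  have c: "c \<in> maximal_atlas (space_manifold Op)" and V1: "complemented_subspace (chart_model c) V1"
    "chart_map c ` (chart_dom c \<inter> idempotents smul) = chart_image c \<inter> V1"
    using cV by (auto simp: adapted_charts_def)
  then have ch: "is_chart (norm_topology Op) c"
    and comp: "compatible_charts c \<lparr>chart_dom = vecs Op, chart_map = (\<lambda>x. x), chart_model = Op\<rparr>"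
    by (auto simp: maximal_atlas_def space_manifold_def)
  have sub: "chart_dom c \<subseteq> vecs Op"
    using openin_subset[OF is_chartD(2)[OF ch]] by (simp add: Op.topspace_norm_topology)
  then have I: "chart_dom c \<inter> vecs Op = chart_dom c" by blast
  interpret Vc: normed_space_on "chart_model c" by (rule is_chartD(1)[OF ch])
  have an_inv: "analytic_between (chart_model c) Op (chart_image c) (chart_inv c)"
    using comp unfolding compatible_charts_def by (simp add: I comp_def)
  have ab: "analytic_between Op (chart_model c) (chart_dom c) (chart_map c \<circ> inv_into (vecs Op) (\<lambda>x. x))"
    using comp unfolding compatible_charts_def by (simp add: I)
  have an_map: "analytic_between Op (chart_model c) (chart_dom c) (chart_map c)"
  proof (rule Op.analytic_betweenI[OF is_chartD(2)[OF ch]])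
    show "analytic_at Op (chart_model c) (chart_map c \<circ> inv_into (vecs Op) (\<lambda>x. x)) a" if "a \<in> chart_dom c" for a
      using ab that by (simp add: Op.analytic_between_iff)
    show "chart_map c x = (chart_map c \<circ> inv_into (vecs Op) (\<lambda>x. x)) x" if "x \<in> chart_dom c" for x
      using that sub by (simp add: inv_into_ident subset_iff)
  qed
  show ?thesis by (rule that[OF d ch an_inv an_map V1])
qed

end

section \<open>The orbit map of an idempotent\<close>

context idempotent_in
begin

abbreviation Orb where "Orb \<equiv> orbit (GL smul) (Ad smul) Q"

lemma bianalytic_orbit_map:
  assumes M: "quotient_manifold GM (GL smul) St M"
  shows "bianalytic M (open_submanifold (idempotent_manifold smul) Orb) (orbit_map (Ad smul) Q)"
proof (rule homogeneous_bianalytic[OF M, where \<phi> = "\<lambda>g. Ad smul g Q"])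
  let ?N = "open_submanifold (idempotent_manifold smul) Orb"
  have topN: "man_top ?N = subtopology (man_top (idempotent_manifold smul)) Orb"
    by (simp add: open_submanifold_def)
  have OrbI: "Orb \<subseteq> idempotents smul"
    using openin_subset[OF openin_orbit_idempotent[OF Q]] by (simp add: topspace_idempotent)
  have AI: "Ad smul g Q \<in> idempotents smul" if "g \<in> G" for g by (rule Ad_idempotents[OF that Q])
  have an\<phi>: "analytic_at Op Op (\<lambda>g. Ad smul g Q) g" if "g \<in> G" for g
    unfolding Ad_def using that GL_mem_Op[OF that]
    by (intro analytic_at_o analytic_at_GL_inv analytic_at_Op_const Op.analytic_at_ident normed_space_Op QO)
  show "Ad smul g Q = Ad smul g' Q \<longleftrightarrow> g <#\<^bsub>GL smul\<^esub> St = g' <#\<^bsub>GL smul\<^esub> St" if "g \<in> G" "g' \<in> G" for g g'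
    unfolding Q.proj_eq_iff[OF that]
    by (rule action_eq_iff[where \<phi> = "Ad smul" and x = Q, OF Ad_compose Ad_id Ad_inj that])
  show "orbit_map (Ad smul) Q (g <#\<^bsub>GL smul\<^esub> St) = Ad smul g Q" if "g \<in> G" for g
    by (rule orbit_map_coset[OF Ad_compose Ad_id that])
  show "topspace (man_top ?N) = (\<lambda>g. Ad smul g Q) ` G"
    unfolding topN using OrbI by (auto simp: topspace_idempotent orbit_eq_image)
  show "continuous_map (man_top GM) (man_top ?N) (\<lambda>g. Ad smul g Q)"
  proof -
    interpret P: normed_space_pair Op Op by unfold_locales
    have "analytic_between Op Op G (\<lambda>g. Ad smul g Q)"
      unfolding Op.analytic_between_iff using an\<phi> openin_GL by blast
    from P.analytic_between_continuous[OF this] show ?thesis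
      unfolding topN man_top_idempotent man_top_GM
      using AI by (auto simp: continuous_map_in_subtopology orbit_eq_image)
  qed
  show "openin (man_top ?N) ((\<lambda>g. Ad smul g Q) ` U)" if "openin (man_top GM) U" for U
  proof -
    have U: "openin (norm_topology Op) U" "U \<subseteq> G" using that by (simp_all add: openin_GM)
    then show ?thesis
      unfolding topN openin_open_subtopology[OF openin_orbit_idempotent[OF Q]]
      using openin_Ad_image[OF Q U] by (auto simp: orbit_eq_image)
  qed
  fix d assume d: "d \<in> atlas ?N"
  obtain c V1 where d_eq: "d = \<lparr>chart_dom = chart_dom c \<inter> idempotents smul \<inter> Orb, chart_map = chart_map c,
      chart_model = (chart_model c)\<lparr>vecs := V1\<rparr>\<rparr>"
    and ch: "is_chart (norm_topology Op) c"
    and ab_inv: "analytic_between (chart_model c) Op (chart_image c) (chart_inv c)"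
    and ab: "analytic_between Op (chart_model c) (chart_dom c) (chart_map c)"
    and V1: "complemented_subspace (chart_model c) V1"
    and flat: "chart_map c ` (chart_dom c \<inter> idempotents smul) = chart_image c \<inter> V1"
    using d by (rule atlas_idempotentE)
  note chD = is_chartD[OF ch]
  interpret Vc: normed_space_on "chart_model c" by (rule chD(1))
  have lin: "linear_subset (chart_model c) V1"
    using V1 by (simp add: complemented_subspace_def closed_subspace_def)
  let ?V1 = "(chart_model c)\<lparr>vecs := V1\<rparr>"
  have nV1: "normed_space_on ?V1" by (rule subspace_normed_space[OF chD(1) lin])
  interpret V1: normed_space_on ?V1 by (rule nV1)
  show "normed_space_on (chart_model d)" using nV1 by (simp add: d_eq)
  show "inj_on (chart_map d) (chart_dom d)"
    using chD(3) by (simp add: d_eq) (rule inj_on_subset, auto)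
  show "openin (man_top ?N) (chart_dom d)"
    unfolding topN man_top_idempotent d_eq using chD(2)
    by (simp add: subtopology_subtopology openin_subtopology) (metis inf_assoc)
  fix g assume g: "g \<in> G" and gd: "Ad smul g Q \<in> chart_dom d"
  define R where "R = Ad smul g Q"
  have Rc: "R \<in> chart_dom c" using gd by (simp add: d_eq R_def)
  have RI: "R \<in> idempotents smul" using AI[OF g] by (simp add: R_def)
  have RV1: "chart_map c R \<in> V1" using flat Rc RI by blast
  have "banach_on (chart_model c)" using ch by (simp add: is_chart_def)
  from complemented_projection[OF this V1]
  obtain p where p: "bounded_linear_on (chart_model c) ?V1 p" and p': "\<forall>v\<in>V1. p v = v"
    by (elim exE conjE) (rule that)
  have anc: "analytic_at Op (chart_model c) (\<lambda>g. chart_map c (Ad smul g Q)) g"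
    using ab Rc by (intro analytic_at_comp[OF normed_space_Op normed_space_Op chD(1) an\<phi>[OF g]])
      (simp add: Op.analytic_between_iff R_def)
  have nc: "near Op g (\<lambda>g. g \<in> G \<and> Ad smul g Q \<in> chart_dom c)"
    using Rc by (intro near_conj near_GL[OF g] near_comp[OF normed_space_Op normed_space_Op an\<phi>[OF g]]
        Op.near_openin[OF chD(2)]) (simp add: R_def)
  \<comment> \<open>Analyticity is known only into the whole model space. Inserting the projection
    \<open>p\<close>, which fixes the values on idempotents, corrects the target to
    \<open>V1\<close>.\<close>
  have "analytic_at Op ?V1 (\<lambda>g. p (chart_map c (Ad smul g Q))) g"
    by (rule analytic_at_linear_comp[OF normed_space_Op chD(1) nV1 anc p])
  moreover have "near Op g (\<lambda>g. p (chart_map c (Ad smul g Q)) = chart_map c (Ad smul g Q))"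
  proof (rule near_mono[OF nc])
    fix h assume "g + h \<in> G \<and> Ad smul (g + h) Q \<in> chart_dom c"
    then have "chart_map c (Ad smul (g + h) Q) \<in> V1" using flat AI by blast
    then show "p (chart_map c (Ad smul (g + h) Q)) = chart_map c (Ad smul (g + h) Q)" by (rule bspec[OF p'])
  qed
  ultimately have "analytic_at Op ?V1 (\<lambda>g. chart_map c (Ad smul g Q)) g" by (rule analytic_at_cong)
  then show "analytic_at Op (chart_model d) (\<lambda>g. chart_map d (Ad smul g Q)) g" by (simp add: d_eq)
  define x0 where "x0 = chart_map c R"
  \<comment> \<open>A coordinate \<open>x\<close> is turned into the idempotent \<open>Y\<close> it
    stands for; \<open>g\<close> carries \<open>Q\<close> to \<open>R\<close> and the intertwiner
    carries \<open>R\<close> to \<open>Y\<close>.\<close>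
  define \<sigma> where "\<sigma> = (\<lambda>x. intertwiner R (chart_inv c x) o\<^sub>L g)"
  have inv0: "chart_inv c x0 = R" unfolding x0_def by (rule inv_into_f_f[OF chD(3) Rc])
  have x0I: "x0 \<in> chart_image c" using Rc by (simp add: x0_def)
  have x0V: "x0 \<in> vecs ?V1" using RV1 by (simp add: x0_def)
  have an_incl: "analytic_at ?V1 (chart_model c) (\<lambda>x. x) x0"
    using x0V by (intro analytic_at_inclusion chD(1) lin) simp
  have an_inv: "analytic_at ?V1 Op (\<lambda>x. chart_inv c x) x0"
    using ab_inv x0I unfolding Vc.analytic_between_iff
    by (intro analytic_at_comp[OF nV1 chD(1) normed_space_Op an_incl]) blast
  have an_int: "analytic_at ?V1 Op (\<lambda>x. intertwiner R (chart_inv c x)) x0"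
    by (intro analytic_intertwiner idempotents_Op(1)[OF RI] nV1 an_inv)
  have an_\<sigma>: "analytic_at ?V1 Op \<sigma> x0"
    unfolding \<sigma>_def by (intro analytic_at_o nV1 an_int analytic_at_Op_const GL_mem_Op[OF g] x0V)
  have int0: "intertwiner R (chart_inv c x0) = id_blinfun"
    using intertwiner_self[OF idempotents_Op(2)[OF RI]] by (simp add: inv0)
  have n1: "near ?V1 x0 (\<lambda>x. intertwiner R (chart_inv c x) \<in> G)"
    by (rule near_comp[OF nV1 normed_space_Op an_int]) (use near_GL[OF id_GL] int0 in simp)
  have n2: "near ?V1 x0 (\<lambda>x. x \<in> chart_image c)"
    by (rule near_comp[OF nV1 chD(1) an_incl]) (rule Vc.near_openin[OF chD(5) x0I])
  have "near ?V1 x0 (\<lambda>x. \<sigma> x \<in> G \<and> Ad smul (\<sigma> x) Q \<in> chart_dom d \<and> chart_map d (Ad smul (\<sigma> x) Q) = x)"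
  proof (rule V1.near_mono_mem[OF near_conj[OF n1 n2] x0V])
    fix x assume xV: "x \<in> vecs ?V1" and x: "intertwiner R (chart_inv c x) \<in> G \<and> x \<in> chart_image c"
    \<comment> \<open>Flatness of the chart turns a coordinate in \<open>V1\<close> back into an
      idempotent.\<close>
    then have "x \<in> chart_map c ` (chart_dom c \<inter> idempotents smul)" using flat by simp
    then obtain Y where Y: "Y \<in> chart_dom c" "Y \<in> idempotents smul" "x = chart_map c Y" by blast
    have iY: "chart_inv c x = Y" unfolding Y(3) by (rule inv_into_f_f[OF chD(3) Y(1)])
    have \<sigma>G: "\<sigma> x \<in> G" unfolding \<sigma>_def using x g by (intro compose_GL) simp_all
    have "Ad smul (\<sigma> x) Q = Ad smul (intertwiner R Y) R"
      unfolding \<sigma>_def iY R_def using x g iY by (intro Ad_compose) (simp_all add: R_def)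
    also have "\<dots> = Y"
      using x iY by (intro Ad_intertwiner idempotents_Op(2) RI Y(2)) simp
    finally have \<sigma>Y: "Ad smul (\<sigma> x) Q = Y" .
    then have "Y \<in> Orb" using \<sigma>G by (auto simp: orbit_eq_image)
    then show "\<sigma> x \<in> G \<and> Ad smul (\<sigma> x) Q \<in> chart_dom d \<and> chart_map d (Ad smul (\<sigma> x) Q) = x"
      using \<sigma>G Y(1,2) Y(3)[symmetric] unfolding \<sigma>Y by (simp add: d_eq)
  qed
  moreover have "\<sigma> x0 = g" by (simp add: \<sigma>_def int0)
  ultimately show "\<exists>\<sigma>. analytic_at (chart_model d) Op \<sigma> (chart_map d (Ad smul g Q)) \<and> \<sigma> (chart_map d (Ad smul g Q)) = g \<and>
        near (chart_model d) (chart_map d (Ad smul g Q))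
          (\<lambda>x. \<sigma> x \<in> G \<and> Ad smul (\<sigma> x) Q \<in> chart_dom d \<and> chart_map d (Ad smul (\<sigma> x) Q) = x)"
    using an_\<sigma> by (intro exI[of _ \<sigma>]) (simp add: d_eq x0_def R_def)
qed

end

section \<open>The Grassmannian\<close>

context banach_over
begin

abbreviation XN :: "('k, 'a) normed_on" where "XN \<equiv> \<lparr>vecs = UNIV, vscale = smul, vnorm = norm\<rparr>"

abbreviation ON where "ON E F \<equiv> operators_between smul E F"

lemma normed_space_XN: "normed_space_on XN"
  by unfold_locales
    (auto simp: linear_subset_def scale_right_distrib scale_left_distrib norm_smul norm_triangle_ineq)

lemma banach_XN: "banach_on XN"
proof -
  interpret X: normed_space_on XN by (rule normed_space_XN)
  have "X.mcomplete"
    unfolding X.mcomplete_iff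
  proof (intro allI impI, elim conjE)
    fix \<sigma> :: "nat \<Rightarrow> 'a"
    assume "\<forall>e>0. \<exists>N. \<forall>n\<ge>N. \<forall>m\<ge>N. vnorm XN (\<sigma> n - \<sigma> m) < e"
    then have "Cauchy \<sigma>" unfolding Cauchy_def dist_norm by simp
    then obtain x where "\<sigma> \<longlonglongrightarrow> x" using Cauchy_convergent convergent_def by blast
    then show "\<exists>x\<in>vecs XN. (\<lambda>n. vnorm XN (\<sigma> n - x)) \<longlonglongrightarrow> 0"
      by (intro bexI[of _ x]) (simp_all add: tendsto_norm_zero LIM_zero)
  qed
  then show ?thesis using normed_space_XN by (simp add: banach_on_iff)
qed

lemma norm_topology_XN: "norm_topology XN = euclidean"
proof -
  have "vdist XN = dist" by (intro ext) (simp add: vdist_def dist_norm)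
  then have "norm_topology XN = Met_TC.mtopology" by (simp add: norm_topology_def)
  then show ?thesis by simp
qed

lemma closed_subspace_XN: "closed_subspace XN S \<longleftrightarrow> subspace S \<and> closed S"
  by (auto simp: closed_subspace_def norm_topology_XN linear_subset_def subspace_def)

text \<open>A pair of complementary closed subspaces is encoded by the bounded projection onto
  \<open>E\<close> along \<open>F\<close>; the action on pairs then becomes conjugation.\<close>

definition is_proj :: "('a \<Rightarrow>\<^sub>L 'a) \<Rightarrow> 'a set \<Rightarrow> 'a set \<Rightarrow> bool" where
  "is_proj P E F \<longleftrightarrow> P \<in> vecs Op \<and> P o\<^sub>L P = P \<and>
     E = {x. blinfun_apply P x = x} \<and> F = {x. blinfun_apply P x = 0}"

lemma is_projD:
  assumes "is_proj P E F"
  shows "P \<in> vecs Op" "blinfun_apply P (blinfun_apply P x) = blinfun_apply P x"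
    "x \<in> E \<longleftrightarrow> blinfun_apply P x = x" "x \<in> F \<longleftrightarrow> blinfun_apply P x = 0"
    "blinfun_apply P x \<in> E" "x - blinfun_apply P x \<in> F"
  using assms idem_apply[of P] by (auto simp: is_proj_def blinfun.bilinear_simps)

lemma is_projI:
  assumes "P \<in> vecs Op" "\<And>x. blinfun_apply P (blinfun_apply P x) = blinfun_apply P x"
    "\<And>x. x \<in> E \<longleftrightarrow> blinfun_apply P x = x" "\<And>x. x \<in> F \<longleftrightarrow> blinfun_apply P x = 0"
  shows "is_proj P E F"
  using assms unfolding is_proj_def by (auto intro: blinfun_eqI)

lemma proj_complement: "is_proj P E F \<Longrightarrow> is_proj (id_blinfun - P) F E"
  by (rule is_projI) (auto simp: is_projD blinfun.bilinear_simps Op.diff_mem id_mem_Op)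

lemma proj_subspaces:
  assumes "is_proj P E F"
  shows "subspace E" "subspace F" "closed E" "closed F" "E \<inter> F = {0}"
proof -
  note P = is_projD[OF assms]
  have eq: "E = {x. blinfun_apply P x = x}" "F = {x. blinfun_apply P x = 0}"
    using assms by (simp_all add: is_proj_def)
  show "subspace E" "subspace F"
    using P(1) by (auto simp: subspace_def P(3,4) blinfun.bilinear_simps mem_Op)
  show "closed E" "closed F"
    unfolding eq by (intro closed_Collect_eq continuous_intros linear_continuous_on blinfun.bounded_linear_right)+
  show "E \<inter> F = {0}" by (auto simp: P(3,4) blinfun.bilinear_simps)
qed

lemma proj_in_complements:
  assumes "is_proj P E F" shows "E \<in> complements smul F"
proof -
  note P = is_projD[OF assms]
  have "\<exists>e\<in>E. \<exists>f\<in>F. x = e + f" for x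
    by (rule bexI[OF _ P(5)[of x]], rule bexI[OF _ P(6)[of x]]) simp
  then show ?thesis using proj_subspaces[OF assms] by (simp add: complements_def)
qed

text \<open>The open mapping theorem enters here, through \<open>projection_along\<close>. Since
  decompositions exist and are unique, the fixed points of the projection are \<open>E\<close> and
  its kernel is \<open>F\<close>.\<close>

lemma complements_proj:
  assumes F: "subspace F" "closed F" and E: "E \<in> complements smul F"
  shows "\<exists>P. is_proj P E F"
proof -
  have E': "subspace E" "closed E" "E \<inter> F = {0}" "\<forall>x. \<exists>e\<in>E. \<exists>f\<in>F. x = e + f"
    using E by (simp_all add: complements_def)
  have cs: "closed_subspace XN E" "closed_subspace XN F" using F E' by (simp_all add: closed_subspace_XN)
  have 0: "0 \<in> E" "0 \<in> F" using E'(3) by blast+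
  show ?thesis
  proof (rule projection_along[OF banach_XN cs E'(3)])
    show "\<exists>e\<in>E. \<exists>f\<in>F. v = e + f" for v using E'(4) by blast
    fix p assume p: "bounded_linear_on XN (XN\<lparr>vecs := E\<rparr>) p" and pE: "\<And>s s'. s \<in> E \<Longrightarrow> s' \<in> F \<Longrightarrow> p (s + s') = s"
    have add: "p (x + y) = p x + p y" and sc: "p (smul c x) = smul c (p x)" and mem: "p x \<in> E" for x y c
      using p by (simp_all add: bounded_linear_on_def)
    obtain B where B: "\<And>x. norm (p x) \<le> B * norm x"
      using p by (auto simp: bounded_linear_on_def)
    have "bounded_linear p"
    proof (rule bounded_linear_intro)
      show "p (r *\<^sub>R x) = r *\<^sub>R p x" for r x using sc[of "of_real r" x] by (simp add: smul_of_real)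
      show "norm (p x) \<le> norm x * B" for x using B[of x] by (simp add: mult.commute)
    qed (rule add)
    then have ap: "blinfun_apply (Blinfun p) x = p x" for x by (simp add: bounded_linear_Blinfun_apply)
    have onE: "p x = x" if "x \<in> E" for x using pE[OF that 0(2)] by simp
    have onF: "p x = 0" if "x \<in> F" for x using pE[OF 0(1) that] by simp
    have "is_proj (Blinfun p) E F"
    proof (rule is_projI, unfold ap)
      show "Blinfun p \<in> vecs Op" by (simp add: mem_Op ap sc)
      show "p (p x) = p x" for x by (rule onE[OF mem])
      show "x \<in> E \<longleftrightarrow> p x = x" for x using onE mem[of x] by auto
      show "x \<in> F \<longleftrightarrow> p x = 0" for x
      proof
        assume z: "p x = 0"
        obtain e f where ef: "e \<in> E" "f \<in> F" "x = e + f" using E'(4) by blast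
        then have "e = 0" using pE[OF ef(1,2)] z by simp
        then show "x \<in> F" using ef by simp
      qed (rule onF)
    qed
    then show "\<exists>P. is_proj P E F" by blast
  qed
qed

lemma mem_alpha: "W \<in> G \<Longrightarrow> x \<in> \<alpha> W E \<longleftrightarrow> blinfun_apply (ginv W) x \<in> E"
proof
  assume W: "W \<in> G"
  { assume "x \<in> \<alpha> W E" then show "blinfun_apply (ginv W) x \<in> E" using W by (auto simp: \<alpha>_def ginv_apply) }
  assume "blinfun_apply (ginv W) x \<in> E"
  from imageI[OF this, of "blinfun_apply W"] show "x \<in> \<alpha> W E" using W by (simp add: \<alpha>_def ginv_apply)
qed

lemma alpha_compose: "\<alpha> (g o\<^sub>L h) E = \<alpha> g (\<alpha> h E)"
  by (simp add: \<alpha>_def image_image)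

lemma alpha_id: "\<alpha> id_blinfun E = E"
  by (simp add: \<alpha>_def)

lemma alpha_inj: "g \<in> G \<Longrightarrow> \<alpha> g E = \<alpha> g E' \<Longrightarrow> E = E'"
  using alpha_compose[of "ginv g" g] GL.l_inv[of g] by (metis alpha_id mult_GL one_GL)

lemma proj_conj:
  assumes P: "is_proj P E F" and W: "W \<in> G"
  shows "is_proj (W o\<^sub>L P o\<^sub>L ginv W) (\<alpha> W E) (\<alpha> W F)"
proof (rule is_projI)
  note P = is_projD[OF P]
  have W_eq: "blinfun_apply W y = x \<longleftrightarrow> y = blinfun_apply (ginv W) x" for x y
    using ginv_apply[OF W] by metis
  show "W o\<^sub>L P o\<^sub>L ginv W \<in> vecs Op"
    by (intro compose_mem_Op GL_mem_Op[OF W] P(1) GL_mem_Op[OF ginv_GL[OF W]])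
  show "blinfun_apply (W o\<^sub>L P o\<^sub>L ginv W) (blinfun_apply (W o\<^sub>L P o\<^sub>L ginv W) x) = blinfun_apply (W o\<^sub>L P o\<^sub>L ginv W) x" for x
    by (simp add: ginv_apply[OF W] P(2))
  show "x \<in> \<alpha> W E \<longleftrightarrow> blinfun_apply (W o\<^sub>L P o\<^sub>L ginv W) x = x" for x
    unfolding mem_alpha[OF W] P(3) by (simp add: W_eq)
  show "x \<in> \<alpha> W F \<longleftrightarrow> blinfun_apply (W o\<^sub>L P o\<^sub>L ginv W) x = 0" for x
    unfolding mem_alpha[OF W] P(4) by (simp add: W_eq blinfun.bilinear_simps)
qed

abbreviation Gr where "Gr \<equiv> grassmannian smul"

text \<open>Complements are symmetric on the level of projections: \<open>id_blinfun - P\<close>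
  exchanges the two subspaces.\<close>

lemma Gr_iff: "E \<in> Gr \<longleftrightarrow> E \<noteq> {0} \<and> E \<noteq> UNIV \<and> (\<exists>P F. is_proj P E F)"
proof
  assume E: "E \<in> Gr"
  then have sub: "subspace E" "closed E" and ne: "E \<noteq> {0}" "E \<noteq> UNIV"
    by (simp_all add: grassmannian_def)
  obtain F where "F \<in> complements smul E" using E by (auto simp: grassmannian_def)
  then obtain P where "is_proj P F E" using complements_proj[OF sub] by blast
  then have "is_proj (id_blinfun - P) E F" by (rule proj_complement)
  with ne show "E \<noteq> {0} \<and> E \<noteq> UNIV \<and> (\<exists>P F. is_proj P E F)" by blast
next
  assume "E \<noteq> {0} \<and> E \<noteq> UNIV \<and> (\<exists>P F. is_proj P E F)"
  then obtain P F where ne: "E \<noteq> {0}" "E \<noteq> UNIV" and P: "is_proj P E F" by blast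
  have "F \<in> complements smul E" by (rule proj_in_complements[OF proj_complement[OF P]])
  then show "E \<in> Gr" using ne proj_subspaces[OF P] by (auto simp: grassmannian_def)
qed

lemma chart_proj:
  assumes "F \<in> Gr" "E \<in> complements smul F" obtains P where "is_proj P E F"
  using complements_proj[of F E] assms by (auto simp: grassmannian_def)

lemma Gr_complement:
  assumes "F \<in> Gr" "is_proj P E F" shows "E \<in> Gr"
proof -
  note P = is_projD[OF assms(2)]
  have "F \<noteq> {0}" "F \<noteq> UNIV" using assms(1) by (auto simp: Gr_iff)
  moreover have "F = UNIV" if "E = {0}"
  proof -
    have "blinfun_apply P x = 0" for x using P(5)[of x] that by simp
    then show ?thesis using P(4) by auto
  qed
  moreover have "F = {0}" if "E = UNIV"
    using proj_subspaces(5)[OF assms(2)] that by simp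
  ultimately show ?thesis using assms(2) unfolding Gr_iff by blast
qed

lemma Gr_alpha:
  assumes "E \<in> Gr" "W \<in> G" shows "\<alpha> W E \<in> Gr"
proof -
  obtain P F where P: "is_proj P E F" and ne: "E \<noteq> {0}" "E \<noteq> UNIV" using assms(1) by (auto simp: Gr_iff)
  have "\<alpha> W {0} = {0}" by (simp add: \<alpha>_def)
  moreover have "\<alpha> W UNIV = UNIV" using mem_alpha[OF assms(2), of _ UNIV] by auto
  ultimately have "\<alpha> W E \<noteq> {0}" "\<alpha> W E \<noteq> UNIV"
    using ne alpha_inj[OF assms(2), of E "{0}"] alpha_inj[OF assms(2), of E UNIV] by auto
  then show ?thesis using proj_conj[OF P assms(2)] unfolding Gr_iff by blast
qed

section \<open>Normed spaces of operators between subspaces\<close>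

lemma mem_ON:
  "T \<in> vecs (ON E F) \<longleftrightarrow> (\<forall>x. x \<notin> E \<longrightarrow> T x = 0) \<and> (\<forall>x\<in>E. T x \<in> F) \<and>
     (\<forall>x\<in>E. \<forall>y\<in>E. T (x + y) = T x + T y) \<and> (\<forall>c. \<forall>x\<in>E. T (smul c x) = smul c (T x)) \<and>
     (\<exists>B. \<forall>x\<in>E. norm (T x) \<le> B * norm x)"
  by (simp add: operators_between_def bounded_linear_on_def)

lemma vscale_ON: "vscale (ON E F) c T = (\<lambda>x. smul c (T x))"
  and vnorm_ON: "vnorm (ON E F) T = (SUP x\<in>E \<inter> cball 0 1. norm (T x))"
  by (simp_all add: operators_between_def)

lemma ON_zero: "subspace E \<Longrightarrow> T \<in> vecs (ON E F) \<Longrightarrow> T 0 = 0"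
  using mem_ON[of T E F] subspace_0[of E] by (metis add_cancel_right_right)

lemma ON_bound: "T \<in> vecs (ON E F) \<Longrightarrow> \<exists>B. \<forall>x\<in>E. norm (T x) \<le> B * norm x"
  unfolding mem_ON by blast

lemma ON_bdd:
  assumes "T \<in> vecs (ON E F)" shows "bdd_above ((\<lambda>x. norm (T x)) ` (E \<inter> cball 0 1))"
proof -
  obtain B where B: "\<forall>x\<in>E. norm (T x) \<le> B * norm x" using ON_bound[OF assms] by (elim exE) (rule that)
  have "norm (T x) \<le> \<bar>B\<bar>" if "x \<in> E \<inter> cball 0 1" for x
  proof -
    have "B * norm x \<le> \<bar>B\<bar> * norm x" by (rule mult_right_mono) auto
    also have "\<dots> \<le> \<bar>B\<bar> * 1" using that by (intro mult_left_mono) auto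
    finally show ?thesis using bspec[OF B, of x] that by auto
  qed
  then show ?thesis by (intro bdd_aboveI2)
qed

lemma norm_ON_le:
  assumes E: "subspace E" and T: "T \<in> vecs (ON E F)" and x: "x \<in> E"
  shows "norm (T x) \<le> vnorm (ON E F) T * norm x"
proof (cases "x = 0")
  case True
  then show ?thesis using ON_zero[OF E T] by simp
next
  case False
  let ?c = "of_real (1 / norm x) :: 'k"
  have nc: "norm ?c = 1 / norm x" unfolding norm_of_real by simp
  have "smul ?c x \<in> E" using E x by (rule subspace_scale)
  moreover have "norm (smul ?c x) = 1" unfolding norm_smul nc using False by simp
  ultimately have "norm (T (smul ?c x)) \<le> vnorm (ON E F) T"
    unfolding vnorm_ON by (intro cSUP_upper ON_bdd[OF T]) auto
  moreover have "T (smul ?c x) = smul ?c (T x)" using T x by (simp add: mem_ON)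
  ultimately have "(1 / norm x) * norm (T x) \<le> vnorm (ON E F) T" by (simp only: norm_smul nc)
  then show ?thesis using False by (simp add: field_simps)
qed

lemma vnorm_ON_le:
  assumes "subspace E" "\<And>x. x \<in> E \<Longrightarrow> norm (T x) \<le> B * norm x" "0 \<le> B"
  shows "vnorm (ON E F) T \<le> B"
  unfolding vnorm_ON
proof (rule cSUP_least)
  show "E \<inter> cball 0 1 \<noteq> {}" using subspace_0[OF assms(1)] by (auto intro!: exI[of _ 0])
  fix x assume x: "x \<in> E \<inter> cball 0 1"
  have "B * norm x \<le> B * 1" using x assms(3) by (intro mult_left_mono) auto
  then show "norm (T x) \<le> B" using assms(2)[of x] x by auto
qed

lemma vnorm_ON_nonneg:
  assumes "subspace E" "T \<in> vecs (ON E F)" shows "0 \<le> vnorm (ON E F) T"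
proof -
  have "norm (T 0) \<le> vnorm (ON E F) T"
    unfolding vnorm_ON using subspace_0[OF assms(1)] by (intro cSUP_upper ON_bdd[OF assms(2)]) auto
  then show ?thesis using ON_zero[OF assms] by simp
qed

lemma ON_add:
  assumes "subspace F" "T \<in> vecs (ON E F)" "T' \<in> vecs (ON E F)" shows "T + T' \<in> vecs (ON E F)"
proof -
  obtain B where B: "\<forall>x\<in>E. norm (T x) \<le> B * norm x" using ON_bound[OF assms(2)] by (elim exE) (rule that)
  obtain C where C: "\<forall>x\<in>E. norm (T' x) \<le> C * norm x" using ON_bound[OF assms(3)] by (elim exE) (rule that)
  have "norm (T x + T' x) \<le> (B + C) * norm x" if "x \<in> E" for x
    using norm_triangle_ineq[of "T x" "T' x"] bspec[OF B that] bspec[OF C that] by (simp add: distrib_right)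
  then show ?thesis
    using assms by (auto simp: mem_ON subspace_add scale_right_distrib)
qed

lemma ON_scale:
  assumes "subspace F" "T \<in> vecs (ON E F)" shows "vscale (ON E F) c T \<in> vecs (ON E F)"
proof -
  obtain B where B: "\<forall>x\<in>E. norm (T x) \<le> B * norm x" using ON_bound[OF assms(2)] by (elim exE) (rule that)
  have "norm (smul c (T x)) \<le> (norm c * B) * norm x" if "x \<in> E" for x
    using mult_left_mono[OF bspec[OF B that], of "norm c"] by (simp add: norm_smul mult.assoc)
  then show ?thesis
    using assms by (auto simp: mem_ON vscale_ON subspace_scale scale_right_distrib mult.commute[of c])
qed

lemma normed_space_ON:
  assumes E: "subspace E" and F: "subspace F" shows "normed_space_on (ON E F)"
proof
  show "linear_subset (ON E F) (vecs (ON E F))"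
    unfolding linear_subset_def
  proof (intro conjI ballI allI subset_refl ON_add[OF F] ON_scale[OF F])
    show "0 \<in> vecs (ON E F)" by (auto simp: mem_ON subspace_0[OF F] intro: exI[of _ 0])
  qed
  fix T assume T: "T \<in> vecs (ON E F)"
  show "vscale (ON E F) 1 T = T" by (simp add: vscale_ON)
  show "vscale (ON E F) c (vscale (ON E F) d T) = vscale (ON E F) (c * d) T" for c d by (simp add: vscale_ON)
  show "vscale (ON E F) (c + d) T = vscale (ON E F) c T + vscale (ON E F) d T" for c d
    by (rule ext) (simp add: vscale_ON scale_left_distrib)
  show "0 \<le> vnorm (ON E F) T" by (rule vnorm_ON_nonneg[OF E T])
  show "vnorm (ON E F) T = 0 \<longleftrightarrow> T = 0"
  proof
    assume z: "vnorm (ON E F) T = 0"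
    show "T = 0"
    proof (rule ext)
      show "T x = 0 x" for x
        using norm_ON_le[OF E T, of x] z T by (cases "x \<in> E") (auto simp: mem_ON)
    qed
  next
    assume "T = 0"
    then have "vnorm (ON E F) T \<le> 0" by (intro vnorm_ON_le[OF E]) auto
    then show "vnorm (ON E F) T = 0" using vnorm_ON_nonneg[OF E T] by simp
  qed
  have scale_le: "vnorm (ON E F) (vscale (ON E F) c T) \<le> norm c * vnorm (ON E F) T" if T: "T \<in> vecs (ON E F)" for c T
  proof (rule vnorm_ON_le[OF E])
    show "norm (vscale (ON E F) c T x) \<le> norm c * vnorm (ON E F) T * norm x" if "x \<in> E" for x
      using mult_left_mono[OF norm_ON_le[OF E T that], of "norm c"] by (simp add: vscale_ON norm_smul mult.assoc)
  qed (simp add: vnorm_ON_nonneg[OF E T])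
  show "vnorm (ON E F) (vscale (ON E F) c T) = norm c * vnorm (ON E F) T" for c
  proof (cases "c = 0")
    case True
    then show ?thesis using scale_le[OF T, of c] vnorm_ON_nonneg[OF E ON_scale[OF F T], of c] by simp
  next
    case False
    have "vscale (ON E F) (1 / c) (vscale (ON E F) c T) = T" using False by (simp add: vscale_ON)
    then have "vnorm (ON E F) T \<le> norm (1 / c) * vnorm (ON E F) (vscale (ON E F) c T)"
      using scale_le[OF ON_scale[OF F T], of "1 / c" c] by simp
    also have "norm (1 / c) = 1 / norm c" by (simp add: norm_divide)
    finally have "norm c * vnorm (ON E F) T \<le> vnorm (ON E F) (vscale (ON E F) c T)"
      using False by (simp add: field_simps)
    with scale_le[OF T, of c] show ?thesis by linarith
  qed
  fix T' assume T': "T' \<in> vecs (ON E F)"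
  show "vscale (ON E F) c (T + T') = vscale (ON E F) c T + vscale (ON E F) c T'" for c
    by (rule ext) (simp add: vscale_ON scale_right_distrib)
  show "vnorm (ON E F) (T + T') \<le> vnorm (ON E F) T + vnorm (ON E F) T'"
  proof (rule vnorm_ON_le[OF E])
    show "norm ((T + T') x) \<le> (vnorm (ON E F) T + vnorm (ON E F) T') * norm x" if "x \<in> E" for x
      using norm_triangle_ineq[of "T x" "T' x"] norm_ON_le[OF E T that] norm_ON_le[OF E T' that]
      by (simp add: distrib_right)
  qed (simp add: vnorm_ON_nonneg[OF E] T T')
qed

lemma proj_normed_ON:
  assumes "is_proj P E F" shows "normed_space_on (ON E F)"
  by (rule normed_space_ON[OF proj_subspaces(1,2)[OF assms]])

text \<open>The operator \<open>T P\<close>, that is, extension by zero along the kernel of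
  \<open>P\<close>. It realizes chart coordinates inside L(X).\<close>

definition extend :: "('a \<Rightarrow>\<^sub>L 'a) \<Rightarrow> ('a \<Rightarrow> 'a) \<Rightarrow> 'a \<Rightarrow>\<^sub>L 'a" where
  "extend P T = Blinfun (\<lambda>x. T (blinfun_apply P x))"

lemma extend:
  assumes P: "is_proj P E F" and T: "T \<in> vecs (ON E F)"
  shows "blinfun_apply (extend P T) x = T (blinfun_apply P x)" "extend P T \<in> vecs Op"
    "norm (extend P T) \<le> norm P * vnorm (ON E F) T"
proof -
  note P' = is_projD[OF P]
  have E: "subspace E" by (rule proj_subspaces[OF P])
  have bd: "norm (T (blinfun_apply P x)) \<le> vnorm (ON E F) T * norm P * norm x" for x
  proof -
    have "norm (T (blinfun_apply P x)) \<le> vnorm (ON E F) T * norm (blinfun_apply P x)"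
      by (rule norm_ON_le[OF E T P'(5)])
    also have "\<dots> \<le> vnorm (ON E F) T * (norm P * norm x)"
      by (intro mult_left_mono norm_blinfun vnorm_ON_nonneg[OF E T])
    finally show ?thesis by (simp add: mult.assoc)
  qed
  have sc: "T (smul c (blinfun_apply P x)) = smul c (T (blinfun_apply P x))" for c x
    using T P'(5) by (simp add: mem_ON)
  have "bounded_linear (\<lambda>x. T (blinfun_apply P x))"
  proof (rule bounded_linear_intro)
    show "T (blinfun_apply P (x + y)) = T (blinfun_apply P x) + T (blinfun_apply P y)" for x y
      using T P'(5) by (simp add: mem_ON blinfun.bilinear_simps)
    show "T (blinfun_apply P (r *\<^sub>R x)) = r *\<^sub>R T (blinfun_apply P x)" for r x
      using sc[of "of_real r"] by (simp add: smul_of_real blinfun.bilinear_simps)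
    show "norm (T (blinfun_apply P x)) \<le> norm x * (vnorm (ON E F) T * norm P)" for x
      using bd[of x] by (simp add: mult.commute)
  qed
  then show ap: "blinfun_apply (extend P T) x = T (blinfun_apply P x)" for x
    unfolding extend_def by (simp add: bounded_linear_Blinfun_apply)
  show "extend P T \<in> vecs Op" using P'(1) by (simp add: mem_Op ap sc)
  show "norm (extend P T) \<le> norm P * vnorm (ON E F) T"
    using bd vnorm_ON_nonneg[OF E T] by (intro norm_blinfun_bound) (simp_all add: ap mult.commute)
qed

lemma linear_extend:
  assumes P: "is_proj P E F" shows "bounded_linear_on (ON E F) Op (extend P)"
proof -
  interpret ON: normed_space_on "ON E F" by (rule proj_normed_ON[OF P])
  show ?thesis
    unfolding bounded_linear_on_def
  proof (intro conjI ballI allI exI)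
    fix T assume T: "T \<in> vecs (ON E F)"
    show "extend P T \<in> vecs Op" by (rule extend(2)[OF P T])
    show "vnorm Op (extend P T) \<le> norm P * vnorm (ON E F) T" using extend(3)[OF P T] by simp
    show "extend P (vscale (ON E F) c T) = vscale Op c (extend P T)" for c
      by (rule blinfun_eqI)
        (simp only: extend(1)[OF P ON.scale_mem[OF T]] extend(1)[OF P T] vscale_Op_apply, simp only: vscale_ON)
    show "extend P (T + T') = extend P T + extend P T'" if T': "T' \<in> vecs (ON E F)" for T'
      by (rule blinfun_eqI) (simp add: extend(1)[OF P ON.add_mem[OF T T']] extend(1)[OF P T] extend(1)[OF P T']
          blinfun.bilinear_simps)
  qed
qed

text \<open>The block of \<open>S\<close> from \<open>E\<close> into the kernel of \<open>P\<close>.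
  The value 0 off \<open>E\<close> is the normalisation of \<open>operators_between\<close>.\<close>

definition restrict_op :: "('a \<Rightarrow>\<^sub>L 'a) \<Rightarrow> 'a set \<Rightarrow> ('a \<Rightarrow>\<^sub>L 'a) \<Rightarrow> 'a \<Rightarrow> 'a" where
  "restrict_op P E S = (\<lambda>x. if x \<in> E then blinfun_apply S x - blinfun_apply P (blinfun_apply S x) else 0)"

lemma linear_restrict_op:
  assumes P: "is_proj P E F" shows "bounded_linear_on Op (ON E F) (restrict_op P E)"
  unfolding bounded_linear_on_def
proof (intro conjI ballI allI exI)
  note P' = is_projD[OF P]
  note sub = proj_subspaces[OF P]
  fix S assume S: "S \<in> vecs Op"
  have bd: "norm (restrict_op P E S x) \<le> ((1 + norm P) * norm S) * norm x" for x
  proof -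
    have "norm (blinfun_apply S x - blinfun_apply P (blinfun_apply S x))
        \<le> norm (blinfun_apply S x) + norm P * norm (blinfun_apply S x)"
      using norm_triangle_ineq4 norm_blinfun[of P "blinfun_apply S x"] by (meson add_left_mono order_trans)
    also have "\<dots> = (1 + norm P) * norm (blinfun_apply S x)" by (simp add: distrib_right)
    also have "\<dots> \<le> (1 + norm P) * (norm S * norm x)"
      by (intro mult_left_mono norm_blinfun) (simp add: add_nonneg_nonneg)
    finally show ?thesis by (simp add: restrict_op_def mult.assoc)
  qed
  have PO: "blinfun_apply P (smul c x) = smul c (blinfun_apply P x)" for c x using P'(1) by (simp add: mem_Op)
  have SO: "blinfun_apply S (smul c x) = smul c (blinfun_apply S x)" for c x using S by (simp add: mem_Op)
  show "restrict_op P E S \<in> vecs (ON E F)"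
    unfolding mem_ON
  proof (intro conjI ballI allI impI exI)
    show "norm (restrict_op P E S x) \<le> ((1 + norm P) * norm S) * norm x" for x by (rule bd)
  qed (use sub in \<open>auto simp: restrict_op_def P'(6) subspace_add subspace_scale PO SO blinfun.bilinear_simps scale_right_diff_distrib\<close>)
  show "vnorm (ON E F) (restrict_op P E S) \<le> (1 + norm P) * vnorm Op S"
    using vnorm_ON_le[OF sub(1) bd] by (simp add: add_nonneg_nonneg)
  show "restrict_op P E (vscale Op c S) = vscale (ON E F) c (restrict_op P E S)" for c
    by (rule ext) (simp add: restrict_op_def vscale_ON vscale_Op_apply PO scale_right_diff_distrib)
  show "restrict_op P E (S + S') = restrict_op P E S + restrict_op P E S'" for S'
    by (rule ext) (simp add: restrict_op_def blinfun.bilinear_simps)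
qed

text \<open>\<open>T\<close> has values in the kernel of \<open>P\<close>, so
  \<open>extend P T\<close> squares to 0 and \<open>id_blinfun - extend P T\<close> is the inverse.
  On \<open>E\<close> the shear is \<open>x + T x\<close>, on \<open>F\<close> it is the
  identity.\<close>

lemma shear:
  assumes P: "is_proj P E F" and T: "T \<in> vecs (ON E F)"
  shows "id_blinfun + extend P T \<in> G" "\<alpha> (id_blinfun + extend P T) E = q_map E T"
    "\<alpha> (id_blinfun + extend P T) F = F"
proof -
  note P' = is_projD[OF P]
  have E: "subspace E" by (rule proj_subspaces[OF P])
  have F: "blinfun_apply P (T (blinfun_apply P x)) = 0" for x
    using T P'(5) by (simp add: mem_ON flip: P'(4))
  have sq: "blinfun_apply (extend P T) (blinfun_apply (extend P T) x) = 0" for x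
    by (simp add: extend(1)[OF P T] F ON_zero[OF E T])
  show "id_blinfun + extend P T \<in> G"
    by (rule GL_I(1)[of _ "id_blinfun - extend P T"])
      (auto intro!: blinfun_eqI Op.add_mem id_mem_Op extend(2)[OF P T] simp: blinfun.bilinear_simps sq)
  show "\<alpha> (id_blinfun + extend P T) E = q_map E T"
    unfolding \<alpha>_def q_map_def
    by (rule image_cong[OF refl]) (simp add: blinfun.bilinear_simps extend(1)[OF P T] P'(3))
  have "blinfun_apply (id_blinfun + extend P T) x = x" if "x \<in> F" for x
    using that by (simp add: blinfun.bilinear_simps extend(1)[OF P T] P'(4) ON_zero[OF E T])
  then show "\<alpha> (id_blinfun + extend P T) F = F" by (simp add: \<alpha>_def)
qed

text \<open>The mixed term of the product contains \<open>P T0\<close> and vanishes, so composing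
  shears adds their operators.\<close>

lemma shear_compose:
  assumes P: "is_proj P E F" and T: "T \<in> vecs (ON E F)" and T0: "T0 \<in> vecs (ON E F)"
  shows "(id_blinfun + extend P (T - T0)) o\<^sub>L (id_blinfun + extend P T0) = id_blinfun + extend P T"
proof (rule blinfun_eqI)
  interpret ON: normed_space_on "ON E F" by (rule proj_normed_ON[OF P])
  note P' = is_projD[OF P]
  have E: "subspace E" by (rule proj_subspaces[OF P])
  have F: "blinfun_apply P (T0 (blinfun_apply P x)) = 0" for x
    using T0 P'(5) by (simp add: mem_ON flip: P'(4))
  show "blinfun_apply ((id_blinfun + extend P (T - T0)) o\<^sub>L (id_blinfun + extend P T0)) x
      = blinfun_apply (id_blinfun + extend P T) x" for x
    by (simp add: blinfun.bilinear_simps extend(1)[OF P T] extend(1)[OF P T0]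
        extend(1)[OF P ON.diff_mem[OF T T0]] F ON_zero[OF E T] ON_zero[OF E T0])
qed

text \<open>Applying \<open>P\<close> to \<open>x + T x = y + T' y\<close> kills the parts in
  \<open>F\<close> and gives \<open>x = y\<close>.\<close>

lemma q_map_inj:
  assumes P: "is_proj P E F" shows "inj_on (q_map E) (vecs (ON E F))"
proof (rule inj_onI, rule ext)
  note P' = is_projD[OF P]
  fix T T' x assume T: "T \<in> vecs (ON E F)" "T' \<in> vecs (ON E F)" and eq: "q_map E T = q_map E T'"
  show "T x = T' x"
  proof (cases "x \<in> E")
    case True
    then have "x + T x \<in> q_map E T" unfolding q_map_def by (rule imageI)
    then have "x + T x \<in> q_map E T'" by (simp only: eq)
    then obtain y where y: "y \<in> E" "x + T x = y + T' y" unfolding q_map_def by (elim imageE)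
    have "blinfun_apply P (T x) = 0" "blinfun_apply P (T' y) = 0"
      using T True y(1) by (simp_all add: mem_ON flip: P'(4))
    moreover have "blinfun_apply P x = x" "blinfun_apply P y = y" using True y(1) by (simp_all add: P'(3))
    ultimately have "x = y"
      using arg_cong[OF y(2), of "blinfun_apply P"] by (simp add: blinfun.bilinear_simps)
    then show ?thesis using y(2) by simp
  qed (use T in \<open>simp add: mem_ON\<close>)
qed

lemma q_map_complements:
  assumes "is_proj P E F" "T \<in> vecs (ON E F)" shows "q_map E T \<in> complements smul F"
  using proj_in_complements[OF proj_conj[OF assms(1) shear(1)[OF assms]]] by (simp add: shear[OF assms])

lemma q_map_Gr:
  assumes "F \<in> Gr" "is_proj P E F" "T \<in> vecs (ON E F)" shows "q_map E T \<in> Gr"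
  using Gr_alpha[OF Gr_complement[OF assms(1,2)] shear(1)[OF assms(2,3)]] by (simp add: shear[OF assms(2,3)])

end

context banach_over
begin

lemma chart_map_q:
  assumes "is_proj P E F" "T \<in> vecs (ON E F)"
  shows "chart_map (grassmann_chart smul E F) (q_map E T) = T"
  unfolding grassmann_chart_def using inv_into_f_f[OF q_map_inj[OF assms(1)] assms(2)] by simp

text \<open>A local section of the action through \<open>g\<close>: if \<open>g\<close> moves the
  base subspace to \<open>q_map E' T0\<close>, then the shear by the difference moves it on to
  \<open>q_map E' T\<close>.\<close>

definition section_at where
  "section_at P T0 g T = (id_blinfun + extend P (T - T0)) o\<^sub>L g"

lemma section_at:
  assumes P: "is_proj P E' F" and T0: "T0 \<in> vecs (ON E' F)" and g: "g \<in> G" and eq: "q_map E' T0 = \<alpha> g E"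
  shows "section_at P T0 g T0 = g" "analytic_at (ON E' F) Op (section_at P T0 g) T0"
    "\<And>T. T \<in> vecs (ON E' F) \<Longrightarrow> section_at P T0 g T \<in> G"
    "\<And>T. T \<in> vecs (ON E' F) \<Longrightarrow> \<alpha> (section_at P T0 g T) E = q_map E' T"
proof -
  interpret ON: normed_space_on "ON E' F" by (rule proj_normed_ON[OF P])
  have nON: "normed_space_on (ON E' F)" by (rule proj_normed_ON[OF P])
  have "extend P (T0 - T0) = 0"
    by (rule blinfun_eqI) (simp only: extend(1)[OF P ON.diff_mem[OF T0 T0]], simp)
  then show "section_at P T0 g T0 = g" by (simp add: section_at_def)
  show "analytic_at (ON E' F) Op (section_at P T0 g) T0"
    unfolding section_at_def
    by (intro analytic_at_o analytic_at_add analytic_at_Op_const analytic_at_linear_comp[OF nON nON normed_space_Op _ linear_extend[OF P]]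
        analytic_at_diff analytic_at_constant ON.analytic_at_ident nON normed_space_Op id_mem_Op GL_mem_Op[OF g] T0)
  fix T assume T: "T \<in> vecs (ON E' F)"
  show "section_at P T0 g T \<in> G"
    unfolding section_at_def by (rule compose_GL[OF shear(1)[OF P ON.diff_mem[OF T T0]] g])
  have "\<alpha> (section_at P T0 g T) E = \<alpha> (id_blinfun + extend P (T - T0)) (q_map E' T0)"
    unfolding section_at_def alpha_compose eq ..
  also have "\<dots> = \<alpha> ((id_blinfun + extend P (T - T0)) o\<^sub>L (id_blinfun + extend P T0)) E'"
    unfolding alpha_compose shear(2)[OF P T0] ..
  also have "\<dots> = q_map E' T" unfolding shear_compose[OF P T T0] by (rule shear(2)[OF P T])
  finally show "\<alpha> (section_at P T0 g T) E = q_map E' T" .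
qed

section \<open>The topology of the Grassmannian and coordinates of moved subspaces\<close>

abbreviation GT where "GT \<equiv> grassmann_topology smul"

lemma man_top_grassmann: "man_top (grassmann_manifold smul) = GT"
  by (simp add: grassmann_manifold_def)

lemma topspace_GT: "topspace GT = Gr"
proof -
  have "openin GT Gr"
    unfolding openin_grassmann_topology
  proof (intro conjI ballI)
    fix F E assume F: "F \<in> Gr" and E: "E \<in> complements smul F"
    obtain P where P: "is_proj P E F" by (rule chart_proj[OF F E])
    interpret ON: normed_space_on "ON E F" by (rule proj_normed_ON[OF P])
    have "{T \<in> vecs (ON E F). q_map E T \<in> Gr} = vecs (ON E F)"
      using q_map_Gr[OF F P] by blast
    then show "openin (norm_topology (ON E F)) {T \<in> vecs (ON E F). q_map E T \<in> Gr}"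
      using ON.openin_vecs by simp
  qed simp
  moreover have "topspace GT \<subseteq> Gr"
    using openin_topspace[of GT] unfolding openin_grassmann_topology by blast
  ultimately show ?thesis using openin_subset by blast
qed

text \<open>It suffices to check openness along the charts: near \<open>T0\<close> the subspace \<open>q_map E T\<close> is the image
  of \<open>q_map E T0\<close> under an operator depending analytically on \<open>T\<close>.\<close>

lemma openin_GT_I:
  assumes sub: "\<U> \<subseteq> Gr"
    and near: "\<And>E0. E0 \<in> \<U> \<Longrightarrow> near Op id_blinfun (\<lambda>W. W \<in> G \<longrightarrow> \<alpha> W E0 \<in> \<U>)"
  shows "openin GT \<U>"
  unfolding openin_grassmann_topology
proof (intro conjI ballI sub)
  fix F E assume F: "F \<in> Gr" and E: "E \<in> complements smul F"
  obtain P where P: "is_proj P E F" by (rule chart_proj[OF F E])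
  have nON: "normed_space_on (ON E F)" by (rule proj_normed_ON[OF P])
  interpret ON: normed_space_on "ON E F" by (rule nON)
  show "openin (norm_topology (ON E F)) {T \<in> vecs (ON E F). q_map E T \<in> \<U>}"
  proof (rule ON.openinI)
    fix T0 assume "T0 \<in> {T \<in> vecs (ON E F). q_map E T \<in> \<U>}"
    then have T0: "T0 \<in> vecs (ON E F)" and U: "q_map E T0 \<in> \<U>" by auto
    note s = section_at[OF P T0 id_GL alpha_id[symmetric]]
    have "near (ON E F) T0 (\<lambda>T. section_at P T0 id_blinfun T \<in> G \<longrightarrow> \<alpha> (section_at P T0 id_blinfun T) (q_map E T0) \<in> \<U>)"
      by (rule near_comp[OF nON normed_space_Op s(2)]) (use near[OF U] in \<open>simp add: s(1)\<close>)
    from ON.near_mono_mem[OF this T0]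
    show "near (ON E F) T0 (\<lambda>T. T \<in> {T \<in> vecs (ON E F). q_map E T \<in> \<U>})"
      using s(3,4) by simp
  qed auto
qed

text \<open>If \<open>E0\<close> is \<open>\<alpha> g E\<close> with \<open>g\<close> in
  \<open>D\<close>, then \<open>\<alpha> W E0\<close> is the image of \<open>E\<close> under
  \<open>W o\<^sub>L g\<close>, which stays in \<open>D\<close> for \<open>W\<close> near the
  identity.\<close>

lemma openin_alpha_image:
  assumes E: "E \<in> Gr" and D: "openin (norm_topology Op) D" "D \<subseteq> G"
  shows "openin GT ((\<lambda>g. \<alpha> g E) ` D)"
proof (rule openin_GT_I)
  show "(\<lambda>g. \<alpha> g E) ` D \<subseteq> Gr" using Gr_alpha[OF E] D(2) by blast
  fix E0 assume "E0 \<in> (\<lambda>g. \<alpha> g E) ` D"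
  then obtain g where g: "g \<in> D" "E0 = \<alpha> g E" by (elim imageE)
  have gO: "g \<in> vecs Op" using g(1) D(2) GL_mem_Op by blast
  have an: "analytic_at Op Op (\<lambda>W. W o\<^sub>L g) id_blinfun"
    by (intro analytic_at_o normed_space_Op Op.analytic_at_ident id_mem_Op analytic_at_Op_const gO)
  have "near Op id_blinfun (\<lambda>W. W o\<^sub>L g \<in> D)"
    by (rule near_comp[OF normed_space_Op normed_space_Op an]) (use Op.near_openin[OF D(1) g(1)] in simp)
  then show "near Op id_blinfun (\<lambda>W. W \<in> G \<longrightarrow> \<alpha> W E0 \<in> (\<lambda>g. \<alpha> g E) ` D)"
  proof (rule near_mono)
    fix h assume "(id_blinfun + h) o\<^sub>L g \<in> D"
    from imageI[OF this, of "\<lambda>g. \<alpha> g E"]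
    show "id_blinfun + h \<in> G \<longrightarrow> \<alpha> (id_blinfun + h) E0 \<in> (\<lambda>g. \<alpha> g E) ` D"
      by (simp add: g(2) alpha_compose)
  qed
qed

text \<open>\<open>W\<close> is replaced by the operator \<open>M W\<close> that agrees with it on
  \<open>E\<close> and is the identity on \<open>F\<close>. Near the identity \<open>M W\<close> is
  invertible, and it carries the pair \<open>E\<close>, \<open>F\<close> to
  \<open>\<alpha> W E\<close>, \<open>F\<close>.\<close>

lemma openin_complements:
  assumes F: "F \<in> Gr" shows "openin GT (complements smul F)"
proof (rule openin_GT_I)
  show "complements smul F \<subseteq> Gr"
    using chart_proj[OF F] Gr_complement[OF F] by blast
  fix E assume "E \<in> complements smul F"
  then obtain P where P: "is_proj P E F" using chart_proj[OF F] by blast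
  note P' = is_projD[OF P]
  have cP: "id_blinfun - P \<in> vecs Op" by (intro Op.diff_mem id_mem_Op P')
  define M where "M W = (W o\<^sub>L P) + (id_blinfun - P)" for W :: "'a \<Rightarrow>\<^sub>L 'a"
  have M1: "M id_blinfun = id_blinfun" by (simp add: M_def)
  have an: "analytic_at Op Op M id_blinfun"
    unfolding M_def
    by (intro analytic_at_add analytic_at_o normed_space_Op Op.analytic_at_ident id_mem_Op analytic_at_Op_const P' cP)
  have "near Op id_blinfun (\<lambda>W. M W \<in> G)"
    by (rule near_comp[OF normed_space_Op normed_space_Op an]) (use near_GL[OF id_GL] M1 in simp)
  then show "near Op id_blinfun (\<lambda>W. W \<in> G \<longrightarrow> \<alpha> W E \<in> complements smul F)"
  proof (rule near_mono, intro impI)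
    fix h :: "'a \<Rightarrow>\<^sub>L 'a" let ?W = "id_blinfun + h"
    assume M: "M ?W \<in> G"
    have "\<alpha> (M ?W) E = \<alpha> ?W E"
      unfolding \<alpha>_def by (rule image_cong[OF refl]) (simp add: M_def blinfun.bilinear_simps P'(3))
    moreover have "\<alpha> (M ?W) F = F"
      unfolding \<alpha>_def using P'(4) by (simp add: M_def blinfun.bilinear_simps)
    ultimately show "\<alpha> ?W E \<in> complements smul F"
      using proj_in_complements[OF proj_conj[OF P M]] by simp
  qed
qed

text \<open>The coordinates of \<open>W E0\<close> in the chart of the pair \<open>(E', F)\<close>, for \<open>W\<close> close to the identity: the
  operator inverted below maps \<open>E0\<close> to \<open>E'\<close> by \<open>P' W\<close> and is the identity on \<open>F\<close>.\<close>

lemma chart_coordinates: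
  assumes P': "is_proj P' E' F" and P0: "is_proj P0 E0 F" and W: "W \<in> G"
    and e: "(P' o\<^sub>L W o\<^sub>L P0) + (id_blinfun - P0) \<in> G"
  shows "q_map E' (restrict_op P' E' (W o\<^sub>L P0 o\<^sub>L ginv ((P' o\<^sub>L W o\<^sub>L P0) + (id_blinfun - P0)))) = \<alpha> W E0"
proof -
  note p' = is_projD[OF P'] and p0 = is_projD[OF P0]
  let ?e = "(P' o\<^sub>L W o\<^sub>L P0) + (id_blinfun - P0)"
  define T where "T = restrict_op P' E' (W o\<^sub>L P0 o\<^sub>L ginv ?e)"
  have e_apply: "blinfun_apply ?e y = blinfun_apply P' (blinfun_apply W (blinfun_apply P0 y)) + (y - blinfun_apply P0 y)" for y
    by (simp add: blinfun.bilinear_simps)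
  have T_apply: "x + T x = blinfun_apply W (blinfun_apply (ginv ?e) x)" "blinfun_apply (ginv ?e) x \<in> E0" if x: "x \<in> E'" for x
  proof -
    define y where "y = blinfun_apply (ginv ?e) x"
    have ey: "blinfun_apply ?e y = x" unfolding y_def by (rule ginv_apply(2)[OF e])
    have Px: "blinfun_apply P' x = x" using x p'(3) by simp
    \<comment> \<open>\<open>P'\<close> removes the component in \<open>F\<close> from the equation
      \<open>?e y = x\<close>. As \<open>x\<close> is fixed by \<open>P'\<close>, that component of
      \<open>y\<close> is 0, so \<open>y\<close> lies in \<open>E0\<close>.\<close>
    have "blinfun_apply P' (y - blinfun_apply P0 y) = 0" using p0(6)[of y] p'(4) by simp
    then have *: "blinfun_apply P' x = blinfun_apply P' (blinfun_apply W (blinfun_apply P0 y))"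
      unfolding ey[symmetric] e_apply by (simp add: blinfun.add_right p'(2))
    then have y0: "y = blinfun_apply P0 y" using ey Px unfolding e_apply by simp
    then show "blinfun_apply (ginv ?e) x \<in> E0" using p0(3)[of y] by (simp add: y_def)
    have Wy: "blinfun_apply P' (blinfun_apply W y) = x" using *[unfolded y0[symmetric] Px] by simp
    have "T x = blinfun_apply W (blinfun_apply P0 y) - blinfun_apply P' (blinfun_apply W (blinfun_apply P0 y))"
      unfolding T_def restrict_op_def using x by (simp add: y_def)
    then show "x + T x = blinfun_apply W (blinfun_apply (ginv ?e) x)"
      unfolding y_def[symmetric] y0[symmetric] Wy by simp
  qed
  show ?thesis
    unfolding T_def[symmetric] q_map_def \<alpha>_def
  proof (intro equalityI subsetI)
    fix z assume "z \<in> (\<lambda>x. x + T x) ` E'"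
    then obtain x where x: "x \<in> E'" "z = x + T x" by (elim imageE)
    show "z \<in> blinfun_apply W ` E0"
      using imageI[OF T_apply(2)[OF x(1)], of "blinfun_apply W"] x(2) T_apply(1)[OF x(1)] by simp
  next
    fix z assume "z \<in> blinfun_apply W ` E0"
    then obtain y where y: "y \<in> E0" "z = blinfun_apply W y" by (elim imageE)
    define x where "x = blinfun_apply P' z"
    have x: "x \<in> E'" unfolding x_def by (rule p'(5))
    have "blinfun_apply ?e y = x"
      unfolding e_apply using y p0(3)[of y] by (simp add: x_def)
    then have "blinfun_apply (ginv ?e) x = y" using ginv_apply(1)[OF e, of y] by simp
    then have "x + T x = z" using T_apply(1)[OF x] y(2) by simp
    then show "z \<in> (\<lambda>x. x + T x) ` E'" using imageI[OF x, of "\<lambda>x. x + T x"] by simp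
  qed
qed

text \<open>The coordinate formula is applied to \<open>x o\<^sub>L ginv g\<close>, which is close
  to the identity, and to the subspace \<open>\<alpha> g E\<close>.\<close>

lemma chart_coordinates_analytic:
  assumes P': "is_proj P' E' F" and F: "F \<in> Gr" and g: "g \<in> G" and gE: "\<alpha> g E \<in> complements smul F"
  shows "\<exists>\<theta>. analytic_at Op (ON E' F) \<theta> g \<and>
    near Op g (\<lambda>x. x \<in> G \<and> \<theta> x \<in> vecs (ON E' F) \<and> q_map E' (\<theta> x) = \<alpha> x E)"
proof -
  obtain P0 where P0: "is_proj P0 (\<alpha> g E) F" by (rule chart_proj[OF F gE])
  note p' = is_projD[OF P'] and p0 = is_projD[OF P0]
  have cP: "id_blinfun - P0 \<in> vecs Op" by (intro Op.diff_mem id_mem_Op p0)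
  have nON: "normed_space_on (ON E' F)" by (rule proj_normed_ON[OF P'])
  define u where "u x = x o\<^sub>L ginv g" for x :: "'a \<Rightarrow>\<^sub>L 'a"
  define e where "e x = (P' o\<^sub>L u x o\<^sub>L P0) + (id_blinfun - P0)" for x
  define \<theta> where "\<theta> x = restrict_op P' E' (u x o\<^sub>L P0 o\<^sub>L ginv (e x))" for x
  have gO: "g \<in> vecs Op" "ginv g \<in> vecs Op" by (intro GL_mem_Op g ginv_GL)+
  have an_u: "analytic_at Op Op u g"
    unfolding u_def by (intro analytic_at_o normed_space_Op Op.analytic_at_ident gO analytic_at_Op_const)
  have an_e: "analytic_at Op Op e g"
    unfolding e_def
    by (intro analytic_at_add analytic_at_o normed_space_Op an_u gO(1) analytic_at_Op_const p0 p' cP)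
  have ug: "u g = id_blinfun" using GL.r_inv[OF g] by (simp add: u_def)
  \<comment> \<open>Both projections have kernel \<open>F\<close>, so each absorbs the other on its
    right.\<close>
  have P'P0: "blinfun_apply P' (blinfun_apply P0 x) = blinfun_apply P' x" for x
    using p0(6)[of x] p'(4)[of "x - blinfun_apply P0 x"] by (simp add: blinfun.bilinear_simps)
  have P0P': "blinfun_apply P0 (blinfun_apply P' x) = blinfun_apply P0 x" for x
    using p'(6)[of x] p0(4)[of "x - blinfun_apply P' x"] by (simp add: blinfun.bilinear_simps)
  \<comment> \<open>At \<open>g\<close> the operator is \<open>id_blinfun + P' - P0\<close>, and
    \<open>P' - P0\<close> squares to 0.\<close>
  have eg: "e g \<in> G"
  proof (rule GL_I(1)[of _ "id_blinfun + P0 - P'"])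
    show "e g \<in> vecs Op" by (rule Op.analytic_at_value[OF an_e])
    show "(id_blinfun + P0 - P') o\<^sub>L e g = id_blinfun" "e g o\<^sub>L (id_blinfun + P0 - P') = id_blinfun"
      by (rule blinfun_eqI, simp add: e_def ug blinfun.bilinear_simps P'P0 P0P' p0(2) p'(2))+
  qed
  have "analytic_at Op (ON E' F) \<theta> g"
    unfolding \<theta>_def
    by (intro analytic_at_linear_comp[OF normed_space_Op normed_space_Op nON _ linear_restrict_op[OF P']]
        analytic_at_o analytic_at_GL_inv normed_space_Op an_u an_e eg analytic_at_Op_const p0 gO)
  moreover have "near Op g (\<lambda>x. x \<in> G \<and> e x \<in> G)"
    by (intro near_conj near_GL[OF g] near_comp[OF normed_space_Op normed_space_Op an_e near_GL[OF eg]])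
  then have "near Op g (\<lambda>x. x \<in> G \<and> \<theta> x \<in> vecs (ON E' F) \<and> q_map E' (\<theta> x) = \<alpha> x E)"
  proof (rule near_mono)
    fix h let ?x = "g + h"
    assume x: "?x \<in> G \<and> e ?x \<in> G"
    then have uG: "u ?x \<in> G" unfolding u_def by (intro compose_GL ginv_GL g) simp
    have "q_map E' (\<theta> ?x) = \<alpha> (u ?x) (\<alpha> g E)"
      unfolding \<theta>_def e_def by (rule chart_coordinates[OF P' P0 uG]) (use x in \<open>simp add: e_def\<close>)
    also have "\<dots> = \<alpha> ?x E"
      unfolding alpha_compose[symmetric] u_def using GL.l_inv[OF g] by (simp add: blinfun_compose_assoc)
    finally have q: "q_map E' (\<theta> ?x) = \<alpha> ?x E" .
    have "u ?x o\<^sub>L P0 o\<^sub>L ginv (e ?x) \<in> vecs Op"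
      using x by (intro compose_mem_Op GL_mem_Op[OF uG] p0 GL_mem_Op[OF ginv_GL]) simp
    then have "\<theta> ?x \<in> vecs (ON E' F)"
      unfolding \<theta>_def using linear_restrict_op[OF P'] by (simp add: bounded_linear_on_def)
    with q x show "?x \<in> G \<and> \<theta> ?x \<in> vecs (ON E' F) \<and> q_map E' (\<theta> ?x) = \<alpha> ?x E" by simp
  qed
  ultimately show ?thesis by blast
qed

lemma openin_orbit_Gr: "E \<in> Gr \<Longrightarrow> openin GT (orbit (GL smul) \<alpha> E)"
  unfolding orbit_eq_image by (rule openin_alpha_image[OF _ openin_GL order_refl])

lemma closedin_orbit_Gr: "E \<in> Gr \<Longrightarrow> closedin GT (orbit (GL smul) \<alpha> E)"
  by (rule closedin_orbit[OF topspace_GT openin_orbit_Gr]) (simp_all add: Gr_alpha alpha_compose alpha_id)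

text \<open>Near \<open>g\<close> the moved subspaces have analytic coordinates in the chart based
  at \<open>\<alpha> g E\<close> itself, with any complement \<open>F\<close>; the openness of
  \<open>\<U>\<close> is read off in that chart.\<close>

lemma continuous_alpha:
  assumes E: "E \<in> Gr" and \<U>: "openin GT \<U>"
  shows "openin (norm_topology Op) {g \<in> G. \<alpha> g E \<in> \<U>}"
proof (rule Op.openinI)
  fix g assume "g \<in> {g \<in> G. \<alpha> g E \<in> \<U>}"
  then have g: "g \<in> G" and gU: "\<alpha> g E \<in> \<U>" by auto
  obtain P F where P: "is_proj P (\<alpha> g E) F" using Gr_alpha[OF E g] unfolding Gr_iff by blast
  have F: "F \<in> Gr" by (rule Gr_complement[OF Gr_alpha[OF E g] proj_complement[OF P]])
  have gF: "\<alpha> g E \<in> complements smul F" by (rule proj_in_complements[OF P])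
  have nON: "normed_space_on (ON (\<alpha> g E) F)" by (rule proj_normed_ON[OF P])
  interpret ON: normed_space_on "ON (\<alpha> g E) F" by (rule nON)
  obtain \<theta> where \<theta>: "analytic_at Op (ON (\<alpha> g E) F) \<theta> g"
    and n: "near Op g (\<lambda>x. x \<in> G \<and> \<theta> x \<in> vecs (ON (\<alpha> g E) F) \<and> q_map (\<alpha> g E) (\<theta> x) = \<alpha> x E)"
    using chart_coordinates_analytic[OF P F g gF] by (elim exE conjE) (rule that)
  have op: "openin (norm_topology (ON (\<alpha> g E) F)) {T \<in> vecs (ON (\<alpha> g E) F). q_map (\<alpha> g E) T \<in> \<U>}"
    using \<U> F gF by (simp add: openin_grassmann_topology)
  have "\<theta> g \<in> {T \<in> vecs (ON (\<alpha> g E) F). q_map (\<alpha> g E) T \<in> \<U>}"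
    using Op.near_imp[OF n] gU by simp
  from near_conj[OF n near_comp[OF normed_space_Op nON \<theta> ON.near_openin[OF op this]]]
  show "near Op g (\<lambda>x. x \<in> {g \<in> G. \<alpha> g E \<in> \<U>})" by (rule near_mono) auto
qed (auto simp: GL_mem_Op)

end

section \<open>The stabilizer and the orbit map of a subspace\<close>

locale subspace_in = banach_over smul
  for smul :: "'k::real_or_complex \<Rightarrow> 'a::banach \<Rightarrow> 'a" +
  fixes E :: "'a set"
  assumes E: "E \<in> grassmannian smul"
begin

abbreviation Orb where "Orb \<equiv> orbit (GL smul) \<alpha> E"

abbreviation St where "St \<equiv> stabilizer (GL smul) \<alpha> E"

text \<open>In blocks relative to \<open>E\<close> and \<open>F\<close>, the first map is the lower
  left block and the second one the corner on \<open>E\<close>, completed by the identity on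
  \<open>F\<close>. The stabilizer consists of the invertible operators that are block upper
  triangular with invertible corner, and the factorization is one step of block elimination.\<close>

lemma split_subgroup_stabilizer:
  assumes P: "is_proj P E F"
  shows "split_subgroup smul (\<lambda>W. (id_blinfun - P) o\<^sub>L W o\<^sub>L P) (\<lambda>W. (P o\<^sub>L W o\<^sub>L P) + (id_blinfun - P)) St"
proof (rule split_subgroup.intro[OF banach_over_axioms], rule split_subgroup_axioms.intro)
  note p = is_projD[OF P]
  let ?k = "\<lambda>W. (id_blinfun - P) o\<^sub>L W o\<^sub>L P" and ?e = "\<lambda>W. (P o\<^sub>L W o\<^sub>L P) + (id_blinfun - P)"
  have cP: "id_blinfun - P \<in> vecs Op" by (intro Op.diff_mem id_mem_Op p)
  have lin: "bounded_linear_on Op Op (\<lambda>W. P o\<^sub>L W o\<^sub>L P)" by (intro bounded_linear_sandwich p)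
  have k_apply: "blinfun_apply (?k W) x = blinfun_apply W (blinfun_apply P x) - blinfun_apply P (blinfun_apply W (blinfun_apply P x))"
    and e_apply: "blinfun_apply (?e W) x = blinfun_apply P (blinfun_apply W (blinfun_apply P x)) + (x - blinfun_apply P x)" for W x
    by (simp_all add: blinfun.bilinear_simps)
  have e_commute: "?e W o\<^sub>L P = P o\<^sub>L ?e W" for W
    by (rule blinfun_eqI) (simp add: blinfun.bilinear_simps p(2))
  have ginv_e: "blinfun_apply (ginv (?e W)) (blinfun_apply P x) = blinfun_apply P (blinfun_apply (ginv (?e W)) x)"
    if "?e W \<in> G" for W x
    using ginv_commute[OF that e_commute, THEN arg_cong, of "\<lambda>T. blinfun_apply T x"] by simp
  show "bounded_linear_on Op Op ?k" by (intro bounded_linear_sandwich cP p)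
  show "?k (?k T) = ?k T" for T by (rule blinfun_eqI) (simp add: blinfun.bilinear_simps p(2))
  show "analytic_at Op Op ?e W" if "W \<in> vecs Op" for W
  proof -
    interpret Q: normed_space_pair Op Op by unfold_locales
    show ?thesis
      by (intro analytic_at_add normed_space_Op Q.analytic_at_bounded_linear[OF lin that] analytic_at_Op_const cP that)
  qed
  show sg: "subgroup St (GL smul)"
    by (rule subgroup_stabilizer) (simp_all add: alpha_compose alpha_id)
  have k_zero: "?k W = 0 \<longleftrightarrow> (\<forall>x\<in>E. blinfun_apply W x \<in> E)" for W
  proof
    assume "?k W = 0"
    then have z: "blinfun_apply (?k W) x = 0" for x by (simp only: blinfun.zero_left)
    show "\<forall>x\<in>E. blinfun_apply W x \<in> E"
    proof
      fix x assume "x \<in> E"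
      then have "blinfun_apply P x = x" using p(3) by simp
      with z[of x] show "blinfun_apply W x \<in> E" unfolding k_apply p(3) by simp
    qed
  next
    assume W: "\<forall>x\<in>E. blinfun_apply W x \<in> E"
    show "?k W = 0"
    proof (rule blinfun_eqI)
      show "blinfun_apply (?k W) x = blinfun_apply 0 x" for x
        using bspec[OF W p(5)[of x]] unfolding k_apply p(3) by simp
    qed
  qed
  have St_sub: "W \<in> St \<longleftrightarrow> W \<in> G \<and> \<alpha> W E = E" for W by (simp add: stabilizer_def)
  have St_G: "W \<in> St \<Longrightarrow> W \<in> G" for W by (simp add: stabilizer_def)
  show closed: "W \<in> St \<longleftrightarrow> ?k W = 0 \<and> ?k (ginv W) = 0" if W: "W \<in> G" for W
  proof -
    have "\<alpha> W E = E \<longleftrightarrow> (\<forall>x. blinfun_apply (ginv W) x \<in> E \<longleftrightarrow> x \<in> E)"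
      using mem_alpha[OF W, of _ E] by (auto simp: set_eq_iff)
    also have "\<dots> \<longleftrightarrow> (\<forall>x\<in>E. blinfun_apply W x \<in> E) \<and> (\<forall>x\<in>E. blinfun_apply (ginv W) x \<in> E)"
      using ginv_apply[OF W] by metis
    finally show ?thesis unfolding St_sub k_zero using W by simp
  qed
  \<comment> \<open>Both \<open>W\<close> and its inverse preserve \<open>E\<close>, so their
    corners are inverse to each other.\<close>
  have St_e: "?e W \<in> G" if W: "W \<in> St" for W
  proof (rule GL_I(1)[of _ "?e (ginv W)"])
    have WG: "W \<in> G" by (rule St_G[OF W])
    have k0: "?k W = 0" "?k (ginv W) = 0" using closed[OF WG] W by simp_all
    have k1: "blinfun_apply P (blinfun_apply W (blinfun_apply P x)) = blinfun_apply W (blinfun_apply P x)"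
      and k2: "blinfun_apply P (blinfun_apply (ginv W) (blinfun_apply P x)) = blinfun_apply (ginv W) (blinfun_apply P x)" for x
      using arg_cong[OF k0(1), of "\<lambda>T. blinfun_apply T x"] arg_cong[OF k0(2), of "\<lambda>T. blinfun_apply T x"]
      unfolding k_apply by simp_all
    show "?e W \<in> vecs Op"
      by (intro Op.add_mem cP compose_mem_Op p GL_mem_Op[OF WG])
    have "blinfun_apply (?e (ginv W)) (blinfun_apply (?e W) x) = x" for x
      unfolding e_apply by (simp add: blinfun.add_right blinfun.diff_right p(2) k1 k2 ginv_apply[OF WG])
    then show "?e (ginv W) o\<^sub>L ?e W = id_blinfun" by (intro blinfun_eqI) simp
    have "blinfun_apply (?e W) (blinfun_apply (?e (ginv W)) x) = x" for x
      unfolding e_apply by (simp add: blinfun.add_right blinfun.diff_right p(2) k1 k2 ginv_apply[OF WG])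
    then show "?e W o\<^sub>L ?e (ginv W) = id_blinfun" by (intro blinfun_eqI) simp
  qed
  \<comment> \<open>An invertible corner makes \<open>W\<close> map \<open>E\<close> onto itself:
    the preimage of \<open>x\<close> in \<open>E\<close> is obtained by inverting
    \<open>?e W\<close>.\<close>
  have e_St: "W \<in> St" if W: "W \<in> G" "?k W = 0" "?e W \<in> G" for W
  proof -
    have WE: "\<forall>x\<in>E. blinfun_apply W x \<in> E" using W(2) k_zero by blast
    have "blinfun_apply (ginv W) x \<in> E" if x: "x \<in> E" for x
    proof -
      define y where "y = blinfun_apply (ginv (?e W)) x"
      have Px: "blinfun_apply P x = x" using x p(3) by simp
      have Py: "blinfun_apply P y = y" using ginv_e[OF W(3), of x] unfolding Px y_def by simp
      then have yE: "y \<in> E" using p(3) by simp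
      then have "blinfun_apply P (blinfun_apply W y) = blinfun_apply W y" using WE p(3) by blast
      moreover have "blinfun_apply (?e W) y = x" unfolding y_def by (rule ginv_apply(2)[OF W(3)])
      ultimately have "blinfun_apply W y = x" unfolding e_apply Py by simp
      then show ?thesis using ginv_apply(1)[OF W(1), of y] yE by simp
    qed
    then show ?thesis unfolding closed[OF W(1)] k_zero using WE by blast
  qed
  show "W \<in> St \<longleftrightarrow> ?k W = 0 \<and> ?e W \<in> G" if "W \<in> G" for W
    using St_e e_St[OF that] closed[OF that] by blast
  fix U assume U: "U \<in> G" "?e U \<in> G"
  define T where "T = ?k U o\<^sub>L ginv (?e U)"
  have T_apply: "blinfun_apply T x = blinfun_apply U (blinfun_apply P (blinfun_apply (ginv (?e U)) x))
      - blinfun_apply P (blinfun_apply U (blinfun_apply P (blinfun_apply (ginv (?e U)) x)))" for x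
    by (simp add: T_def blinfun.bilinear_simps)
  have PT: "blinfun_apply P (blinfun_apply T x) = 0" for x
    unfolding T_apply by (simp add: blinfun.diff_right p(2))
  have TP: "blinfun_apply T (blinfun_apply P x) = blinfun_apply T x" for x
    unfolding T_apply ginv_e[OF U(2)] by (simp add: p(2))
  have kT: "?k T = T" by (rule blinfun_eqI) (simp only: k_apply TP PT diff_0_right)
  have TT: "blinfun_apply T (blinfun_apply T x) = 0" for x
    using TP[of "blinfun_apply T x"] unfolding PT by (simp add: blinfun.zero_right)
  have TO: "T \<in> vecs Op"
    unfolding T_def by (intro compose_mem_Op cP p GL_mem_Op[OF U(1)] GL_mem_Op[OF ginv_GL[OF U(2)]])
  have sT: "id_blinfun + T \<in> G" "ginv (id_blinfun + T) = id_blinfun - T"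
    by (rule GL_I[of _ "id_blinfun - T"];
        auto intro!: blinfun_eqI Op.add_mem id_mem_Op TO simp: blinfun.bilinear_simps TT)+
  \<comment> \<open>Block elimination: \<open>id_blinfun - T\<close> is the inverse of
    \<open>id_blinfun + T\<close> because \<open>T\<close> squares to 0.\<close>
  define B where "B = (id_blinfun - T) o\<^sub>L U"
  have BG: "B \<in> G" unfolding B_def sT(2)[symmetric] by (intro compose_GL ginv_GL sT U)
  have B_apply: "blinfun_apply B x = blinfun_apply U x - blinfun_apply T (blinfun_apply U x)" for x
    by (simp add: B_def blinfun.diff_left)
  \<comment> \<open>\<open>T\<close> is built for this: it ignores the component in \<open>F\<close>
    and sends the corner of \<open>U\<close> to the lower left block of \<open>U\<close>, so
    \<open>B\<close> has lower left block 0.\<close>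
  have TU: "blinfun_apply T (blinfun_apply U (blinfun_apply P x))
      = blinfun_apply U (blinfun_apply P x) - blinfun_apply P (blinfun_apply U (blinfun_apply P x))" for x
  proof -
    have "blinfun_apply (?e U) (blinfun_apply P x) = blinfun_apply P (blinfun_apply U (blinfun_apply P x))"
      unfolding e_apply by (simp add: p(2))
    then have "blinfun_apply (ginv (?e U)) (blinfun_apply P (blinfun_apply U (blinfun_apply P x))) = blinfun_apply P x"
      using ginv_apply(1)[OF U(2), of "blinfun_apply P x"] by simp
    then have "blinfun_apply T (blinfun_apply P (blinfun_apply U (blinfun_apply P x)))
        = blinfun_apply U (blinfun_apply P x) - blinfun_apply P (blinfun_apply U (blinfun_apply P x))"
      unfolding T_apply by (simp add: p(2))
    then show ?thesis unfolding TP .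
  qed
  have kB: "?k B = 0"
    by (rule blinfun_eqI) (simp only: k_apply B_apply TU blinfun.zero_left, simp add: blinfun.diff_right p(2))
  have "?e B = ?e U"
    by (rule blinfun_eqI) (simp only: e_apply B_apply blinfun.diff_right PT diff_0_right)
  then have "B \<in> St" using e_St[OF BG kB] U(2) by simp
  then show "?k (?k U o\<^sub>L ginv (?e U)) = ?k U o\<^sub>L ginv (?e U) \<and> id_blinfun + (?k U o\<^sub>L ginv (?e U)) \<in> G \<and>
      ginv (id_blinfun + (?k U o\<^sub>L ginv (?e U))) o\<^sub>L U \<in> St"
    using kT sT unfolding T_def[symmetric] B_def by simp
next
  note p = is_projD[OF P]
  let ?k = "\<lambda>W. (id_blinfun - P) o\<^sub>L W o\<^sub>L P" and ?e = "\<lambda>W. (P o\<^sub>L W o\<^sub>L P) + (id_blinfun - P)"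
  fix T B assume T: "T \<in> vecs Op" "?k T = T" "id_blinfun + T \<in> G" and B: "B \<in> St"
  have BE: "\<alpha> B E = E" and BG: "B \<in> G" using B by (simp_all add: stabilizer_def)
  have T': "blinfun_apply T x = blinfun_apply T (blinfun_apply P x) - blinfun_apply P (blinfun_apply T (blinfun_apply P x))" for x
    using arg_cong[OF T(2), of "\<lambda>T. blinfun_apply T x"] by (simp add: blinfun.bilinear_simps)
  have PT: "blinfun_apply P (blinfun_apply T x) = 0" for x
    by (subst T') (simp add: blinfun.diff_right p(2))
  have TP: "blinfun_apply T (blinfun_apply P x) = blinfun_apply T x" for x
    using T'[of x] by (simp add: PT)
  have PBP: "blinfun_apply P (blinfun_apply B (blinfun_apply P x)) = blinfun_apply B (blinfun_apply P x)" for x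
    using imageI[OF p(5)[of x], of "blinfun_apply B"] BE p(3) unfolding \<alpha>_def by simp
  have eB: "?e ((id_blinfun + T) o\<^sub>L B) = ?e B"
    by (rule blinfun_eqI) (simp add: blinfun.bilinear_simps PT)
  have eG: "?e B \<in> G"
  proof (rule GL_I(1)[of _ "?e (ginv B)"])
    have PBP': "blinfun_apply P (blinfun_apply (ginv B) (blinfun_apply P x)) = blinfun_apply (ginv B) (blinfun_apply P x)" for x
    proof -
      have "blinfun_apply P x \<in> \<alpha> B E" using p(5) BE by simp
      then show ?thesis using mem_alpha[OF BG] p(3) by blast
    qed
    show "?e B \<in> vecs Op"
      by (intro Op.add_mem compose_mem_Op p GL_mem_Op[OF BG] Op.diff_mem id_mem_Op)
    show "?e (ginv B) o\<^sub>L ?e B = id_blinfun" "?e B o\<^sub>L ?e (ginv B) = id_blinfun"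
      by (rule blinfun_eqI, simp add: blinfun.bilinear_simps p(2) PBP PBP' ginv_apply[OF BG])+
  qed
  have e_apply: "blinfun_apply (?e B) x = blinfun_apply B (blinfun_apply P x) + (x - blinfun_apply P x)" for x
    by (simp add: blinfun.bilinear_simps PBP)
  \<comment> \<open>\<open>T\<close> depends only on the component in \<open>E\<close>, on which
    \<open>?e B\<close> agrees with \<open>B\<close>.\<close>
  have "?k ((id_blinfun + T) o\<^sub>L B) = T o\<^sub>L ?e B"
  proof (rule blinfun_eqI)
    fix x
    have "blinfun_apply T (x - blinfun_apply P x) = 0" by (simp add: blinfun.diff_right TP)
    then have "blinfun_apply (T o\<^sub>L ?e B) x = blinfun_apply T (blinfun_apply B (blinfun_apply P x))"
      unfolding blinfun_apply_blinfun_compose e_apply by (simp add: blinfun.add_right)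
    then show "blinfun_apply (?k ((id_blinfun + T) o\<^sub>L B)) x = blinfun_apply (T o\<^sub>L ?e B) x"
      by (simp add: blinfun.bilinear_simps PBP PT)
  qed
  then have "?k ((id_blinfun + T) o\<^sub>L B) o\<^sub>L ginv (?e B) = T"
    using GL.r_inv[OF eG] by (simp add: blinfun_compose_assoc)
  with eG show "?e ((id_blinfun + T) o\<^sub>L B) \<in> G \<and>
      ?k ((id_blinfun + T) o\<^sub>L B) o\<^sub>L ginv (?e ((id_blinfun + T) o\<^sub>L B)) = T"
    unfolding eB by simp
qed

text \<open>The splitting depends on a choice of projection onto \<open>E\<close>; the choice is
  confined to this proof, and none of the three conclusions mentions it.\<close>

lemma lie_subgroup_stabilizer: "banach_lie_subgroup GM (GL smul) St"
  and quotient_exists: "\<exists>M :: (('a \<Rightarrow>\<^sub>L 'a) set, 'k, 'a \<Rightarrow>\<^sub>L 'a) manifold. quotient_manifold GM (GL smul) St M"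
  and proj_eq: "g \<in> G \<Longrightarrow> g' \<in> G \<Longrightarrow> g <#\<^bsub>GL smul\<^esub> St = g' <#\<^bsub>GL smul\<^esub> St \<longleftrightarrow> ginv g o\<^sub>L g' \<in> St"
proof -
  obtain P F where P: "is_proj P E F" using E unfolding Gr_iff by blast
  interpret H: split_subgroup smul "\<lambda>W. (id_blinfun - P) o\<^sub>L W o\<^sub>L P" "\<lambda>W. (P o\<^sub>L W o\<^sub>L P) + (id_blinfun - P)" St
    by (rule split_subgroup_stabilizer[OF P])
  show "banach_lie_subgroup GM (GL smul) St" by (rule H.lie_subgroup)
  show "\<exists>M :: (('a \<Rightarrow>\<^sub>L 'a) set, 'k, 'a \<Rightarrow>\<^sub>L 'a) manifold. quotient_manifold GM (GL smul) St M"
    using H.quotient_manifold_quotient_mfd by (rule exI)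
  show "g \<in> G \<Longrightarrow> g' \<in> G \<Longrightarrow> g <#\<^bsub>GL smul\<^esub> St = g' <#\<^bsub>GL smul\<^esub> St \<longleftrightarrow> ginv g o\<^sub>L g' \<in> St"
    by (rule H.proj_eq_iff)
qed

lemma bianalytic_orbit_map:
  assumes M: "quotient_manifold GM (GL smul) St M"
  shows "bianalytic M (open_submanifold (grassmann_manifold smul) Orb) (orbit_map \<alpha> E)"
proof (rule homogeneous_bianalytic[OF M, where \<phi> = "\<lambda>g. \<alpha> g E"])
  let ?N = "open_submanifold (grassmann_manifold smul) Orb"
  have topN: "man_top ?N = subtopology GT Orb"
    by (simp add: open_submanifold_def man_top_grassmann)
  have OrbI: "Orb \<subseteq> Gr"
    using openin_subset[OF openin_orbit_Gr[OF E]] by (simp add: topspace_GT)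
  show "\<alpha> g E = \<alpha> g' E \<longleftrightarrow> g <#\<^bsub>GL smul\<^esub> St = g' <#\<^bsub>GL smul\<^esub> St" if "g \<in> G" "g' \<in> G" for g g'
    unfolding proj_eq[OF that]
    by (rule action_eq_iff[where \<phi> = \<alpha> and x = E, OF alpha_compose alpha_id alpha_inj that])
  show "orbit_map \<alpha> E (g <#\<^bsub>GL smul\<^esub> St) = \<alpha> g E" if "g \<in> G" for g
    by (rule orbit_map_coset[OF alpha_compose alpha_id that])
  show "topspace (man_top ?N) = (\<lambda>g. \<alpha> g E) ` G"
    unfolding topN using OrbI by (auto simp: topspace_GT orbit_eq_image)
  show "continuous_map (man_top GM) (man_top ?N) (\<lambda>g. \<alpha> g E)"
    unfolding topN continuous_map_in_subtopology
  proof (intro conjI)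
    show "(\<lambda>g. \<alpha> g E) \<in> topspace (man_top GM) \<rightarrow> Orb" by (auto simp: topspace_GM orbit_eq_image)
    show "continuous_map (man_top GM) GT (\<lambda>g. \<alpha> g E)"
      unfolding continuous_map topspace_GM topspace_GT
    proof (intro conjI allI impI)
      show "(\<lambda>g. \<alpha> g E) ` G \<subseteq> Gr" using Gr_alpha[OF E] by blast
      show "openin (man_top GM) {g \<in> G. \<alpha> g E \<in> \<U>}" if "openin GT \<U>" for \<U>
        using continuous_alpha[OF E that] by (simp add: openin_GM)
    qed
  qed
  show "openin (man_top ?N) ((\<lambda>g. \<alpha> g E) ` U)" if "openin (man_top GM) U" for U
  proof -
    have U: "openin (norm_topology Op) U" "U \<subseteq> G" using that by (simp_all add: openin_GM)
    then have "(\<lambda>g. \<alpha> g E) ` U \<subseteq> Orb" by (auto simp: orbit_eq_image)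
    then show ?thesis
      unfolding topN openin_open_subtopology[OF openin_orbit_Gr[OF E]]
      using openin_alpha_image[OF E U] by simp
  qed
  fix d assume "d \<in> atlas ?N"
  then obtain E' F where F: "F \<in> Gr" and E': "E' \<in> complements smul F"
    and d: "d = (grassmann_chart smul E' F)\<lparr>chart_dom := complements smul F \<inter> Orb\<rparr>"
    by (auto simp: open_submanifold_def grassmann_manifold_def grassmann_chart_def)
  obtain P where P: "is_proj P E' F" by (rule chart_proj[OF F E'])
  have nON: "normed_space_on (ON E' F)" by (rule proj_normed_ON[OF P])
  interpret ON: normed_space_on "ON E' F" by (rule nON)
  have model: "chart_model d = ON E' F" and dom: "chart_dom d = complements smul F \<inter> Orb"
    by (simp_all add: d grassmann_chart_def)
  have map_q: "chart_map d (q_map E' T) = T" if "T \<in> vecs (ON E' F)" for T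
    using chart_map_q[OF P that] by (simp add: d)
  have coords: "\<exists>\<theta>. analytic_at Op (ON E' F) \<theta> g \<and>
      near Op g (\<lambda>x. x \<in> G \<and> \<theta> x \<in> vecs (ON E' F) \<and> q_map E' (\<theta> x) = \<alpha> x E)"
    if "g \<in> G" "\<alpha> g E \<in> chart_dom d" for g
    using that by (intro chart_coordinates_analytic[OF P F]) (simp_all add: dom)
  \<comment> \<open>The chart is an inverse of \<open>q_map\<close> and is under control only on its
    range. The analytic coordinates near \<open>g\<close>, evaluated at \<open>g\<close> itself,
    show that every point of the domain lies there.\<close>
  have surj: "\<exists>T\<in>vecs (ON E' F). q_map E' T = y" if y: "y \<in> chart_dom d" for y
  proof -
    obtain g where g: "g \<in> G" "y = \<alpha> g E" using y by (auto simp: dom orbit_eq_image)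
    obtain \<theta> where "near Op g (\<lambda>x. x \<in> G \<and> \<theta> x \<in> vecs (ON E' F) \<and> q_map E' (\<theta> x) = \<alpha> x E)"
      using coords[OF g(1)] y unfolding g(2) by blast
    from Op.near_imp[OF this] show ?thesis unfolding g(2) by blast
  qed
  show "normed_space_on (chart_model d)" by (simp add: model nON)
  show "inj_on (chart_map d) (chart_dom d)"
  proof (rule inj_onI)
    fix y y' assume y: "y \<in> chart_dom d" "y' \<in> chart_dom d" "chart_map d y = chart_map d y'"
    obtain T where T: "T \<in> vecs (ON E' F)" "q_map E' T = y" using surj[OF y(1)] by blast
    obtain T' where T': "T' \<in> vecs (ON E' F)" "q_map E' T' = y'" using surj[OF y(2)] by blast
    show "y = y'" using y(3) T T' map_q[OF T(1)] map_q[OF T'(1)] by simp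
  qed
  show "openin (man_top ?N) (chart_dom d)"
    unfolding topN dom openin_open_subtopology[OF openin_orbit_Gr[OF E]]
    by (intro conjI openin_Int openin_complements[OF F] openin_orbit_Gr[OF E]) simp
  fix g assume g: "g \<in> G" and gd: "\<alpha> g E \<in> chart_dom d"
  obtain \<theta> where \<theta>: "analytic_at Op (ON E' F) \<theta> g"
    and n: "near Op g (\<lambda>x. x \<in> G \<and> \<theta> x \<in> vecs (ON E' F) \<and> q_map E' (\<theta> x) = \<alpha> x E)"
    using coords[OF g gd] by (elim exE conjE) (rule that)
  have "near Op g (\<lambda>x. \<theta> x = chart_map d (\<alpha> x E))"
  proof (rule near_mono[OF n])
    fix h assume *: "g + h \<in> G \<and> \<theta> (g + h) \<in> vecs (ON E' F) \<and> q_map E' (\<theta> (g + h)) = \<alpha> (g + h) E"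
    then show "\<theta> (g + h) = chart_map d (\<alpha> (g + h) E)" using map_q[of "\<theta> (g + h)"] by simp
  qed
  with \<theta> show "analytic_at Op (chart_model d) (\<lambda>g. chart_map d (\<alpha> g E)) g"
    unfolding model by (rule analytic_at_cong)
  obtain T0 where T0: "T0 \<in> vecs (ON E' F)" "q_map E' T0 = \<alpha> g E" using surj[OF gd] by blast
  \<comment> \<open>Shears by \<open>T - T0\<close> after \<open>g\<close> provide the local section
    of the action in this chart.\<close>
  note s = section_at[OF P T0(1) g T0(2)]
  have m0: "chart_map d (\<alpha> g E) = T0" using map_q[OF T0(1)] T0(2) by simp
  have "near (ON E' F) T0 (\<lambda>T. section_at P T0 g T \<in> G \<and> \<alpha> (section_at P T0 g T) E \<in> chart_dom d \<and>
      chart_map d (\<alpha> (section_at P T0 g T) E) = T)"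
  proof (rule ON.near_mono_mem[OF ON.near_mem[OF T0(1)] T0(1)])
    fix T assume T: "T \<in> vecs (ON E' F)"
    have "\<alpha> (section_at P T0 g T) E \<in> Orb" using s(3)[OF T] by (auto simp: orbit_eq_image)
    then show "section_at P T0 g T \<in> G \<and> \<alpha> (section_at P T0 g T) E \<in> chart_dom d \<and>
      chart_map d (\<alpha> (section_at P T0 g T) E) = T"
      using s(3)[OF T] q_map_complements[OF P T] map_q[OF T] by (simp add: s(4)[OF T] dom)
  qed
  then show "\<exists>\<sigma>. analytic_at (chart_model d) Op \<sigma> (chart_map d (\<alpha> g E)) \<and> \<sigma> (chart_map d (\<alpha> g E)) = g \<and>
        near (chart_model d) (chart_map d (\<alpha> g E))
          (\<lambda>x. \<sigma> x \<in> G \<and> \<alpha> (\<sigma> x) E \<in> chart_dom d \<and> chart_map d (\<alpha> (\<sigma> x) E) = x)"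
    unfolding model m0 using s(1,2) by (intro exI[of _ "section_at P T0 g"] conjI)
qed

end

theorem proposition5p2:
  fixes smul :: "'k::real_or_complex \<Rightarrow> 'a::banach \<Rightarrow> 'a"
    and Q :: "'a \<Rightarrow>\<^sub>L 'a" and E :: "'a set"
  assumes "banach_over smul" and "dim_greater_one smul"
    and "Q \<in> idempotents smul" and "E \<in> grassmannian smul"
  shows
    "banach_lie_subgroup (GL_manifold smul) (GL smul) (stabilizer (GL smul) (Ad smul) Q) \<and>
     banach_lie_subgroup (GL_manifold smul) (GL smul) (stabilizer (GL smul) \<alpha> E) \<and>
     openin (man_top (idempotent_manifold smul)) (orbit (GL smul) (Ad smul) Q) \<and>
     closedin (man_top (idempotent_manifold smul)) (orbit (GL smul) (Ad smul) Q) \<and>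
     openin (man_top (grassmann_manifold smul)) (orbit (GL smul) \<alpha> E) \<and>
     closedin (man_top (grassmann_manifold smul)) (orbit (GL smul) \<alpha> E) \<and>
     (\<exists>M :: (('a \<Rightarrow>\<^sub>L 'a) set, 'k, 'a \<Rightarrow>\<^sub>L 'a) manifold.
        quotient_manifold (GL_manifold smul) (GL smul) (stabilizer (GL smul) (Ad smul) Q) M) \<and>
     (\<forall>M :: (('a \<Rightarrow>\<^sub>L 'a) set, 'k, 'a \<Rightarrow>\<^sub>L 'a) manifold.
        quotient_manifold (GL_manifold smul) (GL smul) (stabilizer (GL smul) (Ad smul) Q) M \<longrightarrow>
        bianalytic M
          (open_submanifold (idempotent_manifold smul) (orbit (GL smul) (Ad smul) Q))
          (orbit_map (Ad smul) Q)) \<and>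
     (\<exists>M :: (('a \<Rightarrow>\<^sub>L 'a) set, 'k, 'a \<Rightarrow>\<^sub>L 'a) manifold.
        quotient_manifold (GL_manifold smul) (GL smul) (stabilizer (GL smul) \<alpha> E) M) \<and>
     (\<forall>M :: (('a \<Rightarrow>\<^sub>L 'a) set, 'k, 'a \<Rightarrow>\<^sub>L 'a) manifold.
        quotient_manifold (GL_manifold smul) (GL smul) (stabilizer (GL smul) \<alpha> E) M \<longrightarrow>
        bianalytic M
          (open_submanifold (grassmann_manifold smul) (orbit (GL smul) \<alpha> E))
          (orbit_map \<alpha> E))"
proof -
  interpret banach_over smul by (rule assms(1))
  interpret Q: idempotent_in smul Q by unfold_locales (rule assms(3))
  interpret E: subspace_in smul E by unfold_locales (rule assms(4))
  show ?thesis
    unfolding man_top_grassmann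
    \<comment> \<open>Existence of the quotients is witnessed by the coset charts; bianalyticity is
      available for every \<open>M\<close> with the quotient property.\<close>
    using openin_orbit_idempotent[OF assms(3)] closedin_orbit_idempotent[OF assms(3)]
      openin_orbit_Gr[OF assms(4)] closedin_orbit_Gr[OF assms(4)]
      exI[of "quotient_manifold GM (GL smul) Q.St", OF Q.Q.quotient_manifold_quotient_mfd]
      Q.bianalytic_orbit_map E.quotient_exists E.bianalytic_orbit_map
    by (intro conjI allI impI Q.Q.lie_subgroup E.lie_subgroup_stabilizer)
qed

end
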